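(* Let $n\ge 1$, $m\ge 2$, and let $M=\{(z,w)\in\mathbb{C}^{2n}\times\mathbb{C}^m:\operatorname{Im} w=\phi(z,z)\}$ be a quadric submanifold such that for every $\nu\in S^{m-1}$ all eigenvalues of the directional Levi form $\phi_\nu(z,z)=\phi(z,z)\cdot\nu$ are nonzero. Let $0\le q\le 2n$ and let $N=N_{0,q}$ be the complex Green operator kernel on $(0,q)$-forms on $\mathbb{C}^{2n}\times\mathbb{R}^m\cong M$ (for $q=n$, the relative fundamental solution $\int_0^\infty e^{-s\Box_b}(I-S_n)\,ds$, with $S_n$ the orthogonal projection of $L^2_{0,n}(M)$ onto $\ker\Box_b$). Then for every multiindex $I\in\mathbb{N}_0^{4n+m}$ there is a constant $C_I>0$ such that $$|D^I N(z,t)|\le \frac{C_I}{\rho(z,t)^{2(2n+m-1)+\langle I\rangle}}\qquad\text{for all }(z,t)\in(\mathbb{C}^{2n}\times\mathbb{R}^m)\setminus\{(0,0)\}.$$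
   Context: Here $\phi:\mathbb{C}^{2n}\times\mathbb{C}^{2n}\to\mathbb{C}^m$ is sesquilinear with $\phi(z,z)\in\mathbb{R}^m$. The projection $(z,t+is)\mapsto(z,t)$ identifies $M$ with $G=\mathbb{C}^{2n}\times\mathbb{R}^m$, which thereby inherits a CR structure and a Lie group structure, $(z',t')\cdot(z,t)=(z+z',\,t+t'+2\operatorname{Im}\phi(z',z))$ ($\phi$ linear in the first slot). $\Box_b=\bar\partial_b\bar\partial_b^*+\bar\partial_b^*\bar\partial_b$ is the Kohn Laplacian acting on $(0,q)$-forms $\sum_K f_K\,d\bar z^K$. Norm and multiindices: $\rho(z,t)=\max\{|z|,|t|^{1/2}\}$. A multiindex $I=(I^1,I^2)$ has $I^1\in\mathbb{N}_0^{4n}$ (derivatives in $z,\bar z$) and $I^2\in\mathbb{N}_0^m$ (derivatives in $t$); $D^I$ is the corresponding coordinate partial derivative and $\langle I\rangle=|I^1|+2|I^2|$. Matrices: for $\nu\in S^{m-1}$ (unit sphere of $\mathbb{R}^m$) let $A_\nu$ be the Hermitian $2n\times 2n$ matrix with $\phi(z,z)\cdot\nu=z^*A_\nu z$. Under the hypotheses $A_\nu$ has exactly $n$ positive and $n$ negative eigenvalues; label the eigenvalues $\mu_1^\nu,\dots,\mu_{2n}^\nu$ so that $\mu_j^\nu>0$ iff $j\in P$, where $P\subset\{1,\dots,2n\}$ is a fixed $n$-element set independent of $\nu$. Let $U(\nu)$ be a unitary matrix (measurable in $\nu$) whose $j$th column is a unit eigenvector for $\mu_j^\nu$; put $z^\nu=U(\nu)^*z$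 and $d\bar Z(\nu,z)=U(\nu)^T d\bar z$ (a column of $(0,1)$-forms). $\mathcal I_q$ is the set of increasing $q$-tuples from $\{1,\dots,2n\}$; for $L\in\mathcal I_q$, $d\bar Z(\nu,z)^L$ is the corresponding wedge product, and $\bar U(\nu)_{K,L}$ is the $q\times q$ submatrix of $\bar U(\nu)$ with rows $K$ and columns $L$ (for $q=0$ the determinant and the form are both $1$). Kernels: set $$A(r,\nu,z)=\sum_{j=1}^{2n}|\mu_j^\nu|\frac{1+r^{|\mu_j^\nu|}}{1-r^{|\mu_j^\nu|}}|z_j^\nu|^2,\qquad B_L(r,\nu)=\prod_{j\in(L^c\cap P)\cup(L\cap P^c)}\frac{r^{|\mu_j^\nu|}|\mu_j^\nu|}{1-r^{|\mu_j^\nu|}}\prod_{k\in(L\cap P)\cup(L^c\cap P^c)}\frac{|\mu_k^\nu|}{1-r^{|\mu_k^\nu|}},$$ and $K_{n,m}=\frac{4^{2n}(2n+m-2)!}{2(2\pi)^{m+2n}}$. The operator $N_{0,q}$ acts on $f_K\,d\bar z^K$ by group convolution of $f_K$ with the form-valued kernel $N_K$, $K\in\mathcal I_q$, given as follows ($d\nu$ is surface measure). If $q\ne n$: $$N_K(z,t)=K_{n,m}\sum_{L\in\mathcal I_q}\int_{S^{m-1}}\det(\bar U(\nu)_{K,L})\,d\bar Z(\nu,z)^L\int_0^1\frac{B_L(r,\nu)}{(A(r,\nu,z)-i\nu\cdot t)^{2n+m-1}}\frac{dr\,d\nu}{r}.$$ If $q=n$: $$N_K(z,t)=K_{n,m}\Big[\sum_{L\in\mathcal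 I_n,L\neq P}\int_{S^{m-1}}\det(\bar U(\nu)_{K,L})\,d\bar Z(\nu,z)^L\int_0^1\frac{B_L(r,\nu)}{(A(r,\nu,z)-i\nu\cdot t)^{2n+m-1}}\frac{dr\,d\nu}{r}$$ $$+\int_{S^{m-1}}\det(\bar U(\nu)_{K,P})\,d\bar Z(\nu,z)^P\int_0^1\Big[\frac{B_P(r,\nu)}{(A(r,\nu,z)-i\nu\cdot t)^{2n+m-1}}-\frac{|\det A_\nu|}{(A(0,\nu,z)-i\nu\cdot t)^{2n+m-1}}\Big]\frac{dr\,d\nu}{r}\Big].$$ These integrals are taken for $z\ne0$; at points $(0,t)$ with $t\ne0$ the kernel and its derivatives are understood by continuous extension. $N=(N_K)_{K\in\mathcal I_q}$; $D^I$ acts on the coefficients of $N_K$ with respect to the constant forms $d\bar z^J$, $J\in\mathcal I_q$, and $|D^IN(z,t)|$ is the maximum modulus of all these coefficients. *)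

theory Defs
  imports "HOL-Analysis.Analysis"
begin

section \<open>The quadratic form and its directional Levi matrices\<close>

type_synonym 'i cvec = "(complex, 'i) vec"
type_synonym 'i rvec = "(real, 'i) vec"
type_synonym 'i nvec = "(nat, 'i) vec"
type_synonym 'i cmat = "((complex, 'i) vec, 'i) vec"

text \<open>
  The index type \<open>'d\<close> plays the role of \<open>{1..2n}\<close> (so \<open>CARD('d) = 2 * n\<close>) and \<open>'m\<close> that of
  \<open>{1..m}\<close>.  The linear order on \<open>'d\<close> is what gives sense to increasing tuples.
  The quadric itself enters only through \<open>\<phi>\<close>: it is parametrised by \<open>(z,t)\<close> in
  \<open>complex ^ 'd \<times> real ^ 'm\<close>.
\<close>

definition sesquilinear :: "('d::finite cvec \<Rightarrow> 'd cvec \<Rightarrow> 'm::finite cvec) \<Rightarrow> bool" where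
  "sesquilinear \<phi> \<longleftrightarrow>
     (\<forall>x y w. \<phi> (x + y) w = \<phi> x w + \<phi> y w) \<and>
     (\<forall>c x w. \<phi> (c *s x) w = c *s \<phi> x w) \<and>
     (\<forall>z x y. \<phi> z (x + y) = \<phi> z x + \<phi> z y) \<and>
     (\<forall>c z x. \<phi> z (c *s x) = cnj c *s \<phi> z x)"

definition real_on_diagonal :: "('d::finite cvec \<Rightarrow> 'd cvec \<Rightarrow> 'm::finite cvec) \<Rightarrow> bool" where
  "real_on_diagonal \<phi> \<longleftrightarrow> (\<forall>z i. \<phi> z z $ i \<in> \<real>)"

definition directional_form ::
    "('d::finite cvec \<Rightarrow> 'd cvec \<Rightarrow> 'm::finite cvec) \<Rightarrow> 'm rvec \<Rightarrow> 'd cvec \<Rightarrow> 'd cvec \<Rightarrow> complex" where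
  "directional_form \<phi> \<nu> z w = (\<Sum>i\<in>UNIV. \<phi> z w $ i * of_real (\<nu> $ i))"

definition ctranspose :: "complex ^ 'n ^ 'k \<Rightarrow> complex ^ 'k ^ 'n" where
  "ctranspose M = (\<chi> i j. cnj (M $ j $ i))"

definition quad_form :: "'d::finite cmat \<Rightarrow> 'd cvec \<Rightarrow> complex" where
  "quad_form M z = (\<Sum>j\<in>UNIV. cnj (z $ j) * (M *v z) $ j)"

text \<open>
  The matrix \<open>A\<^sub>\<nu>\<close>.  As \<open>\<phi>\<close> is linear in its first slot, the entry in row \<open>j\<close> and column \<open>k\<close> is
  obtained from \<open>\<phi> e\<^sub>k e\<^sub>j\<close>; the lemma \<open>levi_matrix_iff\<close> shows that this is the unique Hermitian
  matrix representing the form \<open>\<phi>(z,z) \<cdot> \<nu>\<close>.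
\<close>

definition levi_matrix ::
    "('d::finite cvec \<Rightarrow> 'd cvec \<Rightarrow> 'm::finite cvec) \<Rightarrow> 'm rvec \<Rightarrow> 'd cmat" where
  "levi_matrix \<phi> \<nu> = (\<chi> j k. directional_form \<phi> \<nu> (axis k 1) (axis j 1))"

definition is_eigenvalue :: "'d::finite cmat \<Rightarrow> complex \<Rightarrow> bool" where
  "is_eigenvalue M c \<longleftrightarrow> (\<exists>v. v \<noteq> 0 \<and> M *v v = c *s v)"

definition unitary :: "'d::finite cmat \<Rightarrow> bool" where
  "unitary M \<longleftrightarrow> ctranspose M ** M = mat 1 \<and> M ** ctranspose M = mat 1"

section \<open>Surface measure on the unit sphere\<close>

text \<open>
  The surface measure of \<open>E\<close> is \<open>DIM('a)\<close> times the Lebesgue measure of the truncated cone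
  \<open>{r *\<^sub>R x | r x. x \<in> E \<and> 0 < r \<and> r < 1}\<close>, the normalisation for which integration in polar
  coordinates reads \<open>dx = r ^ (DIM('a) - 1) dr d\<nu>\<close>.
\<close>

definition sphere_measure :: "'a::euclidean_space measure" where
  "sphere_measure =
     scale_measure (of_nat DIM('a))
       (distr (restrict_space lborel (ball 0 1 - {0})) (restrict_space borel (sphere 0 1))
              (\<lambda>x. x /\<^sub>R norm x))"

section \<open>Diagonalisation of the Levi matrices\<close>

definition levi_diagonalization ::
    "('d::finite cvec \<Rightarrow> 'd cvec \<Rightarrow> 'm::finite cvec) \<Rightarrow> 'd set \<Rightarrow> ('m rvec \<Rightarrow> 'd \<Rightarrow> real) \<Rightarrow>
     ('m rvec \<Rightarrow> 'd cmat) \<Rightarrow> bool" where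
  "levi_diagonalization \<phi> P \<mu> U \<longleftrightarrow>
     (\<forall>\<nu>\<in>sphere 0 1.
        unitary (U \<nu>) \<and>
        (\<forall>j. levi_matrix \<phi> \<nu> *v column j (U \<nu>) = of_real (\<mu> \<nu> j) *s column j (U \<nu>)) \<and>
        (\<forall>j. 0 < \<mu> \<nu> j \<longleftrightarrow> j \<in> P)) \<and>
     U \<in> borel_measurable sphere_measure"

section \<open>Forms of type (0,q) with constant coefficients\<close>

text \<open>
  An increasing tuple is represented by its underlying set.  A constant-coefficient
  form is represented by its family of coefficients: \<open>\<omega> J\<close> is the coefficient
  of \<open>dzbar\<^sup>J\<close>.  The sign in \<open>wedge\<close> counts the inversions needed to sort \<open>A\<close> followed by \<open>J - A\<close>.
\<close>

definition tuples :: "nat \<Rightarrow> 'd::finite set set" where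
  "tuples q = {L. card L = q}"

definition wedge :: "('d::{finite,linorder} set \<Rightarrow> complex) \<Rightarrow> ('d set \<Rightarrow> complex) \<Rightarrow> 'd set \<Rightarrow> complex" where
  "wedge \<omega> \<eta> J =
     (\<Sum>A\<in>Pow J. (- 1) ^ card {(i, j). i \<in> A \<and> j \<in> J - A \<and> j < i} * \<omega> A * \<eta> (J - A))"

text \<open>The forms \<open>dZbar\<^sub>j\<close>, i.e. the entries of \<open>U\<^sup>T dzbar\<close>, and their wedge products.\<close>

definition dZbar :: "'d::finite cmat \<Rightarrow> 'd \<Rightarrow> 'd set \<Rightarrow> complex" where
  "dZbar V j J = (\<Sum>k\<in>UNIV. transpose V $ j $ k * (if J = {k} then 1 else 0))"

definition dZbar_wedge :: "'d::{finite,linorder} cmat \<Rightarrow> 'd set \<Rightarrow> 'd set \<Rightarrow> complex" where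
  "dZbar_wedge V L =
     foldr wedge (map (dZbar V) (sorted_list_of_set L)) (\<lambda>J. if J = {} then 1 else 0)"

text \<open>Determinant of the submatrix with rows \<open>K\<close> and columns \<open>L\<close>, for \<open>card K = card L\<close>.\<close>

definition minor_det :: "'d::{finite,linorder} cmat \<Rightarrow> 'd set \<Rightarrow> 'd set \<Rightarrow> complex" where
  "minor_det M K L =
     (\<Sum>p | p permutes {..<card K}. of_int (sign p) *
        (\<Prod>i<card K. M $ (sorted_list_of_set K ! i) $ (sorted_list_of_set L ! p i)))"

definition conj_matrix :: "'d::finite cmat \<Rightarrow> 'd cmat" where
  "conj_matrix M = (\<chi> i j. cnj (M $ i $ j))"

section \<open>The Green kernels\<close>

text \<open>
  \<open>A_fun\<close> and \<open>B_fun\<close> take the eigenvalues \<open>\<mu> \<nu>\<close> and the matrix \<open>U \<nu>\<close> at the given direction.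
  Since \<open>0 powr a = 0\<close>, the value of \<open>A_fun\<close> at \<open>r = 0\<close> is \<open>\<Sum>j. \<bar>\<mu>\<^sub>j\<bar> \<bar>z\<^sub>j\<bar>\<^sup>2\<close>, as intended.
\<close>

definition A_fun :: "('d::finite \<Rightarrow> real) \<Rightarrow> 'd cmat \<Rightarrow> real \<Rightarrow> 'd cvec \<Rightarrow> real" where
  "A_fun \<mu> V r z =
     (\<Sum>j\<in>UNIV. \<bar>\<mu> j\<bar> * ((1 + r powr \<bar>\<mu> j\<bar>) / (1 - r powr \<bar>\<mu> j\<bar>)) * (cmod ((ctranspose V *v z) $ j))\<^sup>2)"

definition B_fun :: "'d set \<Rightarrow> ('d::finite \<Rightarrow> real) \<Rightarrow> 'd set \<Rightarrow> real \<Rightarrow> real" where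
  "B_fun P \<mu> L r =
     (\<Prod>j \<in> (- L \<inter> P) \<union> (L \<inter> - P). r powr \<bar>\<mu> j\<bar> * \<bar>\<mu> j\<bar> / (1 - r powr \<bar>\<mu> j\<bar>)) *
     (\<Prod>k \<in> (L \<inter> P) \<union> (- L \<inter> - P). \<bar>\<mu> k\<bar> / (1 - r powr \<bar>\<mu> k\<bar>))"

definition green_const :: "nat \<Rightarrow> nat \<Rightarrow> real" where
  "green_const n m = 4 ^ (2 * n) * fact (2 * n + m - 2) / (2 * (2 * pi) ^ (m + 2 * n))"

text \<open>\<open>(A(r,\<nu>,z) - i \<nu> \<cdot> t) ^ (2n+m-1)\<close>, with \<open>2n = CARD('d)\<close>.\<close>

definition green_denom ::
    "('m::finite rvec \<Rightarrow> 'd::finite \<Rightarrow> real) \<Rightarrow> ('m rvec \<Rightarrow> 'd cmat) \<Rightarrow> real \<Rightarrow> 'm rvec \<Rightarrow>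
     'd cvec \<Rightarrow> 'm rvec \<Rightarrow> complex" where
  "green_denom \<mu> U r \<nu> z t =
     (of_real (A_fun (\<mu> \<nu>) (U \<nu>) r z) - \<i> * of_real (\<nu> \<bullet> t)) ^ (CARD('d) + CARD('m) - 1)"

definition radial_integral ::
    "'d::finite set \<Rightarrow> ('m::finite rvec \<Rightarrow> 'd \<Rightarrow> real) \<Rightarrow> ('m rvec \<Rightarrow> 'd cmat) \<Rightarrow> 'd set \<Rightarrow>
     'm rvec \<Rightarrow> 'd cvec \<Rightarrow> 'm rvec \<Rightarrow> complex" where
  "radial_integral P \<mu> U L \<nu> z t =
     (LINT r:{0<..<1}|lborel.
        (of_real (B_fun P (\<mu> \<nu>) L r) / green_denom \<mu> U r \<nu> z t) / of_real r)"

definition radial_integral_rel ::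
    "('d::finite cvec \<Rightarrow> 'd cvec \<Rightarrow> 'm::finite cvec) \<Rightarrow>
     'd set \<Rightarrow> ('m rvec \<Rightarrow> 'd \<Rightarrow> real) \<Rightarrow> ('m rvec \<Rightarrow> 'd cmat) \<Rightarrow>
     'm rvec \<Rightarrow> 'd cvec \<Rightarrow> 'm rvec \<Rightarrow> complex" where
  "radial_integral_rel \<phi> P \<mu> U \<nu> z t =
     (LINT r:{0<..<1}|lborel.
        (of_real (B_fun P (\<mu> \<nu>) P r) / green_denom \<mu> U r \<nu> z t
         - of_real (cmod (det (levi_matrix \<phi> \<nu>))) / green_denom \<mu> U 0 \<nu> z t) / of_real r)"

text \<open>
  The coefficient of \<open>dzbar\<^sup>J\<close> in \<open>N\<^sub>K(z,t)\<close> on (0,q)-forms, as an integral; meaningful for \<open>z \<noteq> 0\<close>.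
  Under the standing hypotheses \<open>card P = n\<close>, so that the second case is \<open>q = n\<close>.
\<close>

definition green_kernel ::
    "('d::{finite,linorder} cvec \<Rightarrow> 'd cvec \<Rightarrow> 'm::finite cvec) \<Rightarrow>
     'd set \<Rightarrow> ('m rvec \<Rightarrow> 'd \<Rightarrow> real) \<Rightarrow> ('m rvec \<Rightarrow> 'd cmat) \<Rightarrow>
     nat \<Rightarrow> 'd set \<Rightarrow> 'd set \<Rightarrow> 'd cvec \<times> 'm rvec \<Rightarrow> complex" where
  "green_kernel \<phi> P \<mu> U q K J = (\<lambda>(z, t).
     of_real (green_const (CARD('d) div 2) CARD('m)) *
     (if q \<noteq> card P then
        (\<Sum>L\<in>tuples q. LINT \<nu>|sphere_measure.
           minor_det (conj_matrix (U \<nu>)) K L * dZbar_wedge (U \<nu>) L J * radial_integral P \<mu> U L \<nu> z t)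
      else
        (\<Sum>L\<in>tuples q - {P}. LINT \<nu>|sphere_measure.
           minor_det (conj_matrix (U \<nu>)) K L * dZbar_wedge (U \<nu>) L J * radial_integral P \<mu> U L \<nu> z t)
        + (LINT \<nu>|sphere_measure.
           minor_det (conj_matrix (U \<nu>)) K P * dZbar_wedge (U \<nu>) P J * radial_integral_rel \<phi> P \<mu> U \<nu> z t)))"

section \<open>Coordinate derivatives, continuous extension and the homogeneous norm\<close>

definition dir_deriv :: "'a::real_normed_vector \<Rightarrow> ('a \<Rightarrow> complex) \<Rightarrow> 'a \<Rightarrow> complex" where
  "dir_deriv v f p = vector_derivative (\<lambda>s::real. f (p + s *\<^sub>R v)) (at 0)"

text \<open>The operators \<open>\<partial>/\<partial>z\<^sub>j\<close>, \<open>\<partial>/\<partial>zbar\<^sub>j\<close> (Wirtinger) and \<open>\<partial>/\<partial>t\<^sub>k\<close>.\<close>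

definition d_z :: "'d::finite \<Rightarrow> ('d cvec \<times> 'm::finite rvec \<Rightarrow> complex) \<Rightarrow> 'd cvec \<times> 'm rvec \<Rightarrow> complex" where
  "d_z j f p = (dir_deriv (axis j 1, 0) f p - \<i> * dir_deriv (axis j \<i>, 0) f p) / 2"

definition d_zbar :: "'d::finite \<Rightarrow> ('d cvec \<times> 'm::finite rvec \<Rightarrow> complex) \<Rightarrow> 'd cvec \<times> 'm rvec \<Rightarrow> complex" where
  "d_zbar j f p = (dir_deriv (axis j 1, 0) f p + \<i> * dir_deriv (axis j \<i>, 0) f p) / 2"

definition d_t :: "'m::finite \<Rightarrow> ('d::finite cvec \<times> 'm rvec \<Rightarrow> complex) \<Rightarrow> 'd cvec \<times> 'm rvec \<Rightarrow> complex" where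
  "d_t k f p = dir_deriv (0, axis k 1) f p"

text \<open>
  A multiindex is a pair \<open>(I1, I2)\<close>; the components \<open>I1 $ Inl j\<close> and \<open>I1 $ Inr j\<close> count
  the derivatives \<open>\<partial>/\<partial>z\<^sub>j\<close> and \<open>\<partial>/\<partial>zbar\<^sub>j\<close>, and \<open>I2 $ k\<close> counts \<open>\<partial>/\<partial>t\<^sub>k\<close>.  Removing the outermost
  operator from a composite \<open>D_multi I1 I2 f\<close> leaves another one, so differentiability of all of
  these means that \<open>f\<close> is smooth.
\<close>

definition D_multi ::
    "('d::{finite,linorder} + 'd) nvec \<Rightarrow> 'm::{finite,linorder} nvec \<Rightarrow>
     ('d cvec \<times> 'm rvec \<Rightarrow> complex) \<Rightarrow>
     'd cvec \<times> 'm rvec \<Rightarrow> complex" where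
  "D_multi I1 I2 f =
     foldr (\<lambda>j. d_z j ^^ (I1 $ Inl j)) (sorted_list_of_set UNIV)
       (foldr (\<lambda>j. d_zbar j ^^ (I1 $ Inr j)) (sorted_list_of_set UNIV)
         (foldr (\<lambda>k. d_t k ^^ (I2 $ k)) (sorted_list_of_set UNIV) f))"

definition weight :: "('d::finite + 'd) nvec \<Rightarrow> 'm::finite nvec \<Rightarrow> nat" where
  "weight I1 I2 = (\<Sum>j\<in>UNIV. I1 $ j) + 2 * (\<Sum>k\<in>UNIV. I2 $ k)"

definition off_axis :: "('d::finite cvec \<times> 'm::finite rvec) set" where
  "off_axis = {(z, t). z \<noteq> 0}"

text \<open>Extension by continuity from \<open>off_axis\<close> to the points \<open>(0,t)\<close>.\<close>

definition cont_extension ::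
    "('d::finite cvec \<times> 'm::finite rvec \<Rightarrow> complex) \<Rightarrow> 'd cvec \<times> 'm rvec \<Rightarrow> complex" where
  "cont_extension f p = (if p \<in> off_axis then f p else Lim (at p within off_axis) f)"

definition green_deriv ::
    "('d::{finite,linorder} cvec \<Rightarrow> 'd cvec \<Rightarrow> 'm::{finite,linorder} cvec) \<Rightarrow>
     'd set \<Rightarrow> ('m rvec \<Rightarrow> 'd \<Rightarrow> real) \<Rightarrow> ('m rvec \<Rightarrow> 'd cmat) \<Rightarrow> nat \<Rightarrow>
     ('d + 'd) nvec \<Rightarrow> 'm nvec \<Rightarrow> 'd set \<Rightarrow> 'd set \<Rightarrow> 'd cvec \<times> 'm rvec \<Rightarrow> complex" where
  "green_deriv \<phi> P \<mu> U q I1 I2 K J = D_multi I1 I2 (green_kernel \<phi> P \<mu> U q K J)"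

definition green_deriv_norm ::
    "('d::{finite,linorder} cvec \<Rightarrow> 'd cvec \<Rightarrow> 'm::{finite,linorder} cvec) \<Rightarrow>
     'd set \<Rightarrow> ('m rvec \<Rightarrow> 'd \<Rightarrow> real) \<Rightarrow> ('m rvec \<Rightarrow> 'd cmat) \<Rightarrow> nat \<Rightarrow>
     ('d + 'd) nvec \<Rightarrow> 'm nvec \<Rightarrow> 'd cvec \<times> 'm rvec \<Rightarrow> real" where
  "green_deriv_norm \<phi> P \<mu> U q I1 I2 p =
     Max {cmod (cont_extension (green_deriv \<phi> P \<mu> U q I1 I2 K J) p) | K J.
            K \<in> tuples q \<and> J \<in> tuples q}"

definition hom_norm :: "'d::finite cvec \<times> 'm::finite rvec \<Rightarrow> real" where
  "hom_norm = (\<lambda>(z, t). max (norm z) (sqrt (norm t)))"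

section \<open>The Levi matrix represents the directional form\<close>

lemma ctranspose_nth [simp]: "ctranspose M $ i $ j = cnj (M $ j $ i)"
  by (simp add: ctranspose_def)

lemma sesquilinear_sum1:
  assumes "sesquilinear \<phi>" "finite S"
  shows "\<phi> (\<Sum>k\<in>S. c k *s x k) w = (\<Sum>k\<in>S. c k *s \<phi> (x k) w)"
  using assms(2)
proof induction
  case empty
  have "\<phi> (0 *s 0) w = 0 *s \<phi> 0 w"
    using assms(1) unfolding sesquilinear_def by blast
  then show ?case by simp
qed (use assms(1) in \<open>simp add: sesquilinear_def\<close>)

lemma sesquilinear_sum2:
  assumes "sesquilinear \<phi>" "finite S"
  shows "\<phi> z (\<Sum>k\<in>S. c k *s x k) = (\<Sum>k\<in>S. cnj (c k) *s \<phi> z (x k))"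
  using assms(2)
proof induction
  case empty
  have "\<phi> z (0 *s 0) = cnj 0 *s \<phi> z 0"
    using assms(1) unfolding sesquilinear_def by blast
  then show ?case by simp
qed (use assms(1) in \<open>simp add: sesquilinear_def\<close>)

lemma directional_form_eq_levi_matrix:
  assumes "sesquilinear \<phi>"
  shows "directional_form \<phi> \<nu> z w = (\<Sum>j\<in>UNIV. cnj (w $ j) * (levi_matrix \<phi> \<nu> *v z) $ j)"
proof -
  have "\<phi> z w = \<phi> (\<Sum>k\<in>UNIV. z $ k *s axis k 1) (\<Sum>j\<in>UNIV. w $ j *s axis j 1)"
    by (simp add: basis_expansion)
  also have "\<dots> = (\<Sum>k\<in>UNIV. z $ k *s (\<Sum>j\<in>UNIV. cnj (w $ j) *s \<phi> (axis k 1) (axis j 1)))"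
    by (subst sesquilinear_sum1[OF assms finite], subst sesquilinear_sum2[OF assms finite], rule refl)
  finally have e: "\<phi> z w $ i =
      (\<Sum>k\<in>UNIV. \<Sum>j\<in>UNIV. z $ k * (cnj (w $ j) * \<phi> (axis k 1) (axis j 1) $ i))" for i
    by (simp add: sum_distrib_left)
  have "directional_form \<phi> \<nu> z w = (\<Sum>i\<in>UNIV. \<Sum>k\<in>UNIV. \<Sum>j\<in>UNIV.
      cnj (w $ j) * (\<phi> (axis k 1) (axis j 1) $ i * of_real (\<nu> $ i) * z $ k))"
    unfolding directional_form_def e by (simp add: sum_distrib_left sum_distrib_right mult_ac)
  also have "\<dots> = (\<Sum>k\<in>UNIV. \<Sum>i\<in>UNIV. \<Sum>j\<in>UNIV.
      cnj (w $ j) * (\<phi> (axis k 1) (axis j 1) $ i * of_real (\<nu> $ i) * z $ k))"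
    by (rule sum.swap)
  also have "\<dots> = (\<Sum>k\<in>UNIV. \<Sum>j\<in>UNIV. \<Sum>i\<in>UNIV.
      cnj (w $ j) * (\<phi> (axis k 1) (axis j 1) $ i * of_real (\<nu> $ i) * z $ k))"
    by (intro sum.cong refl, rule sum.swap)
  also have "\<dots> = (\<Sum>j\<in>UNIV. \<Sum>k\<in>UNIV. \<Sum>i\<in>UNIV.
      cnj (w $ j) * (\<phi> (axis k 1) (axis j 1) $ i * of_real (\<nu> $ i) * z $ k))"
    by (rule sum.swap)
  also have "\<dots> = (\<Sum>j\<in>UNIV. cnj (w $ j) * (levi_matrix \<phi> \<nu> *v z) $ j)"
    by (simp add: levi_matrix_def directional_form_def matrix_vector_mult_def
        sum_distrib_left sum_distrib_right mult_ac)
  finally show ?thesis .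
qed

text \<open>Polarisation: the quadratic form of a complex matrix determines the matrix.\<close>

lemma quad_form_cross:
  fixes M :: "complex ^ 'd ^ 'd"
  shows "quad_form M (axis j a + axis k b) =
    cnj a * a * M $ j $ j + cnj a * b * M $ j $ k + cnj b * a * M $ k $ j + cnj b * b * M $ k $ k"
proof -
  have s: "(\<Sum>i\<in>UNIV. cnj (axis j c $ i) * x $ i) = cnj c * x $ j" for j :: 'd and c and x :: "complex ^ 'd"
    by (subst sum.remove[of _ j]) (auto simp: axis_def intro!: sum.neutral)
  have m: "(M *v axis k c) $ j = M $ j $ k * c" for j k c
    unfolding matrix_vector_mult_def
    by (simp, subst sum.remove[of _ k]) (auto simp: axis_def intro!: sum.neutral)
  let ?w = "M *v (axis j a + axis k b)"
  have "quad_form M (axis j a + axis k b) =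
      (\<Sum>i\<in>UNIV. cnj (axis j a $ i) * ?w $ i) + (\<Sum>i\<in>UNIV. cnj (axis k b $ i) * ?w $ i)"
    unfolding quad_form_def by (simp add: distrib_right sum.distrib)
  also have "\<dots> = cnj a * ?w $ j + cnj b * ?w $ k"
    by (simp only: s)
  finally show ?thesis
    by (simp add: matrix_vector_right_distrib m algebra_simps)
qed

lemma quad_form_inject:
  fixes M M' :: "complex ^ 'd ^ 'd"
  assumes "\<And>z. quad_form M z = quad_form M' z"
  shows "M = M'"
proof -
  have q: "quad_form M (axis j a + axis k b) = quad_form M' (axis j a + axis k b)" for j k a b
    using assms by blast
  have d: "M $ j $ j = M' $ j $ j" for j
    using q[of j 1 j 0] by (simp add: quad_form_cross)
  have "M $ j $ k = M' $ j $ k" for j k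
  proof -
    have "M $ j $ k + M $ k $ j = M' $ j $ k + M' $ k $ j"
      using q[of j 1 k 1] by (simp add: quad_form_cross d)
    moreover have "\<i> * (M $ j $ k - M $ k $ j) = \<i> * (M' $ j $ k - M' $ k $ j)"
      using q[of j 1 k \<i>] by (simp add: quad_form_cross d algebra_simps)
    then have "M $ j $ k - M $ k $ j = M' $ j $ k - M' $ k $ j"
      by simp
    ultimately have "2 * M $ j $ k = 2 * M' $ j $ k"
      by (simp add: algebra_simps) algebra
    then show ?thesis by simp
  qed
  then show ?thesis by (simp add: vec_eq_iff)
qed

lemma quad_form_ctranspose: "quad_form (ctranspose M) z = cnj (quad_form M z)"
proof -
  have "quad_form (ctranspose M) z = (\<Sum>j\<in>UNIV. \<Sum>k\<in>UNIV. cnj (z $ j) * (cnj (M $ k $ j) * z $ k))"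
    by (simp add: quad_form_def matrix_vector_mult_def sum_distrib_left)
  also have "\<dots> = (\<Sum>k\<in>UNIV. \<Sum>j\<in>UNIV. cnj (z $ j) * (cnj (M $ k $ j) * z $ k))"
    by (rule sum.swap)
  also have "\<dots> = cnj (quad_form M z)"
    by (simp add: quad_form_def matrix_vector_mult_def sum_distrib_left mult_ac)
  finally show ?thesis .
qed

lemma levi_matrix_iff:
  assumes "sesquilinear \<phi>" "real_on_diagonal \<phi>"
  shows "M = levi_matrix \<phi> \<nu> \<longleftrightarrow>
    ctranspose M = M \<and> (\<forall>z. directional_form \<phi> \<nu> z z = quad_form M z)"
proof -
  have rep: "directional_form \<phi> \<nu> z z = quad_form (levi_matrix \<phi> \<nu>) z" for z
    by (simp add: directional_form_eq_levi_matrix[OF assms(1)] quad_form_def)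
  have "directional_form \<phi> \<nu> z z \<in> \<real>" for z
    using assms(2) unfolding directional_form_def real_on_diagonal_def
    by (intro sum_in_Reals Reals_mult) auto
  then have "quad_form (ctranspose (levi_matrix \<phi> \<nu>)) z = quad_form (levi_matrix \<phi> \<nu>) z" for z
    by (metis quad_form_ctranspose rep Reals_cnj_iff)
  then have "ctranspose (levi_matrix \<phi> \<nu>) = levi_matrix \<phi> \<nu>"
    by (rule quad_form_inject)
  with rep show ?thesis
    by (metis quad_form_inject)
qed

end

theory Submission
  imports Defs "HOL-Complex_Analysis.Conformal_Mappings"
begin

text \<open>
  With \<open>r = exp (- s)\<close> and \<open>x = s \<nu>\<close> the double integral is one over \<open>\<real>\<^sup>m\<close> in polar coordinates.
  Subtracting from the integrand at \<open>s\<close> its value at \<open>2 s\<close> removes the limit at \<open>r = 0\<close> for all \<open>L\<close> and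
  \<open>q\<close> at once, and makes the integrand exponentially small at infinity. Summed over \<open>L\<close>, it is
  \<open>symbol X / (z\<^sup>* (X coth (X/2)) z - i x \<bullet> t)\<^bsup>2n+m-1\<^esup>\<close> at the Levi matrix \<open>X\<close> of \<open>x\<close>, whose numerator is built
  from \<open>X coth (X/2)\<close> and the compound matrices of \<open>exp X\<close>; it extends holomorphically to a tube around
  \<open>\<real>\<^sup>m\<close>, where the two-constants theorem preserves the exponential decay. So the contour can be moved to
  \<open>x + i y \<eta>\<close>. Near \<open>(0, t)\<close>, with \<open>\<eta>\<close> in the direction of \<open>t\<close>, this keeps the real part of the denominator
  bounded below, so the kernel extends smoothly to the complement of the origin. Homogeneity under
  \<open>(z, t) \<mapsto> (r z, r\<^sup>2 t)\<close> and compactness of the unit sphere of \<open>\<rho>\<close> give the bounds.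
\<close>

subsection \<open>Smoothness of parameter integrals\<close>

text \<open>Off the real space the Levi matrix need not be normal, so its functions are not
  controlled by eigenvalues: only crude exponential growth is available there, and the decay that
  the spectral gap gives on real directions has to be carried over by interpolation. Single summands
  in L come with no regularity in \<nu> beyond measurability. The obstacle on z = 0 is that the
  denominator reduces to -i x \<bullet> t, which vanishes on a hyperplane of real x; the shift adds
  y \<eta> \<bullet> t to its real part. Comparing s with 2 s costs only a factor 2: the integral of
  G(2 s) over s > 0 is half that of G, so the difference integrates to half the original value, and
  the limit at s = infinity cancels. The counterterm for L = P and its absence for L \<noteq> P
  therefore need no separate treatment. The contour is moved by the identity theorem in the shift
  parameter, since real shifts leave the integral unchanged by translation invariance. Homogeneity
  is verified on the defining integrals and passes to z = 0 by continuity.\<close>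

lemma dir_deriv_eq:
  assumes "(f has_derivative f') (at p)"
  shows "dir_deriv v f p = f' v"
proof -
  have lin: "linear f'" using assms has_derivative_linear by blast
  have "((\<lambda>s::real. f (p + s *\<^sub>R v)) has_derivative (\<lambda>s. f' (s *\<^sub>R v))) (at 0)"
    by (rule has_derivative_compose[where g=f and f="\<lambda>s. p + s *\<^sub>R v" and f'="\<lambda>s. s *\<^sub>R v" and x=0 and g'=f'])
       (use assms in \<open>auto intro!: derivative_eq_intros\<close>)
  then have "((\<lambda>s::real. f (p + s *\<^sub>R v)) has_vector_derivative f' v) (at 0)"
    unfolding has_vector_derivative_def by (simp add: linear_cmul[OF lin])
  then show ?thesis unfolding dir_deriv_def by (rule vector_derivative_at)
qed

text \<open>Differentiability is required in the ambient space, not within B, and the recursion runs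
  over arbitrary directions. This fits \<open>D_multi\<close>, which only composes directional
  derivatives, and avoids higher derivatives as multilinear maps.\<close>

primrec Ck :: "nat \<Rightarrow> 'a::real_normed_vector set \<Rightarrow> ('a \<Rightarrow> complex) \<Rightarrow> bool" where
  "Ck 0 B f = True"
| "Ck (Suc n) B f = ((\<forall>p\<in>B. f differentiable (at p)) \<and> (\<forall>v. Ck n B (dir_deriv v f)))"

text \<open>Every clause of \<open>Ck\<close> is a condition at single points, so smoothness on the
  complement of the origin can be glued from local integral formulas.\<close>

lemma Ck_pointwise: "Ck n B f \<longleftrightarrow> (\<forall>p\<in>B. Ck n {p} f)"
proof (induction n arbitrary: f)
  case (Suc n)
  show ?case unfolding Ck.simps by (subst Suc) auto
qed simp

lemma dir_deriv_cong:
  assumes "open B" "\<And>p. p \<in> B \<Longrightarrow> f p = g p" "p \<in> B"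
  shows "dir_deriv v f p = dir_deriv v g p"
proof -
  have "((\<lambda>s::real. p + s *\<^sub>R v) \<longlongrightarrow> p + 0 *\<^sub>R v) (at 0)"
    by (intro tendsto_intros)
  then have "\<forall>\<^sub>F s::real in at 0. p + s *\<^sub>R v \<in> B"
    using assms topological_tendstoD by fastforce
  then have "\<forall>\<^sub>F s::real in nhds 0. f (p + s *\<^sub>R v) = g (p + s *\<^sub>R v)"
    unfolding eventually_at_filter
    by eventually_elim (use assms in auto)
  then show ?thesis unfolding dir_deriv_def
    by (intro vector_derivative_cong_eq) (auto elim: eventually_mono)
qed

lemma Ck_cong:
  assumes "open B" "\<And>p. p \<in> B \<Longrightarrow> f p = g p"
  shows "Ck n B f \<longleftrightarrow> Ck n B g"
  using assms(2)
proof (induction n arbitrary: f g)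
  case (Suc n)
  have "f differentiable (at p) \<longleftrightarrow> g differentiable (at p)" if "p \<in> B" for p
  proof -
    have "(f has_derivative D) (at p) \<longleftrightarrow> (g has_derivative D) (at p)" for D
      using has_derivative_transform_within_open[OF _ assms(1) that] Suc.prems by (metis (no_types, lifting))
    then show ?thesis by (simp add: differentiable_def)
  qed
  moreover have "Ck n B (dir_deriv v f) \<longleftrightarrow> Ck n B (dir_deriv v g)" for v
    by (rule Suc.IH) (rule dir_deriv_cong[OF assms(1) Suc.prems])
  ultimately show ?case by simp
qed simp

lemma Ck_const: "Ck n (B :: 'a::real_normed_vector set) (\<lambda>p. c)"
proof (induction n arbitrary: c)
  case (Suc n)
  have "dir_deriv v (\<lambda>p. c) = (\<lambda>p. 0)" for v :: 'a
    by (rule ext, rule dir_deriv_eq[OF has_derivative_const])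
  then show ?case using Suc by (simp add: differentiable_const)
qed simp

lemma Ck_add:
  assumes "open B" "Ck n B f" "Ck n B g"
  shows "Ck n B (\<lambda>p. f p + g p)"
  using assms(2,3)
proof (induction n arbitrary: f g)
  case (Suc n)
  have "dir_deriv v (\<lambda>p. f p + g p) p = dir_deriv v f p + dir_deriv v g p" if "p \<in> B" for p v
  proof -
    have "f differentiable (at p)" "g differentiable (at p)" using Suc.prems that by simp_all
    then obtain f' g' where d: "(f has_derivative f') (at p)" "(g has_derivative g') (at p)"
      unfolding differentiable_def by blast
    show ?thesis
      using dir_deriv_eq[OF has_derivative_add[OF d]] dir_deriv_eq[OF d(1)] dir_deriv_eq[OF d(2)] by simp
  qed
  then have "Ck n B (dir_deriv v (\<lambda>p. f p + g p))" for v
    using Suc.IH[of "dir_deriv v f" "dir_deriv v g"] Suc.prems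
    by (subst Ck_cong[OF assms(1)]) simp_all
  then show ?case using Suc.prems by simp
qed simp

lemma Ck_cmult:
  assumes "open B" "Ck n B f"
  shows "Ck n B (\<lambda>p. c * f p)"
  using assms(2)
proof (induction n arbitrary: f)
  case (Suc n)
  have "dir_deriv v (\<lambda>p. c * f p) p = c * dir_deriv v f p" if "p \<in> B" for p v
  proof -
    have "f differentiable (at p)" using Suc.prems that by simp
    then obtain f' where d: "(f has_derivative f') (at p)"
      unfolding differentiable_def by blast
    show ?thesis
      using dir_deriv_eq[OF has_derivative_mult_right[OF d]] dir_deriv_eq[OF d] by simp
  qed
  then have "Ck n B (dir_deriv v (\<lambda>p. c * f p))" for v
    using Suc.IH[of "dir_deriv v f"] Suc.prems
    by (subst Ck_cong[OF assms(1)]) simp_all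
  then show ?case using Suc.prems by simp
qed simp

lemma Ck_sum:
  assumes "open B" "\<And>i. i \<in> A \<Longrightarrow> Ck n B (f i)"
  shows "Ck n B (\<lambda>p. \<Sum>i\<in>A. f i p)"
  using assms(2)
proof (induction A rule: infinite_finite_induct)
  case (insert i A)
  then have "Ck n B (\<lambda>p. f i p + (\<Sum>i\<in>A. f i p))" by (intro Ck_add assms(1)) auto
  then show ?case using insert by simp
qed (simp_all add: Ck_const)

section \<open>Differentiation under the integral sign\<close>

lemma tendsto_at_seq:
  assumes "(f \<longlongrightarrow> l) (at a)" "X \<longlonglongrightarrow> a" "\<And>n. X n \<noteq> a"
  shows "(\<lambda>n. f (X n)) \<longlonglongrightarrow> l"
proof -
  have "filterlim X (at a) sequentially"
    using assms(2,3) by (intro filterlim_atI always_eventually allI)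
  from filterlim_compose[OF assms(1) this] show ?thesis .
qed

lemma has_vector_derivative_at_0:
  fixes F :: "real \<Rightarrow> 'b::real_normed_vector"
  assumes "(F has_vector_derivative D) (at 0)"
  shows "((\<lambda>s. (F s - F 0) /\<^sub>R s) \<longlongrightarrow> D) (at 0)"
proof -
  have "((\<lambda>h. norm ((F h - F 0) /\<^sub>R h - D)) \<longlongrightarrow> 0) (at 0)"
  proof (rule Lim_transform_eventually)
    show "((\<lambda>h. norm (F (0 + h) - F 0 - h *\<^sub>R D) / norm h) \<longlongrightarrow> 0) (at 0)"
      using assms unfolding has_vector_derivative_def has_derivative_at by blast
    show "\<forall>\<^sub>F h in at 0. norm (F (0 + h) - F 0 - h *\<^sub>R D) / norm h = norm ((F h - F 0) /\<^sub>R h - D)"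
    proof (rule eventually_at_topological[THEN iffD2, rule_format], intro exI[of _ UNIV] conjI ballI impI)
      fix h :: real assume "h \<noteq> 0"
      then have "(F h - F 0) /\<^sub>R h - D = (F h - F 0 - h *\<^sub>R D) /\<^sub>R h"
        by (simp add: scaleR_diff_right)
      then show "norm (F (0 + h) - F 0 - h *\<^sub>R D) / norm h = norm ((F h - F 0) /\<^sub>R h - D)"
        by (simp add: divide_inverse mult.commute)
    qed auto
  qed
  then show ?thesis
    using LIM_zero_cancel tendsto_norm_zero_iff by fast
qed

text \<open>Growth bounds for derivatives are later known one direction at a time; expansion in the
  finite basis turns them into one majorant for all directions.\<close>

lemma norm_linear_le_sum_Basis:
  fixes L :: "'a::euclidean_space \<Rightarrow> complex"
  assumes "linear L" "\<And>b. b \<in> Basis \<Longrightarrow> norm (L b) \<le> C b"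
  shows "norm (L v) \<le> (\<Sum>b\<in>Basis. C b) * norm v"
proof -
  have "L v = L (\<Sum>b\<in>Basis. (v \<bullet> b) *\<^sub>R b)" by (simp add: euclidean_representation)
  also have "\<dots> = (\<Sum>b\<in>Basis. (v \<bullet> b) *\<^sub>R L b)"
    by (simp add: linear_sum[OF assms(1)] linear_cmul[OF assms(1)])
  also have "norm \<dots> \<le> (\<Sum>b\<in>Basis. norm v * C b)"
    by (intro sum_norm_le) (auto intro!: mult_mono assms(2) Basis_le_norm)
  finally show ?thesis by (simp add: sum_distrib_left mult.commute)
qed

text \<open>The mean value inequality turns the bound on the derivatives into a Lipschitz bound with
  the same integrable majorant, and dominated convergence does the rest. Measurability of the
  derivative is obtained along the way.\<close>

lemma has_derivative_integral:
  fixes f :: "'x \<Rightarrow> 'a::euclidean_space \<Rightarrow> complex"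
  assumes e: "0 < e"
    and meas: "\<And>p. p \<in> ball p0 e \<Longrightarrow> (\<lambda>x. f x p) \<in> borel_measurable M"
    and int: "integrable M (\<lambda>x. f x p0)"
    and deriv: "\<And>x p. x \<in> space M \<Longrightarrow> p \<in> ball p0 e \<Longrightarrow> (f x has_derivative f' x p) (at p)"
    and bound: "\<And>x p v. x \<in> space M \<Longrightarrow> p \<in> ball p0 e \<Longrightarrow> norm (f' x p v) \<le> g x * norm v"
    and g: "integrable M g"
  shows "((\<lambda>p. \<integral>x. f x p \<partial>M) has_derivative (\<lambda>v. \<integral>x. f' x p0 v \<partial>M)) (at p0)"
    and "\<And>v. integrable M (\<lambda>x. f' x p0 v)"
proof -
  have p0: "p0 \<in> ball p0 e" using e by simp
  have lip: "norm (f x p - f x p0) \<le> g x * norm (p - p0)" if "x \<in> space M" "p \<in> ball p0 e" for x p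
  proof (rule differentiable_bound[OF convex_ball _ _ that(2) p0])
    fix q assume q: "q \<in> ball p0 e"
    show "(f x has_derivative f' x q) (at q within ball p0 e)"
      using deriv[OF that(1) q] by (rule has_derivative_at_withinI)
    show "onorm (f' x q) \<le> g x"
      by (rule onorm_le) (use bound[OF that(1) q] in auto)
  qed
  have int': "integrable M (\<lambda>x. f x p)" if "p \<in> ball p0 e" for p
  proof (rule Bochner_Integration.integrable_bound[of M "\<lambda>x. norm (f x p0) + g x * norm (p - p0)"])
    show "integrable M (\<lambda>x. norm (f x p0) + g x * norm (p - p0))"
      using int g by auto
    show "AE x in M. norm (f x p) \<le> norm (norm (f x p0) + g x * norm (p - p0))"
    proof (rule AE_I2)
      fix x assume "x \<in> space M"
      from lip[OF this that] have "norm (f x p) \<le> norm (f x p0) + g x * norm (p - p0)"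
        using norm_triangle_sub[of "f x p" "f x p0"] by linarith
      then show "norm (f x p) \<le> norm (norm (f x p0) + g x * norm (p - p0))" by simp
    qed
  qed (use meas that in auto)
  \<comment> \<open>The derivative is a pointwise limit of difference quotients along a sequence.
    The steps \<open>h n\<close> are scaled by the norm of v so that p0 + h n v stays in the ball,
    where f is measurable.\<close>
  have fm: "(\<lambda>x. f' x p0 v) \<in> borel_measurable M" for v
  proof (cases "v = 0")
    case True
    have "f' x p0 0 = 0" if "x \<in> space M" for x
      using deriv[OF that p0] has_derivative_linear linear_0 by blast
    then show ?thesis using True by (subst measurable_cong[where g="\<lambda>x. 0"]) auto
  next
    case False
    define h where "h n = (e / 2 / norm v / real (Suc n))" for n
    have h0: "h n \<noteq> 0" "h n > 0" for n using e False by (auto simp: h_def)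
    have hl: "h \<longlonglongrightarrow> 0"
      using tendsto_mult[OF tendsto_const[of "e / 2 / norm v"] LIMSEQ_inverse_real_of_nat]
      by (simp only: h_def[abs_def] divide_inverse mult_zero_right)
    have hb: "p0 + h n *\<^sub>R v \<in> ball p0 e" for n
    proof -
      have "norm (h n *\<^sub>R v) = e / 2 / real (Suc n)" using False e by (simp add: h_def)
      also have "\<dots> \<le> e / 2 / 1" using e by (intro divide_left_mono) auto
      also have "\<dots> < e" using e by simp
      finally show ?thesis by (simp add: dist_norm)
    qed
    show ?thesis
    proof (rule borel_measurable_LIMSEQ_metric)
      fix n show "(\<lambda>x. (f x (p0 + h n *\<^sub>R v) - f x p0) /\<^sub>R h n) \<in> borel_measurable M"
        using meas[OF hb[of n]] meas[OF p0] by measurable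
    next
      fix x assume x: "x \<in> space M"
      have lin: "linear (f' x p0)" using deriv[OF x p0] has_derivative_linear by blast
      have "((\<lambda>s::real. f x (p0 + s *\<^sub>R v)) has_derivative (\<lambda>s. f' x p0 (s *\<^sub>R v))) (at 0)"
        by (rule has_derivative_compose[where g="f x" and f="\<lambda>s. p0 + s *\<^sub>R v" and f'="\<lambda>s. s *\<^sub>R v" and x=0 and g'="f' x p0"])
           (use deriv[OF x p0] in \<open>auto intro!: derivative_eq_intros\<close>)
      then have "((\<lambda>s::real. f x (p0 + s *\<^sub>R v)) has_vector_derivative f' x p0 v) (at 0)"
        unfolding has_vector_derivative_def by (simp add: linear_cmul[OF lin])
      then have "((\<lambda>s. (f x (p0 + s *\<^sub>R v) - f x p0) /\<^sub>R s) \<longlongrightarrow> f' x p0 v) (at 0)"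
        using has_vector_derivative_at_0[of "\<lambda>s. f x (p0 + s *\<^sub>R v)"] by simp
      then show "(\<lambda>n. (f x (p0 + h n *\<^sub>R v) - f x p0) /\<^sub>R h n) \<longlonglongrightarrow> f' x p0 v"
        by (rule tendsto_at_seq) (use hl h0 in auto)
    qed
  qed
  show fi: "integrable M (\<lambda>x. f' x p0 v)" for v
  proof (rule Bochner_Integration.integrable_bound[of M "\<lambda>x. g x * norm v"])
    show "AE x in M. norm (f' x p0 v) \<le> norm (g x * norm v)"
      using bound[OF _ p0] by (intro AE_I2) (smt (verit) real_norm_def)
  qed (use g fm in auto)
  have "bounded_linear (\<lambda>v. \<integral>x. f' x p0 v \<partial>M)"
  proof (rule bounded_linear_intro)
    fix u v
    have "(\<integral>x. f' x p0 (u + v) \<partial>M) = (\<integral>x. f' x p0 u + f' x p0 v \<partial>M)"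
      using deriv[OF _ p0] has_derivative_linear linear_add
      by (intro Bochner_Integration.integral_cong refl) blast
    then show "(\<integral>x. f' x p0 (u + v) \<partial>M) = (\<integral>x. f' x p0 u \<partial>M) + (\<integral>x. f' x p0 v \<partial>M)"
      using fi by simp
  next
    fix r :: real and v
    have "(\<integral>x. f' x p0 (r *\<^sub>R v) \<partial>M) = (\<integral>x. r *\<^sub>R f' x p0 v \<partial>M)"
      using deriv[OF _ p0] has_derivative_linear linear_cmul
      by (intro Bochner_Integration.integral_cong refl) blast
    then show "(\<integral>x. f' x p0 (r *\<^sub>R v) \<partial>M) = r *\<^sub>R (\<integral>x. f' x p0 v \<partial>M)"
      by simp
  next
    fix v
    have "norm (\<integral>x. f' x p0 v \<partial>M) \<le> (\<integral>x. norm (f' x p0 v) \<partial>M)"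
      by (rule integral_norm_bound)
    also have "\<dots> \<le> (\<integral>x. g x * norm v \<partial>M)"
      by (rule integral_mono[OF integrable_norm[OF fi] integrable_mult_left[OF g]]) (rule bound[OF _ p0])
    finally have "norm (\<integral>x. f' x p0 v \<partial>M) \<le> (\<integral>x. g x * norm v \<partial>M)" .
    then show "norm (\<integral>x. f' x p0 v \<partial>M) \<le> norm v * (\<integral>x. g x \<partial>M)"
      by (simp add: mult.commute)
  qed
  moreover have "((\<lambda>h. norm ((\<integral>x. f x (p0 + h) \<partial>M) - (\<integral>x. f x p0 \<partial>M) - (\<integral>x. f' x p0 h \<partial>M)) / norm h) \<longlongrightarrow> 0) (at 0)"
    unfolding tendsto_at_iff_sequentially comp_def
  proof (intro allI impI)
    fix h :: "nat \<Rightarrow> 'a" assume h: "\<forall>i. h i \<in> UNIV - {0}" "h \<longlonglongrightarrow> 0"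
    obtain N where N: "\<And>n. n \<ge> N \<Longrightarrow> norm (h n) < e"
      using LIMSEQ_D[OF h(2) e] by auto
    \<comment> \<open>The tail of h that stays in the ball, where the majorant is valid.\<close>
    define k where "k n = h (n + N)" for n
    have k0: "k n \<noteq> 0" and kb: "p0 + k n \<in> ball p0 e" for n
      using h(1) N[of "n + N"] by (auto simp: k_def dist_norm)
    have kl: "k \<longlonglongrightarrow> 0" unfolding k_def using h(2) by (rule LIMSEQ_ignore_initial_segment)
    \<comment> \<open>The majorant 2 g collects one g from the Lipschitz bound and one from the
      derivative itself.\<close>
    have "(\<lambda>n. \<integral>x. (f x (p0 + k n) - f x p0 - f' x p0 (k n)) /\<^sub>R norm (k n) \<partial>M) \<longlonglongrightarrow> (\<integral>x. 0 \<partial>M)"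
    proof (rule integral_dominated_convergence[where w="\<lambda>x. 2 * g x"])
      show "integrable M (\<lambda>x. 2 * g x)" using g by simp
      show "(\<lambda>x. (f x (p0 + k i) - f x p0 - f' x p0 (k i)) /\<^sub>R norm (k i)) \<in> borel_measurable M" for i
        using meas[OF kb[of i]] meas[OF p0] fm[of "k i"] by measurable
      show "AE x in M. (\<lambda>i. (f x (p0 + k i) - f x p0 - f' x p0 (k i)) /\<^sub>R norm (k i)) \<longlonglongrightarrow> 0"
      proof (rule AE_I2)
        fix x assume x: "x \<in> space M"
        have "((\<lambda>y. (f x (p0 + y) - f x p0 - f' x p0 y) /\<^sub>R norm y) \<longlongrightarrow> 0) (at 0)"
          using deriv[OF x p0] unfolding has_derivative_at
          by (subst tendsto_norm_zero_iff[symmetric]) (simp add: divide_inverse mult.commute)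
        then show "(\<lambda>i. (f x (p0 + k i) - f x p0 - f' x p0 (k i)) /\<^sub>R norm (k i)) \<longlonglongrightarrow> 0"
          by (rule tendsto_at_seq) (use kl k0 in auto)
      qed
      show "AE x in M. norm ((f x (p0 + k i) - f x p0 - f' x p0 (k i)) /\<^sub>R norm (k i)) \<le> 2 * g x" for i
      proof (rule AE_I2)
        fix x assume x: "x \<in> space M"
        have "norm (f x (p0 + k i) - f x p0 - f' x p0 (k i)) \<le> 2 * g x * norm (k i)"
          using lip[OF x kb[of i]] bound[OF x p0, of "k i"]
            norm_triangle_ineq4[of "f x (p0 + k i) - f x p0" "f' x p0 (k i)"] by simp
        then show "norm ((f x (p0 + k i) - f x p0 - f' x p0 (k i)) /\<^sub>R norm (k i)) \<le> 2 * g x"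
          using k0[of i] by (simp add: divide_inverse[symmetric] mult.commute[of "inverse _"] pos_divide_le_eq)
      qed
    qed simp
    moreover have "norm (\<integral>x. (f x (p0 + k n) - f x p0 - f' x p0 (k n)) /\<^sub>R norm (k n) \<partial>M) =
        norm ((\<integral>x. f x (p0 + k n) \<partial>M) - (\<integral>x. f x p0 \<partial>M) - (\<integral>x. f' x p0 (k n) \<partial>M)) / norm (k n)" for n
      using int'[OF kb[of n]] int fi[of "k n"] k0[of n] by (simp add: divide_inverse mult.commute)
    ultimately have "(\<lambda>n. norm ((\<integral>x. f x (p0 + k n) \<partial>M) - (\<integral>x. f x p0 \<partial>M) - (\<integral>x. f' x p0 (k n) \<partial>M)) / norm (k n)) \<longlonglongrightarrow> 0"
      using tendsto_norm by fastforce
    then show "(\<lambda>n. norm ((\<integral>x. f x (p0 + h n) \<partial>M) - (\<integral>x. f x p0 \<partial>M) - (\<integral>x. f' x p0 (h n) \<partial>M)) / norm (h n)) \<longlonglongrightarrow> 0"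
      unfolding k_def by (rule LIMSEQ_offset)
  qed
  ultimately show "((\<lambda>p. \<integral>x. f x p \<partial>M) has_derivative (\<lambda>v. \<integral>x. f' x p0 v \<partial>M)) (at p0)"
    unfolding has_derivative_at by blast
qed

section \<open>Parameter families of polynomial growth\<close>

definition tame0 :: "'a set \<Rightarrow> ('x::euclidean_space \<Rightarrow> 'a::euclidean_space \<Rightarrow> complex) \<Rightarrow> bool" where
  "tame0 B f \<longleftrightarrow> (\<exists>C N. \<forall>x. \<forall>p\<in>B. norm (f x p) \<le> C * (1 + norm x) ^ N) \<and>
     (\<forall>p\<in>B. (\<lambda>x. f x p) \<in> borel_measurable borel)"

text \<open>These are the factors that may stand next to an exponentially decaying weight: they and
  their parameter derivatives up to order n grow at most polynomially in x, uniformly for p in B.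
  The class is closed under sums, products and, given a uniform lower bound, reciprocals.\<close>

primrec tame :: "nat \<Rightarrow> 'a set \<Rightarrow> ('x::euclidean_space \<Rightarrow> 'a::euclidean_space \<Rightarrow> complex) \<Rightarrow> bool" where
  "tame 0 B f = tame0 B f"
| "tame (Suc n) B f = (tame0 B f \<and> (\<exists>f'. (\<forall>x. \<forall>p\<in>B. (f x has_derivative f' x p) (at p)) \<and>
      (\<forall>v. tame n B (\<lambda>x p. f' x p v))))"

lemma tame0E:
  assumes "tame0 B f"
  obtains C N where "C \<ge> 0" "\<And>x p. p \<in> B \<Longrightarrow> norm (f x p) \<le> C * (1 + norm x) ^ N"
    "\<And>p. p \<in> B \<Longrightarrow> (\<lambda>x. f x p) \<in> borel_measurable borel"
proof -
  from assms obtain C N where "\<And>x p. p \<in> B \<Longrightarrow> norm (f x p) \<le> C * (1 + norm x) ^ N"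
    "\<And>p. p \<in> B \<Longrightarrow> (\<lambda>x. f x p) \<in> borel_measurable borel"
    unfolding tame0_def by blast
  moreover have "C * (1 + norm x) ^ N \<le> \<bar>C\<bar> * (1 + norm x) ^ N" for x :: 'b
    by (intro mult_right_mono) auto
  ultimately show ?thesis using that[of "\<bar>C\<bar>" N] by (meson abs_ge_zero order.trans)
qed

lemma tame0I:
  assumes "\<And>x p. p \<in> B \<Longrightarrow> norm (f x p) \<le> C * (1 + norm x) ^ N"
    "\<And>p. p \<in> B \<Longrightarrow> (\<lambda>x. f x p) \<in> borel_measurable borel"
  shows "tame0 B f"
  unfolding tame0_def
  by (intro conjI exI[of _ C] exI[of _ N] allI ballI assms)

lemma tame_imp_tame0: "tame n B f \<Longrightarrow> tame0 B f"
  by (cases n) auto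

lemma tame_SucI:
  assumes "tame0 B f" "\<And>x p. p \<in> B \<Longrightarrow> (f x has_derivative f' x p) (at p)"
    "\<And>v. tame n B (\<lambda>x p. f' x p v)"
  shows "tame (Suc n) B f"
  unfolding tame.simps by (intro conjI exI[of _ f'] allI ballI assms)

lemma tame_SucE:
  assumes "tame (Suc n) B f"
  obtains f' where "\<And>x p. p \<in> B \<Longrightarrow> (f x has_derivative f' x p) (at p)"
    "\<And>v. tame n B (\<lambda>x p. f' x p v)"
proof -
  from assms have "\<exists>f'. (\<forall>x. \<forall>p\<in>B. (f x has_derivative f' x p) (at p)) \<and> (\<forall>v. tame n B (\<lambda>x p. f' x p v))"
    by (simp only: tame.simps)
  then obtain f' where "(\<forall>x. \<forall>p\<in>B. (f x has_derivative f' x p) (at p)) \<and> (\<forall>v. tame n B (\<lambda>x p. f' x p v))" ..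
  then show ?thesis by (intro that[of f']) simp_all
qed

declare tame.simps(2) [simp del]

lemma tame_Suc_imp: "tame (Suc n) B f \<Longrightarrow> tame n B f"
proof (induction n arbitrary: f)
  case (Suc n)
  obtain f' where f': "\<And>x p. p \<in> B \<Longrightarrow> (f x has_derivative f' x p) (at p)"
    "\<And>v. tame (Suc n) B (\<lambda>x p. f' x p v)" using tame_SucE[OF Suc.prems] by blast
  show ?case
    by (rule tame_SucI[OF tame_imp_tame0[OF Suc.prems] f'(1) Suc.IH[OF f'(2)]])
qed (simp add: tame.simps)

lemma tame0_add:
  assumes "tame0 B f" "tame0 B g"
  shows "tame0 B (\<lambda>x p. f x p + g x p)"
proof -
  obtain C N where f: "C \<ge> 0" "\<And>x p. p \<in> B \<Longrightarrow> norm (f x p) \<le> C * (1 + norm x) ^ N"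
    "\<And>p. p \<in> B \<Longrightarrow> (\<lambda>x. f x p) \<in> borel_measurable borel" using tame0E[OF assms(1)] by blast
  obtain D M where g: "D \<ge> 0" "\<And>x p. p \<in> B \<Longrightarrow> norm (g x p) \<le> D * (1 + norm x) ^ M"
    "\<And>p. p \<in> B \<Longrightarrow> (\<lambda>x. g x p) \<in> borel_measurable borel" using tame0E[OF assms(2)] by blast
  show ?thesis
  proof (rule tame0I[of B _ "C + D" "max N M"])
    fix x p assume p: "p \<in> B"
    have "norm (f x p + g x p) \<le> C * (1 + norm x) ^ N + D * (1 + norm x) ^ M"
      using norm_triangle_mono f(2) g(2) p by blast
    also have "\<dots> \<le> C * (1 + norm x) ^ max N M + D * (1 + norm x) ^ max N M"
      using f(1) g(1) by (intro add_mono mult_left_mono power_increasing) auto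
    finally show "norm (f x p + g x p) \<le> (C + D) * (1 + norm x) ^ max N M" by (simp add: distrib_right)
  qed (use f g in auto)
qed

lemma tame0_mult:
  assumes "tame0 B f" "tame0 B g"
  shows "tame0 B (\<lambda>x p. f x p * g x p)"
proof -
  obtain C N where f: "C \<ge> 0" "\<And>x p. p \<in> B \<Longrightarrow> norm (f x p) \<le> C * (1 + norm x) ^ N"
    "\<And>p. p \<in> B \<Longrightarrow> (\<lambda>x. f x p) \<in> borel_measurable borel" using tame0E[OF assms(1)] by blast
  obtain D M where g: "D \<ge> 0" "\<And>x p. p \<in> B \<Longrightarrow> norm (g x p) \<le> D * (1 + norm x) ^ M"
    "\<And>p. p \<in> B \<Longrightarrow> (\<lambda>x. g x p) \<in> borel_measurable borel" using tame0E[OF assms(2)] by blast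
  show ?thesis
  proof (rule tame0I[of B _ "C * D" "N + M"])
    fix x p assume p: "p \<in> B"
    have "norm (f x p * g x p) \<le> (C * (1 + norm x) ^ N) * (D * (1 + norm x) ^ M)"
      unfolding norm_mult using f g p by (intro mult_mono) auto
    then show "norm (f x p * g x p) \<le> (C * D) * (1 + norm x) ^ (N + M)" by (simp add: power_add mult_ac)
  qed (use f g in auto)
qed

lemma tame_coeff:
  fixes c :: "'x::euclidean_space \<Rightarrow> complex" and B :: "'a::euclidean_space set"
  assumes "c \<in> borel_measurable borel" "\<And>x. norm (c x) \<le> C * (1 + norm x) ^ N"
  shows "tame n B (\<lambda>x p. c x)"
  using assms
proof (induction n arbitrary: c C)
  case 0
  then show ?case by (auto intro!: tame0I)
next
  case (Suc n)
  have "tame n B (\<lambda>(x::'x) p. 0 :: complex)" by (rule Suc.IH[of _ 0]) auto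
  moreover have "tame0 B (\<lambda>x p. c x)" using Suc.prems by (intro tame0I) auto
  ultimately show ?case
    by (intro tame_SucI[where f' = "\<lambda>x p v. 0"]) auto
qed

lemma tame_const: "tame n B (\<lambda>x p. c)"
  by (rule tame_coeff[of _ "norm c" 0]) auto

text \<open>The growth bound must be uniform in the parameter, and a linear function is bounded only
  on bounded sets; its derivative is constant in p.\<close>

lemma tame_linear:
  assumes "bounded_linear L" "bounded B"
  shows "tame n B (\<lambda>x p. L p)"
proof -
  obtain K where K: "\<And>p. p \<in> B \<Longrightarrow> norm p \<le> K" using assms(2) bounded_iff by blast
  have "norm (L p) \<le> onorm L * K" if "p \<in> B" for p
    using onorm[OF assms(1), of p] K[OF that] onorm_pos_le[OF assms(1)]
    by (meson mult_left_mono order.trans)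
  then have "tame0 B (\<lambda>x p. L p)" by (intro tame0I[of _ _ "onorm L * K" 0]) auto
  then show ?thesis
    using assms(1)
    by (cases n) (auto intro!: tame_SucI[where f' = "\<lambda>x p. L"] tame_const bounded_linear_imp_has_derivative)
qed

lemma tame_add:
  assumes "tame n B f" "tame n B g"
  shows "tame n B (\<lambda>x p. f x p + g x p)"
  using assms
proof (induction n arbitrary: f g)
  case (Suc n)
  obtain f' where f': "\<And>x p. p \<in> B \<Longrightarrow> (f x has_derivative f' x p) (at p)" "\<And>v. tame n B (\<lambda>x p. f' x p v)"
    using tame_SucE[OF Suc.prems(1)] by blast
  obtain g' where g': "\<And>x p. p \<in> B \<Longrightarrow> (g x has_derivative g' x p) (at p)" "\<And>v. tame n B (\<lambda>x p. g' x p v)"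
    using tame_SucE[OF Suc.prems(2)] by blast
  show ?case
    by (rule tame_SucI[OF tame0_add[OF Suc.prems[THEN tame_imp_tame0]] has_derivative_add[OF f'(1) g'(1)]
          Suc.IH[OF f'(2) g'(2)]])
qed (simp add: tame0_add)

lemma tame_mult:
  assumes "tame n B f" "tame n B g"
  shows "tame n B (\<lambda>x p. f x p * g x p)"
  using assms
proof (induction n arbitrary: f g)
  case (Suc n)
  obtain f' where f': "\<And>x p. p \<in> B \<Longrightarrow> (f x has_derivative f' x p) (at p)" "\<And>v. tame n B (\<lambda>x p. f' x p v)"
    using tame_SucE[OF Suc.prems(1)] by blast
  obtain g' where g': "\<And>x p. p \<in> B \<Longrightarrow> (g x has_derivative g' x p) (at p)" "\<And>v. tame n B (\<lambda>x p. g' x p v)"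
    using tame_SucE[OF Suc.prems(2)] by blast
  show ?case
    by (rule tame_SucI[OF tame0_mult[OF Suc.prems[THEN tame_imp_tame0]] has_derivative_mult[OF f'(1) g'(1)]
          tame_add[OF Suc.IH[OF Suc.prems(1)[THEN tame_Suc_imp] g'(2)] Suc.IH[OF f'(2) Suc.prems(2)[THEN tame_Suc_imp]]]])
qed (simp add: tame0_mult)

lemma tame_sum:
  assumes "\<And>i. i \<in> A \<Longrightarrow> tame n B (f i)"
  shows "tame n B (\<lambda>x p. \<Sum>i\<in>A. f i x p)"
  using assms
proof (induction A rule: infinite_finite_induct)
  case (insert i A)
  then have "tame n B (\<lambda>x p. f i x p + (\<Sum>i\<in>A. f i x p))" by (intro tame_add) auto
  then show ?case using insert by simp
qed (simp_all add: tame_const)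

lemma tame_power:
  assumes "tame n B f"
  shows "tame n B (\<lambda>x p. f x p ^ k)"
proof (induction k)
  case (Suc k)
  show ?case using tame_mult[OF assms Suc] by simp
qed (simp add: tame_const)

text \<open>The derivative of 1/f is -(1/f) f' (1/f) and contains 1/f again, so the induction on the
  order feeds on itself; the lower bound, uniform in x and p, supplies order zero.\<close>

lemma tame_inverse:
  assumes "tame n B f" "0 < c" "\<And>x p. p \<in> B \<Longrightarrow> c \<le> norm (f x p)"
  shows "tame n B (\<lambda>x p. inverse (f x p))"
proof -
  have t0: "tame0 B (\<lambda>x p. inverse (f x p))"
  proof (rule tame0I[of _ _ "inverse c" 0])
    fix x p assume "p \<in> B"
    then show "norm (inverse (f x p)) \<le> inverse c * (1 + norm x) ^ 0"
      using assms(2,3) by (simp add: norm_inverse le_imp_inverse_le)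
  qed (use tame_imp_tame0[OF assms(1)] in \<open>auto simp: tame0_def\<close>)
  show ?thesis using assms(1)
  proof (induction n)
    case (Suc n)
    obtain f' where f': "\<And>x p. p \<in> B \<Longrightarrow> (f x has_derivative f' x p) (at p)" "\<And>v. tame n B (\<lambda>x p. f' x p v)"
      using tame_SucE[OF Suc.prems] by blast
    have nz: "f x p \<noteq> 0" if "p \<in> B" for x p using assms(2) assms(3)[OF that, of x] norm_zero by fastforce
    have IH: "tame n B (\<lambda>x p. inverse (f x p))" using Suc.IH tame_Suc_imp[OF Suc.prems] .
    have "tame n B (\<lambda>x p. (- 1) * (inverse (f x p) * f' x p v * inverse (f x p)))" for v
      by (intro tame_mult tame_const f'(2) IH)
    then have "tame n B (\<lambda>x p. - (inverse (f x p) * f' x p v * inverse (f x p)))" for v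
      by simp
    from tame_SucI[OF t0 Deriv.has_derivative_inverse[OF nz f'(1)] this] show ?case .
  qed (use t0 in simp)
qed

text \<open>With a = max 1 (N/c) one has 1 + y \<le> a (1 + c y / N) \<le> a exp (c y / N); the N-th
  power gives K = a^N.\<close>

lemma power_exp_bound:
  fixes c :: real
  assumes "c > 0"
  obtains K where "K > 0" "\<And>y. y \<ge> 0 \<Longrightarrow> (1 + y) ^ N \<le> K * exp (c * y)"
proof -
  have "(1 + y) ^ N \<le> (max 1 (real N / c)) ^ N * exp (c * y)" if "y \<ge> 0" for y
  proof (cases "N = 0")
    case False
    let ?a = "max 1 (real N / c)"
    have "1 + y \<le> ?a * (1 + c * y / real N)"
    proof -
      have "?a * (c * y / real N) \<ge> real N / c * (c * y / real N)"
        by (intro mult_right_mono) (use assms that in auto)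
      also have "real N / c * (c * y / real N) = y" using assms False by simp
      finally show ?thesis by (simp add: distrib_left)
    qed
    also have "\<dots> \<le> ?a * exp (c * y / real N)"
      by (intro mult_left_mono exp_ge_add_one_self) auto
    finally have "(1 + y) ^ N \<le> (?a * exp (c * y / real N)) ^ N"
      using that by (intro power_mono) auto
    also have "\<dots> = ?a ^ N * exp (c * y)"
      using False by (simp add: power_mult_distrib exp_of_nat_mult[symmetric])
    finally show ?thesis .
  qed (use assms that in auto)
  then show ?thesis by (intro that[of "(max 1 (real N / c)) ^ N"]) auto
qed

text \<open>Half of the decay rate of the weight absorbs the polynomial growth of f and of its
  derivatives. Integrability of exponentials is a hypothesis here because it is derived from polar
  coordinates, which come later.\<close>

lemma Ck_integral:
  fixes f :: "'x::euclidean_space \<Rightarrow> 'a::euclidean_space \<Rightarrow> complex"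
  assumes "open B" "\<psi> \<in> borel_measurable borel" "0 < c" "\<And>x. norm (\<psi> x) \<le> C * exp (- c * norm x)"
    and exp_int: "\<And>c. 0 < c \<Longrightarrow> integrable lborel (\<lambda>x::'x. exp (- c * norm x))"
    and "tame n B f"
  shows "Ck n B (\<lambda>p. \<integral>x. \<psi> x * f x p \<partial>lborel)"
  using assms(6)
proof (induction n arbitrary: f)
  case (Suc n)
  have C0: "C \<ge> 0" using assms(4)[of 0] norm_ge_zero[of "\<psi> 0"] by (simp del: norm_ge_zero)
  have int: "integrable lborel (\<lambda>x. norm (\<psi> x) * (D * (1 + norm x) ^ N))" if "D \<ge> 0" for D N
  proof -
    obtain K where K: "K > 0" "\<And>y. y \<ge> 0 \<Longrightarrow> (1 + y) ^ N \<le> K * exp (c / 2 * y)"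
      using power_exp_bound[of "c / 2" N] assms(3) by auto
    have "integrable lborel (\<lambda>x::'x. C * D * K * exp (- (c / 2) * norm x))"
      using exp_int[of "c / 2"] assms(3) by auto
    then show ?thesis
    proof (rule Bochner_Integration.integrable_bound)
      show "AE x in lborel. norm (norm (\<psi> x) * (D * (1 + norm x) ^ N)) \<le> norm (C * D * K * exp (- (c / 2) * norm x))"
      proof (rule AE_I2)
        fix x :: 'x
        have "norm (\<psi> x) * (D * (1 + norm x) ^ N) \<le> (C * exp (- c * norm x)) * (D * (K * exp (c / 2 * norm x)))"
          using K assms(4) C0 that by (intro mult_mono) auto
        also have "\<dots> = C * D * K * (exp (- c * norm x) * exp (c / 2 * norm x))" by simp
        also have "exp (- c * norm x) * exp (c / 2 * norm x) = exp (- (c / 2) * norm x)"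
          by (simp add: exp_add[symmetric] algebra_simps)
        finally show "norm (norm (\<psi> x) * (D * (1 + norm x) ^ N)) \<le> norm (C * D * K * exp (- (c / 2) * norm x))"
          using that C0 K by (simp add: abs_mult)
      qed
    qed (use assms(2) in auto)
  qed
  obtain f' where f': "\<And>x p. p \<in> B \<Longrightarrow> (f x has_derivative f' x p) (at p)" "\<And>v. tame n B (\<lambda>x p. f' x p v)"
    using tame_SucE[OF Suc.prems] by blast
  have t0: "tame0 B f" using Suc.prems by (rule tame_imp_tame0)
  have "\<exists>D N. D \<ge> 0 \<and> (\<forall>x. \<forall>p\<in>B. norm (f' x p b) \<le> D * (1 + norm x) ^ N)" for b
    using tame0E[OF tame_imp_tame0[OF f'(2)[of b]]] by metis
  then obtain D N where DN: "\<And>b. D b \<ge> 0" "\<And>b x p. p \<in> B \<Longrightarrow> norm (f' x p b) \<le> D b * (1 + norm x) ^ N b"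
    by metis
  obtain D0 N0 where D0: "D0 \<ge> 0" "\<And>x p. p \<in> B \<Longrightarrow> norm (f x p) \<le> D0 * (1 + norm x) ^ N0"
    "\<And>p. p \<in> B \<Longrightarrow> (\<lambda>x. f x p) \<in> borel_measurable borel" using tame0E[OF t0] by blast
  have der: "((\<lambda>p. \<integral>x. \<psi> x * f x p \<partial>lborel) has_derivative (\<lambda>v. \<integral>x. \<psi> x * f' x p0 v \<partial>lborel)) (at p0)"
    if p0: "p0 \<in> B" for p0
  proof -
    obtain e where e: "e > 0" "ball p0 e \<subseteq> B" using assms(1) p0 open_contains_ball by blast
    show ?thesis
    proof (rule has_derivative_integral(1)[OF e(1), where g = "\<lambda>x. norm (\<psi> x) * (\<Sum>b\<in>Basis. D b * (1 + norm x) ^ N b)"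
          and f = "\<lambda>x p. \<psi> x * f x p" and f' = "\<lambda>x p v. \<psi> x * f' x p v"])
      show "(\<lambda>x. \<psi> x * f x p) \<in> borel_measurable lborel" if "p \<in> ball p0 e" for p
        using assms(2) D0(3)[of p] e that by auto
      show "integrable lborel (\<lambda>x. \<psi> x * f x p0)"
      proof (rule Bochner_Integration.integrable_bound[OF int[OF D0(1), of N0]])
        show "AE x in lborel. norm (\<psi> x * f x p0) \<le> norm (norm (\<psi> x) * (D0 * (1 + norm x) ^ N0))"
          using D0(1) D0(2)[OF p0] by (intro AE_I2) (auto simp: norm_mult abs_mult intro!: mult_left_mono)
      qed (use assms(2) D0(3)[OF p0] in auto)
      show "((\<lambda>p. \<psi> x * f x p) has_derivative (\<lambda>v. \<psi> x * f' x p v)) (at p)" if "p \<in> ball p0 e" for x p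
        using f'(1)[of p x] e that by (intro has_derivative_mult_right) auto
      show "norm (\<psi> x * f' x p v) \<le> norm (\<psi> x) * (\<Sum>b\<in>Basis. D b * (1 + norm x) ^ N b) * norm v"
        if "p \<in> ball p0 e" for x p v
      proof -
        have "p \<in> B" using e that by auto
        then have "norm (f' x p v) \<le> (\<Sum>b\<in>Basis. D b * (1 + norm x) ^ N b) * norm v"
          using f'(1)[of p x] DN(2) has_derivative_linear by (intro norm_linear_le_sum_Basis) blast+
        then show ?thesis by (auto simp: norm_mult mult.assoc intro!: mult_left_mono)
      qed
      show "integrable lborel (\<lambda>x. norm (\<psi> x) * (\<Sum>b\<in>Basis. D b * (1 + norm x) ^ N b))"
        unfolding sum_distrib_left by (intro Bochner_Integration.integrable_sum int DN)
    qed
  qed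
  have "Ck n B (dir_deriv v (\<lambda>p. \<integral>x. \<psi> x * f x p \<partial>lborel))" for v
    by (subst Ck_cong[OF assms(1), where g = "\<lambda>p. \<integral>x. \<psi> x * f' x p v \<partial>lborel"])
       (use dir_deriv_eq[OF der] Suc.IH[OF f'(2)] in auto)
  then show ?case using der by (auto simp: differentiable_def)
qed simp

subsection \<open>The two-constants theorem\<close>

text \<open>Cauchy's estimate on discs of half the radius bounds the complex derivatives by the
  local majorant of the functions, so a majorant for f alone suffices to differentiate under the
  integral.\<close>

lemma holomorphic_on_integral:
  fixes f :: "'x \<Rightarrow> complex \<Rightarrow> complex"
  assumes meas: "\<And>w. w \<in> S \<Longrightarrow> (\<lambda>x. f x w) \<in> borel_measurable M"
    and hol: "\<And>x. x \<in> space M \<Longrightarrow> f x holomorphic_on S"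
    and dom: "\<And>w. w \<in> S \<Longrightarrow> \<exists>e>0. \<exists>g. cball w e \<subseteq> S \<and> integrable M g \<and>
      (\<forall>x\<in>space M. \<forall>w'\<in>cball w e. norm (f x w') \<le> g x)"
  shows "(\<lambda>w. \<integral>x. f x w \<partial>M) holomorphic_on S"
proof (rule holomorphic_onI)
  fix w assume w: "w \<in> S"
  obtain e g where e: "e > 0" "cball w e \<subseteq> S" and g: "integrable M g"
    and fg: "\<And>x w'. x \<in> space M \<Longrightarrow> w' \<in> cball w e \<Longrightarrow> norm (f x w') \<le> g x"
    using dom[OF w] by blast
  have sub: "cball v (e / 2) \<subseteq> cball w e" if "v \<in> ball w (e / 2)" for v
  proof
    fix u assume "u \<in> cball v (e / 2)"
    then have "dist w u \<le> e"
      using that dist_triangle[of w u v] unfolding mem_cball mem_ball by linarith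
    then show "u \<in> cball w e" by simp
  qed
  have diff: "(f x has_field_derivative deriv (f x) v) (at v)" if "x \<in> space M" "v \<in> ball w (e / 2)" for x v
  proof (rule holomorphic_derivI[of _ "ball w e"])
    show "f x holomorphic_on ball w e"
      using hol[OF that(1)] e(2) ball_subset_cball holomorphic_on_subset by blast
  qed (use that e in auto)
  have bd: "norm (deriv (f x) v) \<le> g x / (e / 2)" if x: "x \<in> space M" and v: "v \<in> ball w (e / 2)" for x v
  proof -
    have "f x holomorphic_on cball v (e / 2)"
      using hol[OF x] sub[OF v] e(2) holomorphic_on_subset by blast
    moreover have "norm (f x u) \<le> g x" if "norm (v - u) = e / 2" for u
      using sub[OF v] that by (intro fg x) (auto simp: dist_norm)
    ultimately have "norm ((deriv ^^ 1) (f x) v) \<le> fact 1 * g x / (e / 2) ^ 1"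
      using e(1) ball_subset_cball[of v "e / 2"]
      by (intro Cauchy_inequality holomorphic_on_imp_continuous_on) (auto intro: holomorphic_on_subset)
    then show ?thesis by simp
  qed
  have "((\<lambda>w. \<integral>x. f x w \<partial>M) has_derivative (\<lambda>v. \<integral>x. deriv (f x) w * v \<partial>M)) (at w)"
  proof (rule has_derivative_integral(1)[where e = "e / 2" and g = "\<lambda>x. g x / (e / 2)" and f' = "\<lambda>x w v. deriv (f x) w * v"])
    show "(\<lambda>x. f x p) \<in> borel_measurable M" if "p \<in> ball w (e / 2)" for p
      using that e by (intro meas) auto
    show "integrable M (\<lambda>x. f x w)"
    proof (rule Bochner_Integration.integrable_bound[OF g])
      show "AE x in M. norm (f x w) \<le> norm (g x)"
        using fg[of _ w] e(1) by (intro AE_I2) (auto intro: order.trans[OF _ abs_ge_self])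
    qed (rule meas[OF w])
    show "(f x has_derivative (*) (deriv (f x) p)) (at p)" if "x \<in> space M" "p \<in> ball w (e / 2)" for x p
      using diff[OF that] by (simp add: has_field_derivative_def)
    show "norm (deriv (f x) p * v) \<le> g x / (e / 2) * norm v" if "x \<in> space M" "p \<in> ball w (e / 2)" for x p v
      unfolding norm_mult by (rule mult_right_mono[OF bd[OF that]]) simp
  qed (use e g in auto)
  then have "((\<lambda>w. \<integral>x. f x w \<partial>M) has_derivative (*) (\<integral>x. deriv (f x) w \<partial>M)) (at w)"
    by simp
  then show "(\<lambda>w. \<integral>x. f x w \<partial>M) field_differentiable at w within S"
    unfolding field_differentiable_def has_field_derivative_def[symmetric]
    using has_field_derivative_at_within by blast
qed

text \<open>The factor exp (l (2 i w - w^2)) with l = ln (M/\<eta>) has modulus exp (l ((Im w)^2 -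
  (Re w)^2 - 2 Im w)). This is at most 1 on the base and at most exp (-l) = \<eta>/M on the other
  three sides, so the product with f is bounded by \<eta> on the whole boundary and the maximum
  principle applies. This explicit harmonic exponent takes the place of the harmonic measure of the
  rectangle.\<close>

lemma two_constants_unit:
  assumes hol: "f holomorphic_on S" and sub: "cbox (Complex (-1) 0) (Complex 1 1) \<subseteq> S"
    and M: "\<And>w. w \<in> cbox (Complex (-1) 0) (Complex 1 1) \<Longrightarrow> norm (f w) \<le> M"
    and \<eta>: "\<And>x. \<bar>x\<bar> \<le> 1 \<Longrightarrow> norm (f (of_real x)) \<le> \<eta>"
    and "0 < \<eta>" "\<eta> \<le> M" "0 \<le> y" "y \<le> 1"
  shows "norm (f (\<i> * of_real y)) \<le> \<eta> * exp (2 * y * ln (M / \<eta>))"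
proof -
  define R where "R = cbox (Complex (-1) 0) (Complex 1 1)"
  define l where "l = ln (M / \<eta>)"
  have l0: "l \<ge> 0" using assms by (simp add: l_def)
  have Ml: "M = \<eta> * exp l" using assms by (simp add: l_def)
  define F where "F w = f w * exp (of_real l * (2 * \<i> * w - w\<^sup>2))" for w
  have memR: "w \<in> R \<longleftrightarrow> -1 \<le> Re w \<and> Re w \<le> 1 \<and> 0 \<le> Im w \<and> Im w \<le> 1" for w
    by (auto simp: R_def in_cbox_complex_iff)
  have nF: "norm (F w) = norm (f w) * exp (l * ((Im w)\<^sup>2 - (Re w)\<^sup>2 - 2 * Im w))" for w
    by (simp add: F_def norm_mult power2_eq_square algebra_simps)
  have hF: "F holomorphic_on R"
    unfolding F_def using holomorphic_on_subset[OF hol sub[folded R_def]] by (intro holomorphic_intros)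
  have "norm (F (\<i> * of_real y)) \<le> \<eta>"
  proof (rule maximum_modulus_frontier[of F R])
    show "F holomorphic_on interior R" using hF interior_subset holomorphic_on_subset by blast
    show "continuous_on (closure R) F"
      using holomorphic_on_imp_continuous_on[OF hF] by (simp add: R_def)
    show "bounded R" by (simp add: R_def)
    show "\<i> * of_real y \<in> R" using assms by (auto simp: memR)
    fix w assume "w \<in> frontier R"
    then have w: "w \<in> R" "w \<notin> box (Complex (-1) 0) (Complex 1 1)"
      by (auto simp: frontier_def R_def)
    show "norm (F w) \<le> \<eta>"
    proof (cases "Im w = 0")
      case True
      then have "w = of_real (Re w)" by (simp add: complex_eq_iff)
      then have "f w = f (of_real (Re w))" by (rule arg_cong)
      then have "norm (f w) \<le> \<eta>" using \<eta>[of "Re w"] w(1) by (auto simp: memR)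
      moreover have "exp (l * ((Im w)\<^sup>2 - (Re w)\<^sup>2 - 2 * Im w)) \<le> 1" using True l0 by simp
      ultimately show ?thesis unfolding nF using \<open>0 < \<eta>\<close>
        using mult_mono[of "norm (f w)" \<eta> "exp (l * ((Im w)\<^sup>2 - (Re w)\<^sup>2 - 2 * Im w))" 1] by simp
    next
      case False
      then have "Re w = -1 \<or> Re w = 1 \<or> Im w = 1"
        using w by (auto simp: memR in_box_complex_iff)
      \<comment> \<open>On the vertical sides (Re w)^2 = 1 and (Im w)^2 \<le> 2 Im w; on the top Im
        w = 1. Either way the exponent is at most -1.\<close>
      moreover have "(Im w)\<^sup>2 \<le> Im w" using w(1) by (auto simp: memR power2_eq_square mult_left_le)
      ultimately have "(Im w)\<^sup>2 - (Re w)\<^sup>2 - 2 * Im w \<le> - 1"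
        using w(1) by (auto simp: memR)
      then have "exp (l * ((Im w)\<^sup>2 - (Re w)\<^sup>2 - 2 * Im w)) \<le> exp (- l)"
        using mult_left_mono[OF _ l0] by fastforce
      then have "norm (F w) \<le> M * exp (- l)"
        unfolding nF using M[of w] w(1) assms(5,6) by (intro mult_mono) (auto simp: R_def)
      also have "\<dots> = \<eta>" by (simp add: Ml exp_minus)
      finally show ?thesis .
    qed
  qed
  then have "norm (f (\<i> * of_real y)) * exp (l * (y\<^sup>2 - 2 * y)) \<le> \<eta>" by (simp add: nF)
  then have "norm (f (\<i> * of_real y)) \<le> \<eta> * exp (l * (2 * y - y\<^sup>2))"
    by (simp add: exp_minus[symmetric] exp_diff right_diff_distrib field_simps)
  also have "\<dots> \<le> \<eta> * exp (2 * y * l)"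
    using l0 assms by (auto intro!: mult_left_mono simp: algebra_simps)
  finally show ?thesis by (simp add: l_def)
qed

lemma two_constants:
  assumes hol: "f holomorphic_on S" and \<rho>: "0 < \<rho>" and sub: "cbox (Complex (-\<rho>) 0) (Complex \<rho> \<rho>) \<subseteq> S"
    and M: "\<And>w. w \<in> cbox (Complex (-\<rho>) 0) (Complex \<rho> \<rho>) \<Longrightarrow> norm (f w) \<le> M"
    and \<eta>: "\<And>x. \<bar>x\<bar> \<le> \<rho> \<Longrightarrow> norm (f (of_real x)) \<le> \<eta>"
    and "0 < \<eta>" "\<eta> \<le> M" "0 \<le> y" "y \<le> \<rho>"
  shows "norm (f (\<i> * of_real y)) \<le> \<eta> * exp (2 * (y / \<rho>) * ln (M / \<eta>))"
proof -
  have m: "of_real \<rho> * w \<in> cbox (Complex (-\<rho>) 0) (Complex \<rho> \<rho>)"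
    if "w \<in> cbox (Complex (-1) 0) (Complex 1 1)" for w
  proof -
    have "-1 \<le> Re w" "Re w \<le> 1" "0 \<le> Im w" "Im w \<le> 1" using that by (auto simp: in_cbox_complex_iff)
    then have "\<rho> * -1 \<le> \<rho> * Re w" "\<rho> * Re w \<le> \<rho> * 1" "\<rho> * 0 \<le> \<rho> * Im w" "\<rho> * Im w \<le> \<rho> * 1"
      using \<rho> by (simp_all only: mult_le_cancel_left_pos)
    then show ?thesis by (auto simp: in_cbox_complex_iff)
  qed
  have "norm (f (of_real \<rho> * (\<i> * of_real (y / \<rho>)))) \<le> \<eta> * exp (2 * (y / \<rho>) * ln (M / \<eta>))"
  proof (rule two_constants_unit[of "\<lambda>w. f (of_real \<rho> * w)" "cbox (Complex (-1) 0) (Complex 1 1)"])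
    have "f \<circ> (*) (of_real \<rho>) holomorphic_on cbox (Complex (-1) 0) (Complex 1 1)"
      by (rule holomorphic_on_compose_gen[of _ _ f S]) (use hol sub m in \<open>auto intro!: holomorphic_intros\<close>)
    then show "(\<lambda>w. f (of_real \<rho> * w)) holomorphic_on cbox (Complex (-1) 0) (Complex 1 1)" by (simp add: o_def)
    show "norm (f (of_real \<rho> * of_real x)) \<le> \<eta>" if "\<bar>x\<bar> \<le> 1" for x
      using \<eta>[of "\<rho> * x"] that \<rho> mult_left_mono[OF that, of \<rho>] by (simp add: abs_mult)
  qed (use assms m in auto)
  then show ?thesis using \<rho> by simp
qed

subsection \<open>Polar coordinates\<close>

lemma sets_sphere_measure: "sets sphere_measure = sets (restrict_space borel (sphere 0 1))"
  by (simp add: sphere_measure_def)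

lemma space_sphere_measure: "space sphere_measure = sphere 0 1"
  using sets_eq_imp_space_eq[OF sets_sphere_measure] by (simp add: space_restrict_space)

lemma measurable_radial:
  "(\<lambda>x::'a::euclidean_space. x /\<^sub>R norm x) \<in> restrict_space lborel (ball 0 1 - {0}) \<rightarrow>\<^sub>M restrict_space borel (sphere 0 1)"
  by (rule measurable_restrict_space3[of _ borel borel, simplified] |
      (rule measurable_restrict_space2, force simp: space_restrict_space, rule measurable_restrict_space1, measurable))

lemma nn_integral_sphere_measure:
  fixes f :: "'a::euclidean_space \<Rightarrow> ennreal"
  assumes [measurable]: "f \<in> borel_measurable borel"
  shows "(\<integral>\<^sup>+\<nu>. f \<nu> \<partial>sphere_measure) =
    of_nat DIM('a) * (\<integral>\<^sup>+x. f (x /\<^sub>R norm x) * indicator (ball 0 1 - {0}) x \<partial>lborel)"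
proof -
  have f': "f \<in> borel_measurable (restrict_space borel (sphere 0 1))"
    by (rule measurable_restrict_space1) measurable
  show ?thesis
    unfolding sphere_measure_def
    by (subst nn_integral_scale_measure, use f' in simp, subst nn_integral_distr[OF measurable_radial], use f' in simp)
       (subst nn_integral_restrict_space, auto)
qed

lemma emeasure_space_sphere_measure:
  "emeasure sphere_measure (space (sphere_measure :: 'a::euclidean_space measure)) < \<infinity>"
proof -
  have "emeasure sphere_measure (space (sphere_measure :: 'a measure)) = (\<integral>\<^sup>+\<nu>. 1 \<partial>(sphere_measure :: 'a measure))"
    by simp
  also have "\<dots> = of_nat DIM('a) * (\<integral>\<^sup>+x. indicator (ball 0 1 - {0::'a}) x \<partial>lborel)"
    by (subst nn_integral_sphere_measure) auto
  also have "\<dots> = of_nat DIM('a) * emeasure lborel (ball 0 1 - {0::'a})"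
    by simp
  also have "\<dots> \<le> of_nat DIM('a) * emeasure lborel (ball 0 (1::real) :: 'a set)"
    by (intro mult_left_mono emeasure_mono) auto
  also have "\<dots> < \<infinity>"
    using emeasure_lborel_ball_finite[of "0::'a" 1] by (auto simp: ennreal_mult_less_top of_nat_less_top)
  finally show ?thesis .
qed

lemma finite_sphere_measure: "finite_measure (sphere_measure :: 'a::euclidean_space measure)"
  by (rule finite_measureI) (use emeasure_space_sphere_measure in \<open>auto simp: less_top\<close>)

lemma nn_integral_lborel_scaleR:
  fixes f :: "'a::euclidean_space \<Rightarrow> ennreal"
  assumes [measurable]: "f \<in> borel_measurable borel" and u: "u > 0"
  shows "(\<integral>\<^sup>+x. f x \<partial>lborel) = ennreal (u ^ DIM('a)) * (\<integral>\<^sup>+x. f (u *\<^sub>R x) \<partial>lborel)"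
proof -
  have "(\<integral>\<^sup>+x. f x \<partial>lborel) = (\<integral>\<^sup>+x. f x \<partial>(density (distr lborel borel (\<lambda>x. 0 + u *\<^sub>R x)) (\<lambda>_. ennreal (\<bar>u\<bar> ^ DIM('a)))))"
    using lborel_affine[of u "0::'a"] u by simp
  also have "\<dots> = ennreal (u ^ DIM('a)) * (\<integral>\<^sup>+x. f (u *\<^sub>R x) \<partial>lborel)"
    using u by (simp add: nn_integral_density nn_integral_distr nn_integral_cmult)
  finally show ?thesis .
qed

lemma nn_integral_inverse_power:
  assumes "0 < a" "0 < m"
  shows "(\<integral>\<^sup>+u. ennreal (inverse (u ^ Suc m)) * indicator {a<..} u \<partial>lborel) = ennreal (inverse (real m * a ^ m))"
proof -
  have "(\<integral>\<^sup>+u. ennreal (inverse (u ^ Suc m)) * indicator {a<..} u \<partial>lborel) =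
      (\<integral>\<^sup>+u. ennreal (inverse (u ^ Suc m)) * indicator {a..} u \<partial>lborel)"
  proof (rule nn_integral_cong_AE)
    show "AE u in lborel. ennreal (inverse (u ^ Suc m)) * indicator {a<..} u = ennreal (inverse (u ^ Suc m)) * indicator {a..} u"
      using AE_lborel_singleton[of a] by eventually_elim (auto simp: indicator_def)
  qed
  also have "\<dots> = ennreal (0 - (- inverse (real m * a ^ m)))"
  proof (rule nn_integral_FTC_atLeast[where F = "\<lambda>u. - inverse (real m * u ^ m)"])
    fix u assume u: "a \<le> u"
    then have u0: "u > 0" using assms by simp
    have e: "u ^ m = u * u ^ (m - 1)" using assms(2) by (cases m) auto
    show "((\<lambda>u. - inverse (real m * u ^ m)) has_real_derivative inverse (u ^ Suc m)) (at u)"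
      by (rule derivative_eq_intros refl | use u0 assms in simp; fail)+
         (use u0 assms in \<open>simp add: e field_simps power2_eq_square\<close>)
    show "0 \<le> inverse (u ^ Suc m)" using u0 by simp
  next
    have "filterlim (\<lambda>u::real. real m * u ^ m) at_top at_top"
      by (intro filterlim_tendsto_pos_mult_at_top[OF tendsto_const] filterlim_pow_at_top filterlim_ident) (use assms in auto)
    then have "((\<lambda>u::real. inverse (real m * u ^ m)) \<longlongrightarrow> 0) at_top"
      by (rule tendsto_inverse_0_at_top)
    then show "((\<lambda>u. - inverse (real m * u ^ m)) \<longlongrightarrow> 0) at_top" using tendsto_minus by fastforce
  qed measurable
  finally show ?thesis by simp
qed

lemma measurable_cone_conditions [measurable]:
  "Measurable.pred (borel \<Otimes>\<^sub>M borel) (\<lambda>x::'a::euclidean_space \<times> real. snd x \<in> {norm (fst x)<..})"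
  "(\<lambda>x::'a \<times> real. indicator (- {0}) (fst x) :: ennreal) \<in> borel_measurable (lborel \<Otimes>\<^sub>M lborel)"
proof -
  show "Measurable.pred (borel \<Otimes>\<^sub>M borel) (\<lambda>x::'a \<times> real. snd x \<in> {norm (fst x)<..})"
    unfolding greaterThan_iff by measurable
  have [measurable]: "indicator (- {0}) \<in> borel_measurable (borel :: 'a measure)" by simp
  show "(\<lambda>x::'a \<times> real. indicator (- {0}) (fst x) :: ennreal) \<in> borel_measurable (lborel \<Otimes>\<^sub>M lborel)"
    by measurable
qed

text \<open>The surface measure is read off the cone in the unit ball, with the factor m = DIM. For
  x in the ball, s = |x| u turns s \<nu> into u x. After Fubini, y = u x turns |x| < 1 into u > |y|,
  and the remaining integral of |y|^m / u^(m+1) over u > |y| equals 1/m, which cancels the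
  factor.\<close>

lemma nn_integral_polar:
  fixes f :: "'a::euclidean_space \<Rightarrow> ennreal"
  assumes [measurable]: "f \<in> borel_measurable borel"
  shows "(\<integral>\<^sup>+\<nu>. \<integral>\<^sup>+s. ennreal (s ^ (DIM('a) - 1)) * f (s *\<^sub>R \<nu>) * indicator {0<..} s \<partial>lborel \<partial>sphere_measure) =
    (\<integral>\<^sup>+x. f x \<partial>lborel)"
proof -
  define m where "m = DIM('a)"
  have m0: "m > 0" by (simp add: m_def)
  have mm: "Suc (m - 1) = m" using m0 by simp
  define B where "B = ball 0 1 - {0::'a}"
  have [measurable]: "B \<in> sets borel" by (simp add: B_def)
  have "(\<integral>\<^sup>+\<nu>. \<integral>\<^sup>+s. ennreal (s ^ (m - 1)) * f (s *\<^sub>R \<nu>) * indicator {0<..} s \<partial>lborel \<partial>sphere_measure) =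
      of_nat m * (\<integral>\<^sup>+x. (\<integral>\<^sup>+s. ennreal (s ^ (m - 1)) * f (s *\<^sub>R (x /\<^sub>R norm x)) * indicator {0<..} s \<partial>lborel) * indicator B x \<partial>lborel)"
    unfolding m_def B_def by (rule nn_integral_sphere_measure) measurable
  also have "(\<integral>\<^sup>+x. (\<integral>\<^sup>+s. ennreal (s ^ (m - 1)) * f (s *\<^sub>R (x /\<^sub>R norm x)) * indicator {0<..} s \<partial>lborel) * indicator B x \<partial>lborel) =
      (\<integral>\<^sup>+x. (\<integral>\<^sup>+u. ennreal (norm x ^ m * u ^ (m - 1)) * f (u *\<^sub>R x) * indicator {0<..} u * indicator B x \<partial>lborel) \<partial>lborel)"
  proof (rule nn_integral_cong)
    fix x :: 'a
    show "(\<integral>\<^sup>+s. ennreal (s ^ (m - 1)) * f (s *\<^sub>R (x /\<^sub>R norm x)) * indicator {0<..} s \<partial>lborel) * indicator B x =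
      (\<integral>\<^sup>+u. ennreal (norm x ^ m * u ^ (m - 1)) * f (u *\<^sub>R x) * indicator {0<..} u * indicator B x \<partial>lborel)"
    proof (cases "x \<in> B")
      case True
      then have x: "norm x > 0" by (auto simp: B_def)
      have "(\<integral>\<^sup>+s. ennreal (s ^ (m - 1)) * f (s *\<^sub>R (x /\<^sub>R norm x)) * indicator {0<..} s \<partial>lborel) =
        ennreal \<bar>norm x\<bar> * (\<integral>\<^sup>+u. ennreal ((0 + norm x * u) ^ (m - 1)) * f ((0 + norm x * u) *\<^sub>R (x /\<^sub>R norm x)) * indicator {0<..} (0 + norm x * u) \<partial>lborel)"
        using x by (intro nn_integral_real_affine) auto
      also have "\<dots> = (\<integral>\<^sup>+u. ennreal (norm x) * (ennreal ((norm x * u) ^ (m - 1)) * f (u *\<^sub>R x) * indicator {0<..} u) \<partial>lborel)"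
        using x by (subst nn_integral_cmult[symmetric]) (auto simp: zero_less_mult_iff indicator_def field_simps intro!: nn_integral_cong)
      also have "\<dots> = (\<integral>\<^sup>+u. ennreal (norm x ^ m * u ^ (m - 1)) * f (u *\<^sub>R x) * indicator {0<..} u * indicator B x \<partial>lborel)"
      proof (rule nn_integral_cong)
        fix u :: real
        have "ennreal (norm x) * ennreal ((norm x * u) ^ (m - 1)) = ennreal (norm x ^ m * u ^ (m - 1))" if "u > 0"
        proof -
          have "norm x ^ m = norm x * norm x ^ (m - 1)" using mm power_Suc by metis
          then show ?thesis using that x by (subst ennreal_mult[symmetric]) (auto simp: power_mult_distrib)
        qed
        note e = this
        show "ennreal (norm x) * (ennreal ((norm x * u) ^ (m - 1)) * f (u *\<^sub>R x) * indicator {0<..} u) =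
          ennreal (norm x ^ m * u ^ (m - 1)) * f (u *\<^sub>R x) * indicator {0<..} u * indicator B x"
        proof (cases "u > 0")
          case u: True
          have "ennreal (norm x) * (ennreal ((norm x * u) ^ (m - 1)) * f (u *\<^sub>R x) * indicator {0<..} u) =
            (ennreal (norm x) * ennreal ((norm x * u) ^ (m - 1))) * f (u *\<^sub>R x) * indicator {0<..} u"
            by (simp only: mult.assoc)
          moreover have "indicator B x = (1 :: ennreal)" using True by (rule indicator_simps(1))
          ultimately show ?thesis by (simp only: e[OF u] mult_1_right)
        next
          case False
          then have "indicator {0<..} u = (0 :: ennreal)" by simp
          then show ?thesis by (simp only: mult_zero_right mult_zero_left)
        qed
      qed
      finally show ?thesis using True by simp
    qed simp
  qed
  also have "\<dots> = (\<integral>\<^sup>+u. (\<integral>\<^sup>+x. ennreal (norm x ^ m * u ^ (m - 1)) * f (u *\<^sub>R x) * indicator {0<..} u * indicator B x \<partial>lborel) \<partial>lborel)"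
    by (rule lborel_pair.Fubini') measurable
  also have "\<dots> = (\<integral>\<^sup>+u. (\<integral>\<^sup>+y. ennreal (norm y ^ m) * f y * (ennreal (inverse (u ^ Suc m)) * indicator {norm y<..} u) * indicator (-{0}) y \<partial>lborel) \<partial>lborel)"
  proof (rule nn_integral_cong)
    fix u :: real
    show "(\<integral>\<^sup>+x. ennreal (norm x ^ m * u ^ (m - 1)) * f (u *\<^sub>R x) * indicator {0<..} u * indicator B x \<partial>lborel) =
      (\<integral>\<^sup>+y. ennreal (norm y ^ m) * f y * (ennreal (inverse (u ^ Suc m)) * indicator {norm y<..} u) * indicator (-{0}) y \<partial>lborel)"
    proof (cases "u > 0")
      case True
      have [measurable]: "Measurable.pred borel (\<lambda>x::'a. u \<in> {norm x<..})"
        unfolding greaterThan_iff by measurable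
      have [measurable]: "indicator (- {0}) \<in> borel_measurable (borel :: 'a measure)" by simp
      have "(\<integral>\<^sup>+y. ennreal (norm y ^ m) * f y * (ennreal (inverse (u ^ Suc m)) * indicator {norm y<..} u) * indicator (-{0}) y \<partial>lborel) =
        ennreal (u ^ m) * (\<integral>\<^sup>+y. ennreal (norm (u *\<^sub>R y) ^ m) * f (u *\<^sub>R y) * (ennreal (inverse (u ^ Suc m)) * indicator {norm (u *\<^sub>R y)<..} u) * indicator (-{0}) (u *\<^sub>R y) \<partial>lborel)"
        unfolding m_def using True by (intro nn_integral_lborel_scaleR) measurable
      also have "\<dots> = (\<integral>\<^sup>+y. ennreal (u ^ m) * (ennreal (norm (u *\<^sub>R y) ^ m) * f (u *\<^sub>R y) * (ennreal (inverse (u ^ Suc m)) * indicator {norm (u *\<^sub>R y)<..} u) * indicator (-{0}) (u *\<^sub>R y)) \<partial>lborel)"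
        by (rule nn_integral_cmult[symmetric]) measurable
      also have "\<dots> = (\<integral>\<^sup>+x. ennreal (norm x ^ m * u ^ (m - 1)) * f (u *\<^sub>R x) * indicator {0<..} u * indicator B x \<partial>lborel)"
      proof (rule nn_integral_cong)
        fix y :: 'a
        have i: "indicator {norm (u *\<^sub>R y)<..} u * indicator (-{0}) (u *\<^sub>R y) = (indicator B y :: ennreal)"
          using True by (auto simp: indicator_def B_def)
        have "u ^ m * (norm (u *\<^sub>R y) ^ m * inverse (u ^ Suc m)) = norm y ^ m * u ^ (m - 1)"
        proof -
          have "u ^ m = u * u ^ (m - 1)" using mm power_Suc by metis
          then show ?thesis using True by (simp add: power_mult_distrib field_simps)
        qed
        then have "ennreal (u ^ m) * (ennreal (norm (u *\<^sub>R y) ^ m) * ennreal (inverse (u ^ Suc m))) = ennreal (norm y ^ m * u ^ (m - 1))"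
          using True by (simp add: ennreal_mult[symmetric] del: power_Suc)
        then have "ennreal (u ^ m) * (ennreal (norm (u *\<^sub>R y) ^ m) * ennreal (inverse (u ^ Suc m))) * f (u *\<^sub>R y) * (indicator {norm (u *\<^sub>R y)<..} u * indicator (-{0}) (u *\<^sub>R y)) =
          ennreal (norm y ^ m * u ^ (m - 1)) * f (u *\<^sub>R y) * indicator B y"
          by (simp only: i)
        then show "ennreal (u ^ m) * (ennreal (norm (u *\<^sub>R y) ^ m) * f (u *\<^sub>R y) * (ennreal (inverse (u ^ Suc m)) * indicator {norm (u *\<^sub>R y)<..} u) * indicator (-{0}) (u *\<^sub>R y)) =
          ennreal (norm y ^ m * u ^ (m - 1)) * f (u *\<^sub>R y) * indicator {0<..} u * indicator B y"
          using True by (simp only: mult_ac indicator_simps greaterThan_iff mult_1 mult_1_right)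
      qed
      finally show ?thesis ..
    next
      case False
      then have "indicator {norm y<..} u = (0::ennreal)" for y :: 'a
        using norm_ge_zero[of y] by (auto simp: indicator_def simp del: norm_ge_zero)
      then show ?thesis using False by simp
    qed
  qed
  also have "\<dots> = (\<integral>\<^sup>+y. (\<integral>\<^sup>+u. ennreal (norm y ^ m) * f y * (ennreal (inverse (u ^ Suc m)) * indicator {norm y<..} u) * indicator (-{0}) y \<partial>lborel) \<partial>lborel)"
    by (rule lborel_pair.Fubini') measurable
  also have "\<dots> = (\<integral>\<^sup>+y. f y * ennreal (inverse (real m)) \<partial>lborel)"
  proof (rule nn_integral_cong_AE)
    show "AE y in lborel. (\<integral>\<^sup>+u. ennreal (norm y ^ m) * f y * (ennreal (inverse (u ^ Suc m)) * indicator {norm y<..} u) * indicator (-{0}) y \<partial>lborel) =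
      f y * ennreal (inverse (real m))"
      using AE_lborel_singleton[of 0]
    proof eventually_elim
      fix y :: 'a assume y: "y \<noteq> 0"
      have "(\<integral>\<^sup>+u. ennreal (norm y ^ m) * f y * (ennreal (inverse (u ^ Suc m)) * indicator {norm y<..} u) * indicator (-{0}) y \<partial>lborel)
        = (\<integral>\<^sup>+u. (ennreal (norm y ^ m) * f y) * (ennreal (inverse (u ^ Suc m)) * indicator {norm y<..} u) \<partial>lborel)"
        using y by simp
      also have "\<dots> = ennreal (norm y ^ m) * f y * ennreal (inverse (real m * norm y ^ m))"
        using y m0 by (subst nn_integral_cmult) (simp_all add: nn_integral_inverse_power del: power_Suc)
      also have "\<dots> = f y * (ennreal (norm y ^ m) * ennreal (inverse (real m * norm y ^ m)))"
        by (simp only: mult_ac)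
      also have "ennreal (norm y ^ m) * ennreal (inverse (real m * norm y ^ m)) = ennreal (inverse (real m))"
        using y m0 by (subst ennreal_mult[symmetric]) (auto simp: field_simps)
      finally show "(\<integral>\<^sup>+u. ennreal (norm y ^ m) * f y * (ennreal (inverse (u ^ Suc m)) * indicator {norm y<..} u) * indicator (-{0}) y \<partial>lborel) =
        f y * ennreal (inverse (real m))" .
    qed
  qed
  also have "\<dots> = (\<integral>\<^sup>+y. f y \<partial>lborel) * ennreal (inverse (real m))"
    by (rule nn_integral_multc) measurable
  also have "of_nat m * ((\<integral>\<^sup>+y. f y \<partial>lborel) * ennreal (inverse (real m))) = (of_nat m * ennreal (inverse (real m))) * (\<integral>\<^sup>+y. f y \<partial>lborel)"
    by (simp only: mult_ac)
  also have "of_nat m * ennreal (inverse (real m)) = 1"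
    using m0 by (subst ennreal_of_nat_eq_real_of_nat, subst ennreal_mult[symmetric]) auto
  finally show ?thesis by (simp add: m_def)
qed

definition radial_measure :: "nat \<Rightarrow> real measure" where
  "radial_measure m = density lborel (\<lambda>s. ennreal (s ^ (m - 1)) * indicator {0<..} s)"

text \<open>In the form of an identity of measures, polar coordinates transfer to complex-valued
  integrals through image measures and Fubini, without splitting the integrand into positive
  parts.\<close>

lemma lborel_polar:
  "(lborel :: 'a::euclidean_space measure) =
     distr (sphere_measure \<Otimes>\<^sub>M radial_measure DIM('a)) borel (\<lambda>(\<nu>, s). s *\<^sub>R \<nu>)"
proof (rule measure_eqI)
  interpret R: sigma_finite_measure "radial_measure DIM('a)"
    unfolding radial_measure_def
    by (subst sigma_finite_measure.sigma_finite_iff_density_finite[OF lborel.sigma_finite_measure_axioms]) (auto simp: indicator_def)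
  fix A :: "'a set" assume "A \<in> sets lborel"
  then have A[measurable]: "A \<in> sets borel" by simp
  have [measurable]: "(\<lambda>x. x) \<in> sphere_measure \<rightarrow>\<^sub>M (borel :: 'a measure)"
    by (subst measurable_cong_sets[OF sets_sphere_measure refl]) (rule measurable_restrict_space1, simp)
  have [measurable]: "(\<lambda>(\<nu>, s). s *\<^sub>R \<nu>) \<in> sphere_measure \<Otimes>\<^sub>M radial_measure DIM('a) \<rightarrow>\<^sub>M (borel :: 'a measure)"
  proof -
    have "(\<lambda>(\<nu>, s). s *\<^sub>R \<nu>) \<in> sphere_measure \<Otimes>\<^sub>M borel \<rightarrow>\<^sub>M (borel :: 'a measure)" by measurable
    then show ?thesis
      by (subst measurable_cong_sets[OF sets_pair_measure_cong[OF refl] refl, of _ borel]) (simp_all add: radial_measure_def)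
  qed
  have "emeasure (distr (sphere_measure \<Otimes>\<^sub>M radial_measure DIM('a)) borel (\<lambda>(\<nu>, s). s *\<^sub>R \<nu>)) A =
    (\<integral>\<^sup>+p. indicator A (case p of (\<nu>, s) \<Rightarrow> s *\<^sub>R \<nu>) \<partial>(sphere_measure \<Otimes>\<^sub>M radial_measure DIM('a)))"
    by (subst nn_integral_indicator[symmetric], simp, subst nn_integral_distr) auto
  also have "\<dots> = (\<integral>\<^sup>+\<nu>. \<integral>\<^sup>+s. indicator A (s *\<^sub>R \<nu>) \<partial>radial_measure DIM('a) \<partial>sphere_measure)"
    by (subst R.nn_integral_fst[symmetric]) simp_all
  also have "\<dots> = (\<integral>\<^sup>+\<nu>. \<integral>\<^sup>+s. ennreal (s ^ (DIM('a) - 1)) * indicator A (s *\<^sub>R \<nu>) * indicator {0<..} s \<partial>lborel \<partial>sphere_measure)"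
    unfolding radial_measure_def
    by (intro nn_integral_cong, subst nn_integral_density) (auto simp: mult_ac)
  also have "\<dots> = (\<integral>\<^sup>+x. indicator A x \<partial>lborel)"
    by (rule nn_integral_polar) measurable
  finally show "emeasure lborel A = emeasure (distr (sphere_measure \<Otimes>\<^sub>M radial_measure DIM('a)) borel (\<lambda>(\<nu>, s). s *\<^sub>R \<nu>)) A"
    by simp
qed simp

text \<open>In polar coordinates half of the rate absorbs the Jacobian s^(DIM - 1), and the surface
  measure of the sphere is finite.\<close>

lemma integrable_exp_norm:
  assumes "0 < c"
  shows "integrable lborel (\<lambda>x::'a::euclidean_space. exp (- c * norm x))"
proof (rule integrableI_nonneg)
  interpret S: finite_measure "sphere_measure :: 'a measure" by (rule finite_sphere_measure)
  obtain K where K: "K > 0" "\<And>y. y \<ge> 0 \<Longrightarrow> (1 + y) ^ (DIM('a) - 1) \<le> K * exp (c / 2 * y)"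
    using power_exp_bound[of "c / 2" "DIM('a) - 1"] assms by auto
  have "(\<integral>\<^sup>+x. ennreal (exp (- c * norm (x::'a))) \<partial>lborel) =
     (\<integral>\<^sup>+\<nu>. \<integral>\<^sup>+s. ennreal (s ^ (DIM('a) - 1)) * ennreal (exp (- c * norm (s *\<^sub>R (\<nu>::'a)))) * indicator {0<..} s \<partial>lborel \<partial>sphere_measure)"
    by (rule nn_integral_polar[symmetric]) measurable
  also have "\<dots> \<le> (\<integral>\<^sup>+\<nu>. (\<integral>\<^sup>+s. ennreal (K * exp (- (c / 2) * s)) * indicator {0..} s \<partial>lborel) \<partial>(sphere_measure :: 'a measure))"
  proof (intro nn_integral_mono)
    fix \<nu> :: 'a and s :: real assume "\<nu> \<in> space sphere_measure"
    then have \<nu>: "norm \<nu> = 1" by (simp add: space_sphere_measure)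
    show "ennreal (s ^ (DIM('a) - 1)) * ennreal (exp (- c * norm (s *\<^sub>R \<nu>))) * indicator {0<..} s \<le>
      ennreal (K * exp (- (c / 2) * s)) * indicator {0..} s"
    proof (cases "s > 0")
      case True
      have "s ^ (DIM('a) - 1) \<le> (1 + s) ^ (DIM('a) - 1)" using True by (intro power_mono) auto
      also have "\<dots> \<le> K * exp (c / 2 * s)" using K True by auto
      finally have "s ^ (DIM('a) - 1) * exp (- c * s) \<le> K * exp (c / 2 * s) * exp (- c * s)"
        by (intro mult_right_mono) auto
      also have "\<dots> = K * exp (- (c / 2) * s)" by (simp add: mult.assoc exp_add[symmetric] algebra_simps)
      finally show ?thesis using True \<nu> by (simp add: ennreal_mult[symmetric] ennreal_leI)
    qed simp
  qed
  also have "(\<integral>\<^sup>+s. ennreal (K * exp (- (c / 2) * s)) * indicator {0..} s \<partial>lborel) = ennreal (0 - (- (2 * K / c) * exp (- (c / 2) * 0)))"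
  proof (rule nn_integral_FTC_atLeast[where F = "\<lambda>s. - (2 * K / c) * exp (- (c / 2) * s)"])
    show "((\<lambda>s. - (2 * K / c) * exp (- (c / 2) * s)) has_real_derivative K * exp (- (c / 2) * s)) (at s)" for s
      using assms by (auto intro!: derivative_eq_intros)
    have "((\<lambda>s. exp (- (c / 2 * s))) \<longlongrightarrow> 0) at_top"
      using assms by (intro filterlim_compose[OF exp_at_bot] filterlim_uminus_at_bot_at_top[THEN filterlim_compose]
          filterlim_tendsto_pos_mult_at_top[OF tendsto_const] filterlim_ident) auto
    then show "((\<lambda>s. - (2 * K / c) * exp (- (c / 2) * s)) \<longlongrightarrow> 0) at_top"
      using tendsto_mult_right_zero[of "\<lambda>s. exp (- (c / 2 * s))" at_top "- (2 * K / c)"] by simp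
  qed (use K in auto)
  finally have "(\<integral>\<^sup>+x. ennreal (exp (- c * norm (x::'a))) \<partial>lborel) \<le> ennreal (2 * K / c) * emeasure sphere_measure (space (sphere_measure :: 'a measure))"
    by (simp add: mult.commute)
  also have "\<dots> < \<infinity>" using emeasure_space_sphere_measure[where 'a='a] by (simp add: ennreal_mult_less_top)
  finally show "(\<integral>\<^sup>+x. ennreal (exp (- c * norm (x::'a))) \<partial>lborel) < \<infinity>" .
qed auto

subsection \<open>Nearly Hermitian matrices\<close>

definition cip :: "complex ^ 'd \<Rightarrow> complex ^ 'd::finite \<Rightarrow> complex" where
  "cip u v = (\<Sum>j\<in>UNIV. cnj (u $ j) * v $ j)"

lemma cip_add_left: "cip (u + v) w = cip u w + cip v w"
  by (simp add: cip_def distrib_right sum.distrib)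

lemma cip_add_right: "cip u (v + w) = cip u v + cip u w"
  by (simp add: cip_def distrib_left sum.distrib)

lemma cip_scale_left: "cip (c *s u) v = cnj c * cip u v"
  by (simp add: cip_def sum_distrib_left mult.assoc)

lemma cip_scale_right: "cip u (c *s v) = c * cip u v"
  by (simp add: cip_def sum_distrib_left mult_ac)

lemma cnj_cip: "cnj (cip u v) = cip v u"
  by (simp add: cip_def mult.commute)

lemma cip_self: "cip v v = of_real ((norm v)\<^sup>2)"
proof -
  have "(norm v)\<^sup>2 = (\<Sum>j\<in>UNIV. (cmod (v $ j))\<^sup>2)"
    by (simp add: norm_vec_def L2_set_def sum_nonneg)
  moreover have "cnj c * c = of_real ((cmod c)\<^sup>2)" for c
    by (metis complex_norm_square mult.commute)
  ultimately show ?thesis unfolding cip_def by simp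
qed

lemma norm_cip_le: "cmod (cip u v) \<le> norm u * norm v"
proof -
  have "cmod (cip u v) \<le> (\<Sum>j\<in>UNIV. \<bar>cmod (u $ j)\<bar> * \<bar>cmod (v $ j)\<bar>)"
    unfolding cip_def by (rule order.trans[OF norm_sum]) (simp add: norm_mult)
  also have "\<dots> \<le> norm u * norm v"
    unfolding norm_vec_def by (rule L2_set_mult_ineq)
  finally show ?thesis .
qed

lemma cip_ctranspose: "cip u (M *v v) = cip (ctranspose M *v u) v"
proof -
  have "cip u (M *v v) = (\<Sum>j\<in>UNIV. \<Sum>k\<in>UNIV. cnj (u $ j) * (M $ j $ k * v $ k))"
    by (simp add: cip_def matrix_vector_mult_def sum_distrib_left)
  also have "\<dots> = (\<Sum>k\<in>UNIV. \<Sum>j\<in>UNIV. cnj (u $ j) * (M $ j $ k * v $ k))" by (rule sum.swap)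
  also have "\<dots> = cip (ctranspose M *v u) v"
    by (simp add: cip_def matrix_vector_mult_def sum_distrib_left sum_distrib_right mult_ac)
  finally show ?thesis .
qed

text \<open>A norm built from the moduli of the entries: it dominates the operator norm and is
  continuous along entrywise holomorphic families, which yields local bounds.\<close>

definition entry_norm :: "complex ^ 'n ^ 'k \<Rightarrow> real" where
  "entry_norm X = (\<Sum>a\<in>UNIV. \<Sum>b\<in>UNIV. cmod (X $ a $ b))"

lemma entry_norm_nonneg: "0 \<le> entry_norm X"
  by (simp add: entry_norm_def sum_nonneg)

lemma row_le_entry_norm: "(\<Sum>b\<in>UNIV. cmod (X $ a $ b)) \<le> entry_norm X"
  unfolding entry_norm_def
  by (rule member_le_sum[of a UNIV "\<lambda>a. \<Sum>b\<in>UNIV. cmod (X $ a $ b)"]) (auto intro: sum_nonneg)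

lemma entry_le_entry_norm: "cmod (X $ a $ b) \<le> entry_norm X"
  by (rule order.trans[OF _ row_le_entry_norm[of X a]], rule member_le_sum) auto

lemma norm_matrix_vector_le: "norm (X *v v) \<le> entry_norm X * norm (v :: complex ^ 'd::finite)"
proof -
  have "norm (X *v v) \<le> (\<Sum>a\<in>UNIV. cmod ((X *v v) $ a))"
    unfolding norm_vec_def by (rule L2_set_le_sum) simp
  also have "\<dots> \<le> (\<Sum>a\<in>UNIV. \<Sum>b\<in>UNIV. cmod (X $ a $ b) * norm v)"
    unfolding matrix_vector_mult_def
    by (intro sum_mono) (auto simp: norm_mult intro!: sum_norm_le mult_left_mono Finite_Cartesian_Product.norm_nth_le)
  finally show ?thesis by (simp add: entry_norm_def sum_distrib_right)
qed

lemma entry_eq_cip: "X $ a $ b = cip (axis a 1) (X *v axis b (1::complex))"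
proof -
  have "cip (axis a 1) w = w $ a" for w :: "complex ^ 'b"
    unfolding cip_def by (subst sum.remove[of _ a]) (auto simp: axis_def intro!: sum.neutral)
  moreover have "(X *v axis b 1) $ a = X $ a $ b"
    unfolding matrix_vector_mult_def by (simp, subst sum.remove[of _ b]) (auto simp: axis_def intro!: sum.neutral)
  ultimately show ?thesis by simp
qed

text \<open>Inverse matrix by Cramer's rule, so that analyticity in the entries is evident.\<close>

definition cramer_inv :: "complex ^ 'd ^ 'd::finite \<Rightarrow> complex ^ 'd ^ 'd" where
  "cramer_inv Y = (\<chi> a b. det (\<chi> i j. if j = a then axis b 1 $ i else Y $ i $ j) / det Y)"

lemma cramer_inv:
  assumes "det Y \<noteq> 0"
  shows "Y ** cramer_inv Y = mat 1" "cramer_inv Y ** Y = mat 1"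
proof -
  have "Y *v (\<chi> a. cramer_inv Y $ a $ b) = axis b 1" for b
    by (subst cramer[OF assms]) (simp add: cramer_inv_def vec_eq_iff)
  then have "(Y *v (\<chi> a. cramer_inv Y $ a $ b)) $ i = axis b 1 $ i" for b i by simp
  then show "Y ** cramer_inv Y = mat 1"
    by (simp add: vec_eq_iff matrix_matrix_mult_def matrix_vector_mult_def mat_def axis_def)
  then show "cramer_inv Y ** Y = mat 1" by (simp add: matrix_left_right_inverse)
qed

lemma det_nonzero_if_bounded_below:
  fixes Y :: "complex ^ 'd ^ 'd::finite"
  assumes "0 < \<delta>" "\<And>v. \<delta> * norm v \<le> norm (Y *v v)"
  shows "det Y \<noteq> 0"
proof -
  have "\<forall>x. Y *v x = 0 \<longrightarrow> x = 0"
    using assms by (metis mult_le_0_iff norm_le_zero_iff norm_zero not_less order_antisym_conv)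
  then have "\<exists>B. B ** Y = mat 1" by (simp add: matrix_left_invertible_ker)
  then have "invertible Y" by (simp add: invertible_left_inverse)
  then show ?thesis by (simp add: invertible_det_nz)
qed

text \<open>A splitting M + i E with Hermitian M and E exists for every matrix; the content is the
  bound on E. For the Levi matrix at x + i y \<eta>, E is y times the Levi matrix of \<eta>.\<close>

definition near_hermitian :: "real \<Rightarrow> complex ^ 'd ^ 'd::finite \<Rightarrow> bool" where
  "near_hermitian \<epsilon> X \<longleftrightarrow> (\<exists>M E. X = (\<chi> a b. M $ a $ b + \<i> * E $ a $ b) \<and>
     ctranspose M = M \<and> ctranspose E = E \<and> (\<forall>v. norm (E *v v) \<le> \<epsilon> * norm v))"

lemma near_hermitian_mono: "near_hermitian \<epsilon> X \<Longrightarrow> \<epsilon> \<le> \<epsilon>' \<Longrightarrow> near_hermitian \<epsilon>' X"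
proof -
  assume "near_hermitian \<epsilon> X" and le: "\<epsilon> \<le> \<epsilon>'"
  then obtain M E where "X = (\<chi> a b. M $ a $ b + \<i> * E $ a $ b)" "ctranspose M = M" "ctranspose E = E"
    and E: "\<And>v. norm (E *v v) \<le> \<epsilon> * norm v"
    unfolding near_hermitian_def by blast
  moreover have "norm (E *v v) \<le> \<epsilon>' * norm v" for v
    using E[of v] mult_right_mono[OF le norm_ge_zero[of v]] by linarith
  ultimately show ?thesis unfolding near_hermitian_def by blast
qed

definition shifted_square :: "real \<Rightarrow> complex ^ 'd ^ 'd::finite \<Rightarrow> complex ^ 'd ^ 'd" where
  "shifted_square w X = (\<chi> a b. (X ** X) $ a $ b + (if a = b then of_real (w\<^sup>2) else 0))"

lemma shifted_square_vector: "shifted_square w X *v v = X *v (X *v v) + of_real (w\<^sup>2) *s v"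
proof -
  have "(shifted_square w X *v v) $ a = ((X ** X) *v v) $ a + of_real (w\<^sup>2) * v $ a" for a
    unfolding shifted_square_def matrix_vector_mult_def
    by (simp add: distrib_right sum.distrib if_distrib[of "\<lambda>x. x * _"] sum.delta cong: if_cong)
  then show ?thesis by (simp add: vec_eq_iff matrix_vector_mul_assoc)
qed

context
  fixes \<epsilon> :: real and X :: "complex ^ 'd ^ 'd::finite" and w :: real
  assumes X: "near_hermitian \<epsilon> X" and \<epsilon>: "0 \<le> \<epsilon>" "\<epsilon> \<le> 1" and w: "2 \<le> w"
begin

text \<open>Pair with v: the form of M is real, so the imaginary part is s w |v|^2 up to an error of
  at most \<epsilon> |v|^2 from E. Since \<epsilon> \<le> 1 \<le> w/2, half of the main term
  survives, and Cauchy-Schwarz removes the pairing.\<close>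

lemma resolvent_lower:
  assumes "s = 1 \<or> s = - 1"
  shows "w / 2 * norm v \<le> norm (X *v v + (\<i> * of_real (s * w)) *s v)"
proof (cases "v = 0")
  case False
  from X obtain M E where ME: "X = (\<chi> a b. M $ a $ b + \<i> * E $ a $ b)"
    "ctranspose M = M" "ctranspose E = E" "\<And>v. norm (E *v v) \<le> \<epsilon> * norm v"
    unfolding near_hermitian_def by blast
  have Xv: "X *v v = M *v v + \<i> *s (E *v v)"
    by (simp add: ME(1) vec_eq_iff matrix_vector_mult_def distrib_right sum.distrib sum_distrib_left mult.assoc)
  have real: "Im (cip v (M *v v)) = 0" if "ctranspose M = M" for M :: "complex ^ 'd ^ 'd"
    using cip_ctranspose[of v M v] cnj_cip[of v "M *v v"] that by (metis complex_cnj_cancel_iff cnj.sel(2) neg_equal_zero)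
  let ?u = "X *v v + (\<i> * of_real (s * w)) *s v"
  have "cip v ?u = cip v (M *v v) + \<i> * cip v (E *v v) + \<i> * of_real (s * w * (norm v)\<^sup>2)"
    by (simp add: Xv cip_add_right cip_scale_right cip_self mult.assoc)
  then have im: "Im (cip v ?u) = Re (cip v (E *v v)) + s * w * (norm v)\<^sup>2"
    using real[OF ME(2)] by simp
  have "\<bar>Re (cip v (E *v v))\<bar> \<le> norm v * (\<epsilon> * norm v)"
    using abs_Re_le_cmod[of "cip v (E *v v)"] norm_cip_le[of v "E *v v"] mult_left_mono[OF ME(4)[of v], of "norm v"]
    by simp
  also have "\<dots> \<le> 1 * (norm v)\<^sup>2" using \<epsilon> by (simp add: power2_eq_square mult_right_mono mult.assoc[symmetric] mult_left_le)
  also have "\<dots> \<le> w / 2 * (norm v)\<^sup>2" using w by (intro mult_right_mono) auto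
  finally have "w / 2 * (norm v)\<^sup>2 \<le> \<bar>Im (cip v ?u)\<bar>"
    using assms unfolding im by (auto simp: abs_if split: if_splits)
  also have "\<dots> \<le> norm v * norm ?u"
    using abs_Im_le_cmod norm_cip_le order.trans by blast
  finally have "norm v * (w / 2 * norm v) \<le> norm v * norm ?u" by (simp add: power2_eq_square mult_ac)
  then show ?thesis using False by simp
qed simp

text \<open>X^2 + w^2 factors as (X + i w) (X - i w), and \<open>resolvent_lower\<close> applies to
  each factor.\<close>

lemma shifted_square_lower: "w\<^sup>2 / 4 * norm v \<le> norm (shifted_square w X *v v)"
proof -
  let ?u = "X *v v + (\<i> * of_real ((- 1) * w)) *s v"
  have "shifted_square w X *v v = X *v ?u + (\<i> * of_real (1 * w)) *s ?u"
    by (simp add: shifted_square_vector matrix_vector_right_distrib vec.scale vec_eq_iff algebra_simps power2_eq_square)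
  then have "w / 2 * norm ?u \<le> norm (shifted_square w X *v v)"
    using resolvent_lower[of 1 ?u] by simp
  moreover have "w / 2 * (w / 2 * norm v) \<le> w / 2 * norm ?u"
    using w by (intro mult_left_mono resolvent_lower) auto
  ultimately show ?thesis by (simp add: power2_eq_square)
qed

lemma det_shifted_square: "det (shifted_square w X) \<noteq> 0"
  by (rule det_nonzero_if_bounded_below[OF _ shifted_square_lower]) (use w in simp)

lemma shifted_square_inv_vector: "shifted_square w X *v (cramer_inv (shifted_square w X) *v z) = z"
  using cramer_inv(1)[OF det_shifted_square] by (simp add: matrix_vector_mul_assoc)

lemma norm_shifted_square_inv: "norm (cramer_inv (shifted_square w X) *v z) \<le> 4 / w\<^sup>2 * norm z"
  using shifted_square_lower[of "cramer_inv (shifted_square w X) *v z"] w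
  by (simp add: shifted_square_inv_vector field_simps)

text \<open>Let y be the solution of (X^2 + w^2) y = z. Pairing z with X^2 y gives |X^2 y|^2 plus
  w^2 times the pairing of y with X^2 y. Because M and E are Hermitian, the mixed terms of the
  latter are purely imaginary and its real part is |M y|^2 - |E y|^2 \<ge> -\<epsilon>^2 |y|^2. The
  bound |y| \<le> 4 |z| / w^2 then produces the constant 16.\<close>

lemma Re_cip_square_resolvent:
  "- (16 * \<epsilon>\<^sup>2 / w\<^sup>2) * (norm z)\<^sup>2 \<le> Re (cip z (X *v (X *v (cramer_inv (shifted_square w X) *v z))))"
proof -
  from X obtain M E where ME: "X = (\<chi> a b. M $ a $ b + \<i> * E $ a $ b)"
    "ctranspose M = M" "ctranspose E = E" "\<And>v. norm (E *v v) \<le> \<epsilon> * norm v"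
    unfolding near_hermitian_def by blast
  have Xv: "X *v v = M *v v + \<i> *s (E *v v)" for v
    by (simp add: ME(1) vec_eq_iff matrix_vector_mult_def distrib_right sum.distrib sum_distrib_left mult.assoc)
  define y where "y = cramer_inv (shifted_square w X) *v z"
  have z: "z = X *v (X *v y) + of_real (w\<^sup>2) *s y"
    using shifted_square_inv_vector[of z] by (simp add: y_def[symmetric] shifted_square_vector)
  have ny: "norm y \<le> 4 / w\<^sup>2 * norm z" unfolding y_def by (rule norm_shifted_square_inv)
  let ?m = "M *v y" and ?e = "E *v y"
  have herm: "cip y (M *v v) = cip ?m v" "cip y (E *v v) = cip ?e v" for v
    using cip_ctranspose[of y M v] cip_ctranspose[of y E v] ME(2,3) by simp_all
  have "cip y (X *v (X *v y)) = cip ?m (?m + \<i> *s ?e) + \<i> * cip ?e (?m + \<i> *s ?e)"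
    by (simp add: Xv cip_add_right cip_scale_right herm)
  also have "\<dots> = cip ?m ?m - cip ?e ?e + \<i> * (cip ?m ?e + cnj (cip ?m ?e))"
    by (simp add: cip_add_right cip_scale_right cnj_cip algebra_simps)
  finally have "Re (cip y (X *v (X *v y))) = (norm ?m)\<^sup>2 - (norm ?e)\<^sup>2"
    by (simp add: cip_self)
  also have "\<dots> \<ge> - ((\<epsilon> * norm y)\<^sup>2)"
    using power_mono[OF ME(4)[of y] norm_ge_zero, of 2] zero_le_power2[of "norm ?m"] by linarith
  finally have "w\<^sup>2 * Re (cip y (X *v (X *v y))) \<ge> w\<^sup>2 * - ((\<epsilon> * norm y)\<^sup>2)"
    by (intro mult_left_mono) auto
  moreover have "Re (cip z (X *v (X *v y))) = (norm (X *v (X *v y)))\<^sup>2 + w\<^sup>2 * Re (cip y (X *v (X *v y)))"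
    by (subst z) (simp add: cip_add_left cip_scale_left cip_self)
  ultimately have "Re (cip z (X *v (X *v y))) \<ge> w\<^sup>2 * - ((\<epsilon> * norm y)\<^sup>2)"
    using zero_le_power2[of "norm (X *v (X *v y))"] by linarith
  moreover have "w\<^sup>2 * ((\<epsilon> * norm y)\<^sup>2) \<le> w\<^sup>2 * ((\<epsilon> * (4 / w\<^sup>2 * norm z))\<^sup>2)"
    using ny \<epsilon> by (intro mult_left_mono power_mono) auto
  moreover have "w\<^sup>2 * ((\<epsilon> * (4 / w\<^sup>2 * norm z))\<^sup>2) = 16 * \<epsilon>\<^sup>2 / w\<^sup>2 * (norm z)\<^sup>2"
    using w by (simp add: power_mult_distrib power_divide field_simps power2_eq_square)
  ultimately show ?thesis unfolding y_def by simp
qed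

lemma norm_square_resolvent:
  "norm (X *v (X *v (cramer_inv (shifted_square w X) *v z))) \<le> (entry_norm X)\<^sup>2 * (4 / w\<^sup>2) * norm z"
proof -
  let ?y = "cramer_inv (shifted_square w X) *v z"
  have "norm (X *v (X *v ?y)) \<le> entry_norm X * (entry_norm X * norm ?y)"
    by (rule order.trans[OF norm_matrix_vector_le mult_left_mono[OF norm_matrix_vector_le entry_norm_nonneg]])
  also have "\<dots> \<le> entry_norm X * (entry_norm X * (4 / w\<^sup>2 * norm z))"
    by (intro mult_left_mono norm_shifted_square_inv entry_norm_nonneg)
  finally show ?thesis by (simp add: power2_eq_square mult_ac)
qed

end

subsection \<open>Matrix functions\<close>

text \<open>The matrix function \<open>X coth (X/2)\<close>, through its partial fraction expansion.\<close>

definition pole :: "nat \<Rightarrow> real" where "pole k = 2 * pi * real (Suc k)"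

definition coth_term :: "nat \<Rightarrow> complex ^ 'd ^ 'd::finite \<Rightarrow> complex ^ 'd ^ 'd" where
  "coth_term k X = X ** X ** cramer_inv (shifted_square (pole k) X)"

definition xcoth :: "complex ^ 'd ^ 'd::finite \<Rightarrow> complex ^ 'd ^ 'd" where
  "xcoth X = (\<chi> a b. (if a = b then 2 else 0) + 4 * (\<Sum>k. coth_term k X $ a $ b))"

lemma pole_ge_2: "2 \<le> pole k"
proof -
  have "2 * 1 * 1 \<le> 2 * pi * real (Suc k)" using pi_gt3 by (intro mult_mono) auto
  then show ?thesis by (simp add: pole_def)
qed

text \<open>The sum pi^2/6 of the inverse squares, divided by 4 pi^2. The size of 1/24 is what
  closes the two estimates below: 16/24 \<le> 1 in \<open>norm_xcoth\<close> and 64 \<epsilon>^2 /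
  24 \<le> 1 for \<epsilon> \<le> 1/2 in \<open>Re_cip_xcoth\<close>.\<close>

lemma sum_inverse_pole: "(\<lambda>k. 1 / (pole k)\<^sup>2) sums (1 / 24)"
proof -
  have "(\<lambda>k. 1 / (4 * pi\<^sup>2) * (1 / real (k + 1) ^ 2)) sums (1 / (4 * pi\<^sup>2) * (pi\<^sup>2 / 6))"
    by (intro sums_mult) (use inverse_squares_sums in simp)
  then show ?thesis by (simp add: pole_def power_mult_distrib add.commute)
qed

lemma coth_term_vector: "coth_term k X *v z = X *v (X *v (cramer_inv (shifted_square (pole k) X) *v z))"
  by (simp add: coth_term_def matrix_vector_mul_assoc matrix_mul_assoc)

lemma norm_axis_1: "norm (axis a (1::complex)) = 1"
proof -
  have "of_real ((norm (axis a (1::complex)))\<^sup>2) = (\<Sum>j\<in>UNIV. cnj (axis a 1 $ j) * axis a (1::complex) $ j)"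
    unfolding cip_self[symmetric] cip_def ..
  also have "\<dots> = 1"
    by (subst sum.remove[of _ a]) (auto simp: axis_def intro!: sum.neutral)
  finally have "(norm (axis a (1::complex)))\<^sup>2 = 1" by (metis of_real_eq_1_iff)
  then show ?thesis using norm_ge_zero[of "axis a (1::complex)"] by (simp add: power2_eq_1_iff)
qed

lemma norm_coth_term:
  assumes "near_hermitian \<epsilon> X" "0 \<le> \<epsilon>" "\<epsilon> \<le> 1"
  shows "cmod (coth_term k X $ a $ b) \<le> 4 * (entry_norm X)\<^sup>2 * (1 / (pole k)\<^sup>2)"
proof -
  have "cmod (coth_term k X $ a $ b) \<le> norm (axis a (1::complex)) * norm (coth_term k X *v axis b 1)"
    unfolding entry_eq_cip[of "coth_term k X" a b] by (rule norm_cip_le)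
  also have "\<dots> \<le> 1 * ((entry_norm X)\<^sup>2 * (4 / (pole k)\<^sup>2) * norm (axis b (1::complex)))"
    unfolding coth_term_vector by (intro mult_mono norm_square_resolvent[OF assms pole_ge_2]) (auto simp: norm_axis_1)
  finally show ?thesis by (simp add: norm_axis_1 mult.commute)
qed

lemma summable_coth_term:
  assumes "near_hermitian \<epsilon> X" "0 \<le> \<epsilon>" "\<epsilon> \<le> 1"
  shows "summable (\<lambda>k. coth_term k X $ a $ b)"
  by (rule summable_comparison_test'[OF summable_mult[OF sums_summable[OF sum_inverse_pole]] norm_coth_term[OF assms]])

lemma norm_xcoth:
  assumes "near_hermitian \<epsilon> X" "0 \<le> \<epsilon>" "\<epsilon> \<le> 1"
  shows "cmod (xcoth X $ a $ b) \<le> 2 + (entry_norm X)\<^sup>2"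
proof -
  have "cmod (\<Sum>k. coth_term k X $ a $ b) \<le> (\<Sum>k. 4 * (entry_norm X)\<^sup>2 * (1 / (pole k)\<^sup>2))"
    by (rule norm_suminf_le[OF norm_coth_term[OF assms] summable_mult[OF sums_summable[OF sum_inverse_pole]]])
  also have "\<dots> = 4 * (entry_norm X)\<^sup>2 * (1 / 24)"
    using sums_unique[OF sums_mult[OF sum_inverse_pole]] by metis
  finally have "cmod (4 * (\<Sum>k. coth_term k X $ a $ b)) \<le> (entry_norm X)\<^sup>2"
    using norm_ge_zero[of "\<Sum>k. coth_term k X $ a $ b"] zero_le_power2[of "entry_norm X"] unfolding norm_mult norm_numeral by linarith
  moreover have "cmod (if a = b then 2 else 0) \<le> 2" by simp
  moreover have "xcoth X $ a $ b = (if a = b then 2 else 0) + 4 * (\<Sum>k. coth_term k X $ a $ b)"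
    by (simp add: xcoth_def)
  ultimately show ?thesis
    using norm_triangle_ineq[of "if a = b then 2 else 0" "4 * (\<Sum>k. coth_term k X $ a $ b)"] by simp
qed

text \<open>Each partial fraction loses at most 16 \<epsilon>^2 |z|^2 / w^2 at w =
  \<open>pole k\<close>; with the prefactor 4 the total loss is at most 2/3 |z|^2 out of the leading
  2 |z|^2. This coercivity bounds the real part of the denominator from below throughout the
  tube.\<close>

lemma Re_cip_xcoth:
  assumes "near_hermitian \<epsilon> X" "0 \<le> \<epsilon>" "\<epsilon> \<le> 1 / 2"
  shows "(norm z)\<^sup>2 \<le> Re (cip z (xcoth X *v z))"
proof -
  have e1: "\<epsilon> \<le> 1" using assms by simp
  note s = summable_coth_term[OF assms(1,2) e1]
  have "(\<lambda>k. cip z (coth_term k X *v z)) sums (\<Sum>a\<in>UNIV. cnj (z $ a) * (\<Sum>b\<in>UNIV. (\<Sum>k. coth_term k X $ a $ b) * z $ b))"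
    unfolding cip_def matrix_vector_mult_def by (simp, intro sums_sum sums_mult sums_mult2 summable_sums s)
  then have 1: "(\<lambda>k. Re (cip z (coth_term k X *v z))) sums Re (\<Sum>a\<in>UNIV. cnj (z $ a) * (\<Sum>b\<in>UNIV. (\<Sum>k. coth_term k X $ a $ b) * z $ b))" (is "_ sums Re ?R")
    by (rule sums_Re)
  have 2: "(\<lambda>k. - (16 * \<epsilon>\<^sup>2 * (norm z)\<^sup>2) * (1 / (pole k)\<^sup>2)) sums (- (16 * \<epsilon>\<^sup>2 * (norm z)\<^sup>2) * (1 / 24))"
    by (intro sums_mult sum_inverse_pole)
  have "- (16 * \<epsilon>\<^sup>2 * (norm z)\<^sup>2) * (1 / 24) \<le> Re ?R"
  proof (rule sums_le[OF _ 2 1])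
    fix k show "- (16 * \<epsilon>\<^sup>2 * (norm z)\<^sup>2) * (1 / (pole k)\<^sup>2) \<le> Re (cip z (coth_term k X *v z))"
      using Re_cip_square_resolvent[OF assms(1,2) e1 pole_ge_2, of k z] by (simp add: coth_term_vector)
  qed
  moreover have "\<epsilon>\<^sup>2 * (norm z)\<^sup>2 \<le> 1 / 4 * (norm z)\<^sup>2"
    using power_mono[OF assms(3,2), of 2] by (intro mult_right_mono) (auto simp: power_divide)
  moreover have e: "cip z (xcoth X *v z) = 2 * cip z z + 4 * ?R"
  proof -
    have "(xcoth X *v z) $ a = 2 * z $ a + 4 * (\<Sum>b\<in>UNIV. (\<Sum>k. coth_term k X $ a $ b) * z $ b)" for a
      unfolding xcoth_def matrix_vector_mult_def
      by (simp add: distrib_right sum.distrib if_distrib[of "\<lambda>x. x * _"] sum.delta sum_distrib_left mult.assoc cong: if_cong)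
    then show ?thesis unfolding cip_def
      by (simp add: distrib_left sum.distrib sum_distrib_left mult_ac)
  qed
  moreover from e have "Re (cip z (xcoth X *v z)) = 2 * (norm z)\<^sup>2 + 4 * Re ?R"
    unfolding cip_self by simp
  ultimately show ?thesis using zero_le_power2[of "norm z"] by linarith
qed

section \<open>The matrix exponential\<close>

primrec mpow :: "complex ^ 'd ^ 'd::finite \<Rightarrow> nat \<Rightarrow> complex ^ 'd ^ 'd" where
  "mpow X 0 = mat 1"
| "mpow X (Suc n) = X ** mpow X n"

definition mexp :: "complex ^ 'd ^ 'd::finite \<Rightarrow> complex ^ 'd ^ 'd" where
  "mexp X = (\<chi> a b. \<Sum>n. mpow X n $ a $ b / fact n)"

lemma norm_mpow: "cmod (mpow X n $ a $ b) \<le> entry_norm X ^ n"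
proof (induction n arbitrary: a b)
  case (Suc n)
  have "cmod (mpow X (Suc n) $ a $ b) \<le> (\<Sum>k\<in>UNIV. cmod (X $ a $ k) * entry_norm X ^ n)"
    unfolding mpow.simps matrix_matrix_mult_def
    by (auto simp: norm_mult intro!: sum_norm_le mult_left_mono Suc)
  also have "\<dots> \<le> entry_norm X * entry_norm X ^ n"
    unfolding sum_distrib_right[symmetric] by (intro mult_right_mono row_le_entry_norm zero_le_power entry_norm_nonneg)
  finally show ?case by simp
qed (simp add: mat_def)

lemma norm_mexp_term: "cmod (mpow X n $ a $ b / fact n) \<le> entry_norm X ^ n / fact n"
  by (simp add: norm_divide divide_right_mono norm_mpow)

lemma summable_exp_real: "summable (\<lambda>n. (x::real) ^ n / fact n)"
  using summable_exp[of x] by (simp add: field_simps)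

lemma norm_mexp: "cmod (mexp X $ a $ b) \<le> exp (entry_norm X)"
proof -
  have "cmod (\<Sum>n. mpow X n $ a $ b / fact n) \<le> (\<Sum>n. entry_norm X ^ n / fact n)"
    by (rule norm_suminf_le[OF norm_mexp_term summable_exp_real])
  also have "\<dots> = exp (entry_norm X)" by (simp add: exp_def divide_inverse mult.commute)
  finally show ?thesis by (simp add: mexp_def)
qed

section \<open>Entrywise holomorphic and measurable families of matrices\<close>

definition mhol :: "complex set \<Rightarrow> (complex \<Rightarrow> complex ^ 'n ^ 'k) \<Rightarrow> bool" where
  "mhol S F \<longleftrightarrow> (\<forall>a b. (\<lambda>w. F w $ a $ b) holomorphic_on S)"

definition mmeas :: "'x measure \<Rightarrow> ('x \<Rightarrow> complex ^ 'n ^ 'k) \<Rightarrow> bool" where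
  "mmeas M F \<longleftrightarrow> (\<forall>a b. (\<lambda>x. F x $ a $ b) \<in> borel_measurable M)"

lemma holomorphic_on_det:
  assumes "mhol S F"
  shows "(\<lambda>w. det (F w)) holomorphic_on S"
  unfolding det_def using assms by (intro holomorphic_intros) (auto simp: mhol_def)

lemma measurable_det:
  assumes "mmeas M F"
  shows "(\<lambda>x. det (F x :: complex ^ 'n ^ 'n::finite)) \<in> borel_measurable M"
  unfolding det_def using assms by (intro borel_measurable_sum borel_measurable_times borel_measurable_prod) (auto simp: mmeas_def)

lemma mhol_mult:
  assumes "mhol S F" "mhol S G"
  shows "mhol S (\<lambda>w. F w ** G w)"
  using assms unfolding mhol_def matrix_matrix_mult_def
  by (auto intro!: holomorphic_on_sum holomorphic_on_mult)

lemma mmeas_mult: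
  assumes "mmeas M F" "mmeas M G"
  shows "mmeas M (\<lambda>w. F w ** G w)"
  using assms unfolding mmeas_def matrix_matrix_mult_def
  by (auto intro!: borel_measurable_sum borel_measurable_times)

lemma mhol_cramer_inv:
  assumes "mhol S F" "\<And>w. w \<in> S \<Longrightarrow> det (F w) \<noteq> 0"
  shows "mhol S (\<lambda>w. cramer_inv (F w))"
proof -
  have "(\<lambda>w. det (\<chi> i j. if j = a then axis b 1 $ i else F w $ i $ j)) holomorphic_on S" for a b
  proof (rule holomorphic_on_det, unfold mhol_def, intro allI)
    fix i j
    show "(\<lambda>w. (\<chi> i j. if j = a then axis b 1 $ i else F w $ i $ j) $ i $ j) holomorphic_on S"
      using assms(1) by (cases "j = a") (auto simp: mhol_def)
  qed
  then show ?thesis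
    using holomorphic_on_det[OF assms(1)] assms(2)
    unfolding mhol_def cramer_inv_def by (auto intro!: holomorphic_on_divide)
qed

lemma mmeas_cramer_inv:
  assumes "mmeas M F"
  shows "mmeas M (\<lambda>w. cramer_inv (F w))"
proof -
  have "(\<lambda>w. det (\<chi> i j. if j = a then axis b 1 $ i else F w $ i $ j)) \<in> borel_measurable M" for a b
  proof (rule measurable_det, unfold mmeas_def, intro allI)
    fix i j
    show "(\<lambda>w. (\<chi> i j. if j = a then axis b 1 $ i else F w $ i $ j) $ i $ j) \<in> borel_measurable M"
      using assms by (cases "j = a") (auto simp: mmeas_def)
  qed
  then show ?thesis
    using measurable_det[OF assms(1)]
    unfolding mmeas_def cramer_inv_def by (auto intro!: borel_measurable_divide)
qed

lemma mhol_coth_term: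
  assumes "mhol S F" "\<And>w. w \<in> S \<Longrightarrow> near_hermitian \<epsilon> (F w)" "0 \<le> \<epsilon>" "\<epsilon> \<le> 1"
  shows "mhol S (\<lambda>w. coth_term k (F w))"
proof -
  have "mhol S (\<lambda>w. shifted_square (pole k) (F w))"
    using mhol_mult[OF assms(1,1)] unfolding shifted_square_def mhol_def
    by (auto intro!: holomorphic_on_add)
  then show ?thesis unfolding coth_term_def
    by (intro mhol_mult mhol_cramer_inv assms(1) det_shifted_square[OF assms(2-4) pole_ge_2])
qed

lemma mmeas_coth_term:
  assumes "mmeas M F"
  shows "mmeas M (\<lambda>w. coth_term k (F w))"
proof -
  have "mmeas M (\<lambda>w. shifted_square (pole k) (F w))"
    using mmeas_mult[OF assms assms] unfolding shifted_square_def mmeas_def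
    by (auto intro!: borel_measurable_add)
  then show ?thesis unfolding coth_term_def
    by (intro mmeas_mult mmeas_cramer_inv assms(1))
qed

text \<open>The Weierstrass majorant may depend on the disc, which suits bounds in terms of
  \<open>entry_norm\<close> that are only locally uniform.\<close>

lemma holomorphic_on_suminf:
  assumes "open S" "\<And>n. f n holomorphic_on S"
    and "\<And>w. w \<in> S \<Longrightarrow> \<exists>d>0. \<exists>B. cball w d \<subseteq> S \<and> summable B \<and> (\<forall>v\<in>cball w d. \<forall>n. cmod (f n v) \<le> B n)"
  shows "(\<lambda>w. \<Sum>n. f n w) holomorphic_on S"
proof (rule holomorphic_uniform_sequence[OF assms(1), where f = "\<lambda>n w. \<Sum>i<n. f i w"])
  show "(\<lambda>w. \<Sum>i<n. f i w) holomorphic_on S" for n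
    by (intro holomorphic_on_sum assms(2))
  fix w assume "w \<in> S"
  from assms(3)[OF this] obtain d B where "d > 0" "cball w d \<subseteq> S" "summable B"
    "\<And>v n. v \<in> cball w d \<Longrightarrow> cmod (f n v) \<le> B n" by blast
  then show "\<exists>d>0. cball w d \<subseteq> S \<and> uniform_limit (cball w d) (\<lambda>n w. \<Sum>i<n. f i w) (\<lambda>w. \<Sum>n. f n w) sequentially"
    using Weierstrass_m_test[of "cball w d" f B] by blast
qed

lemma continuous_on_entry_norm:
  assumes "mhol S F"
  shows "continuous_on S (\<lambda>w. entry_norm (F w))"
  using assms unfolding entry_norm_def mhol_def
  by (intro continuous_on_sum continuous_on_norm holomorphic_on_imp_continuous_on) blast

lemma entry_norm_locally_bounded:
  assumes "mhol S F" "open S" "w \<in> S"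
  obtains d R where "d > 0" "cball w d \<subseteq> S" "R \<ge> 0" "\<And>v. v \<in> cball w d \<Longrightarrow> entry_norm (F v) \<le> R"
proof -
  obtain d where d: "d > 0" "cball w d \<subseteq> S" using assms open_contains_cball by blast
  have "bounded ((\<lambda>w. entry_norm (F w)) ` cball w d)"
    by (intro compact_imp_bounded compact_continuous_image continuous_on_subset[OF continuous_on_entry_norm[OF assms(1)] d(2)]) simp
  then obtain R where "\<And>v. v \<in> cball w d \<Longrightarrow> norm (entry_norm (F v)) \<le> R"
    unfolding bounded_iff by blast
  moreover from this[of w] have "R \<ge> 0" using d entry_norm_nonneg[of "F w"] by simp
  ultimately show ?thesis using d that[of d R] by (simp add: abs_le_iff)
qed

lemma mhol_xcoth:
  assumes "mhol S F" "open S" "\<And>w. w \<in> S \<Longrightarrow> near_hermitian \<epsilon> (F w)" "0 \<le> \<epsilon>" "\<epsilon> \<le> 1"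
  shows "mhol S (\<lambda>w. xcoth (F w))"
proof -
  have "(\<lambda>w. \<Sum>k. coth_term k (F w) $ a $ b) holomorphic_on S" for a b
  proof (rule holomorphic_on_suminf[OF assms(2)])
    show "(\<lambda>w. coth_term k (F w) $ a $ b) holomorphic_on S" for k
      using mhol_coth_term[OF assms(1) assms(3-5)] by (auto simp: mhol_def)
    fix w assume "w \<in> S"
    then obtain d R where d: "d > 0" "cball w d \<subseteq> S" "R \<ge> 0" "\<And>v. v \<in> cball w d \<Longrightarrow> entry_norm (F v) \<le> R"
      using entry_norm_locally_bounded[OF assms(1,2)] by metis
    have "cmod (coth_term k (F v) $ a $ b) \<le> 4 * R\<^sup>2 * (1 / (pole k)\<^sup>2)" if "v \<in> cball w d" for k v
    proof (rule order.trans[OF norm_coth_term[OF assms(3-5)]])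
      show "4 * (entry_norm (F v))\<^sup>2 * (1 / (pole k)\<^sup>2) \<le> 4 * R\<^sup>2 * (1 / (pole k)\<^sup>2)"
        by (intro mult_right_mono mult_left_mono power_mono d that entry_norm_nonneg) auto
    qed (use d that in auto)
    then show "\<exists>d>0. \<exists>B. cball w d \<subseteq> S \<and> summable B \<and> (\<forall>v\<in>cball w d. \<forall>n. cmod (coth_term n (F v) $ a $ b) \<le> B n)"
      using d summable_mult[OF sums_summable[OF sum_inverse_pole], of "4 * R\<^sup>2"] by blast
  qed
  then show ?thesis unfolding mhol_def xcoth_def by (auto intro!: holomorphic_intros)
qed

lemma mmeas_xcoth:
  assumes "mmeas M F"
  shows "mmeas M (\<lambda>w. xcoth (F w))"
  using mmeas_coth_term[OF assms] unfolding mmeas_def xcoth_def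
  by (auto intro!: borel_measurable_add borel_measurable_times borel_measurable_suminf)

lemma mhol_mpow: "mhol S F \<Longrightarrow> mhol S (\<lambda>w. mpow (F w) n)"
  by (induction n) (auto intro!: mhol_mult, auto simp: mhol_def)

lemma mmeas_mpow: "mmeas M F \<Longrightarrow> mmeas M (\<lambda>w. mpow (F w) n)"
  by (induction n) (auto intro!: mmeas_mult, auto simp: mmeas_def)

lemma mhol_mexp:
  assumes "mhol S F" "open S"
  shows "mhol S (\<lambda>w. mexp (F w))"
proof -
  have "(\<lambda>w. \<Sum>n. mpow (F w) n $ a $ b / fact n) holomorphic_on S" for a b
  proof (rule holomorphic_on_suminf[OF assms(2)])
    show "(\<lambda>w. mpow (F w) n $ a $ b / fact n) holomorphic_on S" for n
      using mhol_mpow[OF assms(1)] by (auto simp: mhol_def intro!: holomorphic_intros)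
    fix w assume "w \<in> S"
    then obtain d R where d: "d > 0" "cball w d \<subseteq> S" "R \<ge> 0" "\<And>v. v \<in> cball w d \<Longrightarrow> entry_norm (F v) \<le> R"
      using entry_norm_locally_bounded[OF assms(1,2)] by metis
    have "cmod (mpow (F v) n $ a $ b / fact n) \<le> R ^ n / fact n" if "v \<in> cball w d" for n v
      by (rule order.trans[OF norm_mexp_term]) (intro divide_right_mono power_mono d that entry_norm_nonneg, auto)
    then show "\<exists>d>0. \<exists>B. cball w d \<subseteq> S \<and> summable B \<and> (\<forall>v\<in>cball w d. \<forall>n. cmod (mpow (F v) n $ a $ b / fact n) \<le> B n)"
      using d summable_exp_real[of R] by blast
  qed
  then show ?thesis unfolding mhol_def mexp_def by auto
qed

lemma mmeas_mexp:
  assumes "mmeas M F"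
  shows "mmeas M (\<lambda>w. mexp (F w))"
  using mmeas_mpow[OF assms] unfolding mmeas_def mexp_def
  by (auto intro!: borel_measurable_suminf borel_measurable_divide)

lemma norm_det_le:
  fixes Y :: "complex ^ 'd ^ 'd::finite"
  assumes "\<And>a b. cmod (Y $ a $ b) \<le> C"
  shows "cmod (det Y) \<le> fact CARD('d) * C ^ CARD('d)"
proof -
  have "cmod (of_int (sign p) * (\<Prod>i\<in>UNIV. Y $ i $ p i)) \<le> C ^ CARD('d)" for p
  proof -
    have "cmod (of_int (sign p)) = 1" by (simp add: sign_def)
    moreover have "(\<Prod>i\<in>UNIV. cmod (Y $ i $ p i)) \<le> (\<Prod>i\<in>(UNIV::'d set). C)"
      by (intro prod_mono) (use assms in auto)
    ultimately show ?thesis by (simp add: norm_mult prod_norm)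
  qed
  then have "cmod (det Y) \<le> (\<Sum>p | p permutes (UNIV::'d set). C ^ CARD('d))"
    unfolding det_def by (intro sum_norm_le) auto
  then show ?thesis by (simp add: card_permutations)
qed

section \<open>Functional calculus in a unitary eigenbasis\<close>

definition sdiag :: "complex ^ 'd ^ 'd::finite \<Rightarrow> ('d \<Rightarrow> complex) \<Rightarrow> complex ^ 'd ^ 'd" where
  "sdiag U f = (\<chi> a b. \<Sum>j\<in>UNIV. U $ a $ j * f j * cnj (U $ b $ j))"

lemma sdiag_nth: "sdiag U f $ a $ b = (\<Sum>j\<in>UNIV. U $ a $ j * f j * cnj (U $ b $ j))"
  by (simp add: sdiag_def)

lemma unitary_columns:
  assumes "unitary U"
  shows "(\<Sum>k\<in>UNIV. cnj (U $ k $ i) * U $ k $ j) = (if i = j then 1 else 0)"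
proof -
  have "(ctranspose U ** U) $ i $ j = mat 1 $ i $ j" using assms by (simp add: unitary_def)
  then show ?thesis by (simp add: matrix_matrix_mult_def mat_def)
qed

lemma unitary_rows:
  assumes "unitary U"
  shows "(\<Sum>k\<in>UNIV. U $ i $ k * cnj (U $ j $ k)) = (if i = j then 1 else 0)"
proof -
  have "(U ** ctranspose U) $ i $ j = mat 1 $ i $ j" using assms by (simp add: unitary_def)
  then show ?thesis by (simp add: matrix_matrix_mult_def mat_def)
qed

lemma sdiag_mult:
  assumes "unitary U"
  shows "sdiag U f ** sdiag U g = sdiag U (\<lambda>j. f j * g j)"
proof -
  have "(sdiag U f ** sdiag U g) $ a $ b = sdiag U (\<lambda>j. f j * g j) $ a $ b" for a b
  proof -
    have "(sdiag U f ** sdiag U g) $ a $ b =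
        (\<Sum>k\<in>UNIV. \<Sum>i\<in>UNIV. \<Sum>j\<in>UNIV. (U $ a $ i * f i * g j * cnj (U $ b $ j)) * (cnj (U $ k $ i) * U $ k $ j))"
      by (simp add: matrix_matrix_mult_def sdiag_def sum_product mult_ac)
    also have "\<dots> = (\<Sum>i\<in>UNIV. \<Sum>k\<in>UNIV. \<Sum>j\<in>UNIV. (U $ a $ i * f i * g j * cnj (U $ b $ j)) * (cnj (U $ k $ i) * U $ k $ j))"
      by (rule sum.swap)
    also have "\<dots> = (\<Sum>i\<in>UNIV. \<Sum>j\<in>UNIV. \<Sum>k\<in>UNIV. (U $ a $ i * f i * g j * cnj (U $ b $ j)) * (cnj (U $ k $ i) * U $ k $ j))"
      by (rule sum.cong[OF refl], rule sum.swap)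
    also have "\<dots> = (\<Sum>i\<in>UNIV. \<Sum>j\<in>UNIV. (U $ a $ i * f i * g j * cnj (U $ b $ j)) * (if i = j then 1 else 0))"
      by (simp only: sum_distrib_left[symmetric] unitary_columns[OF assms])
    also have "\<dots> = (\<Sum>i\<in>UNIV. U $ a $ i * f i * g i * cnj (U $ b $ i))"
      by (simp add: if_distrib[of "\<lambda>x. _ * x"] sum.delta cong: if_cong)
    finally show ?thesis by (simp add: sdiag_def mult_ac)
  qed
  then show ?thesis by (simp add: vec_eq_iff)
qed

lemma sdiag_1: "unitary U \<Longrightarrow> sdiag U (\<lambda>_. 1) = mat 1"
  by (simp add: sdiag_def vec_eq_iff unitary_rows mat_def)

lemma sdiag_const:
  assumes "unitary U"
  shows "(\<Sum>j\<in>UNIV. U $ a $ j * c * cnj (U $ b $ j)) = (if a = b then c else 0)"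
proof -
  have "(\<Sum>j\<in>UNIV. U $ a $ j * c * cnj (U $ b $ j)) = c * (\<Sum>j\<in>UNIV. U $ a $ j * cnj (U $ b $ j))"
    by (simp add: sum_distrib_left mult_ac)
  then show ?thesis by (simp add: unitary_rows[OF assms])
qed

lemma det_ctranspose_mult:
  assumes "unitary U"
  shows "det U * det (ctranspose U) = 1"
  using assms by (metis det_I det_mul unitary_def)

lemma det_sdiag:
  assumes "unitary U"
  shows "det (sdiag U f) = (\<Prod>j\<in>UNIV. f j)"
proof -
  define Dm where "Dm = (\<chi> i j. if i = j then f i else 0)"
  have "sdiag U f = U ** Dm ** ctranspose U"
    by (simp add: sdiag_def Dm_def matrix_matrix_mult_def vec_eq_iff if_distrib[of "\<lambda>x. _ * x"] sum.delta cong: if_cong)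
  then have "det (sdiag U f) = det Dm * (det U * det (ctranspose U))"
    by (simp add: det_mul)
  moreover have "det Dm = (\<Prod>j\<in>UNIV. f j)"
    by (subst det_diagonal) (auto simp: Dm_def)
  ultimately show ?thesis by (simp add: det_ctranspose_mult[OF assms])
qed

text \<open>In the rotated coordinates \<open>ctranspose U *v z\<close> the form is diagonal; this
  is how the squares of the rotated components enter A.\<close>

lemma cip_sdiag: "cip z (sdiag U f *v z) = (\<Sum>j\<in>UNIV. f j * of_real ((cmod ((ctranspose U *v z) $ j))\<^sup>2))"
proof -
  have "cip z (sdiag U f *v z) = (\<Sum>a\<in>UNIV. \<Sum>b\<in>UNIV. \<Sum>j\<in>UNIV. f j * ((cnj (z $ a) * U $ a $ j) * (cnj (U $ b $ j) * z $ b)))"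
    by (simp add: cip_def matrix_vector_mult_def sdiag_def sum_distrib_left sum_distrib_right mult_ac)
  also have "\<dots> = (\<Sum>a\<in>UNIV. \<Sum>j\<in>UNIV. \<Sum>b\<in>UNIV. f j * ((cnj (z $ a) * U $ a $ j) * (cnj (U $ b $ j) * z $ b)))"
    by (rule sum.cong[OF refl], rule sum.swap)
  also have "\<dots> = (\<Sum>j\<in>UNIV. \<Sum>a\<in>UNIV. \<Sum>b\<in>UNIV. f j * ((cnj (z $ a) * U $ a $ j) * (cnj (U $ b $ j) * z $ b)))"
    by (rule sum.swap)
  also have "\<dots> = (\<Sum>j\<in>UNIV. f j * ((\<Sum>a\<in>UNIV. cnj (z $ a) * U $ a $ j) * (\<Sum>b\<in>UNIV. cnj (U $ b $ j) * z $ b)))"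
    unfolding sum_product by (simp only: sum_distrib_left)
  also have "\<dots> = (\<Sum>j\<in>UNIV. f j * of_real ((cmod ((ctranspose U *v z) $ j))\<^sup>2))"
  proof (intro sum.cong refl)
    fix j
    have "(\<Sum>a\<in>UNIV. cnj (z $ a) * U $ a $ j) = cnj ((ctranspose U *v z) $ j)"
      by (simp add: matrix_vector_mult_def mult.commute)
    moreover have "(\<Sum>b\<in>UNIV. cnj (U $ b $ j) * z $ b) = (ctranspose U *v z) $ j"
      by (simp add: matrix_vector_mult_def)
    moreover have "cnj c * c = of_real ((cmod c)\<^sup>2)" for c
      by (metis complex_norm_square mult.commute)
    ultimately show "f j * ((\<Sum>a\<in>UNIV. cnj (z $ a) * U $ a $ j) * (\<Sum>b\<in>UNIV. cnj (U $ b $ j) * z $ b)) =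
      f j * of_real ((cmod ((ctranspose U *v z) $ j))\<^sup>2)" by simp
  qed
  finally show ?thesis .
qed

text \<open>The partial fraction expansion of x coth (x/2). As a series it also makes sense at x =
  0; the closed form for x \<noteq> 0 is \<open>coth_scalar_eq\<close>.\<close>

definition coth_scalar :: "real \<Rightarrow> real" where
  "coth_scalar x = 2 + 4 * (\<Sum>k. x\<^sup>2 / (x\<^sup>2 + (pole k)\<^sup>2))"

lemma cramer_inv_unique:
  assumes "Y ** Z = mat 1"
  shows "cramer_inv Y = Z"
proof -
  have "det Y * det Z = 1" using assms by (metis det_I det_mul)
  then have "det Y \<noteq> 0" by auto
  then have "cramer_inv Y ** Y = mat 1" by (rule cramer_inv)
  then show ?thesis using assms by (metis matrix_mul_assoc matrix_mul_lid matrix_mul_rid)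
qed

text \<open>All matrices involved share the eigenbasis U, so the inverse is written down on the
  diagonal and identified by uniqueness.\<close>

lemma coth_term_sdiag:
  assumes U: "unitary U"
  shows "coth_term k (sdiag U (\<lambda>j. of_real (x j))) = sdiag U (\<lambda>j. of_real ((x j)\<^sup>2 / ((x j)\<^sup>2 + (pole k)\<^sup>2)))"
proof -
  have p: "pole k \<noteq> 0"
    using pole_ge_2[of k] by simp
  have "shifted_square (pole k) (sdiag U (\<lambda>j. of_real (x j))) = sdiag U (\<lambda>j. of_real ((x j)\<^sup>2 + (pole k)\<^sup>2))"
    unfolding shifted_square_def sdiag_mult[OF U] sdiag_const[OF U, symmetric]
    by (simp add: sdiag_def vec_eq_iff sum.distrib[symmetric] distrib_left distrib_right power2_eq_square)
  moreover have "sdiag U (\<lambda>j. of_real ((x j)\<^sup>2 + (pole k)\<^sup>2)) ** sdiag U (\<lambda>j. of_real (1 / ((x j)\<^sup>2 + (pole k)\<^sup>2))) = mat 1"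
    unfolding sdiag_mult[OF U] of_real_mult[symmetric] using p by (simp add: sdiag_1[OF U])
  ultimately have "cramer_inv (shifted_square (pole k) (sdiag U (\<lambda>j. of_real (x j)))) = sdiag U (\<lambda>j. of_real (1 / ((x j)\<^sup>2 + (pole k)\<^sup>2)))"
    by (simp only: cramer_inv_unique)
  then show ?thesis unfolding coth_term_def
    by (simp add: sdiag_mult[OF U] power2_eq_square)
qed

lemma summable_coth_scalar: "summable (\<lambda>k. x\<^sup>2 / (x\<^sup>2 + (pole k)\<^sup>2))"
proof (rule summable_comparison_test'[OF summable_mult[OF sums_summable[OF sum_inverse_pole], of "x\<^sup>2"]])
  fix k
  show "norm (x\<^sup>2 / (x\<^sup>2 + (pole k)\<^sup>2)) \<le> x\<^sup>2 * (1 / (pole k)\<^sup>2)"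
    using pole_ge_2[of k] by (simp add: divide_left_mono add_nonneg_pos)
qed

lemma xcoth_sdiag:
  assumes U: "unitary U"
  shows "xcoth (sdiag U (\<lambda>j. of_real (x j))) = sdiag U (\<lambda>j. of_real (coth_scalar (x j)))"
proof -
  have "xcoth (sdiag U (\<lambda>j. of_real (x j))) $ a $ b = sdiag U (\<lambda>j. of_real (coth_scalar (x j))) $ a $ b" for a b
  proof -
    have "(\<lambda>k. coth_term k (sdiag U (\<lambda>j. of_real (x j))) $ a $ b) sums
      (\<Sum>j\<in>UNIV. U $ a $ j * of_real (\<Sum>k. (x j)\<^sup>2 / ((x j)\<^sup>2 + (pole k)\<^sup>2)) * cnj (U $ b $ j))"
      unfolding coth_term_sdiag[OF U] sdiag_nth
      by (intro sums_sum sums_mult sums_mult2 sums_of_real summable_sums summable_coth_scalar)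
    then have "xcoth (sdiag U (\<lambda>j. of_real (x j))) $ a $ b =
      (if a = b then 2 else 0) + 4 * (\<Sum>j\<in>UNIV. U $ a $ j * of_real (\<Sum>k. (x j)\<^sup>2 / ((x j)\<^sup>2 + (pole k)\<^sup>2)) * cnj (U $ b $ j))"
      by (simp add: xcoth_def sums_iff)
    also have "\<dots> = (\<Sum>j\<in>UNIV. U $ a $ j * of_real (coth_scalar (x j)) * cnj (U $ b $ j))"
      unfolding sdiag_const[OF U, of a 2 b, symmetric] sum_distrib_left sum.distrib[symmetric] coth_scalar_def
      by (intro sum.cong refl) (simp add: algebra_simps)
    finally show ?thesis by (simp add: sdiag_def)
  qed
  then show ?thesis by (simp add: vec_eq_iff)
qed

lemma mpow_sdiag:
  assumes U: "unitary U"
  shows "mpow (sdiag U f) n = sdiag U (\<lambda>j. f j ^ n)"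
  by (induction n) (simp_all add: sdiag_mult[OF U] sdiag_1[OF U])

lemma mexp_sdiag:
  assumes U: "unitary U"
  shows "mexp (sdiag U f) = sdiag U (\<lambda>j. exp (f j))"
proof -
  have "mexp (sdiag U f) $ a $ b = sdiag U (\<lambda>j. exp (f j)) $ a $ b" for a b
  proof -
    have e: "(\<lambda>n. c ^ n / fact n) sums exp (c::complex)" for c
      using exp_converges[of c] by (simp add: scaleR_conv_of_real field_simps)
    have "(\<lambda>n. \<Sum>j\<in>UNIV. U $ a $ j * (f j ^ n / fact n) * cnj (U $ b $ j)) sums (\<Sum>j\<in>UNIV. U $ a $ j * exp (f j) * cnj (U $ b $ j))"
      by (intro sums_sum sums_mult sums_mult2 e)
    then show ?thesis
      by (simp add: mexp_def mpow_sdiag[OF U] sdiag_nth sum_divide_distrib sums_iff)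
  qed
  then show ?thesis by (simp add: vec_eq_iff)
qed

subsection \<open>Partial fractions of the hyperbolic cotangent\<close>

text \<open>Differentiate Gamma(z) Gamma(1 - z) = pi / sin (pi z) in two ways and divide by the
  common value.\<close>

lemma Digamma_reflection:
  fixes z :: complex
  assumes "z \<notin> \<int>"
  shows "Digamma z - Digamma (1 - z) = - (of_real pi * cos (of_real pi * z) / sin (of_real pi * z))"
proof -
  have nz: "v \<notin> \<int>\<^sub>\<le>\<^sub>0 \<and> 1 - v \<notin> \<int>\<^sub>\<le>\<^sub>0 \<and> sin (of_real pi * v) \<noteq> 0" if "v \<notin> \<int>" for v :: complex
  proof -
    have "1 - v \<notin> \<int>" using that by (metis Ints_1 Ints_diff diff_diff_eq2 add_diff_cancel_left')
    moreover have "sin (of_real pi * v) \<noteq> 0"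
    proof
      assume "sin (of_real pi * v) = 0"
      then obtain n :: int where "of_real pi * v = of_real (of_int n * pi)"
        by (auto simp: sin_eq_0)
      then have "of_real pi * v = of_real pi * of_int n" by simp
      then have "v = of_int n" using pi_neq_zero by (simp only: mult_cancel_left of_real_eq_0_iff) auto
      then show False using that by simp
    qed
    ultimately show ?thesis using that nonpos_Ints_Int by metis
  qed
  let ?s = "sin (of_real pi * z)" and ?c = "cos (of_real pi * z)"
  have o: "open (- \<int> :: complex set)" using closed_Ints[where 'a=complex] by (simp add: open_Compl)
  have "((\<lambda>v. Gamma v * Gamma (1 - v)) has_field_derivative
      (Gamma z * Digamma z) * Gamma (1 - z) + Gamma z * (- (Gamma (1 - z) * Digamma (1 - z)))) (at z)"
    using nz[OF assms] by (auto intro!: derivative_eq_intros)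
  moreover have "((\<lambda>v. Gamma v * Gamma (1 - v)) has_field_derivative
      - (of_real pi * (of_real pi * ?c)) / ?s\<^sup>2) (at z)"
  proof -
    have "((\<lambda>v. of_real pi / sin (of_real pi * v)) has_field_derivative - (of_real pi * (of_real pi * ?c)) / ?s\<^sup>2) (at z)"
      using nz[OF assms] by (auto intro!: derivative_eq_intros simp: power2_eq_square)
    then show ?thesis unfolding Gamma_reflection_complex .
  qed
  ultimately have "(Gamma z * Digamma z) * Gamma (1 - z) + Gamma z * (- (Gamma (1 - z) * Digamma (1 - z))) = - (of_real pi * (of_real pi * ?c)) / ?s\<^sup>2"
    by (rule DERIV_unique)
  then have "(Gamma z * Gamma (1 - z)) * (Digamma z - Digamma (1 - z)) = - (of_real pi * (of_real pi * ?c)) / ?s\<^sup>2"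
    by (simp add: algebra_simps)
  then have "of_real pi / ?s * (Digamma z - Digamma (1 - z)) = of_real pi / ?s * (- (of_real pi * ?c / ?s))"
    unfolding Gamma_reflection_complex by (simp add: power2_eq_square)
  then show ?thesis
    using nz[OF assms] by (subst (asm) mult_cancel_left) auto
qed

text \<open>Subtracting the Digamma series at 1 + z and 1 - z cancels the Euler-Mascheroni constant;
  shifting 1 + z back to z contributes 1/z, which is the summand 1 after multiplication by
  z.\<close>

lemma cot_partial_fractions:
  fixes z :: complex
  assumes "z \<notin> \<int>"
  shows "(\<lambda>k. 2 * z\<^sup>2 / ((of_nat (Suc k))\<^sup>2 - z\<^sup>2)) sums (1 - of_real pi * z * cos (of_real pi * z) / sin (of_real pi * z))"
proof -
  have nz: "1 + z \<noteq> 0" "1 - z \<noteq> 0" "z \<noteq> 0"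
    using assms by (metis Ints_0 Ints_1 Ints_minus add_eq_0_iff, metis Ints_1 eq_iff_diff_eq_0, metis Ints_0)
  let ?a = "\<lambda>v k. inverse (of_nat (Suc k)) - inverse (v + of_nat k) :: complex"
  have s: "(\<lambda>k. ?a v k) sums (Digamma v + euler_mascheroni)" if "v \<noteq> 0" for v
    using summable_sums[OF summable_Digamma[OF that]] by (simp add: Digamma_def)
  have "(\<lambda>k. ?a (1 + z) k - ?a (1 - z) k) sums (Digamma (1 + z) - Digamma (1 - z))"
    using sums_diff[OF s[OF nz(1)] s[OF nz(2)]] by simp
  then have "(\<lambda>k. z * (?a (1 + z) k - ?a (1 - z) k)) sums (z * (Digamma z - Digamma (1 - z) + 1 / z))"
    using Digamma_plus1[OF nz(3)] by (intro sums_mult) (simp add: add.commute algebra_simps)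
  moreover have "z * (Digamma z - Digamma (1 - z) + 1 / z) = 1 - of_real pi * z * cos (of_real pi * z) / sin (of_real pi * z)"
    unfolding Digamma_reflection[OF assms] using nz(3) by (simp add: algebra_simps)
  moreover have "z * (?a (1 + z) k - ?a (1 - z) k) = 2 * z\<^sup>2 / ((of_nat (Suc k))\<^sup>2 - z\<^sup>2)" for k
  proof -
    have i: "of_nat (Suc k) + z \<noteq> 0" "of_nat (Suc k) - z \<noteq> 0"
      using assms by (metis Ints_minus Ints_of_nat add_eq_0_iff, metis Ints_of_nat eq_iff_diff_eq_0)
    have "z * (?a (1 + z) k - ?a (1 - z) k) = z * (inverse (of_nat (Suc k) - z) - inverse (of_nat (Suc k) + z))"
      by (simp add: algebra_simps)
    also have "\<dots> = z * (2 * z / ((of_nat (Suc k) - z) * (of_nat (Suc k) + z)))"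
      using i by (simp add: divide_simps) (simp add: algebra_simps)?
    also have "\<dots> = 2 * z\<^sup>2 / ((of_nat (Suc k))\<^sup>2 - z\<^sup>2)"
      by (simp add: power2_eq_square algebra_simps)
    finally show ?thesis .
  qed
  ultimately show ?thesis by simp
qed

lemma sums_cong_eq:
  assumes "f sums a" "a = b" "\<And>k. f k = g k"
  shows "g sums b"
  using assms by (metis ext)

lemma coth_scalar_eq:
  assumes "x \<noteq> 0"
  shows "coth_scalar x = x * (exp x + 1) / (exp x - 1)"
proof -
  \<comment> \<open>On the imaginary axis the cotangent becomes hyperbolic: here pi z = i x /
    2.\<close>
  define z where "z = \<i> * of_real (x / (2 * pi))"
  have zI: "z \<notin> \<int>"
  proof
    assume "z \<in> \<int>"
    then have "Im z = 0" by (auto elim!: Ints_cases)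
    then show False using assms by (simp add: z_def)
  qed
  have z2: "z\<^sup>2 = of_real (- (x\<^sup>2 / (4 * pi\<^sup>2)))"
    by (simp add: z_def power_mult_distrib power_divide)
  have piz: "of_real pi * z = \<i> * of_real (x / 2)" by (simp add: z_def)
  have t: "2 * z\<^sup>2 / ((of_nat (Suc k))\<^sup>2 - z\<^sup>2) = of_real (- 2 * (x\<^sup>2 / (x\<^sup>2 + (pole k)\<^sup>2)))" for k
  proof -
    have "2 * z\<^sup>2 / ((of_nat (Suc k))\<^sup>2 - z\<^sup>2) = of_real (2 * (- (x\<^sup>2 / (4 * pi\<^sup>2))) / ((real (Suc k))\<^sup>2 - (- (x\<^sup>2 / (4 * pi\<^sup>2)))))"
      unfolding z2 by simp
    also have "2 * (- (x\<^sup>2 / (4 * pi\<^sup>2))) / ((real (Suc k))\<^sup>2 - (- (x\<^sup>2 / (4 * pi\<^sup>2)))) = - 2 * (x\<^sup>2 / (x\<^sup>2 + (pole k)\<^sup>2))"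
    proof -
      have p: "4 * pi\<^sup>2 > 0" by simp
      have "(real (Suc k))\<^sup>2 - (- (x\<^sup>2 / (4 * pi\<^sup>2))) = (x\<^sup>2 + (pole k)\<^sup>2) / (4 * pi\<^sup>2)"
        by (simp add: pole_def power_mult_distrib add_divide_distrib)
      then show ?thesis by simp
    qed
    finally show ?thesis .
  qed
  have e1: "exp (x / 2) * exp (x / 2) = exp x" by (simp add: exp_add[symmetric])
  have ne: "exp x - 1 \<noteq> 0" using assms by simp
  have "of_real pi * z * cos (of_real pi * z) / sin (of_real pi * z) = of_real (x / 2 * (exp x + 1) / (exp x - 1))"
  proof -
    have ii: "\<i> * (\<i> * of_real (x / 2)) = of_real (- (x / 2))" "- (\<i> * (\<i> * of_real (x / 2))) = of_real (x / 2)"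
      by (simp_all add: mult.assoc[symmetric])
    have c: "cos (\<i> * of_real (x / 2)) = of_real ((exp (x / 2) + exp (- (x / 2))) / 2)"
      unfolding cos_exp_eq ii exp_of_real by (simp add: exp_of_real[symmetric])
    have s: "sin (\<i> * of_real (x / 2)) = \<i> * of_real ((exp (x / 2) - exp (- (x / 2))) / 2)"
      unfolding sin_exp_eq ii exp_of_real by (simp add: exp_of_real[symmetric] field_simps)
    have "exp (x / 2) - exp (- (x / 2)) = exp (- (x / 2)) * (exp x - 1)" "exp (x / 2) + exp (- (x / 2)) = exp (- (x / 2)) * (exp x + 1)"
      by (simp_all add: algebra_simps exp_add[symmetric])
    then have "of_real (x / 2) * of_real ((exp (x / 2) + exp (- (x / 2))) / 2) / of_real ((exp (x / 2) - exp (- (x / 2))) / 2) = (of_real (x / 2 * (exp x + 1) / (exp x - 1)) :: complex)"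
      using ne unfolding of_real_mult[symmetric] of_real_divide[symmetric] by simp
    then show ?thesis unfolding piz c s by simp
  qed
  then have "(\<lambda>k. of_real (- 2 * (x\<^sup>2 / (x\<^sup>2 + (pole k)\<^sup>2))) :: complex) sums of_real (1 - x / 2 * (exp x + 1) / (exp x - 1))"
    using cot_partial_fractions[OF zI] unfolding t by simp
  then have "(\<lambda>k. - 2 * (x\<^sup>2 / (x\<^sup>2 + (pole k)\<^sup>2))) sums (1 - x / 2 * (exp x + 1) / (exp x - 1))"
    by (simp only: sums_of_real_iff)
  then have "(\<lambda>k. - 2 * (- 2 * (x\<^sup>2 / (x\<^sup>2 + (pole k)\<^sup>2)))) sums (- 2 * (1 - x / 2 * (exp x + 1) / (exp x - 1)))"
    by (rule sums_mult)
  then have "(\<lambda>k. 4 * (x\<^sup>2 / (x\<^sup>2 + (pole k)\<^sup>2))) sums (x * (exp x + 1) / (exp x - 1) - 2)"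
  proof (rule sums_cong_eq)
    show "- 2 * (1 - x / 2 * (exp x + 1) / (exp x - 1)) = x * (exp x + 1) / (exp x - 1) - 2"
      using ne by (simp add: field_simps)
  qed simp
  then have "4 * (\<Sum>k. x\<^sup>2 / (x\<^sup>2 + (pole k)\<^sup>2)) = x * (exp x + 1) / (exp x - 1) - 2"
    by (rule sums_unique2[OF sums_mult[OF summable_sums[OF summable_coth_scalar]]])
  then show ?thesis by (simp add: coth_scalar_def)
qed

subsection \<open>Wedge products and minors\<close>

definition one_form :: "('d \<Rightarrow> complex) \<Rightarrow> 'd::finite set \<Rightarrow> complex" where
  "one_form w J = (\<Sum>k\<in>UNIV. w k * (if J = {k} then 1 else 0))"

text \<open>The one-form is given by its coefficient vector, so that linearity in that vector can be
  expressed.\<close>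

definition wedge1 :: "('d::{finite,linorder} \<Rightarrow> complex) \<Rightarrow> ('d set \<Rightarrow> complex) \<Rightarrow> 'd set \<Rightarrow> complex" where
  "wedge1 w \<eta> = wedge (one_form w) \<eta>"

definition inv_sign :: "'d::linorder set \<Rightarrow> 'd \<Rightarrow> complex" where
  "inv_sign J a = (- 1) ^ card {b \<in> J. b < a}"

lemma one_form_singleton: "one_form w {a} = w a"
proof -
  have "one_form w {a} = (\<Sum>k\<in>UNIV. if k = a then w k else 0)"
    unfolding one_form_def by (intro sum.cong) auto
  then show ?thesis by simp
qed

lemma one_form_eq_0: "(\<And>a. A \<noteq> {a}) \<Longrightarrow> one_form w A = 0"
  unfolding one_form_def by (intro sum.neutral) auto

text \<open>One-forms live on singletons, so the sum over subsets of J collapses to the elements of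
  J, and the inversions counted by \<open>wedge\<close> are the elements of J below a.\<close>

lemma wedge1_eq: "wedge1 w \<eta> J = (\<Sum>a\<in>J. inv_sign J a * w a * \<eta> (J - {a}))"
proof -
  let ?f = "\<lambda>A. (- 1) ^ card {(i, j). i \<in> A \<and> j \<in> J - A \<and> j < i} * one_form w A * \<eta> (J - A)"
  have "wedge1 w \<eta> J = (\<Sum>A\<in>Pow J. ?f A)" by (simp add: wedge1_def wedge_def)
  also have "\<dots> = (\<Sum>A\<in>(\<lambda>a. {a}) ` J. ?f A)"
    by (rule sum.mono_neutral_right) (auto intro!: one_form_eq_0)
  also have "\<dots> = (\<Sum>a\<in>J. ?f {a})"
    by (subst sum.reindex) (auto simp: inj_on_def)
  also have "\<dots> = (\<Sum>a\<in>J. inv_sign J a * w a * \<eta> (J - {a}))"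
  proof (intro sum.cong refl)
    fix a
    have "{(i, j). i \<in> {a} \<and> j \<in> J - {a} \<and> j < i} = Pair a ` {b \<in> J. b < a}" by auto
    then have "card {(i, j). i \<in> {a} \<and> j \<in> J - {a} \<and> j < i} = card {b \<in> J. b < a}"
      by (simp add: card_image inj_on_def)
    then show "?f {a} = inv_sign J a * w a * \<eta> (J - {a})" by (simp add: inv_sign_def one_form_singleton)
  qed
  finally show ?thesis .
qed

text \<open>Removing a shifts the position of b by one exactly when a < b. This asymmetry between a
  and b is the source of anticommutativity.\<close>

lemma inv_sign_remove:
  fixes a b :: "'d::{finite,linorder}"
  assumes "a \<in> J" "a \<noteq> b"
  shows "inv_sign (J - {a}) b = (if a < b then - inv_sign J b else inv_sign J b)"
proof (cases "a < b")
  case True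
  then have "{x \<in> J. x < b} = insert a {x \<in> J - {a}. x < b}" using assms by auto
  then have "card {x \<in> J. x < b} = Suc (card {x \<in> J - {a}. x < b})" by simp
  then show ?thesis using True by (simp add: inv_sign_def)
next
  case False
  then have "{x \<in> J. x < b} = {x \<in> J - {a}. x < b}" using assms by auto
  then show ?thesis using False by (simp add: inv_sign_def)
qed

lemma wedge1_scale: "wedge1 w (\<lambda>J. c * \<eta> J) = (\<lambda>J. c * wedge1 w \<eta> J)"
  by (rule ext) (simp add: wedge1_eq sum_distrib_left mult_ac)

lemma wedge1_sum: "wedge1 w (\<lambda>J. \<Sum>i\<in>A. c i * \<eta> i J) = (\<lambda>J. \<Sum>i\<in>A. c i * wedge1 w (\<eta> i) J)"
proof (rule ext)
  fix J
  have "wedge1 w (\<lambda>J. \<Sum>i\<in>A. c i * \<eta> i J) J = (\<Sum>a\<in>J. \<Sum>i\<in>A. c i * (inv_sign J a * w a * \<eta> i (J - {a})))"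
    by (simp add: wedge1_eq sum_distrib_left mult_ac)
  also have "\<dots> = (\<Sum>i\<in>A. \<Sum>a\<in>J. c i * (inv_sign J a * w a * \<eta> i (J - {a})))" by (rule sum.swap)
  finally show "wedge1 w (\<lambda>J. \<Sum>i\<in>A. c i * \<eta> i J) J = (\<Sum>i\<in>A. c i * wedge1 w (\<eta> i) J)"
    by (simp add: wedge1_eq sum_distrib_left)
qed

lemma wedge1_sum_left: "wedge1 (\<lambda>k. \<Sum>j\<in>A. g j * u j k) \<eta> J = (\<Sum>j\<in>A. g j * wedge1 (u j) \<eta> J)"
proof -
  have "wedge1 (\<lambda>k. \<Sum>j\<in>A. g j * u j k) \<eta> J = (\<Sum>a\<in>J. \<Sum>j\<in>A. g j * (inv_sign J a * u j a * \<eta> (J - {a})))"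
    by (simp add: wedge1_eq sum_distrib_left sum_distrib_right mult_ac)
  also have "\<dots> = (\<Sum>j\<in>A. \<Sum>a\<in>J. g j * (inv_sign J a * u j a * \<eta> (J - {a})))" by (rule sum.swap)
  finally show ?thesis by (simp add: wedge1_eq sum_distrib_left)
qed

text \<open>Expand over ordered pairs of distinct elements removed from J. Exchanging the order of
  removal flips exactly one of the two signs involved.\<close>

lemma wedge1_anticommute: "wedge1 u (wedge1 v \<eta>) = (\<lambda>J. - 1 * wedge1 v (wedge1 u \<eta>) J)"
proof (rule ext)
  fix J :: "'a set"
  have e: "wedge1 u (wedge1 v \<eta>) J = (\<Sum>a\<in>J. \<Sum>b\<in>J. if a = b then 0 else
     inv_sign J a * inv_sign (J - {a}) b * (u a * v b) * \<eta> (J - {a, b}))" for u v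
  proof -
    have "wedge1 u (wedge1 v \<eta>) J = (\<Sum>a\<in>J. \<Sum>b\<in>J - {a}. inv_sign J a * inv_sign (J - {a}) b * (u a * v b) * \<eta> (J - {a, b}))"
    proof -
      have "J - {a} - {b} = J - {a, b}" for a b by auto
      then show ?thesis by (simp add: wedge1_eq sum_distrib_left mult_ac)
    qed
    also have "\<dots> = (\<Sum>a\<in>J. \<Sum>b\<in>J. if a = b then 0 else
     inv_sign J a * inv_sign (J - {a}) b * (u a * v b) * \<eta> (J - {a, b}))"
      by (intro sum.cong refl sum.mono_neutral_cong_left) auto
    finally show ?thesis .
  qed
  have "wedge1 v (wedge1 u \<eta>) J = (\<Sum>b\<in>J. \<Sum>a\<in>J. if a = b then 0 else
     inv_sign J a * inv_sign (J - {a}) b * (v a * u b) * \<eta> (J - {a, b}))"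
    unfolding e by (rule sum.swap)
  also have "\<dots> = (\<Sum>b\<in>J. \<Sum>a\<in>J. - 1 * (if b = a then 0 else
     inv_sign J b * inv_sign (J - {b}) a * (u b * v a) * \<eta> (J - {b, a})))"
  proof (intro sum.cong refl)
    fix a b assume ab: "b \<in> J" "a \<in> J"
    show "(if a = b then 0 else inv_sign J a * inv_sign (J - {a}) b * (v a * u b) * \<eta> (J - {a, b})) =
      - 1 * (if b = a then 0 else inv_sign J b * inv_sign (J - {b}) a * (u b * v a) * \<eta> (J - {b, a}))"
    proof (cases "a = b")
      case False
      then show ?thesis using inv_sign_remove[OF ab(2), of b] inv_sign_remove[OF ab(1), of a]
        by (auto simp: insert_commute)
    qed simp
  qed
  also have "\<dots> = - 1 * wedge1 u (wedge1 v \<eta>) J"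
    unfolding e sum_distrib_left ..
  finally show "wedge1 u (wedge1 v \<eta>) J = - 1 * wedge1 v (wedge1 u \<eta>) J" by simp
qed

lemma foldr_wedge1_scale: "foldr wedge1 ws (\<lambda>J. c * \<eta> J) = (\<lambda>J. c * foldr wedge1 ws \<eta> J)"
  by (induction ws) (simp_all add: wedge1_scale)

lemma foldr_wedge1_move: "foldr wedge1 ys (wedge1 y \<eta>) = (\<lambda>J. (- 1) ^ length ys * wedge1 y (foldr wedge1 ys \<eta>) J)"
proof (induction ys)
  case (Cons w ys)
  have "foldr wedge1 (w # ys) (wedge1 y \<eta>) = (\<lambda>J. (- 1) ^ length ys * wedge1 w (wedge1 y (foldr wedge1 ys \<eta>)) J)"
    by (simp add: Cons wedge1_scale)
  then show ?case by (subst (asm) wedge1_anticommute[of w]) simp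
qed simp

text \<open>Moving the second factor across \<open>ys\<close> costs the same sign in both orders,
  after which the two factors are adjacent and anticommute.\<close>

lemma foldr_wedge1_swap:
  "foldr wedge1 (xs @ x # ys @ y # zs) \<eta> J = - foldr wedge1 (xs @ y # ys @ x # zs) \<eta> J"
proof -
  let ?r = "foldr wedge1 ys (foldr wedge1 zs \<eta>)"
  have e: "foldr wedge1 (x # ys @ y # zs) \<eta> = (\<lambda>J. (- 1) ^ length ys * wedge1 x (wedge1 y ?r) J)" for x y
    by (simp add: foldr_wedge1_move wedge1_scale)
  have "foldr wedge1 (x # ys @ y # zs) \<eta> = (\<lambda>J. - 1 * foldr wedge1 (y # ys @ x # zs) \<eta> J)"
    unfolding e by (subst wedge1_anticommute[of x]) simp
  then have "foldr wedge1 xs (foldr wedge1 (x # ys @ y # zs) \<eta>) J = - 1 * foldr wedge1 xs (foldr wedge1 (y # ys @ x # zs) \<eta>) J"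
    by (simp only: foldr_wedge1_scale)
  then show ?thesis unfolding foldr_append[of _ xs] by simp
qed

text \<open>Exchanging two equal factors leaves the product unchanged and reverses its sign.\<close>

lemma foldr_wedge1_not_distinct:
  assumes "\<not> distinct l"
  shows "foldr wedge1 (map u l) \<eta> J = 0"
proof -
  obtain xs x ys zs where l: "l = xs @ [x] @ ys @ [x] @ zs"
    using not_distinct_decomp[OF assms] by blast
  show ?thesis using foldr_wedge1_swap[of "map u xs" "u x" "map u ys" "u x" "map u zs" \<eta> J]
    by (simp add: l)
qed

lemma permute_list_transpose:
  assumes "i < j" "j < length l"
  shows "permute_list (Transposition.transpose i j) l = take i l @ l ! j # drop (Suc i) (take j l) @ l ! i # drop (Suc j) l"
proof (rule nth_equalityI)
  show "length (permute_list (Transposition.transpose i j) l) = length (take i l @ l ! j # drop (Suc i) (take j l) @ l ! i # drop (Suc j) l)"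
    using assms by simp
  fix k assume "k < length (permute_list (Transposition.transpose i j) l)"
  then have k: "k < length l" by simp
  consider "k < i" | "k = i" | "i < k" "k < j" | "k = j" | "j < k" by linarith
  then show "permute_list (Transposition.transpose i j) l ! k = (take i l @ l ! j # drop (Suc i) (take j l) @ l ! i # drop (Suc j) l) ! k"
    using assms k by cases (auto simp: permute_list_def nth_append nth_Cons' Transposition.transpose_def Suc_diff_Suc)
qed

lemma foldr_wedge1_transpose:
  assumes "i \<noteq> j" "i < length l" "j < length l"
  shows "foldr wedge1 (map u (permute_list (Transposition.transpose i j) l)) \<eta> J = - foldr wedge1 (map u l) \<eta> J"
proof -
  have *: "foldr wedge1 (map u (permute_list (Transposition.transpose i j) l)) \<eta> J = - foldr wedge1 (map u l) \<eta> J"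
    if "i < j" "j < length l" for i j
  proof -
    have l: "l = take i l @ l ! i # drop (Suc i) (take j l) @ l ! j # drop (Suc j) l"
    proof -
      have "take j l = take i l @ l ! i # drop (Suc i) (take j l)"
        using id_take_nth_drop[of i "take j l"] that by (simp add: min_def)
      then show ?thesis using id_take_nth_drop[of j l] that by (metis append_Cons append_assoc)
    qed
    have ml: "map u l = map u (take i l) @ u (l ! i) # map u (drop (Suc i) (take j l)) @ u (l ! j) # map u (drop (Suc j) l)"
      using arg_cong[OF l, of "map u"] by (simp only: map_append list.map)
    show ?thesis unfolding permute_list_transpose[OF that] ml map_append list.map
      by (rule foldr_wedge1_swap)
  qed
  show ?thesis
    using *[of i j] *[of j i] assms by (cases "i < j") (auto simp: Transposition.transpose_commute)
qed

lemma foldr_wedge1_permute: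
  assumes "p permutes {..<n}" "length l = n"
  shows "foldr wedge1 (map u (permute_list p l)) \<eta> J = of_int (sign p) * foldr wedge1 (map u l) \<eta> J"
proof -
  have "\<forall>l. length l = n \<longrightarrow> foldr wedge1 (map u (permute_list p l)) \<eta> J = of_int (sign p) * foldr wedge1 (map u l) \<eta> J"
    using assms(1) finite_lessThan
  proof (induction p rule: permutes_induct)
    case id
    then show ?case by simp
  next
    case (swap a b p)
    show ?case
    proof (intro allI impI)
      fix l :: "'a list" assume l: "length l = n"
      have tr: "Transposition.transpose a b permutes {..<length l}" using swap l by (intro permutes_swap_id) auto
      have "permute_list (Transposition.transpose a b \<circ> p) l = permute_list p (permute_list (Transposition.transpose a b) l)"
        using permute_list_compose[of p l "Transposition.transpose a b"] swap l by simp
      moreover have "sign (Transposition.transpose a b \<circ> p) = - sign p"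
      proof -
        have "permutation (Transposition.transpose a b)" "permutation p"
          using tr swap permutation_permutes finite_lessThan by blast+
        then show ?thesis using swap by (simp add: sign_compose sign_swap_id)
      qed
      ultimately show "foldr wedge1 (map u (permute_list (Transposition.transpose a b \<circ> p) l)) \<eta> J =
          of_int (sign (Transposition.transpose a b \<circ> p)) * foldr wedge1 (map u l) \<eta> J"
        using swap l foldr_wedge1_transpose[of a b l u \<eta> J] by simp
    qed
  qed
  then show ?thesis using assms(2) by blast
qed

lemma finite_lists_length_UNIV: "finite {l :: 'a::finite list. length l = n}"
  using finite_lists_length_eq[of "UNIV :: 'a set" n] by simp

text \<open>Multilinear expansion. The lists l may repeat indices; those terms disappear only
  through \<open>foldr_wedge1_not_distinct\<close>.\<close>

lemma foldr_wedge1_expand: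
  fixes u :: "'a::finite \<Rightarrow> 'd::{finite,linorder} \<Rightarrow> complex"
  shows "foldr wedge1 (map (\<lambda>c k. \<Sum>j\<in>UNIV. g c j * u j k) cs) \<eta> =
    (\<lambda>J. \<Sum>l | length l = length cs. (\<Prod>i<length cs. g (cs ! i) (l ! i)) * foldr wedge1 (map u l) \<eta> J)"
proof (induction cs)
  case Nil
  have "{l :: 'a list. length l = 0} = {[]}" by auto
  then show ?case by simp
next
  case (Cons c cs)
  let ?n = "length cs"
  have img: "{l. length l = Suc ?n} = (\<lambda>(j, l). j # l) ` (UNIV \<times> {l :: 'a list. length l = ?n})"
    by (auto simp: length_Suc_conv image_def)
  show ?case
  proof (rule ext)
    fix J
    have "foldr wedge1 (map (\<lambda>c k. \<Sum>j\<in>UNIV. g c j * u j k) (c # cs)) \<eta> J =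
      (\<Sum>j\<in>UNIV. g c j * (\<Sum>l | length l = ?n. (\<Prod>i<?n. g (cs ! i) (l ! i)) * wedge1 (u j) (foldr wedge1 (map u l) \<eta>) J))"
    proof -
      have "foldr wedge1 (map (\<lambda>c k. \<Sum>j\<in>UNIV. g c j * u j k) (c # cs)) \<eta> J =
        (\<Sum>j\<in>UNIV. g c j * wedge1 (u j) (foldr wedge1 (map (\<lambda>c k. \<Sum>j\<in>UNIV. g c j * u j k) cs) \<eta>) J)"
        by (simp only: list.map foldr_Cons o_apply wedge1_sum_left)
      then show ?thesis by (simp only: Cons wedge1_sum)
    qed
    also have "\<dots> = (\<Sum>(j, l)\<in>UNIV \<times> {l. length l = ?n}. (\<Prod>i<Suc ?n. g ((c # cs) ! i) ((j # l) ! i)) * foldr wedge1 (map u (j # l)) \<eta> J)"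
      unfolding sum.cartesian_product[symmetric] sum_distrib_left
      by (intro sum.cong refl) (simp only: prod.lessThan_Suc_shift, simp add: mult.assoc)
    also have "\<dots> = (\<Sum>l | length l = Suc ?n. (\<Prod>i<Suc ?n. g ((c # cs) ! i) (l ! i)) * foldr wedge1 (map u l) \<eta> J)"
      unfolding img by (subst sum.reindex) (auto simp: inj_on_def case_prod_beta)
    finally show "foldr wedge1 (map (\<lambda>c k. \<Sum>j\<in>UNIV. g c j * u j k) (c # cs)) \<eta> J =
      (\<Sum>l | length l = length (c # cs). (\<Prod>i<length (c # cs). g ((c # cs) ! i) (l ! i)) * foldr wedge1 (map u l) \<eta> J)"
      by simp
  qed
qed

text \<open>A list without repetitions is a permutation, in exactly one way, of the sorted list of
  its underlying set.\<close>

lemma sum_distinct_lists: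
  fixes H :: "'d::{finite,linorder} list \<Rightarrow> complex"
  assumes "\<And>l. \<not> distinct l \<Longrightarrow> H l = 0"
  shows "(\<Sum>l | length l = n. H l) = (\<Sum>L\<in>tuples n. \<Sum>p | p permutes {..<n}. H (permute_list p (sorted_list_of_set L)))"
proof -
  have "(\<Sum>l | length l = n. H l) = (\<Sum>l\<in>{l. length l = n \<and> distinct l}. H l)"
    by (rule sum.mono_neutral_right) (use assms finite_lists_length_UNIV in auto)
  also have "\<dots> = (\<Sum>L\<in>tuples n. \<Sum>l | l \<in> {l. length l = n \<and> distinct l} \<and> set l = L. H l)"
    by (rule sum.group[symmetric])
       (auto simp: tuples_def distinct_card intro: finite_subset[OF _ finite_lists_length_UNIV[of n]])
  also have "\<dots> = (\<Sum>L\<in>tuples n. \<Sum>p | p permutes {..<n}. H (permute_list p (sorted_list_of_set L)))"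
  proof (rule sum.cong[OF refl])
    fix L :: "'d set" assume L: "L \<in> tuples n"
    let ?s = "sorted_list_of_set L"
    have len: "length ?s = n" using L by (simp add: tuples_def)
    have "bij_betw (\<lambda>p. permute_list p ?s) {p. p permutes {..<n}} {l. l \<in> {l. length l = n \<and> distinct l} \<and> set l = L}"
    proof (rule bij_betwI')
      fix p q assume p: "p \<in> {p. p permutes {..<n}}" and q: "q \<in> {p. p permutes {..<n}}"
      show "(permute_list p ?s = permute_list q ?s) = (p = q)"
      proof
        assume e: "permute_list p ?s = permute_list q ?s"
        show "p = q"
        proof
          fix i
          show "p i = q i"
          proof (cases "i < n")
            case True
            have "permute_list p ?s ! i = ?s ! p i" "permute_list q ?s ! i = ?s ! q i"
              using True p q len by (simp_all add: permute_list_nth)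
            then have "?s ! p i = ?s ! q i" using e by simp
            moreover have "p i < n" "q i < n"
              using permutes_in_image[of p "{..<n}" i] permutes_in_image[of q "{..<n}" i] p q True by simp_all
            ultimately show ?thesis using len by (simp add: nth_eq_iff_index_eq)
          next
            case False
            then show ?thesis using p q by (simp add: permutes_not_in)
          qed
        qed
      qed simp
    next
      fix p assume "p \<in> {p. p permutes {..<n}}"
      then have "p permutes {..<length ?s}" using len by simp
      then show "permute_list p ?s \<in> {l. l \<in> {l. length l = n \<and> distinct l} \<and> set l = L}"
        using len by simp
    next
      fix l assume l: "l \<in> {l. l \<in> {l. length l = n \<and> distinct l} \<and> set l = L}"
      then have "mset l = mset ?s" by (intro set_eq_iff_mset_eq_distinct[THEN iffD1]) auto
      then obtain p where "p permutes {..<length ?s}" "permute_list p ?s = l"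
        using mset_eq_permutation by metis
      then show "\<exists>p\<in>{p. p permutes {..<n}}. l = permute_list p ?s" using len by auto
    qed
    then show "(\<Sum>l | l \<in> {l. length l = n \<and> distinct l} \<and> set l = L. H l) =
      (\<Sum>p | p permutes {..<n}. H (permute_list p ?s))"
      by (rule sum.reindex_bij_betw[symmetric])
  qed
  finally show ?thesis .
qed

lemma dZbar_wedge_eq: "dZbar_wedge V L = foldr wedge1 (map (\<lambda>j k. V $ k $ j) (sorted_list_of_set L)) (\<lambda>J. if J = {} then 1 else 0)"
proof -
  have "wedge (dZbar V j) = wedge1 (\<lambda>k. V $ k $ j)" for j
  proof -
    have "dZbar V j = one_form (\<lambda>k. V $ k $ j)"
      by (rule ext) (simp add: dZbar_def one_form_def transpose_def)
    then show ?thesis by (intro ext) (simp only: wedge1_def)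
  qed
  then have "foldr wedge (map (dZbar V) ls) \<eta> = foldr wedge1 (map (\<lambda>j k. V $ k $ j) ls) \<eta>" for ls \<eta>
    by (induction ls) simp_all
  then show ?thesis by (simp add: dZbar_wedge_def)
qed

text \<open>The compound matrix of \<open>U diag(f) U\<^sup>*\<close>: both sides expand into all lists of columns, and the
  alternating wedge product collects the lists with the same underlying set into a minor.\<close>

lemma dZbar_wedge_sdiag:
  "dZbar_wedge (sdiag U f) K J =
    (\<Sum>L\<in>tuples (card K). minor_det (conj_matrix U) K L * dZbar_wedge U L J * (\<Prod>j\<in>L. f j))"
proof -
  define n where "n = card K"
  let ?k = "sorted_list_of_set K" and ?\<eta> = "\<lambda>J. if J = {} then 1 else (0::complex)"
  let ?u = "\<lambda>j k. U $ k $ j"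
  have len: "length ?k = n" by (simp add: n_def)
  have "(\<lambda>j k. sdiag U f $ k $ j) = (\<lambda>c k. \<Sum>j\<in>UNIV. (f j * cnj (U $ c $ j)) * U $ k $ j)"
    by (simp add: sdiag_nth fun_eq_iff mult_ac)
  then have "dZbar_wedge (sdiag U f) K J = (\<Sum>l | length l = n. (\<Prod>i<n. f (l ! i) * cnj (U $ (?k ! i) $ (l ! i))) * foldr wedge1 (map ?u l) ?\<eta> J)"
    unfolding dZbar_wedge_eq by (simp only: foldr_wedge1_expand[of "\<lambda>c j. f j * cnj (U $ c $ j)" ?u] len)
  also have "\<dots> = (\<Sum>L\<in>tuples n. \<Sum>p | p permutes {..<n}.
     (\<Prod>i<n. f (permute_list p (sorted_list_of_set L) ! i) * cnj (U $ (?k ! i) $ (permute_list p (sorted_list_of_set L) ! i))) *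
     foldr wedge1 (map ?u (permute_list p (sorted_list_of_set L))) ?\<eta> J)"
    by (rule sum_distinct_lists) (simp add: foldr_wedge1_not_distinct)
  also have "\<dots> = (\<Sum>L\<in>tuples n. minor_det (conj_matrix U) K L * dZbar_wedge U L J * (\<Prod>j\<in>L. f j))"
  proof (rule sum.cong[OF refl])
    fix L :: "'a set" assume L: "L \<in> tuples n"
    let ?s = "sorted_list_of_set L"
    have ls: "length ?s = n" using L by (simp add: tuples_def)
    have "(\<Prod>i<n. f (permute_list p ?s ! i) * cnj (U $ (?k ! i) $ (permute_list p ?s ! i))) * foldr wedge1 (map ?u (permute_list p ?s)) ?\<eta> J =
      of_int (sign p) * (\<Prod>i<n. conj_matrix U $ (?k ! i) $ (?s ! p i)) * (dZbar_wedge U L J * (\<Prod>j\<in>L. f j))"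
      if p: "p permutes {..<n}" for p
    proof -
      have pl: "permute_list p ?s ! i = ?s ! p i" if "i < n" for i
        using that p ls by (simp add: permute_list_nth)
      \<comment> \<open>The product of the values of f ignores the order of the list, so it leaves
        the sum over p; what remains there is the Leibniz sum of the minor.\<close>
      have "(\<Prod>i<n. f (?s ! p i)) = (\<Prod>i<n. f (?s ! i))"
        using prod.permute[OF p, of "\<lambda>i. f (?s ! i)"] by (simp add: o_def)
      also have "\<dots> = (\<Prod>j\<in>L. f j)"
      proof -
        have "bij_betw ((!) ?s) {..<n} L"
          by (rule bij_betw_nth) (use ls in auto)
        then show ?thesis by (rule prod.reindex_bij_betw)
      qed
      finally show ?thesis
        unfolding foldr_wedge1_permute[OF p ls] dZbar_wedge_eq
        by (simp add: pl prod.distrib conj_matrix_def mult_ac)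
    qed
    then have "(\<Sum>p | p permutes {..<n}. (\<Prod>i<n. f (permute_list p ?s ! i) * cnj (U $ (?k ! i) $ (permute_list p ?s ! i))) * foldr wedge1 (map ?u (permute_list p ?s)) ?\<eta> J) =
      (\<Sum>p | p permutes {..<n}. of_int (sign p) * (\<Prod>i<n. conj_matrix U $ (?k ! i) $ (?s ! p i)) * (dZbar_wedge U L J * (\<Prod>j\<in>L. f j)))"
      by (intro sum.cong) auto
    then show "(\<Sum>p | p permutes {..<n}. (\<Prod>i<n. f (permute_list p ?s ! i) * cnj (U $ (?k ! i) $ (permute_list p ?s ! i))) * foldr wedge1 (map ?u (permute_list p ?s)) ?\<eta> J) =
      minor_det (conj_matrix U) K L * dZbar_wedge U L J * (\<Prod>j\<in>L. f j)"
      unfolding minor_det_def n_def[symmetric] by (simp only: sum_distrib_right mult.assoc)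
  qed
  finally show ?thesis by (simp add: n_def)
qed

text \<open>Each further factor is a sum over the elements of J, hence of at most
  \<open>CARD('d)\<close> terms with coefficients of modulus at most R.\<close>

lemma norm_foldr_wedge1:
  fixes V :: "'d::{finite,linorder} cmat"
  assumes "\<And>a b. cmod (V $ a $ b) \<le> R"
  shows "cmod (foldr wedge1 (map (\<lambda>j k. V $ k $ j) l) (\<lambda>J. if J = {} then 1 else 0) J) \<le> (real CARD('d) * R) ^ length l"
proof (induction l arbitrary: J)
  case (Cons a l)
  have R0: "0 \<le> R" using assms[of undefined undefined] norm_ge_zero order.trans by blast
  have "cmod (wedge1 (\<lambda>k. V $ k $ a) \<omega> J) \<le> real CARD('d) * R * B" if "\<And>J. cmod (\<omega> J) \<le> B" for \<omega> B
  proof -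
    have B0: "0 \<le> B" using that[of J] norm_ge_zero order.trans by blast
    have "cmod (wedge1 (\<lambda>k. V $ k $ a) \<omega> J) \<le> (\<Sum>b\<in>J. R * B)"
      unfolding wedge1_eq using assms that R0
      by (intro sum_norm_le) (auto simp: norm_mult inv_sign_def norm_power intro!: mult_mono)
    also have "\<dots> \<le> real CARD('d) * (R * B)"
      using R0 B0 card_mono[of UNIV J] by (auto intro!: mult_right_mono)
    finally show ?thesis by (simp add: mult.assoc)
  qed
  from this[OF Cons] show ?case by simp
qed simp

lemma norm_dZbar_wedge:
  fixes V :: "'d::{finite,linorder} cmat"
  assumes "\<And>a b. cmod (V $ a $ b) \<le> R"
  shows "cmod (dZbar_wedge V L J) \<le> (real CARD('d) * R) ^ card L"
  unfolding dZbar_wedge_eq using norm_foldr_wedge1[OF assms, of "sorted_list_of_set L"] by simp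

lemma holomorphic_on_dZbar_wedge:
  assumes "mhol S F"
  shows "(\<lambda>w. dZbar_wedge (F w) L J) holomorphic_on S"
proof -
  have "(\<lambda>w. foldr wedge1 (map (\<lambda>j k. F w $ k $ j) l) (\<lambda>J. if J = {} then 1 else 0) J) holomorphic_on S" for l
    using assms by (induction l arbitrary: J) (auto simp: wedge1_eq mhol_def intro!: holomorphic_intros)
  then show ?thesis by (simp add: dZbar_wedge_eq)
qed

lemma measurable_dZbar_wedge:
  assumes "mmeas M F"
  shows "(\<lambda>w. dZbar_wedge (F w) L J) \<in> borel_measurable M"
proof -
  have "(\<lambda>w. foldr wedge1 (map (\<lambda>j k. F w $ k $ j) l) (\<lambda>J. if J = {} then 1 else 0) J) \<in> borel_measurable M" for l
    using assms by (induction l arbitrary: J) (auto simp: wedge1_eq mmeas_def intro!: borel_measurable_sum borel_measurable_times)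
  then show ?thesis by (simp add: dZbar_wedge_eq)
qed

lemma norm_minor_det:
  assumes "\<And>a b. cmod (V $ a $ b) \<le> 1"
  shows "cmod (minor_det V K L) \<le> fact (card K)"
proof -
  have "cmod (of_int (sign p) * (\<Prod>i<card K. V $ (sorted_list_of_set K ! i) $ (sorted_list_of_set L ! p i))) \<le> 1" for p
  proof -
    have "cmod (of_int (sign p)) = 1" by (simp add: sign_def)
    then show ?thesis using assms by (simp add: norm_mult prod_norm[symmetric] prod_le_1)
  qed
  then have "cmod (minor_det V K L) \<le> (\<Sum>p | p permutes {..<card K}. 1)"
    unfolding minor_det_def by (intro sum_norm_le) auto
  then show ?thesis by (simp add: card_permutations[of _ "card K"])
qed

lemma measurable_minor_det:
  assumes "mmeas M F"
  shows "(\<lambda>w. minor_det (F w) K L) \<in> borel_measurable M"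
  unfolding minor_det_def using assms
  by (intro borel_measurable_sum borel_measurable_times borel_measurable_prod) (auto simp: mmeas_def)

text \<open>Telescoping, one factor at a time. Because R \<ge> 1, the exponent can be rounded up to
  the full cardinality.\<close>

lemma norm_prod_diff_le:
  fixes a b :: "'i \<Rightarrow> 'a::real_normed_field"
  assumes "finite I" "1 \<le> R" "\<And>i. i \<in> I \<Longrightarrow> norm (a i) \<le> R" "\<And>i. i \<in> I \<Longrightarrow> norm (b i) \<le> R"
    "\<And>i. i \<in> I \<Longrightarrow> norm (a i - b i) \<le> e" "0 \<le> e"
  shows "norm (prod a I - prod b I) \<le> real (card I) * R ^ card I * e"
  using assms(1,3-5)
proof (induction I rule: finite_induct)
  case (insert i I)
  let ?k = "card I"
  have pb: "norm (prod b I) \<le> R ^ ?k"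
    using prod_mono[of I "\<lambda>i. norm (b i)" "\<lambda>_. R"] insert by (simp add: prod_norm)
  have "prod a (insert i I) - prod b (insert i I) = a i * (prod a I - prod b I) + (a i - b i) * prod b I"
    using insert by (simp add: algebra_simps)
  also have "norm \<dots> \<le> R * (real ?k * R ^ ?k * e) + e * R ^ ?k"
    using insert pb assms(2,6) by (intro order.trans[OF norm_triangle_ineq] add_mono) (auto simp: norm_mult intro!: mult_mono)
  also have "\<dots> \<le> R * (real ?k * R ^ ?k * e) + e * (R * R ^ ?k)"
    using assms(2,6) mult_right_mono[of 1 R "R ^ ?k"] by (intro add_left_mono mult_left_mono) auto
  also have "\<dots> = real (card (insert i I)) * R ^ card (insert i I) * e"
    using insert by (simp add: algebra_simps)
  finally show ?case .
qed simp

subsection \<open>Symbols in a complex tube\<close>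

definition dbl :: "complex ^ 'n ^ 'k \<Rightarrow> complex ^ 'n ^ 'k" where
  "dbl X = (\<chi> a b. 2 * X $ a $ b)"

lemma entry_norm_dbl: "entry_norm (dbl X) = 2 * entry_norm X"
  by (simp add: entry_norm_def dbl_def norm_mult sum_distrib_left)

lemma near_hermitian_dbl:
  assumes "near_hermitian \<epsilon> X"
  shows "near_hermitian (2 * \<epsilon>) (dbl X)"
proof -
  from assms obtain M E where ME: "X = (\<chi> a b. M $ a $ b + \<i> * E $ a $ b)"
    "ctranspose M = M" "ctranspose E = E" "\<And>v. norm (E *v v) \<le> \<epsilon> * norm v"
    unfolding near_hermitian_def by blast
  have h: "ctranspose (dbl M) = dbl M" if "ctranspose M = M" for M :: "complex ^ 'a ^ 'a"
    using that by (simp add: dbl_def vec_eq_iff)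
  have "dbl E *v v = 2 *\<^sub>R (E *v v)" for v
    by (simp add: dbl_def matrix_vector_mult_def vec_eq_iff sum_distrib_left scaleR_conv_of_real mult.assoc)
  then have "norm (dbl E *v v) \<le> 2 * \<epsilon> * norm v" for v
    using ME(4)[of v] by simp
  moreover have "dbl X = (\<chi> a b. dbl M $ a $ b + \<i> * dbl E $ a $ b)"
    by (simp add: ME(1) dbl_def vec_eq_iff algebra_simps)
  ultimately show ?thesis unfolding near_hermitian_def using h[OF ME(2)] h[OF ME(3)] by blast
qed

lemma mhol_dbl: "mhol S F \<Longrightarrow> mhol S (\<lambda>w. dbl (F w))"
  by (auto simp: mhol_def dbl_def intro!: holomorphic_intros)

lemma mmeas_dbl: "mmeas M F \<Longrightarrow> mmeas M (\<lambda>w. dbl (F w))"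
  by (auto simp: mmeas_def dbl_def intro!: borel_measurable_times)

text \<open>At \<open>X = s A\<^sub>\<nu>\<close> and \<open>r = exp (- s)\<close> this is \<open>s\<^bsup>2n\<^esup>\<close> times the numerator of the paper's integrand, summed
  over \<open>L\<close>; unlike the single summands it depends on the matrix only, not on its eigenvectors, and so extends
  holomorphically to complex directions.\<close>

definition symbol :: "'d::{finite,linorder} set \<Rightarrow> 'd set \<Rightarrow> 'd cmat \<Rightarrow> complex" where
  "symbol K J X = det (\<chi> a b. (xcoth X $ a $ b - X $ a $ b) / 2) * dZbar_wedge (mexp X) K J"

text \<open>The numerator at s minus the numerator at 2 s. At radius s the symbol carries the factor
  s^d with d = \<open>CARD('d)\<close>, so the value at the doubled matrix is rescaled by
  2^(-d).\<close>

definition symbol_diff :: "'d::{finite,linorder} set \<Rightarrow> 'd set \<Rightarrow> 'd cmat \<Rightarrow> complex" where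
  "symbol_diff K J X = symbol K J X - (1 / 2) ^ CARD('d) * symbol K J (dbl X)"

text \<open>Coefficient of the product of cnj (z $ a) and z $ b in the error made when the
  denominator at 2 s is replaced by the one at s: the rescaled symbol of the doubled matrix times
  the entry of the change of the quadratic form.\<close>

definition symbol_cross :: "'d::{finite,linorder} set \<Rightarrow> 'd set \<Rightarrow> 'd \<Rightarrow> 'd \<Rightarrow> 'd cmat \<Rightarrow> complex" where
  "symbol_cross K J a b X = (1 / 2) ^ CARD('d) * symbol K J (dbl X) * (xcoth (dbl X) $ a $ b / 2 - xcoth X $ a $ b)"

lemma holomorphic_symbol:
  assumes "mhol S F" "open S" "\<And>w. w \<in> S \<Longrightarrow> near_hermitian 1 (F w)"
  shows "(\<lambda>w. symbol K J (F w)) holomorphic_on S"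
  unfolding symbol_def
proof (intro holomorphic_on_mult holomorphic_on_det holomorphic_on_dZbar_wedge mhol_mexp assms)
  show "mhol S (\<lambda>w. \<chi> a b. (xcoth (F w) $ a $ b - F w $ a $ b) / 2)"
    using mhol_xcoth[OF assms] assms(1) by (auto simp: mhol_def intro!: holomorphic_intros)
qed

lemma holomorphic_symbols:
  assumes "mhol S F" "open S" "\<And>w. w \<in> S \<Longrightarrow> near_hermitian (1 / 4) (F w)"
  shows "(\<lambda>w. symbol_diff K J (F w)) holomorphic_on S" "(\<lambda>w. symbol_cross K J a b (F w)) holomorphic_on S"
    "(\<lambda>w. xcoth (F w) $ a $ b) holomorphic_on S" "(\<lambda>w. xcoth (dbl (F w)) $ a $ b) holomorphic_on S"
proof -
  have 1: "near_hermitian 1 (F w)" if "w \<in> S" for w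
    using assms(3)[OF that] by (rule near_hermitian_mono) simp
  have 2: "near_hermitian 1 (dbl (F w))" if "w \<in> S" for w
    using near_hermitian_dbl[OF assms(3)[OF that]] by (rule near_hermitian_mono) simp
  note h = holomorphic_symbol[OF assms(1,2) 1] holomorphic_symbol[OF mhol_dbl[OF assms(1)] assms(2) 2]
  show 3: "(\<lambda>w. xcoth (F w) $ a $ b) holomorphic_on S" "(\<lambda>w. xcoth (dbl (F w)) $ a $ b) holomorphic_on S"
    using mhol_xcoth[OF assms(1,2) 1] mhol_xcoth[OF mhol_dbl[OF assms(1)] assms(2) 2] by (auto simp: mhol_def)
  show "(\<lambda>w. symbol_diff K J (F w)) holomorphic_on S" "(\<lambda>w. symbol_cross K J a b (F w)) holomorphic_on S"
    unfolding symbol_diff_def symbol_cross_def by (intro holomorphic_intros h 3; simp)+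
qed

lemma measurable_symbols:
  fixes F :: "'x \<Rightarrow> 'd::{finite,linorder} cmat"
  assumes "mmeas M F"
  shows "(\<lambda>w. symbol_diff K J (F w)) \<in> borel_measurable M" "(\<lambda>w. symbol_cross K J a b (F w)) \<in> borel_measurable M"
    "(\<lambda>w. xcoth (F w) $ a $ b) \<in> borel_measurable M" "(\<lambda>w. xcoth (dbl (F w)) $ a $ b) \<in> borel_measurable M"
proof -
  have s: "(\<lambda>w. symbol K J (F w)) \<in> borel_measurable M" if "mmeas M F" for F :: "'x \<Rightarrow> 'd cmat"
    unfolding symbol_def
  proof (intro borel_measurable_times measurable_det measurable_dZbar_wedge mmeas_mexp that)
    show "mmeas M (\<lambda>w. \<chi> a b. (xcoth (F w) $ a $ b - F w $ a $ b) / 2)"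
      using mmeas_xcoth[OF that] that by (auto simp: mmeas_def intro!: borel_measurable_divide borel_measurable_diff)
  qed
  note [measurable] = s[OF assms] s[OF mmeas_dbl[OF assms]]
  show [measurable]: "(\<lambda>w. xcoth (F w) $ a $ b) \<in> borel_measurable M" "(\<lambda>w. xcoth (dbl (F w)) $ a $ b) \<in> borel_measurable M"
    using mmeas_xcoth[OF assms] mmeas_xcoth[OF mmeas_dbl[OF assms]] by (auto simp: mmeas_def)
  show "(\<lambda>w. symbol_diff K J (F w)) \<in> borel_measurable M" "(\<lambda>w. symbol_cross K J a b (F w)) \<in> borel_measurable M"
    unfolding symbol_diff_def symbol_cross_def by measurable
qed

lemma xcoth_exp_bound:
  fixes X :: "complex ^ 'd ^ 'd::finite"
  assumes "near_hermitian 1 X"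
  shows "cmod (xcoth X $ a $ b) \<le> 4 * exp (entry_norm X)"
proof -
  let ?s = "entry_norm X"
  have s0: "0 \<le> ?s" by (rule entry_norm_nonneg)
  have "1 + ?s + ?s\<^sup>2 / 2 \<le> exp ?s" using exp_lower_Taylor_quadratic[OF s0] .
  then have "2 + ?s\<^sup>2 \<le> 2 * exp ?s" using s0 by (simp add: field_simps)
  then show ?thesis using norm_xcoth[OF assms, of a b] exp_gt_zero[of ?s] by linarith
qed

lemma norm_symbol:
  assumes "near_hermitian 1 (X :: 'd::{finite,linorder} cmat)"
  shows "cmod (symbol K J X) \<le> fact CARD('d) * 3 ^ CARD('d) * real CARD('d) ^ card K * exp ((real CARD('d) + real (card K)) * entry_norm X)"
proof -
  let ?s = "entry_norm X" and ?d = "CARD('d)"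
  have "cmod ((xcoth X $ a $ b - X $ a $ b) / 2) \<le> 3 * exp ?s" for a b
  proof -
    have "cmod (X $ a $ b) \<le> exp ?s"
      using entry_le_entry_norm[of X a b] exp_ge_add_one_self[of ?s] by linarith
    then have "cmod (xcoth X $ a $ b - X $ a $ b) \<le> 4 * exp ?s + exp ?s"
      using xcoth_exp_bound[OF assms, of a b] norm_triangle_ineq4[of "xcoth X $ a $ b" "X $ a $ b"] by linarith
    also have "\<dots> \<le> 6 * exp ?s" by simp
    finally show ?thesis by (simp add: norm_divide)
  qed
  then have "cmod (det (\<chi> a b. (xcoth X $ a $ b - X $ a $ b) / 2)) \<le> fact ?d * (3 * exp ?s) ^ ?d"
    by (intro norm_det_le) simp
  moreover have "cmod (dZbar_wedge (mexp X) K J) \<le> (real ?d * exp ?s) ^ card K"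
    by (rule norm_dZbar_wedge[OF norm_mexp])
  ultimately have "cmod (symbol K J X) \<le> (fact ?d * (3 * exp ?s) ^ ?d) * ((real ?d * exp ?s) ^ card K)"
    unfolding symbol_def norm_mult by (intro mult_mono) auto
  also have "\<dots> = fact ?d * 3 ^ ?d * real ?d ^ card K * exp ((real ?d + real (card K)) * ?s)"
    by (simp add: power_mult_distrib exp_of_nat_mult[symmetric] exp_add distrib_right)
  finally show ?thesis .
qed

text \<open>Exponential growth in the whole tube, without any use of eigenvalues: this provides the
  large constant in the two-constants theorem.\<close>

lemma norm_symbols_crude:
  fixes K J :: "'d::{finite,linorder} set"
  obtains C c where "C > 0" "c > 0"
    "\<And>X. near_hermitian (1 / 4) X \<Longrightarrow> cmod (symbol_diff K J X) \<le> C * exp (c * entry_norm X)"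
    "\<And>X a b. near_hermitian (1 / 4) X \<Longrightarrow> cmod (symbol_cross K J a b X) \<le> C * exp (c * entry_norm X)"
proof -
  define d where "d = real CARD('d)"
  define D where "D = fact CARD('d) * 3 ^ CARD('d) * d ^ card K"
  define e where "e = d + real (card K)"
  have d1: "d \<ge> 1" by (simp add: d_def Suc_leI)
  have D0: "D \<ge> 1"
  proof -
    have "1 * 1 * 1 \<le> fact CARD('d) * 3 ^ CARD('d) * d ^ card K"
      using d1 by (intro mult_mono one_le_power fact_ge_1) auto
    then show ?thesis by (simp add: D_def)
  qed
  have e0: "e \<ge> 1" using d1 by (simp add: e_def)
  have b1: "cmod (symbol K J X) \<le> D * exp ((2 * e) * entry_norm X)"
    and b2: "cmod ((1 / 2) ^ CARD('d) * symbol K J (dbl X)) \<le> D * exp ((2 * e) * entry_norm X)"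
    and n1: "near_hermitian 1 X" and n2: "near_hermitian 1 (dbl X)"
    if X: "near_hermitian (1 / 4) X" for X
  proof -
    have h: "(1 / 2 :: real) ^ CARD('d) \<le> 1" by (rule power_le_one) auto
    show n: "near_hermitian 1 X" "near_hermitian 1 (dbl X)"
      using X near_hermitian_dbl[OF X] near_hermitian_mono by force+
    show "cmod (symbol K J X) \<le> D * exp ((2 * e) * entry_norm X)"
      by (rule order.trans[OF norm_symbol[OF n(1)]])
         (use D0 e0 entry_norm_nonneg[of X] in \<open>auto simp: D_def d_def e_def intro!: mult_mono mult_right_mono\<close>)
    have "cmod (symbol K J (dbl X)) \<le> D * exp ((2 * e) * entry_norm X)"
      using norm_symbol[OF n(2), of K J] by (simp add: D_def d_def e_def entry_norm_dbl mult_ac)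
    then show "cmod ((1 / 2) ^ CARD('d) * symbol K J (dbl X)) \<le> D * exp ((2 * e) * entry_norm X)"
      using mult_mono[OF h, of "cmod (symbol K J (dbl X))"] by (simp add: norm_mult norm_power power_divide norm_divide)
  qed
  show ?thesis
  proof (rule that[of "8 * D" "2 * e + 2"])
    fix X :: "'d cmat" assume X: "near_hermitian (1 / 4) X"
    let ?s = "entry_norm X"
    have s0: "?s \<ge> 0" by (rule entry_norm_nonneg)
    have m: "exp ((2 * e) * ?s) \<le> exp ((2 * e + 2) * ?s)" using s0 by (simp add: mult_right_mono)
    have "cmod (symbol_diff K J X) \<le> D * exp ((2 * e) * ?s) + D * exp ((2 * e) * ?s)"
      unfolding symbol_diff_def using b1[OF X] b2[OF X] norm_triangle_ineq4 order.trans add_mono by meson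
    also have "\<dots> \<le> 8 * D * exp ((2 * e + 2) * ?s)"
    proof -
      have "D * exp ((2 * e) * ?s) \<le> D * exp ((2 * e + 2) * ?s)" "0 \<le> D * exp ((2 * e + 2) * ?s)"
        using mult_left_mono[OF m, of D] D0 by auto
      then show ?thesis unfolding mult.assoc[of 8] by linarith
    qed
    finally show "cmod (symbol_diff K J X) \<le> 8 * D * exp ((2 * e + 2) * ?s)" .
    fix a b
    have "cmod (xcoth (dbl X) $ a $ b / 2 - xcoth X $ a $ b) \<le> 4 * exp (2 * ?s) / 2 + 4 * exp ?s"
      using xcoth_exp_bound[OF n2[OF X], of a b] xcoth_exp_bound[OF n1[OF X], of a b]
        norm_triangle_ineq4[of "xcoth (dbl X) $ a $ b / 2" "xcoth X $ a $ b"]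
      by (simp add: entry_norm_dbl norm_divide)
    also have "\<dots> \<le> 8 * exp (2 * ?s)" using s0 by (simp add: order.trans[of _ "4 * exp (2 * ?s)"])
    finally have "cmod (symbol_cross K J a b X) \<le> D * exp ((2 * e) * ?s) * (8 * exp (2 * ?s))"
      unfolding symbol_cross_def norm_mult[of "(1 / 2) ^ CARD('d) * symbol K J (dbl X)"]
      using b2[OF X] D0 by (intro mult_mono) auto
    then have that:  "cmod (symbol_cross K J a b X) \<le> D * exp ((2 * e) * ?s) * (8 * exp (2 * ?s))"
      .
    show "cmod (symbol_cross K J a b X) \<le> 8 * D * exp ((2 * e + 2) * ?s)"
    proof -
      have "exp ((2 * e + 2) * ?s) = exp ((2 * e) * ?s) * exp (2 * ?s)"
        unfolding distrib_right exp_add ..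
      then have "D * exp ((2 * e) * ?s) * (8 * exp (2 * ?s)) = 8 * D * exp ((2 * e + 2) * ?s)" by simp
      with that show ?thesis by simp
    qed
  qed (use D0 e0 in auto)
qed

section \<open>Levi matrices along complex lines\<close>

locale quadric =
  fixes \<phi> :: "'d::{finite,linorder} cvec \<Rightarrow> 'd cvec \<Rightarrow> 'm::{finite,linorder} cvec"
    and P :: "'d set" and \<mu> :: "'m rvec \<Rightarrow> 'd \<Rightarrow> real" and U :: "'m rvec \<Rightarrow> 'd cmat"
  assumes sesquilinear: "sesquilinear \<phi>" and real_on_diagonal: "real_on_diagonal \<phi>"
    and nondegenerate: "\<forall>\<nu>\<in>sphere 0 1. \<forall>c. is_eigenvalue (levi_matrix \<phi> \<nu>) c \<longrightarrow> c \<noteq> 0"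
    and diagonalization: "levi_diagonalization \<phi> P \<mu> U"
begin

abbreviation levi :: "'m rvec \<Rightarrow> 'd cmat" where "levi \<equiv> levi_matrix \<phi>"

lemma levi_nth: "levi x $ a $ b = (\<Sum>i\<in>UNIV. \<phi> (axis b 1) (axis a 1) $ i * of_real (x $ i))"
  by (simp add: levi_matrix_def directional_form_def)

lemma levi_add: "levi (x + y) $ a $ b = levi x $ a $ b + levi y $ a $ b"
  by (simp add: levi_nth distrib_left sum.distrib)

lemma levi_scaleR: "levi (r *\<^sub>R x) $ a $ b = of_real r * levi x $ a $ b"
  by (simp add: levi_nth sum_distrib_left mult_ac)

lemma hermitian_levi: "ctranspose (levi x) = levi x"
  using levi_matrix_iff[OF sesquilinear real_on_diagonal] by blast

text \<open>The summand 1 makes the constant positive, so that tube widths may be divided by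
  it.\<close>

definition levi_bound :: real where
  "levi_bound = 1 + (\<Sum>a\<in>UNIV. \<Sum>b\<in>UNIV. \<Sum>i\<in>UNIV. cmod (\<phi> (axis b 1) (axis a 1) $ i))"

lemma levi_bound_ge_1: "1 \<le> levi_bound"
  by (simp add: levi_bound_def sum_nonneg)

lemma entry_norm_levi: "entry_norm (levi x) \<le> levi_bound * norm x"
proof -
  have "entry_norm (levi x) \<le> (\<Sum>a\<in>UNIV. \<Sum>b\<in>UNIV. \<Sum>i\<in>UNIV. cmod (\<phi> (axis b 1) (axis a 1) $ i) * norm x)"
    unfolding entry_norm_def levi_nth
    by (intro sum_mono sum_norm_le) (auto simp: norm_mult intro!: mult_left_mono component_le_norm_cart)
  also have "\<dots> \<le> levi_bound * norm x"
    unfolding sum_distrib_right[symmetric] by (intro mult_right_mono) (auto simp: levi_bound_def)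
  finally show ?thesis .
qed

text \<open>The Levi matrix is linear in the direction; this is its complex-linear extension,
  evaluated at the complex point x + w \<eta>.\<close>

definition line :: "'m rvec \<Rightarrow> 'm rvec \<Rightarrow> complex \<Rightarrow> 'd cmat" where
  "line x \<eta> w = (\<chi> a b. levi x $ a $ b + w * levi \<eta> $ a $ b)"

lemma line_shift: "line x \<eta> (of_real r + w) = line (x + r *\<^sub>R \<eta>) \<eta> w"
  by (simp add: line_def levi_add levi_scaleR algebra_simps vec_eq_iff)

lemma line_real: "line x \<eta> (of_real r) = levi (x + r *\<^sub>R \<eta>)"
  by (simp add: line_def levi_add levi_scaleR vec_eq_iff)

lemma line_minus: "line x (- \<eta>) w = line x \<eta> (- w)"
  using levi_scaleR[of "-1" \<eta>] by (simp add: line_def vec_eq_iff)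

lemma mhol_line: "mhol S (line x \<eta>)"
  by (auto simp: mhol_def line_def[abs_def] intro!: holomorphic_intros)

lemma mmeas_line: "mmeas borel (\<lambda>x. line x \<eta> w)"
proof -
  have "(\<lambda>x::'m rvec. complex_of_real (x $ i)) \<in> borel_measurable borel" for i
    by (intro borel_measurable_continuous_onI continuous_intros)
  then show ?thesis unfolding mmeas_def line_def levi_nth
    by (auto intro!: borel_measurable_add borel_measurable_sum borel_measurable_times)
qed

text \<open>The real part of w only moves the base point; the skew part comes from Im w
  alone.\<close>

lemma near_hermitian_line:
  assumes "norm \<eta> = 1"
  shows "near_hermitian (levi_bound * \<bar>Im w\<bar>) (line x \<eta> w)"
proof -
  let ?E = "levi (Im w *\<^sub>R \<eta>)"
  have "line x \<eta> w = line (x + Re w *\<^sub>R \<eta>) \<eta> (\<i> * of_real (Im w))"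
    using line_shift[of x \<eta> "Re w" "\<i> * of_real (Im w)"] complex_eq[of w] by simp
  also have "\<dots> = (\<chi> a b. levi (x + Re w *\<^sub>R \<eta>) $ a $ b + \<i> * ?E $ a $ b)"
    by (simp add: line_def levi_scaleR vec_eq_iff)
  finally have "line x \<eta> w = (\<chi> a b. levi (x + Re w *\<^sub>R \<eta>) $ a $ b + \<i> * ?E $ a $ b)" .
  moreover have "norm (?E *v v) \<le> levi_bound * \<bar>Im w\<bar> * norm v" for v
    by (rule order.trans[OF norm_matrix_vector_le mult_right_mono[OF order.trans[OF entry_norm_levi]]])
       (use assms in auto)
  ultimately show ?thesis unfolding near_hermitian_def using hermitian_levi by blast
qed

lemma entry_norm_line:
  assumes "norm \<eta> = 1"
  shows "entry_norm (line x \<eta> w) \<le> levi_bound * (norm x + cmod w)"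
proof -
  have "entry_norm (line x \<eta> w) \<le> entry_norm (levi x) + cmod w * entry_norm (levi \<eta>)"
    unfolding entry_norm_def line_def sum_distrib_left sum.distrib[symmetric]
    by (intro sum_mono) (simp add: norm_triangle_le norm_mult)
  also have "\<dots> \<le> levi_bound * norm x + cmod w * (levi_bound * 1)"
    using entry_norm_levi[of x] entry_norm_levi[of \<eta>] assms by (intro add_mono mult_left_mono) auto
  finally show ?thesis by (simp add: algebra_simps)
qed

text \<open>Exponential decay on the real space and exponential growth in a tube imply, by the two
  constants theorem, exponential decay in a smaller tube.\<close>

definition decaying :: "('d cmat \<Rightarrow> complex) \<Rightarrow> bool" where
  "decaying f \<longleftrightarrow> (\<exists>C>0. \<exists>c>0. \<exists>\<epsilon>>0. \<forall>x \<eta> w. norm \<eta> = 1 \<longrightarrow> \<bar>Im w\<bar> \<le> \<epsilon> \<longrightarrow>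
     cmod (f (line x \<eta> w)) \<le> C * exp (- c * norm (x + Re w *\<^sub>R \<eta>)))"

lemma decaying_tube:
  fixes f :: "'d cmat \<Rightarrow> complex"
  assumes hol: "\<And>S F. mhol S F \<Longrightarrow> open S \<Longrightarrow> (\<And>w. w \<in> S \<Longrightarrow> near_hermitian (1 / 4) (F w)) \<Longrightarrow> (\<lambda>w. f (F w)) holomorphic_on S"
    and crude: "0 < D" "0 < e" "\<And>X. near_hermitian (1 / 4) X \<Longrightarrow> cmod (f X) \<le> D * exp (e * entry_norm X)"
    and decay: "0 < C" "0 < c" "\<And>x. cmod (f (levi x)) \<le> C * exp (- c * norm x)"
  shows "decaying f"
proof -
  \<comment> \<open>The strip |Im w| < 2 \<rho> has tolerance 1/4, and the rectangle of height
    \<rho> for the two-constants theorem lies inside it.\<close>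
  define \<rho> where "\<rho> = 1 / (8 * levi_bound)"
  have lb: "levi_bound > 0" using levi_bound_ge_1 by simp
  have \<rho>0: "\<rho> > 0" using lb by (simp add: \<rho>_def)
  define S where "S = {w. \<bar>Im w\<bar> < 2 * \<rho>}"
  have nh: "near_hermitian (1 / 4) (line x \<eta> w)" if "norm \<eta> = 1" "w \<in> S" for x \<eta> w
  proof (rule near_hermitian_mono[OF near_hermitian_line[OF that(1)]])
    have "levi_bound * \<bar>Im w\<bar> \<le> levi_bound * (2 * \<rho>)"
      using that(2) lb by (intro mult_left_mono) (auto simp: S_def)
    also have "\<dots> = 1 / 4" using lb by (simp add: \<rho>_def)
    finally show "levi_bound * \<bar>Im w\<bar> \<le> 1 / 4" .
  qed
  have oS: "open S"
    unfolding S_def by (intro open_Collect_less continuous_intros)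
  define g where "g = e * levi_bound"
  define C4 where "C4 = C * exp (c * \<rho>)"
  define C2 where "C2 = max C4 (D * exp (g * (2 * \<rho>)))"
  have g0: "g > 0" using crude lb by (simp add: g_def)
  have C40: "C4 > 0" using decay by (simp add: C4_def)
  have C2: "C2 \<ge> C4" "C2 > 0" using C40 by (auto simp: C2_def)
  \<comment> \<open>At height y the two-constants theorem gives the exponent -c + 2 (y/\<rho>) (g +
    c) in front of |x|; y/\<rho> \<le> c / (4 (g + c)) keeps half of the decay, and y/\<rho> \<le>
    1/2 lets the ratio C2/C4 enter at most to the first power.\<close>
  define \<epsilon> where "\<epsilon> = \<rho> * min (1 / 2) (c / (4 * (g + c)))"
  have \<epsilon>0: "\<epsilon> > 0" using \<rho>0 g0 decay by (simp add: \<epsilon>_def)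
  have main: "cmod (f (line x \<eta> (\<i> * of_real y))) \<le> C2 * exp (- (c / 2) * norm x)"
    if \<eta>: "norm \<eta> = 1" and y: "0 \<le> y" "y \<le> \<epsilon>" for x \<eta> y
  proof -
    define M where "M = C2 * exp (g * norm x)"
    define h where "h = C4 * exp (- c * norm x)"
    have h0: "h > 0" using C40 by (simp add: h_def)
    have "- c * norm x \<le> 0" "0 \<le> g * norm x" using g0 decay(2) by auto
    then have "exp (- c * norm x) \<le> exp (g * norm x)" by (simp only: exp_le_cancel_iff)
    then have hM: "h \<le> M" unfolding h_def M_def
      using C2 C40 by (intro mult_mono) auto
    have y2: "y / \<rho> \<le> 1 / 2" "y / \<rho> \<le> c / (4 * (g + c))"
      using y \<rho>0 unfolding \<epsilon>_def by (auto simp: divide_le_eq mult.commute min_mult_distrib_left)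
    have "cmod (f (line x \<eta> (\<i> * of_real y))) \<le> h * exp (2 * (y / \<rho>) * ln (M / h))"
    proof (rule two_constants[where S = S and f = "\<lambda>w. f (line x \<eta> w)"])
      show "(\<lambda>w. f (line x \<eta> w)) holomorphic_on S"
        by (rule hol[OF mhol_line oS nh[OF \<eta>]])
      show sub: "cbox (Complex (- \<rho>) 0) (Complex \<rho> \<rho>) \<subseteq> S"
        using \<rho>0 by (auto simp: S_def in_cbox_complex_iff)
      show "cmod (f (line x \<eta> w)) \<le> M" if w: "w \<in> cbox (Complex (- \<rho>) 0) (Complex \<rho> \<rho>)" for w
      proof -
        have "cmod w \<le> 2 * \<rho>"
          using w cmod_le[of w] by (auto simp: in_cbox_complex_iff)
        then have "e * entry_norm (line x \<eta> w) \<le> e * (levi_bound * (norm x + 2 * \<rho>))"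
          using entry_norm_line[OF \<eta>, of x w] crude(2) lb
          by (intro mult_left_mono) (auto intro: order.trans)
        also have "\<dots> = g * (2 * \<rho>) + g * norm x" by (simp add: g_def algebra_simps)
        finally have "exp (e * entry_norm (line x \<eta> w)) \<le> exp (g * (2 * \<rho>)) * exp (g * norm x)"
          by (simp add: exp_add[symmetric])
        then have "D * exp (e * entry_norm (line x \<eta> w)) \<le> D * exp (g * (2 * \<rho>)) * exp (g * norm x)"
          using crude(1) by (simp add: mult.assoc)
        also have "\<dots> \<le> M" unfolding M_def C2_def by (intro mult_right_mono) auto
        finally show ?thesis using crude(3)[OF nh[OF \<eta>]] sub w by (meson order.trans subsetD)
      qed
      show "cmod (f (line x \<eta> (of_real r))) \<le> h" if r: "\<bar>r\<bar> \<le> \<rho>" for r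
      proof -
        have "norm x - \<rho> \<le> norm (x + r *\<^sub>R \<eta>)"
          using norm_triangle_ineq4[of "x + r *\<^sub>R \<eta>" "r *\<^sub>R \<eta>"] r \<eta> by simp
        then have "c * (norm x - \<rho>) \<le> c * norm (x + r *\<^sub>R \<eta>)" using decay(2) by (intro mult_left_mono) auto
        then have "exp (- c * norm (x + r *\<^sub>R \<eta>)) \<le> exp (c * \<rho>) * exp (- c * norm x)"
          by (simp add: exp_add[symmetric] algebra_simps)
        then have "C * exp (- c * norm (x + r *\<^sub>R \<eta>)) \<le> h"
          using decay(1) by (simp add: h_def C4_def mult.assoc)
        then show ?thesis using decay(3)[of "x + r *\<^sub>R \<eta>"] by (simp add: line_real)
      qed
      show "y \<le> \<rho>" using y2(1) \<rho>0 by (simp add: divide_le_eq)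
    qed (use \<rho>0 h0 hM y in auto)
    also have "\<dots> \<le> C2 * exp (- (c / 2) * norm x)"
    proof -
      have "M / h = (C2 / C4) * exp ((g + c) * norm x)"
        using C40 by (simp add: M_def h_def field_simps exp_add[symmetric])
      then have l: "ln (M / h) = ln (C2 / C4) + (g + c) * norm x"
        using C40 C2 by (simp only:) (subst ln_mult, auto)
      have "2 * (y / \<rho>) * ln (C2 / C4) \<le> 1 * ln (C2 / C4)"
      proof (rule mult_right_mono)
        show "2 * (y / \<rho>) \<le> 1" using y2(1) by linarith
      qed (use C2 C40 in auto)
      moreover have "2 * (y / \<rho>) * ((g + c) * norm x) \<le> 2 * (c / (4 * (g + c))) * ((g + c) * norm x)"
        using y2(2) g0 decay(2) by (intro mult_right_mono) auto
      moreover have "2 * (c / (4 * (g + c))) * ((g + c) * norm x) = c / 2 * norm x"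
        using g0 decay(2) by (simp add: field_simps)
      ultimately have "2 * (y / \<rho>) * ln (M / h) \<le> ln (C2 / C4) + c / 2 * norm x"
        unfolding l distrib_left by linarith
      then have "exp (2 * (y / \<rho>) * ln (M / h)) \<le> (C2 / C4) * exp (c / 2 * norm x)"
        using C2 C40 by (metis exp_add exp_le_cancel_iff exp_ln divide_pos_pos)
      then have "h * exp (2 * (y / \<rho>) * ln (M / h)) \<le> h * ((C2 / C4) * exp (c / 2 * norm x))"
        using h0 by (intro mult_left_mono) auto
      also have "\<dots> = C2 * (exp (- c * norm x) * exp (c / 2 * norm x))"
        using C40 by (simp add: h_def)
      also have "exp (- c * norm x) * exp (c / 2 * norm x) = exp (- (c / 2) * norm x)"
        by (simp add: exp_add[symmetric] algebra_simps)
      finally show ?thesis .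
    qed
    finally show ?thesis .
  qed
  show ?thesis unfolding decaying_def
  proof (intro exI conjI allI impI)
    show "C2 > 0" "c / 2 > 0" "\<epsilon> > 0" using C2 decay \<epsilon>0 by auto
    fix x \<eta> :: "'m rvec" and w assume \<eta>: "norm \<eta> = 1" and w: "\<bar>Im w\<bar> \<le> \<epsilon>"
    have e: "line x \<eta> w = line (x + Re w *\<^sub>R \<eta>) \<eta> (\<i> * of_real (Im w))"
      using line_shift[of x \<eta> "Re w" "\<i> * of_real (Im w)"] complex_eq[of w] by simp
    show "cmod (f (line x \<eta> w)) \<le> C2 * exp (- (c / 2) * norm (x + Re w *\<^sub>R \<eta>))"
    \<comment> \<open>The lower half of the tube for \<eta> is the upper half of the tube for
      -\<eta>.\<close>
    proof (cases "Im w \<ge> 0")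
      case True
      then show ?thesis unfolding e using main[OF \<eta>, of "Im w"] w by simp
    next
      case False
      have "line (x + Re w *\<^sub>R \<eta>) \<eta> (\<i> * of_real (Im w)) = line (x + Re w *\<^sub>R \<eta>) (- \<eta>) (\<i> * of_real (- Im w))"
        by (simp add: line_minus)
      then show ?thesis unfolding e using main[of "- \<eta>" "- Im w" "x + Re w *\<^sub>R \<eta>"] w False \<eta> by simp
    qed
  qed
qed

end

subsection \<open>Eigenvalue estimates\<close>

text \<open>One factor of B_L. The flag e says that j belongs to both or to neither of L and P,
  which is the case without the power of r in the numerator.\<close>

definition bfac :: "bool \<Rightarrow> real \<Rightarrow> real \<Rightarrow> real" where
  "bfac e \<mu> r = (if e then \<bar>\<mu>\<bar> / (1 - r powr \<bar>\<mu>\<bar>) else r powr \<bar>\<mu>\<bar> * \<bar>\<mu>\<bar> / (1 - r powr \<bar>\<mu>\<bar>))"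

lemma B_fun_eq: "B_fun P \<mu> L r = (\<Prod>j\<in>UNIV. bfac ((j \<in> L) = (j \<in> P)) (\<mu> j) r)"
proof -
  let ?A = "(- L \<inter> P) \<union> (L \<inter> - P)" and ?B = "(L \<inter> P) \<union> (- L \<inter> - P)"
  have "(\<Prod>j\<in>UNIV. bfac ((j \<in> L) = (j \<in> P)) (\<mu> j) r) = (\<Prod>j\<in>?A \<union> ?B. bfac ((j \<in> L) = (j \<in> P)) (\<mu> j) r)"
    by (rule prod.cong) auto
  also have "\<dots> = (\<Prod>j\<in>?A. bfac ((j \<in> L) = (j \<in> P)) (\<mu> j) r) * (\<Prod>j\<in>?B. bfac ((j \<in> L) = (j \<in> P)) (\<mu> j) r)"
    by (rule prod.union_disjoint) auto
  also have "\<dots> = B_fun P \<mu> L r"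
    unfolding B_fun_def by (intro arg_cong2[where f = "(*)"] prod.cong) (auto simp: bfac_def)
  finally show ?thesis ..
qed

lemma exp_powr: "exp (- s) powr (a::real) = exp (- (s * a))"
  by (simp add: powr_def mult.commute)

lemma one_minus_exp_bounds:
  fixes y :: real
  assumes "0 < y"
  shows "0 < 1 - exp (- y)" "y * exp (- y) \<le> 1 - exp (- y)"
proof -
  show "0 < 1 - exp (- y)" using assms by simp
  have "exp (- y) * (1 + y) \<le> exp (- y) * exp y" by (intro mult_left_mono exp_ge_add_one_self) auto
  then show "y * exp (- y) \<le> 1 - exp (- y)" by (simp add: exp_add[symmetric] algebra_simps)
qed

text \<open>From 1 - exp (-y) \<ge> y exp (-y) at y = s |\<mu>| a factor is at most exp y / s: every
  eigenvalue contributes one singularity 1/s.\<close>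

lemma bfac_small:
  assumes "0 < s" "s \<le> 1" "\<mu> \<noteq> 0" "\<bar>\<mu>\<bar> \<le> C"
  shows "\<bar>bfac e \<mu> (exp (- s))\<bar> \<le> exp C / s"
proof -
  define y where "y = s * \<bar>\<mu>\<bar>"
  have y: "0 < y" "y \<le> C" using assms mult_mono[of s 1 "\<bar>\<mu>\<bar>" C] by (auto simp: y_def)
  note b = one_minus_exp_bounds[OF y(1)]
  have "\<bar>\<mu>\<bar> / (1 - exp (- y)) \<le> \<bar>\<mu>\<bar> / (y * exp (- y))"
    using b y by (intro divide_left_mono) auto
  also have "\<dots> = exp y / s" using assms by (simp add: y_def exp_minus field_simps)
  also have "\<dots> \<le> exp C / s" using y assms by (simp add: divide_right_mono)
  finally have 1: "\<bar>\<mu>\<bar> / (1 - exp (- y)) \<le> exp C / s" .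
  have "exp (- y) * (\<bar>\<mu>\<bar> / (1 - exp (- y))) \<le> 1 * (\<bar>\<mu>\<bar> / (1 - exp (- y)))"
    using y b by (intro mult_right_mono) auto
  then show ?thesis using 1 b y by (auto simp: bfac_def exp_powr y_def[symmetric] abs_mult)
qed

text \<open>For either value of the flag the deviation from the limit at r = 0 is the factor with
  the power of r in the numerator; a lower bound c on |\<mu>| makes it exponentially small in
  s.\<close>

lemma bfac_large:
  assumes "1 \<le> s" "0 < c" "c \<le> \<bar>\<mu>\<bar>" "\<bar>\<mu>\<bar> \<le> C"
  shows "\<bar>bfac e \<mu> (exp (- s))\<bar> \<le> C / (1 - exp (- c))"
    "\<bar>bfac e \<mu> (exp (- s)) - (if e then \<bar>\<mu>\<bar> else 0)\<bar> \<le> C / (1 - exp (- c)) * exp (- c * s)"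
proof -
  define y where "y = s * \<bar>\<mu>\<bar>"
  have cs: "c * s \<le> y" using mult_mono[of c "\<bar>\<mu>\<bar>" s s] assms by (simp add: y_def mult.commute)
  have "c * 1 \<le> c * s" using assms by (intro mult_left_mono) auto
  then have y: "0 < y" "c \<le> y" using cs assms(2) by linarith+
  note b = one_minus_exp_bounds[OF y(1)]
  have e: "exp (- y) \<le> exp (- c)" using y by simp
  have c1: "0 < 1 - exp (- c)" using assms by simp
  have 1: "\<bar>\<mu>\<bar> / (1 - exp (- y)) \<le> C / (1 - exp (- c))"
    using e c1 assms by (intro frac_le) auto
  have 2: "exp (- y) * (\<bar>\<mu>\<bar> / (1 - exp (- y))) \<le> exp (- c * s) * (C / (1 - exp (- c)))"
    using 1 cs b by (intro mult_mono) auto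
  have 3: "exp (- y) * (\<bar>\<mu>\<bar> / (1 - exp (- y))) \<le> 1 * (\<bar>\<mu>\<bar> / (1 - exp (- y)))"
    using y b by (intro mult_right_mono) auto
  show "\<bar>bfac e \<mu> (exp (- s))\<bar> \<le> C / (1 - exp (- c))"
    using 1 3 b y by (auto simp: bfac_def exp_powr y_def[symmetric] abs_mult)
  have "bfac e \<mu> (exp (- s)) - (if e then \<bar>\<mu>\<bar> else 0) = exp (- y) * (\<bar>\<mu>\<bar> / (1 - exp (- y)))"
    using b by (simp add: bfac_def exp_powr y_def[symmetric] field_simps)
  then show "\<bar>bfac e \<mu> (exp (- s)) - (if e then \<bar>\<mu>\<bar> else 0)\<bar> \<le> C / (1 - exp (- c)) * exp (- c * s)"
    using 2 b by (simp add: abs_mult mult.commute)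
qed

lemma coth_scalar_abs:
  assumes "y \<noteq> 0"
  shows "coth_scalar y = \<bar>y\<bar> * ((1 + exp (- \<bar>y\<bar>)) / (1 - exp (- \<bar>y\<bar>)))"
proof (cases "y > 0")
  case True
  then have "exp y > 1" by simp
  then show ?thesis using True unfolding coth_scalar_eq[OF assms] by (simp add: exp_minus field_simps)
next
  case False
  then have "exp y < 1" using assms by simp
  then show ?thesis using False unfolding coth_scalar_eq[OF assms] by (simp add: field_simps)
qed

text \<open>The bracket equals x / (exp x - 1) at x = s \<mu>, and multiplication by exp x turns it
  into x / (1 - exp (-x)). Rewriting with |\<mu>| swaps the two forms when \<mu> < 0, whence the
  comparison of l with the sign of \<mu>. This identity dictates the determinant and the exponential
  in \<open>symbol\<close>.\<close>

lemma coth_scalar_bfac: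
  assumes "0 < s" "\<mu> \<noteq> 0"
  shows "(coth_scalar (s * \<mu>) - s * \<mu>) / 2 * (if l then exp (s * \<mu>) else 1) = s * bfac (l = (0 < \<mu>)) \<mu> (exp (- s))"
proof -
  define x where "x = s * \<mu>"
  have x: "x \<noteq> 0" "x > 0 \<longleftrightarrow> \<mu> > 0" "x = s * \<mu>" using assms by (auto simp: x_def zero_less_mult_iff)
  have ne: "exp x - 1 \<noteq> 0" "1 - exp x \<noteq> 0" using x by auto
  have aux: "(x * (u + 2) / u - x) / 2 = x / u" if "u \<noteq> 0" for u
    using that by (simp add: field_simps)
  have "(coth_scalar x - x) / 2 = x / (exp x - 1)"
  proof -
    have "exp x - 1 + 2 = exp x + 1" by simp
    with aux[OF ne(1)] show ?thesis unfolding coth_scalar_eq[OF x(1)] by (simp only:)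
  qed
  then have l: "(coth_scalar (s * \<mu>) - s * \<mu>) / 2 = x / (exp x - 1)" by (simp only: x_def)
  have ux: "exp x \<noteq> 0" "exp x \<noteq> 1" using x(1) by auto
  have pos: "s * m / (u - 1) * u = s * (m / (1 - 1 / u))" "s * m / (u - 1) * 1 = s * (1 / u * m / (1 - 1 / u))"
    if "u \<noteq> 0" "u \<noteq> 1" for u m :: real
    using that by (simp_all add: divide_simps)
  have neg: "s * m / (u - 1) * u = s * (u * - m / (1 - u))" "s * m / (u - 1) * 1 = s * (- m / (1 - u))"
    if "u \<noteq> 1" for u m :: real
    using that by (simp_all add: divide_simps) (simp_all add: algebra_simps)
  show ?thesis
  proof (cases "\<mu> > 0")
    case True
    have E: "exp (- (s * \<bar>\<mu>\<bar>)) = 1 / exp x" using True by (simp add: x_def exp_minus inverse_eq_divide)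
    have "\<bar>\<mu>\<bar> = \<mu>" "(l = (0 < \<mu>)) = l" using True by auto
    then show ?thesis unfolding l bfac_def exp_powr E unfolding x(3)[symmetric]
      using pos[OF ux, of \<mu>] by (cases l) (simp_all only: x(3)[symmetric] if_True if_False)
  next
    case False
    then have am: "\<bar>\<mu>\<bar> = - \<mu>" "(l = (0 < \<mu>)) = (\<not> l)" by auto
    have E: "exp (- (s * \<bar>\<mu>\<bar>)) = exp x" unfolding am by (simp add: x_def)
    show ?thesis unfolding l bfac_def exp_powr E unfolding am x(3)[symmetric]
      using neg[OF ux(2), of \<mu>]
      by (cases l) (simp_all only: x(3)[symmetric] if_True if_False not_True_eq_False not_False_eq_True)
  qed
qed

lemma exp_substitution:
  fixes G :: "real \<Rightarrow> complex"
  assumes [measurable]: "G \<in> borel_measurable borel" and int: "set_integrable lborel {0<..} G"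
  shows "(LINT r:{0<..<1}|lborel. G (- ln r) / of_real r) = (LINT s:{0<..}|lborel. G s)"
proof -
  let ?S = "{0<..<1::real}"
  have img: "(\<lambda>r. - ln r) ` ?S = {0<..}"
  proof
    show "{0<..} \<subseteq> (\<lambda>r. - ln r) ` ?S"
    proof
      fix s :: real assume "s \<in> {0<..}"
      then show "s \<in> (\<lambda>r. - ln r) ` ?S" by (intro image_eqI[of _ _ "exp (- s)"]) auto
    qed
  qed auto
  \<comment> \<open>With r = exp (-s), dr / r becomes ds. The change of variables is carried out for
    Lebesgue measure, so the integrals pass to the completion and back.\<close>
  have ai: "G absolutely_integrable_on {0<..}"
    using int unfolding set_integrable_def by (rule integrable_completion[THEN iffD2, rotated]) (simp add: borel_measurable_scaleR)
  have "(\<lambda>r. \<bar>- (1 / r)\<bar> *\<^sub>R G (- ln r)) absolutely_integrable_on ?S \<and>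
      integral ?S (\<lambda>r. \<bar>- (1 / r)\<bar> *\<^sub>R G (- ln r)) = integral {0<..} G"
    by (subst has_absolute_integral_change_of_variables_real[where g = "\<lambda>r. - ln r"])
       (use ai in \<open>auto simp: img inj_on_def intro!: derivative_eq_intros simp: divide_inverse\<close>)
  then have *: "(\<lambda>r. \<bar>- (1 / r)\<bar> *\<^sub>R G (- ln r)) absolutely_integrable_on ?S"
      "integral ?S (\<lambda>r. \<bar>- (1 / r)\<bar> *\<^sub>R G (- ln r)) = integral {0<..} G" by blast+
  have "(LINT r:?S|lborel. G (- ln r) / of_real r) = (LINT r:?S|lborel. \<bar>- (1 / r)\<bar> *\<^sub>R G (- ln r))"
    by (rule set_lebesgue_integral_cong) (auto simp: scaleR_conv_of_real divide_inverse mult.commute)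
  also have "\<dots> = (LINT r:?S|lebesgue. \<bar>- (1 / r)\<bar> *\<^sub>R G (- ln r))"
    unfolding set_lebesgue_integral_def by (rule integral_completion[symmetric]) measurable
  also have "\<dots> = integral ?S (\<lambda>r. \<bar>- (1 / r)\<bar> *\<^sub>R G (- ln r))"
    by (rule set_lebesgue_integral_eq_integral(2)[OF *(1)])
  also have "\<dots> = (LINT s:{0<..}|lborel. G s)"
    unfolding *(2) by (rule set_borel_integral_eq_integral(2)[OF int, symmetric])
  finally show ?thesis .
qed

lemma set_integral_scale:
  fixes G :: "real \<Rightarrow> complex"
  shows "(LINT s:{0<..}|lborel. G s) = 2 * (LINT s:{0<..}|lborel. G (2 * s))"
  unfolding set_lebesgue_integral_def
  by (subst lborel_integral_real_affine[where c = 2 and t = 0])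
     (auto simp: scaleR_conv_of_real indicator_def zero_less_mult_iff intro!: Bochner_Integration.integral_cong)

lemma set_integrable_scale:
  fixes G :: "real \<Rightarrow> complex"
  assumes "set_integrable lborel {0<..} G"
  shows "set_integrable lborel {0<..} (\<lambda>s. G (2 * s))"
proof -
  have "integrable lborel (\<lambda>s. indicator {0<..} (0 + 2 * s) *\<^sub>R G (0 + 2 * s))"
    using assms unfolding set_integrable_def by (subst lborel_integrable_real_affine_iff[of 2 "\<lambda>s. indicator {0<..} s *\<^sub>R G s" 0]) auto
  moreover have "indicator {0<..} (0 + 2 * s) = (indicator {0<..} s :: real)" for s :: real
    by (auto simp: indicator_def)
  ultimately show ?thesis unfolding set_integrable_def by simp
qed

section \<open>The spectral gap and the symbol on real directions\<close>

context quadric begin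

lemma diag:
  assumes "\<nu> \<in> sphere 0 1"
  shows "unitary (U \<nu>)" "levi \<nu> *v column j (U \<nu>) = of_real (\<mu> \<nu> j) *s column j (U \<nu>)" "0 < \<mu> \<nu> j \<longleftrightarrow> j \<in> P"
  using diagonalization assms unfolding levi_diagonalization_def by blast+

lemma column_norm:
  assumes "\<nu> \<in> sphere 0 1"
  shows "norm (column j (U \<nu>)) = 1"
proof -
  have "of_real ((norm (column j (U \<nu>)))\<^sup>2) = (1 :: complex)"
    using unitary_columns[OF diag(1)[OF assms], of j j] unfolding cip_self[symmetric] cip_def by (simp add: column_def)
  then have "(norm (column j (U \<nu>)))\<^sup>2 = 1" by (metis of_real_eq_1_iff)
  then show ?thesis using norm_ge_zero[of "column j (U \<nu>)"] by (simp add: power2_eq_1_iff)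
qed

lemma entry_U_le_1:
  assumes "\<nu> \<in> sphere 0 1"
  shows "cmod (U \<nu> $ a $ b) \<le> 1"
  using Finite_Cartesian_Product.norm_nth_le[of "column b (U \<nu>)" a] column_norm[OF assms] by (simp add: column_def)

lemma norm_levi_column:
  assumes "\<nu> \<in> sphere 0 1"
  shows "norm (levi \<nu> *v column j (U \<nu>)) = \<bar>\<mu> \<nu> j\<bar>"
proof -
  have "norm (c *s v) = cmod c * norm v" for c and v :: "'d cvec"
    by (simp add: norm_vec_def L2_set_def norm_mult power_mult_distrib sum_distrib_left[symmetric] real_sqrt_mult)
  then show ?thesis by (simp add: diag(2)[OF assms] column_norm[OF assms])
qed

lemma eigenvalue_le:
  assumes "\<nu> \<in> sphere 0 1"
  shows "\<bar>\<mu> \<nu> j\<bar> \<le> levi_bound"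
  using norm_matrix_vector_le[of "levi \<nu>" "column j (U \<nu>)"] entry_norm_levi[of \<nu>] assms
  by (simp add: norm_levi_column column_norm)

text \<open>Continuity of \<mu> in \<nu> is not at hand, so compactness is applied to pairs of unit
  vectors (\<nu>, v) and the norm of the Levi matrix of \<nu> applied to v. Nondegeneracy makes the
  minimum positive, and unit eigenvectors give the gap.\<close>

lemma ex_gap: "\<exists>c>0. \<forall>\<nu>\<in>sphere 0 1. \<forall>j. c \<le> \<bar>\<mu> \<nu> j\<bar>"
proof -
  let ?S = "sphere 0 1 \<times> sphere 0 1 :: ('m rvec \<times> 'd cvec) set"
  have cont: "continuous_on ?S (\<lambda>p. norm (levi (fst p) *v snd p))"
    unfolding matrix_vector_mult_def levi_nth by (intro continuous_intros continuous_on_vec_lambda)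
  have "compact ?S" by (intro compact_Times) auto
  moreover have "?S \<noteq> {}"
    using vector_choose_size[of 1, where 'a = "'m rvec"] vector_choose_size[of 1, where 'a = "'d cvec"] by auto
  ultimately obtain p where p: "p \<in> ?S" "\<And>q. q \<in> ?S \<Longrightarrow> norm (levi (fst p) *v snd p) \<le> norm (levi (fst q) *v snd q)"
    using continuous_attains_inf[OF _ _ cont] by blast
  have "norm (levi (fst p) *v snd p) > 0"
  proof (rule ccontr)
    assume "\<not> norm (levi (fst p) *v snd p) > 0"
    then have "levi (fst p) *v snd p = 0 *s snd p" by simp
    moreover have "snd p \<noteq> 0" using p(1) by auto
    ultimately have "is_eigenvalue (levi (fst p)) 0" unfolding is_eigenvalue_def by blast
    then show False using nondegenerate p(1) by auto
  qed
  moreover have "norm (levi (fst p) *v snd p) \<le> \<bar>\<mu> \<nu> j\<bar>" if "\<nu> \<in> sphere 0 1" for \<nu> j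
    using p(2)[of "(\<nu>, column j (U \<nu>))"] that by (simp add: norm_levi_column column_norm)
  ultimately show ?thesis by blast
qed

definition gap :: real where "gap = (SOME c. c > 0 \<and> (\<forall>\<nu>\<in>sphere 0 1. \<forall>j. c \<le> \<bar>\<mu> \<nu> j\<bar>))"

lemma gap: "0 < gap" "\<nu> \<in> sphere 0 1 \<Longrightarrow> gap \<le> \<bar>\<mu> \<nu> j\<bar>"
  using someI_ex[OF ex_gap[unfolded Bex_def]] unfolding gap_def by auto

lemma mu_nonzero: "\<nu> \<in> sphere 0 1 \<Longrightarrow> \<mu> \<nu> j \<noteq> 0"
  using gap(1) gap(2)[of \<nu> j] by auto

text \<open>The columns of U form an orthonormal eigenbasis; inserting the completeness relation of
  the rows of U rebuilds the matrix from its action on them.\<close>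

lemma levi_sdiag:
  assumes "\<nu> \<in> sphere 0 1"
  shows "levi (s *\<^sub>R \<nu>) = sdiag (U \<nu>) (\<lambda>j. of_real (s * \<mu> \<nu> j))"
proof -
  have col: "(\<Sum>k\<in>UNIV. levi \<nu> $ a $ k * U \<nu> $ k $ j) = of_real (\<mu> \<nu> j) * U \<nu> $ a $ j" for a j
    using arg_cong[OF diag(2)[OF assms, of j], of "\<lambda>v. v $ a"] by (simp add: matrix_vector_mult_def column_def)
  have "levi \<nu> $ a $ b = (\<Sum>j\<in>UNIV. U \<nu> $ a $ j * of_real (\<mu> \<nu> j) * cnj (U \<nu> $ b $ j))" for a b
  proof -
    have "(\<Sum>j\<in>UNIV. U \<nu> $ a $ j * of_real (\<mu> \<nu> j) * cnj (U \<nu> $ b $ j)) =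
      (\<Sum>j\<in>UNIV. (\<Sum>k\<in>UNIV. levi \<nu> $ a $ k * U \<nu> $ k $ j) * cnj (U \<nu> $ b $ j))"
      unfolding col by (simp add: mult.commute)
    also have "\<dots> = (\<Sum>j\<in>UNIV. \<Sum>k\<in>UNIV. levi \<nu> $ a $ k * (U \<nu> $ k $ j * cnj (U \<nu> $ b $ j)))"
      by (simp add: sum_distrib_right mult.assoc)
    also have "\<dots> = (\<Sum>k\<in>UNIV. \<Sum>j\<in>UNIV. levi \<nu> $ a $ k * (U \<nu> $ k $ j * cnj (U \<nu> $ b $ j)))"
      by (rule sum.swap)
    also have "\<dots> = (\<Sum>k\<in>UNIV. levi \<nu> $ a $ k * (if k = b then 1 else 0))"
      by (simp only: sum_distrib_left[symmetric] unitary_rows[OF diag(1)[OF assms]])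
    also have "\<dots> = levi \<nu> $ a $ b"
      by (simp add: if_distrib[of "\<lambda>x. _ * x"] sum.delta cong: if_cong)
    finally show ?thesis ..
  qed
  then show ?thesis
    by (simp add: vec_eq_iff sdiag_nth levi_scaleR sum_distrib_left mult_ac)
qed

definition form_weight :: "'d set \<Rightarrow> 'd set \<Rightarrow> 'd set \<Rightarrow> 'm rvec \<Rightarrow> complex" where
  "form_weight K J L \<nu> = minor_det (conj_matrix (U \<nu>)) K L * dZbar_wedge (U \<nu>) L J"

text \<open>The determinant supplies (x coth (x/2) - x) / 2 for each eigenvalue x = s \<mu>, and the
  compound matrix of the exponential supplies exp x for the indices in L.
  \<open>coth_scalar_bfac\<close> merges the two into B_L, with one power of s per index.\<close>

lemma symbol_levi:
  assumes \<nu>: "\<nu> \<in> sphere 0 1" and s: "0 < s"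
  shows "symbol K J (levi (s *\<^sub>R \<nu>)) =
    of_real (s ^ CARD('d)) * (\<Sum>L\<in>tuples (card K). form_weight K J L \<nu> * of_real (B_fun P (\<mu> \<nu>) L (exp (- s))))"
proof -
  note un = diag(1)[OF \<nu>]
  let ?x = "\<lambda>j. s * \<mu> \<nu> j"
  let ?b = "\<lambda>j. of_real ((coth_scalar (?x j) - ?x j) / 2) :: complex"
  have "(\<chi> a b. (xcoth (levi (s *\<^sub>R \<nu>)) $ a $ b - levi (s *\<^sub>R \<nu>) $ a $ b) / 2) = sdiag (U \<nu>) ?b"
    unfolding levi_sdiag[OF \<nu>] xcoth_sdiag[OF un]
    by (simp add: vec_eq_iff sdiag_nth sum_subtractf[symmetric] sum_divide_distrib algebra_simps diff_divide_distrib)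
  then have d: "det (\<chi> a b. (xcoth (levi (s *\<^sub>R \<nu>)) $ a $ b - levi (s *\<^sub>R \<nu>) $ a $ b) / 2) = (\<Prod>j\<in>UNIV. ?b j)"
    by (simp only: det_sdiag[OF un])
  have p: "(\<Prod>j\<in>UNIV. ?b j) * (\<Prod>j\<in>L. exp (of_real (?x j))) = of_real (s ^ CARD('d) * B_fun P (\<mu> \<nu>) L (exp (- s)))" for L
  proof -
    have "(\<Prod>j\<in>L. exp (of_real (?x j))) = (\<Prod>j\<in>UNIV. if j \<in> L then exp (of_real (?x j)) else (1 :: complex))"
      by (simp add: prod.If_cases)
    then have "(\<Prod>j\<in>UNIV. ?b j) * (\<Prod>j\<in>L. exp (of_real (?x j))) = (\<Prod>j\<in>UNIV. ?b j * (if j \<in> L then exp (of_real (?x j)) else 1))"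
      by (simp only: prod.distrib)
    also have "\<dots> = (\<Prod>j\<in>UNIV. of_real (s * bfac ((j \<in> L) = (j \<in> P)) (\<mu> \<nu> j) (exp (- s))))"
    proof (rule prod.cong[OF refl])
      fix j
      have "?b j * (if j \<in> L then exp (of_real (?x j)) else 1) = of_real ((coth_scalar (?x j) - ?x j) / 2 * (if j \<in> L then exp (?x j) else 1))"
        by (cases "j \<in> L") (simp_all only: if_True if_False exp_of_real of_real_mult[symmetric] mult_1_right)
      then show "?b j * (if j \<in> L then exp (of_real (?x j)) else 1) = of_real (s * bfac ((j \<in> L) = (j \<in> P)) (\<mu> \<nu> j) (exp (- s)))"
        by (simp only: coth_scalar_bfac[OF s mu_nonzero[OF \<nu>]] diag(3)[OF \<nu>])
    qed
    also have "\<dots> = of_real (s ^ CARD('d) * B_fun P (\<mu> \<nu>) L (exp (- s)))"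
      by (simp add: B_fun_eq prod.distrib)
    finally show ?thesis .
  qed
  have "symbol K J (levi (s *\<^sub>R \<nu>)) = (\<Prod>j\<in>UNIV. ?b j) * (\<Sum>L\<in>tuples (card K). form_weight K J L \<nu> * (\<Prod>j\<in>L. exp (of_real (?x j))))"
    unfolding symbol_def d by (simp only: levi_sdiag[OF \<nu>] mexp_sdiag[OF un] dZbar_wedge_sdiag form_weight_def)
  also have "\<dots> = (\<Sum>L\<in>tuples (card K). form_weight K J L \<nu> * ((\<Prod>j\<in>UNIV. ?b j) * (\<Prod>j\<in>L. exp (of_real (?x j)))))"
    by (simp add: sum_distrib_left mult_ac)
  also have "\<dots> = of_real (s ^ CARD('d)) * (\<Sum>L\<in>tuples (card K). form_weight K J L \<nu> * of_real (B_fun P (\<mu> \<nu>) L (exp (- s))))"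
    unfolding p by (simp add: sum_distrib_left mult_ac)
  finally show ?thesis .
qed

lemma cip_xcoth_levi:
  assumes \<nu>: "\<nu> \<in> sphere 0 1" and s: "0 < s"
  shows "cip z (xcoth (levi (s *\<^sub>R \<nu>)) *v z) = of_real (s * A_fun (\<mu> \<nu>) (U \<nu>) (exp (- s)) z)"
proof -
  have "coth_scalar (s * \<mu> \<nu> j) = s * (\<bar>\<mu> \<nu> j\<bar> * ((1 + exp (- s) powr \<bar>\<mu> \<nu> j\<bar>) / (1 - exp (- s) powr \<bar>\<mu> \<nu> j\<bar>)))" for j
    using coth_scalar_abs[of "s * \<mu> \<nu> j"] mu_nonzero[OF \<nu>, of j] s by (simp add: exp_powr abs_mult)
  then show ?thesis
    unfolding levi_sdiag[OF \<nu>] xcoth_sdiag[OF diag(1)[OF \<nu>]] cip_sdiag A_fun_def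
    by (simp add: sum_distrib_left mult.assoc)
qed

end

section \<open>The integrand in the radial variable and its limit\<close>

lemma measurable_cnj: "cnj \<in> borel_measurable borel"
  by (intro borel_measurable_continuous_onI continuous_intros)

context quadric begin

lemma near_hermitian_levi: "near_hermitian 0 (levi x)"
proof -
  have "(0 :: 'd cmat) *v v = 0" for v by (simp add: matrix_vector_mult_def vec_eq_iff)
  then show ?thesis unfolding near_hermitian_def
    using hermitian_levi[of x] by (intro exI[of _ "levi x"] exI[of _ 0]) (simp add: vec_eq_iff)
qed

lemma sum_rotated:
  assumes "\<nu> \<in> sphere 0 1"
  shows "(\<Sum>j\<in>UNIV. (cmod ((ctranspose (U \<nu>) *v z) $ j))\<^sup>2) = (norm z)\<^sup>2"
proof -
  have "cip z (sdiag (U \<nu>) (\<lambda>_. 1) *v z) = of_real (\<Sum>j\<in>UNIV. (cmod ((ctranspose (U \<nu>) *v z) $ j))\<^sup>2)"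
    by (simp add: cip_sdiag)
  then have "of_real ((norm z)\<^sup>2) = (of_real (\<Sum>j\<in>UNIV. (cmod ((ctranspose (U \<nu>) *v z) $ j))\<^sup>2) :: complex)"
    by (simp only: sdiag_1[OF diag(1)[OF assms]] matrix_vector_mul_lid cip_self)
  then show ?thesis by (simp only: of_real_eq_iff)
qed

text \<open>Taken to be at least 1 so that it can serve as R in \<open>norm_prod_diff_le\<close>; it
  also bounds every |\<mu>|.\<close>

definition bfac_const :: real where "bfac_const = max 1 (levi_bound / (1 - exp (- gap)))"

lemma bfac_const_ge_1: "1 \<le> bfac_const" by (simp add: bfac_const_def)

lemma eigenvalue_le_bfac_const: "\<nu> \<in> sphere 0 1 \<Longrightarrow> \<bar>\<mu> \<nu> j\<bar> \<le> bfac_const"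
proof -
  assume "\<nu> \<in> sphere 0 1"
  then have "\<bar>\<mu> \<nu> j\<bar> \<le> levi_bound / 1" using eigenvalue_le by simp
  also have "\<dots> \<le> levi_bound / (1 - exp (- gap))"
    using gap(1) levi_bound_ge_1 by (intro divide_left_mono) auto
  finally show ?thesis by (simp add: bfac_const_def)
qed

lemma bfac_bounds:
  assumes "\<nu> \<in> sphere 0 1" "1 \<le> s"
  shows "\<bar>bfac e (\<mu> \<nu> j) (exp (- s))\<bar> \<le> bfac_const"
    "\<bar>bfac e (\<mu> \<nu> j) (exp (- s)) - (if e then \<bar>\<mu> \<nu> j\<bar> else 0)\<bar> \<le> bfac_const * exp (- gap * s)"
proof -
  note b = bfac_large[OF assms(2) gap(1) gap(2)[OF assms(1)] eigenvalue_le[OF assms(1)], of e j]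
  show "\<bar>bfac e (\<mu> \<nu> j) (exp (- s))\<bar> \<le> bfac_const" using b(1) by (simp add: bfac_const_def)
  have "levi_bound / (1 - exp (- gap)) * exp (- gap * s) \<le> bfac_const * exp (- gap * s)"
    by (intro mult_right_mono) (auto simp: bfac_const_def)
  then show "\<bar>bfac e (\<mu> \<nu> j) (exp (- s)) - (if e then \<bar>\<mu> \<nu> j\<bar> else 0)\<bar> \<le> bfac_const * exp (- gap * s)"
    using b(2) by linarith
qed

text \<open>The value of B_L at r = 0. It vanishes unless L = P, where it is the modulus of the Levi
  determinant; hence only L = P carries a counterterm.\<close>

definition B_lim :: "'d set \<Rightarrow> 'm rvec \<Rightarrow> real" where
  "B_lim L \<nu> = (\<Prod>j\<in>UNIV. if (j \<in> L) = (j \<in> P) then \<bar>\<mu> \<nu> j\<bar> else 0)"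

lemma B_lim_eq_0: "L \<noteq> P \<Longrightarrow> B_lim L \<nu> = 0"
  unfolding B_lim_def by (rule prod_zero) auto

lemma det_levi:
  assumes "\<nu> \<in> sphere 0 1"
  shows "cmod (det (levi \<nu>)) = B_lim P \<nu>"
  using levi_sdiag[OF assms, of 1] det_sdiag[OF diag(1)[OF assms], of "\<lambda>j. of_real (\<mu> \<nu> j)"]
  by (simp add: B_lim_def prod_norm[symmetric])

lemma B_fun_small:
  assumes "\<nu> \<in> sphere 0 1" "0 < s" "s \<le> 1"
  shows "\<bar>B_fun P (\<mu> \<nu>) L (exp (- s))\<bar> \<le> exp levi_bound ^ CARD('d) / s ^ CARD('d)"
proof -
  have "\<bar>B_fun P (\<mu> \<nu>) L (exp (- s))\<bar> \<le> (\<Prod>j\<in>(UNIV::'d set). exp levi_bound / s)"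
    unfolding B_fun_eq abs_prod
    by (intro prod_mono conjI bfac_small assms mu_nonzero eigenvalue_le) auto
  then show ?thesis by (simp add: power_divide)
qed

lemma B_fun_large:
  assumes "\<nu> \<in> sphere 0 1" "1 \<le> s"
  shows "\<bar>B_fun P (\<mu> \<nu>) L (exp (- s))\<bar> \<le> bfac_const ^ CARD('d)"
    "\<bar>B_fun P (\<mu> \<nu>) L (exp (- s)) - B_lim L \<nu>\<bar> \<le> real CARD('d) * bfac_const ^ CARD('d) * (bfac_const * exp (- gap * s))"
proof -
  have "\<bar>B_fun P (\<mu> \<nu>) L (exp (- s))\<bar> \<le> (\<Prod>j\<in>(UNIV::'d set). bfac_const)"
    unfolding B_fun_eq abs_prod by (intro prod_mono conjI bfac_bounds assms) auto
  then show "\<bar>B_fun P (\<mu> \<nu>) L (exp (- s))\<bar> \<le> bfac_const ^ CARD('d)" by simp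
  have "norm (B_fun P (\<mu> \<nu>) L (exp (- s)) - B_lim L \<nu>) \<le> real CARD('d) * bfac_const ^ CARD('d) * (bfac_const * exp (- gap * s))"
    unfolding B_fun_eq B_lim_def
  proof (rule norm_prod_diff_le[OF finite bfac_const_ge_1])
    fix j
    show "norm (bfac ((j \<in> L) = (j \<in> P)) (\<mu> \<nu> j) (exp (- s))) \<le> bfac_const"
      using bfac_bounds(1)[OF assms] by (simp only: real_norm_def)
    show "norm (if (j \<in> L) = (j \<in> P) then \<bar>\<mu> \<nu> j\<bar> else 0) \<le> bfac_const"
      using eigenvalue_le_bfac_const[OF assms(1), of j] bfac_const_ge_1 by simp
    show "norm (bfac ((j \<in> L) = (j \<in> P)) (\<mu> \<nu> j) (exp (- s)) - (if (j \<in> L) = (j \<in> P) then \<bar>\<mu> \<nu> j\<bar> else 0)) \<le> bfac_const * exp (- gap * s)"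
      using bfac_bounds(2)[OF assms] by (simp only: real_norm_def)
  qed (use bfac_const_ge_1 in auto)
  then show "\<bar>B_fun P (\<mu> \<nu>) L (exp (- s)) - B_lim L \<nu>\<bar> \<le> real CARD('d) * bfac_const ^ CARD('d) * (bfac_const * exp (- gap * s))"
    by simp
qed

lemma B_lim_le: "\<nu> \<in> sphere 0 1 \<Longrightarrow> \<bar>B_lim L \<nu>\<bar> \<le> bfac_const ^ CARD('d)"
proof -
  assume \<nu>: "\<nu> \<in> sphere 0 1"
  have "\<bar>B_lim L \<nu>\<bar> \<le> (\<Prod>j\<in>(UNIV::'d set). bfac_const)"
    unfolding B_lim_def abs_prod using eigenvalue_le_bfac_const[OF \<nu>] bfac_const_ge_1 by (intro prod_mono) auto
  then show ?thesis by simp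
qed

abbreviation Af :: "'m rvec \<Rightarrow> real \<Rightarrow> 'd cvec \<Rightarrow> real" where
  "Af \<nu> r z \<equiv> A_fun (\<mu> \<nu>) (U \<nu>) r z"

text \<open>Coercivity for a Hermitian matrix, divided by s. This growth 1/s of A compensates the
  singularity of B_L at s = 0.\<close>

lemma A_fun_lower_small:
  assumes "\<nu> \<in> sphere 0 1" "0 < s"
  shows "(norm z)\<^sup>2 / s \<le> Af \<nu> (exp (- s)) z"
  using Re_cip_xcoth[OF near_hermitian_levi, of z "s *\<^sub>R \<nu>"] assms
  by (simp add: cip_xcoth_levi divide_le_eq mult.commute)

lemma A_fun_0: "Af \<nu> 0 z = (\<Sum>j\<in>UNIV. \<bar>\<mu> \<nu> j\<bar> * (cmod ((ctranspose (U \<nu>) *v z) $ j))\<^sup>2)"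
  by (simp add: A_fun_def)

text \<open>(1 + E) / (1 - E) = 1 + 2 E / (1 - E): the deviation of A from its value at r = 0 is
  made of the same small factors as that of B_L.\<close>

lemma A_fun_diff:
  assumes "\<nu> \<in> sphere 0 1" "0 < s"
  shows "Af \<nu> (exp (- s)) z = Af \<nu> 0 z + 2 * (\<Sum>j\<in>UNIV. bfac False (\<mu> \<nu> j) (exp (- s)) * (cmod ((ctranspose (U \<nu>) *v z) $ j))\<^sup>2)"
proof -
  have "\<bar>\<mu> \<nu> j\<bar> * ((1 + exp (- s) powr \<bar>\<mu> \<nu> j\<bar>) / (1 - exp (- s) powr \<bar>\<mu> \<nu> j\<bar>)) = \<bar>\<mu> \<nu> j\<bar> + 2 * bfac False (\<mu> \<nu> j) (exp (- s))" for j
  proof -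
    have "exp (- s) powr \<bar>\<mu> \<nu> j\<bar> < 1" using assms mu_nonzero[OF assms(1), of j] by (simp add: exp_powr)
    then show ?thesis by (simp add: bfac_def field_simps)
  qed
  then show ?thesis
    unfolding A_fun_0 by (simp add: A_fun_def distrib_right sum.distrib sum_distrib_left mult.assoc)
qed

lemma A_fun_0_lower:
  assumes "\<nu> \<in> sphere 0 1"
  shows "gap * (norm z)\<^sup>2 \<le> Af \<nu> 0 z"
  unfolding A_fun_0 sum_rotated[OF assms, symmetric] sum_distrib_left
  by (intro sum_mono mult_right_mono gap(2)[OF assms]) auto

lemma A_fun_lower:
  assumes "\<nu> \<in> sphere 0 1" "0 < s"
  shows "gap * (norm z)\<^sup>2 \<le> Af \<nu> (exp (- s)) z"
proof -
  have "0 \<le> bfac False (\<mu> \<nu> j) (exp (- s))" for j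
    using assms(2) by (auto simp: bfac_def exp_powr intro!: divide_nonneg_nonneg)
  then have "0 \<le> (\<Sum>j\<in>UNIV. bfac False (\<mu> \<nu> j) (exp (- s)) * (cmod ((ctranspose (U \<nu>) *v z) $ j))\<^sup>2)"
    by (intro sum_nonneg mult_nonneg_nonneg) auto
  then show ?thesis using A_fun_diff[OF assms, of z] A_fun_0_lower[OF assms(1), of z] by linarith
qed

lemma A_fun_diff_le:
  assumes "\<nu> \<in> sphere 0 1" "1 \<le> s"
  shows "\<bar>Af \<nu> (exp (- s)) z - Af \<nu> 0 z\<bar> \<le> 2 * (bfac_const * exp (- gap * s)) * (norm z)\<^sup>2"
proof -
  have "\<bar>\<Sum>j\<in>UNIV. bfac False (\<mu> \<nu> j) (exp (- s)) * (cmod ((ctranspose (U \<nu>) *v z) $ j))\<^sup>2\<bar> \<le>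
    (\<Sum>j\<in>UNIV. (bfac_const * exp (- gap * s)) * (cmod ((ctranspose (U \<nu>) *v z) $ j))\<^sup>2)"
  proof (rule order.trans[OF sum_abs sum_mono])
    fix j
    have "\<bar>bfac False (\<mu> \<nu> j) (exp (- s))\<bar> \<le> bfac_const * exp (- gap * s)"
      using bfac_bounds(2)[OF assms, of False j] by simp
    then show "\<bar>bfac False (\<mu> \<nu> j) (exp (- s)) * (cmod ((ctranspose (U \<nu>) *v z) $ j))\<^sup>2\<bar> \<le>
      (bfac_const * exp (- gap * s)) * (cmod ((ctranspose (U \<nu>) *v z) $ j))\<^sup>2"
      unfolding abs_mult by (intro mult_mono) auto
  qed
  also have "\<dots> = (bfac_const * exp (- gap * s)) * (norm z)\<^sup>2"
    by (simp only: sum_distrib_left[symmetric] sum_rotated[OF assms(1)])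
  finally show ?thesis using A_fun_diff[OF assms(1), of s z] assms(2) by simp
qed

definition den :: "'m rvec \<Rightarrow> real \<Rightarrow> 'd cvec \<Rightarrow> 'm rvec \<Rightarrow> complex" where
  "den \<nu> r z t = of_real (Af \<nu> r z) - \<i> * of_real (\<nu> \<bullet> t)"

lemma den_lower:
  assumes "a \<le> Af \<nu> r z"
  shows "a \<le> cmod (den \<nu> r z t)"
  using complex_Re_le_cmod[of "den \<nu> r z t"] assms by (simp add: den_def)

text \<open>The integrand in the variable s = -ln r, in which dr / r is ds.\<close>

definition F :: "'d set \<Rightarrow> 'm rvec \<Rightarrow> 'd cvec \<Rightarrow> 'm rvec \<Rightarrow> real \<Rightarrow> complex" where
  "F L \<nu> z t s = of_real (B_fun P (\<mu> \<nu>) L (exp (- s))) / den \<nu> (exp (- s)) z t ^ (CARD('d) + CARD('m) - 1)"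

definition F_lim :: "'d set \<Rightarrow> 'm rvec \<Rightarrow> 'd cvec \<Rightarrow> 'm rvec \<Rightarrow> complex" where
  "F_lim L \<nu> z t = of_real (B_lim L \<nu>) / den \<nu> 0 z t ^ (CARD('d) + CARD('m) - 1)"

text \<open>With d = \<open>CARD('d)\<close> and m = \<open>CARD('m)\<close>, the d singular factors
  1/s of B_L meet s^(d + m - 1) from the inverse denominator, which leaves s^(m - 1) \<le>
  1.\<close>

lemma F_small:
  assumes "\<nu> \<in> sphere 0 1" "0 < s" "s \<le> 1" "z \<noteq> 0"
  shows "cmod (F L \<nu> z t s) \<le> exp levi_bound ^ CARD('d) / ((norm z)\<^sup>2) ^ (CARD('d) + CARD('m) - 1)"
proof -
  let ?z = "(norm z)\<^sup>2"
  have z: "?z > 0" using assms by simp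
  have "?z / s \<le> cmod (den \<nu> (exp (- s)) z t)" by (rule den_lower[OF A_fun_lower_small[OF assms(1,2)]])
  then have d: "(?z / s) ^ (CARD('d) + CARD('m) - 1) \<le> cmod (den \<nu> (exp (- s)) z t) ^ (CARD('d) + CARD('m) - 1)"
    using z assms by (intro power_mono) auto
  have "cmod (F L \<nu> z t s) \<le> (exp levi_bound ^ CARD('d) / s ^ CARD('d)) / (?z / s) ^ (CARD('d) + CARD('m) - 1)"
    unfolding F_def norm_divide norm_power norm_of_real
    using d z assms B_fun_small[OF assms(1-3), of L] by (intro frac_le) auto
  also have "\<dots> = exp levi_bound ^ CARD('d) * s ^ (CARD('m) - 1) / ?z ^ (CARD('d) + CARD('m) - 1)"
  proof -
    have "s ^ (CARD('d) + CARD('m) - 1) = s ^ CARD('d) * s ^ (CARD('m) - 1)"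
      by (subst power_add[symmetric]) (simp add: Suc_leI)
    then show ?thesis using z assms by (simp add: power_divide)
  qed
  also have "\<dots> \<le> exp levi_bound ^ CARD('d) * 1 / ?z ^ (CARD('d) + CARD('m) - 1)"
    using z assms by (intro divide_right_mono mult_left_mono power_le_one) auto
  finally show ?thesis by simp
qed

text \<open>The constant may depend on z but not on \<nu>, L or t, which later gives integrability
  over the sphere. For s \<le> 1 both terms are bounded; for s \<ge> 1 numerator and denominator
  each deviate from their limits by a multiple of exp (-gap s).\<close>

lemma F_diff_bound:
  assumes "z \<noteq> 0"
  obtains C where "C > 0" "\<And>L \<nu> t s. \<nu> \<in> sphere 0 1 \<Longrightarrow> 0 < s \<Longrightarrow> cmod (F L \<nu> z t s - F_lim L \<nu> z t) \<le> C * exp (- gap * s)"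
proof -
  let ?z = "(norm z)\<^sup>2"
  \<comment> \<open>A common bound for the inverse denominators at r = 0 and at every s, raised to
    at least 1 for \<open>norm_prod_diff_le\<close>.\<close>
  define Q where "Q = max 1 (1 / (gap * ?z))"
  have gz: "gap * ?z > 0" using gap(1) assms by simp
  have Q1: "Q \<ge> 1" by (simp add: Q_def)
  have inv: "cmod (1 / den \<nu> r z t) \<le> Q" if "gap * ?z \<le> Af \<nu> r z" for \<nu> r t
  proof -
    have "1 / cmod (den \<nu> r z t) \<le> 1 / (gap * ?z)"
      using den_lower[OF that, of t] gz gap(1) by (intro divide_left_mono mult_pos_pos) auto
    then show ?thesis by (simp add: norm_divide Q_def)
  qed
  have FQ: "cmod (F_lim L \<nu> z t) \<le> bfac_const ^ CARD('d) * Q ^ (CARD('d) + CARD('m) - 1)" if "\<nu> \<in> sphere 0 1" for L \<nu> t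
  proof -
    have e: "F_lim L \<nu> z t = of_real (B_lim L \<nu>) * (1 / den \<nu> 0 z t) ^ (CARD('d) + CARD('m) - 1)"
      by (simp add: F_lim_def power_divide)
    show ?thesis
      unfolding e norm_mult norm_power norm_of_real
      using B_lim_le[OF that, of L] inv[OF A_fun_0_lower[OF that], of t] bfac_const_ge_1
      by (intro mult_mono power_mono) auto
  qed
  define C1 where "C1 = exp levi_bound ^ CARD('d) / ?z ^ (CARD('d) + CARD('m) - 1) + bfac_const ^ CARD('d) * Q ^ (CARD('d) + CARD('m) - 1)"
  define C2 where "C2 = real CARD('d) * bfac_const ^ CARD('d) * bfac_const * Q ^ (CARD('d) + CARD('m) - 1) + bfac_const ^ CARD('d) * (real (CARD('d) + CARD('m) - 1) * Q ^ (CARD('d) + CARD('m) - 1) * (2 * bfac_const * ?z * Q * Q))"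
  have C1: "C1 > 0" unfolding C1_def using assms bfac_const_ge_1 Q1 by (intro add_pos_pos divide_pos_pos mult_pos_pos zero_less_power) auto
  have C2: "C2 \<ge> 0" unfolding C2_def using bfac_const_ge_1 Q1 by auto
  show ?thesis
  proof (rule that[of "C1 * exp gap + C2"])
    show "C1 * exp gap + C2 > 0" using C1 C2 by (intro add_pos_nonneg) auto
    fix L :: "'d set" and \<nu> t :: "'m rvec" and s :: real assume \<nu>: "\<nu> \<in> sphere 0 1" and s: "0 < s"
    show "cmod (F L \<nu> z t s - F_lim L \<nu> z t) \<le> (C1 * exp gap + C2) * exp (- gap * s)"
    proof (cases "s \<le> 1")
      case True
      have "cmod (F L \<nu> z t s - F_lim L \<nu> z t) \<le> C1"
        using norm_triangle_ineq4[of "F L \<nu> z t s" "F_lim L \<nu> z t"] F_small[OF \<nu> s True assms, of L t] FQ[OF \<nu>, of L t]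
        unfolding C1_def by linarith
      also have "\<dots> = C1 * exp 0" by simp
      also have "\<dots> \<le> C1 * exp (gap + - gap * s)"
        using C1 gap(1) True by (intro mult_left_mono) (auto simp: algebra_simps)
      also have "\<dots> \<le> (C1 * exp gap + C2) * exp (- gap * s)"
        using C2 unfolding exp_add distrib_right mult.assoc by simp
      finally show ?thesis .
    next
      case False
      then have s1: "1 \<le> s" by simp
      define e where "e = exp (- gap * s)"
      define a b where "a = 1 / den \<nu> (exp (- s)) z t" and "b = 1 / den \<nu> 0 z t"
      define \<beta> \<beta>' where "\<beta> = B_fun P (\<mu> \<nu>) L (exp (- s))" and "\<beta>' = B_lim L \<nu>"
      have aQ: "cmod a \<le> Q" unfolding a_def by (rule inv[OF A_fun_lower[OF \<nu> s]])
      have bQ: "cmod b \<le> Q" unfolding b_def by (rule inv[OF A_fun_0_lower[OF \<nu>]])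
      have nz: "den \<nu> (exp (- s)) z t \<noteq> 0" "den \<nu> 0 z t \<noteq> 0"
        using den_lower[OF A_fun_lower[OF \<nu> s], of z t] den_lower[OF A_fun_0_lower[OF \<nu>], of z t] gz by auto
      have "a - b = (den \<nu> 0 z t - den \<nu> (exp (- s)) z t) * a * b"
        using nz by (simp add: a_def b_def field_simps)
      also have "cmod \<dots> \<le> (2 * (bfac_const * e) * ?z) * Q * Q"
        unfolding norm_mult
      proof (intro mult_mono aQ bQ)
        have "den \<nu> 0 z t - den \<nu> (exp (- s)) z t = of_real (- (Af \<nu> (exp (- s)) z - Af \<nu> 0 z))"
          by (simp add: den_def)
        then show "cmod (den \<nu> 0 z t - den \<nu> (exp (- s)) z t) \<le> 2 * (bfac_const * e) * ?z"
          using A_fun_diff_le[OF \<nu> s1, of z] by (simp only: norm_of_real e_def abs_minus_cancel)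
      qed (use bfac_const_ge_1 Q1 in \<open>auto simp: e_def\<close>)
      finally have ab: "cmod (a - b) \<le> (2 * (bfac_const * e) * ?z) * Q * Q" .
      have "cmod ((\<Prod>i<(CARD('d) + CARD('m) - 1). a) - (\<Prod>i<(CARD('d) + CARD('m) - 1). b)) \<le> real (card {..<(CARD('d) + CARD('m) - 1)}) * Q ^ card {..<(CARD('d) + CARD('m) - 1)} * ((2 * (bfac_const * e) * ?z) * Q * Q)"
        by (rule norm_prod_diff_le) (use Q1 aQ bQ ab bfac_const_ge_1 in \<open>auto simp: e_def\<close>)
      then have pw: "cmod (a ^ (CARD('d) + CARD('m) - 1) - b ^ (CARD('d) + CARD('m) - 1)) \<le> real (CARD('d) + CARD('m) - 1) * Q ^ (CARD('d) + CARD('m) - 1) * ((2 * (bfac_const * e) * ?z) * Q * Q)"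
        by simp
      have FF: "F L \<nu> z t s = of_real \<beta> * a ^ (CARD('d) + CARD('m) - 1)" "F_lim L \<nu> z t = of_real \<beta>' * b ^ (CARD('d) + CARD('m) - 1)"
        by (simp_all add: F_def F_lim_def a_def b_def \<beta>_def \<beta>'_def power_divide)
      have "F L \<nu> z t s - F_lim L \<nu> z t = of_real (\<beta> - \<beta>') * a ^ (CARD('d) + CARD('m) - 1) + of_real \<beta>' * (a ^ (CARD('d) + CARD('m) - 1) - b ^ (CARD('d) + CARD('m) - 1))"
        unfolding FF by (simp only: of_real_diff) algebra
      also have "cmod \<dots> \<le> (real CARD('d) * bfac_const ^ CARD('d) * (bfac_const * e)) * Q ^ (CARD('d) + CARD('m) - 1) + bfac_const ^ CARD('d) * (real (CARD('d) + CARD('m) - 1) * Q ^ (CARD('d) + CARD('m) - 1) * ((2 * (bfac_const * e) * ?z) * Q * Q))"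
      proof (rule order.trans[OF norm_triangle_ineq add_mono])
        show "cmod (of_real (\<beta> - \<beta>') * a ^ (CARD('d) + CARD('m) - 1)) \<le> (real CARD('d) * bfac_const ^ CARD('d) * (bfac_const * e)) * Q ^ (CARD('d) + CARD('m) - 1)"
          unfolding norm_mult norm_power norm_of_real \<beta>_def \<beta>'_def e_def
          using aQ bfac_const_ge_1 Q1 by (intro mult_mono power_mono B_fun_large[OF \<nu> s1]) auto
        show "cmod (of_real \<beta>' * (a ^ (CARD('d) + CARD('m) - 1) - b ^ (CARD('d) + CARD('m) - 1))) \<le> bfac_const ^ CARD('d) * (real (CARD('d) + CARD('m) - 1) * Q ^ (CARD('d) + CARD('m) - 1) * ((2 * (bfac_const * e) * ?z) * Q * Q))"
          unfolding norm_mult norm_of_real \<beta>'_def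
          using pw bfac_const_ge_1 by (intro mult_mono B_lim_le[OF \<nu>]) auto
      qed
      also have "\<dots> = C2 * e" by (simp add: C2_def algebra_simps)
      also have "\<dots> \<le> (C1 * exp gap + C2) * e"
        using C1 by (intro mult_right_mono) (auto simp: e_def)
      finally show ?thesis by (simp add: e_def)
    qed
  qed
qed

lemma mmeas_U: "mmeas sphere_measure U"
proof -
  have "U \<in> borel_measurable sphere_measure"
    using diagonalization by (simp add: levi_diagonalization_def)
  moreover have "(\<lambda>V :: 'd cmat. V $ a $ b) \<in> borel_measurable borel" for a b
    by (intro borel_measurable_continuous_onI continuous_intros)
  ultimately show ?thesis unfolding mmeas_def by (auto intro: measurable_compose)
qed

lemma measurable_id_sphere: "(\<lambda>\<nu>. \<nu>) \<in> sphere_measure \<rightarrow>\<^sub>M (borel :: 'm rvec measure)"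
  by (subst measurable_cong_sets[OF sets_sphere_measure refl]) (rule measurable_restrict_space1, simp)

text \<open>Measurability is assumed of U; the eigenvalue is recovered from it as the Rayleigh
  quotient of column j.\<close>

lemma measurable_\<mu>: "(\<lambda>\<nu>. \<mu> \<nu> j) \<in> borel_measurable sphere_measure"
proof -
  let ?h = "\<lambda>\<nu>. Re (\<Sum>a\<in>UNIV. \<Sum>b\<in>UNIV. cnj (U \<nu> $ a $ j) * (levi \<nu> $ a $ b * U \<nu> $ b $ j))"
  have "\<mu> \<nu> j = ?h \<nu>" if "\<nu> \<in> space sphere_measure" for \<nu>
  proof -
    have \<nu>: "\<nu> \<in> sphere 0 1" using that by (simp add: space_sphere_measure)
    have "cip (column j (U \<nu>)) (levi \<nu> *v column j (U \<nu>)) = of_real (\<mu> \<nu> j) * of_real ((norm (column j (U \<nu>)))\<^sup>2)"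
      by (simp only: diag(2)[OF \<nu>] cip_scale_right cip_self)
    then have "Re (cip (column j (U \<nu>)) (levi \<nu> *v column j (U \<nu>))) = \<mu> \<nu> j"
      by (simp add: column_norm[OF \<nu>])
    then show ?thesis by (simp add: cip_def matrix_vector_mult_def column_def sum_distrib_left)
  qed
  moreover have "(\<lambda>\<nu>. levi \<nu> $ a $ b) \<in> borel_measurable sphere_measure" for a b
  proof -
    have "(\<lambda>x. levi x $ a $ b) \<in> borel_measurable borel"
      using mmeas_line[of 0 0] by (simp add: mmeas_def line_def)
    from measurable_compose[OF measurable_id_sphere this] show ?thesis .
  qed
  then have "?h \<in> borel_measurable sphere_measure"
    using mmeas_U unfolding mmeas_def
    by (intro measurable_compose[OF _ borel_measurable_Re] borel_measurable_sum borel_measurable_times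
        measurable_compose[OF _ measurable_cnj]) auto
  ultimately show ?thesis by (subst measurable_cong[where g = ?h]) auto
qed

text \<open>Joint measurability in direction and radius; the factor c covers both radii s and 2
  s.\<close>

lemma measurable_F:
  "(\<lambda>p. F L (fst p) z t (c * snd p)) \<in> borel_measurable (sphere_measure \<Otimes>\<^sub>M lborel)"
proof -
  note [measurable] = measurable_\<mu> measurable_id_sphere
  have [measurable]: "(\<lambda>\<nu>. (ctranspose (U \<nu>) *v z) $ j) \<in> borel_measurable sphere_measure" for j
    using mmeas_U unfolding mmeas_def matrix_vector_mult_def
    by (auto intro!: borel_measurable_sum borel_measurable_times measurable_compose[OF _ measurable_cnj])
  show ?thesis
    unfolding F_def den_def A_fun_def B_fun_eq bfac_def by measurable
qed

end

lemma integral_polar: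
  fixes H :: "'a::euclidean_space \<Rightarrow> complex"
  assumes "integrable lborel H"
  shows "(\<integral>x. H x \<partial>lborel) = (LINT \<nu>|sphere_measure. (LINT s:{0<..}|lborel. of_real (s ^ (DIM('a) - 1)) * H (s *\<^sub>R \<nu>)))"
proof -
  interpret R: sigma_finite_measure "radial_measure DIM('a)"
    unfolding radial_measure_def
    by (subst sigma_finite_measure.sigma_finite_iff_density_finite[OF lborel.sigma_finite_measure_axioms]) (auto simp: indicator_def)
  interpret S: finite_measure "sphere_measure :: 'a measure" by (rule finite_sphere_measure)
  interpret SR: pair_sigma_finite "sphere_measure :: 'a measure" "radial_measure DIM('a)" ..
  have mi: "(\<lambda>x. x) \<in> sphere_measure \<rightarrow>\<^sub>M (borel :: 'a measure)"
    by (subst measurable_cong_sets[OF sets_sphere_measure refl]) (rule measurable_restrict_space1, simp)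
  have m: "(\<lambda>(\<nu>, s). s *\<^sub>R \<nu>) \<in> sphere_measure \<Otimes>\<^sub>M radial_measure DIM('a) \<rightarrow>\<^sub>M (borel :: 'a measure)"
  proof -
    note [measurable] = mi
    have "(\<lambda>(\<nu>, s). s *\<^sub>R \<nu>) \<in> sphere_measure \<Otimes>\<^sub>M borel \<rightarrow>\<^sub>M (borel :: 'a measure)" by measurable
    then show ?thesis
      by (subst measurable_cong_sets[OF sets_pair_measure_cong[OF refl] refl, of _ borel]) (simp_all add: radial_measure_def)
  qed
  have H[measurable]: "H \<in> borel_measurable borel" using assms by auto
  have int: "integrable (sphere_measure \<Otimes>\<^sub>M radial_measure DIM('a)) (\<lambda>p. H (case p of (\<nu>, s) \<Rightarrow> s *\<^sub>R \<nu>))"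
    using assms by (subst (asm) lborel_polar) (subst (asm) integrable_distr_eq[OF m H])
  have "(\<integral>x. H x \<partial>lborel) = (\<integral>p. H (case p of (\<nu>, s) \<Rightarrow> s *\<^sub>R \<nu>) \<partial>(sphere_measure \<Otimes>\<^sub>M radial_measure DIM('a)))"
    by (subst lborel_polar) (rule integral_distr[OF m H])
  also have "\<dots> = (LINT \<nu>|sphere_measure. LINT s|radial_measure DIM('a). H (s *\<^sub>R \<nu>))"
    using SR.integral_fst'[OF int] by simp
  also have "\<dots> = (LINT \<nu>|sphere_measure. (LINT s:{0<..}|lborel. of_real (s ^ (DIM('a) - 1)) * H (s *\<^sub>R \<nu>)))"
  proof (rule Bochner_Integration.integral_cong[OF refl])
    fix \<nu> :: 'a
    have "radial_measure DIM('a) = density lborel (\<lambda>s. ennreal (s ^ (DIM('a) - 1) * indicator {0<..} s))"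
      unfolding radial_measure_def by (rule density_cong) (auto simp: indicator_def)
    then have "(LINT s|radial_measure DIM('a). H (s *\<^sub>R \<nu>)) = (LINT s|lborel. (s ^ (DIM('a) - 1) * indicator {0<..} s) *\<^sub>R H (s *\<^sub>R \<nu>))"
      by (simp only:) (rule integral_density, auto simp: indicator_def)
    then show "(LINT s|radial_measure DIM('a). H (s *\<^sub>R \<nu>)) = (LINT s:{0<..}|lborel. of_real (s ^ (DIM('a) - 1)) * H (s *\<^sub>R \<nu>))"
      unfolding set_lebesgue_integral_def by (simp add: scaleR_conv_of_real mult_ac)
  qed
  finally show ?thesis .
qed

text \<open>The geometric sum formula with b - a extracted. Applied to the two phases, this
  difference is the factor that decays exponentially on real directions.\<close>

lemma power_diff_expansion:
  fixes a b :: complex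
  assumes "a \<noteq> 0" "b \<noteq> 0"
  shows "inverse a ^ k - inverse b ^ k = (b - a) * (\<Sum>i<k. inverse a ^ Suc i * inverse b ^ (k - i))"
proof -
  have d: "inverse a - inverse b = (b - a) * (inverse a * inverse b)" using assms by (simp add: field_simps)
  have "inverse a ^ k - inverse b ^ k = (inverse a - inverse b) * (\<Sum>i<k. inverse b ^ (k - Suc i) * inverse a ^ i)"
    by (rule power_diff_sumr2)
  also have "\<dots> = (b - a) * (\<Sum>i<k. (inverse a * inverse b) * (inverse b ^ (k - Suc i) * inverse a ^ i))"
    unfolding d by (simp add: sum_distrib_left mult.assoc)
  also have "(\<Sum>i<k. (inverse a * inverse b) * (inverse b ^ (k - Suc i) * inverse a ^ i)) = (\<Sum>i<k. inverse a ^ Suc i * inverse b ^ (k - i))"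
  proof (rule sum.cong[OF refl])
    fix i assume "i \<in> {..<k}"
    then have "k - i = Suc (k - Suc i)" by simp
    then have "inverse b ^ (k - i) = inverse b * inverse b ^ (k - Suc i)" by (simp only: power_Suc)
    then show "(inverse a * inverse b) * (inverse b ^ (k - Suc i) * inverse a ^ i) = inverse a ^ Suc i * inverse b ^ (k - i)"
      by (simp only: power_Suc mult_ac)
  qed
  finally show ?thesis .
qed

subsection \<open>The kernel as an integral over the dual of the centre\<close>

text \<open>At the Levi matrix of x = s \<nu> and w = x \<bullet> t this is s (A - i \<nu> \<bullet>
  t) with A taken at r = exp (-s).\<close>

definition phase1 :: "complex ^ 'd ^ 'd::finite \<Rightarrow> complex \<Rightarrow> complex ^ 'd \<Rightarrow> complex" where
  "phase1 X w z = cip z (xcoth X *v z) - \<i> * w"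

text \<open>Half of \<open>phase1\<close> at the doubled matrix and 2 w, so that on real directions
  it carries the same factor s as \<open>phase1\<close>, now with A taken at r = exp (-2 s).\<close>

definition phase2 :: "complex ^ 'd ^ 'd::finite \<Rightarrow> complex \<Rightarrow> complex ^ 'd \<Rightarrow> complex" where
  "phase2 X w z = cip z (xcoth (dbl X) *v z) / 2 - \<i> * w"

definition cross_form :: "'d::{finite,linorder} set \<Rightarrow> 'd set \<Rightarrow> 'd cmat \<Rightarrow> 'd cvec \<Rightarrow> complex" where
  "cross_form K J X z = (\<Sum>a\<in>UNIV. \<Sum>b\<in>UNIV. symbol_cross K J a b X * (cnj (z $ a) * z $ b))"

text \<open>The integrand \<open>symbol X / D(X)^k - 2^(-d) symbol (2X) / (D(2X)/2)^k\<close>, written with coefficients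
  that are exponentially small at infinity.\<close>

definition kern :: "nat \<Rightarrow> 'd::{finite,linorder} set \<Rightarrow> 'd set \<Rightarrow> 'd cmat \<Rightarrow> complex \<Rightarrow> 'd cvec \<Rightarrow> complex" where
  "kern k K J X w z = symbol_diff K J X * inverse (phase1 X w z) ^ k +
     cross_form K J X z * (\<Sum>i<k. inverse (phase1 X w z) ^ Suc i * inverse (phase2 X w z) ^ (k - i))"

lemma cross_form_eq: "cross_form K J X z = (1 / 2) ^ CARD('d) * symbol K J (dbl X) * (phase2 X w z - phase1 X w z)"
  for X :: "'d::{finite,linorder} cmat"
  unfolding cross_form_def symbol_cross_def phase1_def phase2_def cip_def matrix_vector_mult_def
  by (simp add: sum_distrib_left sum_divide_distrib sum_subtractf[symmetric] algebra_simps)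

lemma kern_eq:
  fixes X :: "'d::{finite,linorder} cmat"
  assumes "phase1 X w z \<noteq> 0" "phase2 X w z \<noteq> 0"
  shows "kern k K J X w z = symbol K J X * inverse (phase1 X w z) ^ k - (1 / 2) ^ CARD('d) * symbol K J (dbl X) * inverse (phase2 X w z) ^ k"
proof -
  let ?c = "(1 / 2) ^ CARD('d) * symbol K J (dbl X)"
  have "cross_form K J X z * (\<Sum>i<k. inverse (phase1 X w z) ^ Suc i * inverse (phase2 X w z) ^ (k - i)) =
    ?c * (inverse (phase1 X w z) ^ k - inverse (phase2 X w z) ^ k)"
    unfolding power_diff_expansion[OF assms] cross_form_eq[of K J X z w] by (simp only: mult.assoc)
  then show ?thesis unfolding kern_def symbol_diff_def by (simp add: algebra_simps)
qed

lemma coth_split: "E < 1 \<Longrightarrow> m * ((1 + E) / (1 - E)) = m + 2 * (E * m / (1 - E))" for E m :: real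
  by (simp add: divide_simps) (simp add: algebra_simps)

section \<open>Decay of the coefficients on real directions\<close>

context quadric begin

lemma coth_bfac:
  assumes "0 < s" "\<nu> \<in> sphere 0 1"
  shows "coth_scalar (s * \<mu> \<nu> j) = s * (\<bar>\<mu> \<nu> j\<bar> + 2 * bfac False (\<mu> \<nu> j) (exp (- s)))"
proof -
  have "exp (- (s * \<bar>\<mu> \<nu> j\<bar>)) < 1" using assms mu_nonzero[OF assms(2), of j] by simp
  then have "\<bar>\<mu> \<nu> j\<bar> * ((1 + exp (- (s * \<bar>\<mu> \<nu> j\<bar>))) / (1 - exp (- (s * \<bar>\<mu> \<nu> j\<bar>)))) = \<bar>\<mu> \<nu> j\<bar> + 2 * bfac False (\<mu> \<nu> j) (exp (- s))"
    by (simp only: bfac_def exp_powr if_False coth_split)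
  moreover have "coth_scalar (s * \<mu> \<nu> j) = s * (\<bar>\<mu> \<nu> j\<bar> * ((1 + exp (- (s * \<bar>\<mu> \<nu> j\<bar>))) / (1 - exp (- (s * \<bar>\<mu> \<nu> j\<bar>)))))"
    using coth_scalar_abs[of "s * \<mu> \<nu> j"] mu_nonzero[OF assms(2), of j] assms(1) by (simp add: abs_mult)
  ultimately show ?thesis by simp
qed

lemma dbl_levi: "dbl (levi (s *\<^sub>R x)) = levi ((2 * s) *\<^sub>R x)"
  by (simp add: dbl_def levi_scaleR vec_eq_iff)

lemma symbol_dbl_levi:
  assumes \<nu>: "\<nu> \<in> sphere 0 1" and s: "0 < s"
  shows "(1 / 2) ^ CARD('d) * symbol K J (dbl (levi (s *\<^sub>R \<nu>))) =
    of_real (s ^ CARD('d)) * (\<Sum>L\<in>tuples (card K). form_weight K J L \<nu> * of_real (B_fun P (\<mu> \<nu>) L (exp (- (2 * s)))))"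
proof -
  have "(1 / 2 :: complex) ^ CARD('d) * of_real ((2 * s) ^ CARD('d)) = of_real (s ^ CARD('d))"
    by (simp add: power_mult_distrib power_divide)
  then show ?thesis
    using symbol_levi[OF \<nu>, of "2 * s" K J] s by (simp add: dbl_levi mult.assoc[symmetric])
qed

text \<open>With q = \<open>card K\<close>: q! bounds a minor with entries of modulus at most 1, and
  \<open>CARD('d) ^ q\<close> bounds the coefficients of a q-fold wedge product.\<close>

definition weight_bound :: "'d set \<Rightarrow> real" where
  "weight_bound K = fact (card K) * real CARD('d) ^ card K"

lemma form_weight_le:
  assumes "\<nu> \<in> sphere 0 1" "L \<in> tuples (card K)"
  shows "cmod (form_weight K J L \<nu>) \<le> weight_bound K"
proof -
  have "cmod (minor_det (conj_matrix (U \<nu>)) K L) \<le> fact (card K)"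
    using entry_U_le_1[OF assms(1)] by (intro norm_minor_det) (simp add: conj_matrix_def)
  moreover have "cmod (dZbar_wedge (U \<nu>) L J) \<le> real CARD('d) ^ card K"
    using norm_dZbar_wedge[of "U \<nu>" 1 L J] entry_U_le_1[OF assms(1)] assms(2) by (simp add: tuples_def)
  ultimately show ?thesis unfolding form_weight_def weight_bound_def norm_mult
    by (intro mult_mono) auto
qed

lemma weight_bound_nonneg: "0 \<le> weight_bound K"
  by (simp add: weight_bound_def)

text \<open>On the unit ball the crude bound suffices; outside it, half of the gap absorbs the
  powers of s.\<close>

lemma decay_radial_to_full:
  fixes f :: "'d cmat \<Rightarrow> complex"
  assumes crude: "0 < D" "0 < e" "\<And>X. near_hermitian (1 / 4) X \<Longrightarrow> cmod (f X) \<le> D * exp (e * entry_norm X)"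
    and large: "0 \<le> C" "\<And>\<nu> s. \<nu> \<in> sphere 0 1 \<Longrightarrow> 1 \<le> s \<Longrightarrow> cmod (f (levi (s *\<^sub>R \<nu>))) \<le> C * s ^ N * exp (- gap * s)"
  shows "\<exists>C'>0. \<forall>x. cmod (f (levi x)) \<le> C' * exp (- (gap / 2) * norm x)"
proof -
  obtain M where M: "M > 0" "\<And>y. y \<ge> 0 \<Longrightarrow> (1 + y) ^ N \<le> M * exp (gap / 2 * y)"
    using power_exp_bound[of "gap / 2" N] gap(1) by auto
  let ?C = "D * exp (e * levi_bound) * exp (gap / 2) + C * M"
  show ?thesis
  proof (intro exI[of _ ?C] conjI allI)
    show "?C > 0" using crude large M by (intro add_pos_nonneg) auto
    fix x :: "'m rvec"
    show "cmod (f (levi x)) \<le> ?C * exp (- (gap / 2) * norm x)"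
    proof (cases "norm x \<le> 1")
      case True
      have "entry_norm (levi x) \<le> levi_bound * 1"
        using entry_norm_levi[of x] mult_left_mono[OF True, of levi_bound] levi_bound_ge_1 by linarith
      then have "D * exp (e * entry_norm (levi x)) \<le> D * exp (e * levi_bound)"
        using crude by simp
      then have "cmod (f (levi x)) \<le> D * exp (e * levi_bound) * 1"
      proof -
        have "near_hermitian (1 / 4) (levi x)" by (rule near_hermitian_mono[OF near_hermitian_levi]) simp
        then show ?thesis using crude(3) \<open>D * exp (e * entry_norm (levi x)) \<le> D * exp (e * levi_bound)\<close> by fastforce
      qed
      also have "\<dots> \<le> D * exp (e * levi_bound) * exp (gap / 2 + - (gap / 2) * norm x)"
        using True crude gap(1) by (intro mult_left_mono) (auto simp: mult_left_le)
      also have "\<dots> \<le> ?C * exp (- (gap / 2) * norm x)"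
        using large M unfolding exp_add distrib_right mult.assoc by simp
      finally show ?thesis .
    next
      case False
      define s where "s = norm x"
      have s: "1 \<le> s" using False by (simp add: s_def)
      have "x = s *\<^sub>R (x /\<^sub>R s)" using s by simp
      moreover have \<nu>: "x /\<^sub>R s \<in> sphere 0 1"
      proof -
        have "norm x \<noteq> 0" using s by (auto simp: s_def)
        then show ?thesis by (simp add: s_def)
      qed
      ultimately have "cmod (f (levi x)) \<le> C * s ^ N * exp (- gap * s)"
        using large(2)[OF \<nu> s] by simp
      also have "\<dots> \<le> C * (M * exp (gap / 2 * s)) * exp (- gap * s)"
      proof (intro mult_right_mono mult_left_mono)
        show "s ^ N \<le> M * exp (gap / 2 * s)"
          using M(2)[of s] s power_mono[of s "1 + s" N] by simp
      qed (use large in auto)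
      also have "\<dots> = C * M * (exp (gap / 2 * s) * exp (- gap * s))" by simp
      also have "exp (gap / 2 * s) * exp (- gap * s) = exp (- (gap / 2) * s)"
        by (simp add: exp_add[symmetric] algebra_simps)
      also have "C * M * exp (- (gap / 2) * s) \<le> ?C * exp (- (gap / 2) * s)"
        using crude by (intro mult_right_mono) auto
      finally show ?thesis by (simp add: s_def)
    qed
  qed
qed

text \<open>The limits of B_L at r = 0 cancel between s and 2 s for every L, including L =
  P.\<close>

lemma symbol_diff_large:
  assumes "\<nu> \<in> sphere 0 1" "1 \<le> s"
  shows "cmod (symbol_diff K J (levi (s *\<^sub>R \<nu>))) \<le>
    (real (card (tuples (card K) :: 'd set set)) * (weight_bound K * (2 * (real CARD('d) * bfac_const ^ CARD('d) * bfac_const)))) * s ^ CARD('d) * exp (- gap * s)"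
proof -
  let ?T = "tuples (card K) :: 'd set set" and ?b = "real CARD('d) * bfac_const ^ CARD('d) * bfac_const"
  have s: "0 < s" using assms by simp
  have e2: "exp (- gap * (2 * s)) \<le> exp (- gap * s)" using s gap(1) by simp
  have bnd: "\<bar>B_fun P (\<mu> \<nu>) L (exp (- s)) - B_fun P (\<mu> \<nu>) L (exp (- (2 * s)))\<bar> \<le> 2 * ?b * exp (- gap * s)" for L
  proof -
    have "?b * exp (- gap * (2 * s)) \<le> ?b * exp (- gap * s)"
      using e2 bfac_const_ge_1 by (intro mult_left_mono) auto
    then show ?thesis
      using B_fun_large(2)[OF assms, of L] B_fun_large(2)[OF assms(1), of "2 * s" L] assms(2)
      by (simp only: mult.assoc) linarith
  qed
  have "symbol_diff K J (levi (s *\<^sub>R \<nu>)) = of_real (s ^ CARD('d)) * (\<Sum>L\<in>?T. form_weight K J L \<nu> * of_real (B_fun P (\<mu> \<nu>) L (exp (- s)) - B_fun P (\<mu> \<nu>) L (exp (- (2 * s)))))"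
    unfolding symbol_diff_def symbol_dbl_levi[OF assms(1) s] symbol_levi[OF assms(1) s]
    by (simp add: right_diff_distrib sum_subtractf)
  also have "cmod \<dots> \<le> s ^ CARD('d) * (\<Sum>L\<in>?T. weight_bound K * (2 * ?b * exp (- gap * s)))"
    unfolding norm_mult norm_of_real using s bnd form_weight_le[OF assms(1), of _ K J] weight_bound_nonneg[of K]
    by (intro mult_mono sum_norm_le) (auto simp: norm_mult simp del: of_real_diff intro!: mult_mono)
  also have "\<dots> = (real (card ?T) * (weight_bound K * (2 * ?b))) * s ^ CARD('d) * exp (- gap * s)"
    by simp
  finally show ?thesis .
qed

text \<open>The symbol of the doubled matrix only grows like s^d here. The decay comes from the
  difference of the forms, where the leading terms s |\<mu>| cancel.\<close>

lemma symbol_cross_large: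
  assumes "\<nu> \<in> sphere 0 1" "1 \<le> s"
  shows "cmod (symbol_cross K J a b (levi (s *\<^sub>R \<nu>))) \<le>
    (real (card (tuples (card K) :: 'd set set)) * (weight_bound K * bfac_const ^ CARD('d)) * (real CARD('d) * (4 * bfac_const))) * s ^ (CARD('d) + 1) * exp (- gap * s)"
proof -
  let ?T = "tuples (card K) :: 'd set set"
  have s: "0 < s" "0 < 2 * s" "1 \<le> 2 * s" using assms by auto
  have e2: "exp (- gap * (2 * s)) \<le> exp (- gap * s)" using s gap(1) by simp
  have 1: "cmod ((1 / 2) ^ CARD('d) * symbol K J (dbl (levi (s *\<^sub>R \<nu>)))) \<le> s ^ CARD('d) * (\<Sum>L\<in>?T. weight_bound K * bfac_const ^ CARD('d))"
    unfolding symbol_dbl_levi[OF assms(1) s(1)] norm_mult norm_of_real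
    using s form_weight_le[OF assms(1), of _ K J] weight_bound_nonneg[of K] B_fun_large(1)[OF assms(1) s(3)]
    by (intro mult_mono sum_norm_le) (auto simp: norm_mult intro!: mult_mono)
  have X2: "dbl (levi (s *\<^sub>R \<nu>)) = sdiag (U \<nu>) (\<lambda>j. of_real ((2 * s) * \<mu> \<nu> j))"
    unfolding dbl_levi by (rule levi_sdiag[OF assms(1)])
  have ee2: "xcoth (dbl (levi (s *\<^sub>R \<nu>))) $ a $ b = (\<Sum>j\<in>UNIV. U \<nu> $ a $ j * of_real (coth_scalar ((2 * s) * \<mu> \<nu> j)) * cnj (U \<nu> $ b $ j))"
    by (simp only: X2 xcoth_sdiag[OF diag(1)[OF assms(1)]] sdiag_nth)
  have ee1: "xcoth (levi (s *\<^sub>R \<nu>)) $ a $ b = (\<Sum>j\<in>UNIV. U \<nu> $ a $ j * of_real (coth_scalar (s * \<mu> \<nu> j)) * cnj (U \<nu> $ b $ j))"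
    by (simp only: levi_sdiag[OF assms(1)] xcoth_sdiag[OF diag(1)[OF assms(1)]] sdiag_nth)
  have "xcoth (dbl (levi (s *\<^sub>R \<nu>))) $ a $ b / 2 - xcoth (levi (s *\<^sub>R \<nu>)) $ a $ b =
    (\<Sum>j\<in>UNIV. U \<nu> $ a $ j * of_real (coth_scalar ((2 * s) * \<mu> \<nu> j) / 2 - coth_scalar (s * \<mu> \<nu> j)) * cnj (U \<nu> $ b $ j))"
    unfolding ee1 ee2
    by (simp add: sum_divide_distrib sum_subtractf[symmetric] algebra_simps)
  also have "cmod \<dots> \<le> (\<Sum>j\<in>(UNIV::'d set). 1 * (s * (4 * bfac_const * exp (- gap * s))) * 1)"
  proof (rule sum_norm_le)
    fix j
    have f1: "\<bar>bfac False (\<mu> \<nu> j) (exp (- s))\<bar> \<le> bfac_const * exp (- gap * s)"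
      using bfac_bounds(2)[OF assms, of False j] by simp
    have f2: "\<bar>bfac False (\<mu> \<nu> j) (exp (- (2 * s)))\<bar> \<le> bfac_const * exp (- gap * s)"
    proof -
      have "\<bar>bfac False (\<mu> \<nu> j) (exp (- (2 * s)))\<bar> \<le> bfac_const * exp (- gap * (2 * s))"
        using bfac_bounds(2)[OF assms(1) s(3), of False j] by simp
      also have "\<dots> \<le> bfac_const * exp (- gap * s)" by (intro mult_left_mono e2) (use bfac_const_ge_1 in simp)
      finally show ?thesis .
    qed
    have "coth_scalar ((2 * s) * \<mu> \<nu> j) / 2 - coth_scalar (s * \<mu> \<nu> j) = s * (2 * (bfac False (\<mu> \<nu> j) (exp (- (2 * s))) - bfac False (\<mu> \<nu> j) (exp (- s))))"
      unfolding coth_bfac[OF s(2) assms(1)] coth_bfac[OF s(1) assms(1)] by (simp add: algebra_simps)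
    moreover have "2 * \<bar>bfac False (\<mu> \<nu> j) (exp (- (2 * s))) - bfac False (\<mu> \<nu> j) (exp (- s))\<bar> \<le> 4 * bfac_const * exp (- gap * s)"
    proof -
      have "2 * x \<le> 4 * X" if "x \<le> a + b" "a \<le> X" "b \<le> X" for x a b X :: real
        using that by linarith
      from this[OF abs_triangle_ineq4 f2 f1] show ?thesis by (simp only: mult.assoc)
    qed
    ultimately have "\<bar>coth_scalar ((2 * s) * \<mu> \<nu> j) / 2 - coth_scalar (s * \<mu> \<nu> j)\<bar> \<le> s * (4 * bfac_const * exp (- gap * s))"
      using s(1) mult_left_mono[of _ _ s] by (simp only: abs_mult abs_of_pos abs_numeral)
    then show "cmod (U \<nu> $ a $ j * of_real (coth_scalar ((2 * s) * \<mu> \<nu> j) / 2 - coth_scalar (s * \<mu> \<nu> j)) * cnj (U \<nu> $ b $ j)) \<le> 1 * (s * (4 * bfac_const * exp (- gap * s))) * 1"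
      unfolding norm_mult norm_of_real complex_mod_cnj using entry_U_le_1[OF assms(1)] s bfac_const_ge_1
      by (intro mult_mono) auto
  qed
  finally have 2: "cmod (xcoth (dbl (levi (s *\<^sub>R \<nu>))) $ a $ b / 2 - xcoth (levi (s *\<^sub>R \<nu>)) $ a $ b) \<le> real CARD('d) * (s * (4 * bfac_const * exp (- gap * s)))"
    by simp
  have "cmod (symbol_cross K J a b (levi (s *\<^sub>R \<nu>))) \<le> (s ^ CARD('d) * (\<Sum>L\<in>?T. weight_bound K * bfac_const ^ CARD('d))) * (real CARD('d) * (s * (4 * bfac_const * exp (- gap * s))))"
    unfolding symbol_cross_def norm_mult[of "(1 / 2) ^ CARD('d) * symbol K J (dbl (levi (s *\<^sub>R \<nu>)))"]
    using 1 2 s weight_bound_nonneg[of K] bfac_const_ge_1 by (intro mult_mono) (auto intro!: mult_nonneg_nonneg sum_nonneg)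
  then show ?thesis by (simp add: mult_ac)
qed

lemma decay_levi:
  obtains C where "C > 0" "\<And>x. cmod (symbol_diff K J (levi x)) \<le> C * exp (- (gap / 2) * norm x)"
    "\<And>a b x. cmod (symbol_cross K J a b (levi x)) \<le> C * exp (- (gap / 2) * norm x)"
    and "decaying (symbol_diff K J)" "\<And>a b. decaying (symbol_cross K J a b)"
proof -
  obtain D e where De: "D > 0" "e > 0"
    "\<And>X. near_hermitian (1 / 4) X \<Longrightarrow> cmod (symbol_diff K J X) \<le> D * exp (e * entry_norm X)"
    "\<And>X a b. near_hermitian (1 / 4) X \<Longrightarrow> cmod (symbol_cross K J a b X) \<le> D * exp (e * entry_norm X)"
    using norm_symbols_crude[of K J] by metis
  have n1: "0 \<le> real (card (tuples (card K) :: 'd set set)) * (weight_bound K * (2 * (real CARD('d) * bfac_const ^ CARD('d) * bfac_const)))"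
    "0 \<le> real (card (tuples (card K) :: 'd set set)) * (weight_bound K * bfac_const ^ CARD('d)) * (real CARD('d) * (4 * bfac_const))"
    using weight_bound_nonneg[of K] bfac_const_ge_1 by (auto intro!: mult_nonneg_nonneg)
  obtain C1 where C1: "C1 > 0" "\<And>x. cmod (symbol_diff K J (levi x)) \<le> C1 * exp (- (gap / 2) * norm x)"
    using decay_radial_to_full[of D e "symbol_diff K J", OF De(1,2,3) n1(1) symbol_diff_large] by blast
  have "\<exists>C>0. \<forall>x. cmod (symbol_cross K J a b (levi x)) \<le> C * exp (- (gap / 2) * norm x)" for a b
    by (rule decay_radial_to_full[of D e "symbol_cross K J a b", OF De(1,2,4) n1(2) symbol_cross_large])
  then obtain C2 where C2: "\<And>a b. C2 a b > 0" "\<And>a b x. cmod (symbol_cross K J a b (levi x)) \<le> C2 a b * exp (- (gap / 2) * norm x)"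
    by metis
  have g: "gap / 2 > 0" using gap(1) by simp
  let ?C = "C1 + (\<Sum>a\<in>UNIV. \<Sum>b\<in>UNIV. C2 a b)"
  have nn: "0 \<le> C2 a b" for a b using C2(1)[of a b] by simp
  have C2le: "C2 a b \<le> (\<Sum>a\<in>UNIV. \<Sum>b\<in>UNIV. C2 a b)" for a b
    by (intro order.trans[OF member_le_sum[of b UNIV "C2 a"] member_le_sum[of a UNIV "\<lambda>a. \<Sum>b\<in>UNIV. C2 a b"]])
      (auto intro!: sum_nonneg nn)
  have s0: "0 \<le> (\<Sum>a\<in>UNIV. \<Sum>b\<in>UNIV. C2 a b)" by (intro sum_nonneg nn)
  show ?thesis
  proof (rule that[of ?C])
    show "?C > 0" using C1 s0 by simp
    show "cmod (symbol_diff K J (levi x)) \<le> ?C * exp (- (gap / 2) * norm x)" for x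
      by (rule order.trans[OF C1(2)], rule mult_right_mono) (use s0 in auto)
    show "cmod (symbol_cross K J a b (levi x)) \<le> ?C * exp (- (gap / 2) * norm x)" for a b x
      by (rule order.trans[OF C2(2)], rule mult_right_mono) (use C2le[of a b] C1(1) in auto)
    show "decaying (symbol_diff K J)"
      by (rule decaying_tube[OF holomorphic_symbols(1) De(1,2,3) C1(1) g C1(2)])
    show "decaying (symbol_cross K J a b)" for a b
      by (rule decaying_tube[OF holomorphic_symbols(2) De(1,2,4) C2(1) g C2(2)])
  qed
qed

end

section \<open>From radial integrals to one integral over the space of directions\<close>

context quadric begin

lemma phase_levi:
  assumes "\<nu> \<in> sphere 0 1" "0 < s"
  shows "phase1 (levi (s *\<^sub>R \<nu>)) (of_real ((s *\<^sub>R \<nu>) \<bullet> t)) z = of_real s * den \<nu> (exp (- s)) z t"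
    "phase2 (levi (s *\<^sub>R \<nu>)) (of_real ((s *\<^sub>R \<nu>) \<bullet> t)) z = of_real s * den \<nu> (exp (- (2 * s))) z t"
proof -
  show "phase1 (levi (s *\<^sub>R \<nu>)) (of_real ((s *\<^sub>R \<nu>) \<bullet> t)) z = of_real s * den \<nu> (exp (- s)) z t"
    unfolding phase1_def cip_xcoth_levi[OF assms] den_def by (simp add: algebra_simps)
  have "0 < 2 * s" using assms by simp
  note c = cip_xcoth_levi[OF assms(1) this]
  show "phase2 (levi (s *\<^sub>R \<nu>)) (of_real ((s *\<^sub>R \<nu>) \<bullet> t)) z = of_real s * den \<nu> (exp (- (2 * s))) z t"
    unfolding phase2_def dbl_levi c den_def by (simp add: algebra_simps)
qed

text \<open>With d = \<open>CARD('d)\<close> and m = \<open>CARD('m)\<close>: s^(m - 1) is the polar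
  Jacobian and s^d comes from the symbol; the power s^(d + m - 1) from the phases cancels
  both.\<close>

lemma kern_levi:
  assumes \<nu>: "\<nu> \<in> sphere 0 1" and s: "0 < s" and z: "z \<noteq> 0"
  shows "of_real (s ^ (CARD('m) - 1)) * kern (CARD('d) + CARD('m) - 1) K J (levi (s *\<^sub>R \<nu>)) (of_real ((s *\<^sub>R \<nu>) \<bullet> t)) z =
    (\<Sum>L\<in>tuples (card K). form_weight K J L \<nu> * (F L \<nu> z t s - F L \<nu> z t (2 * s)))"
proof -
  let ?k = "CARD('d) + CARD('m) - 1" and ?w = "complex_of_real ((s *\<^sub>R \<nu>) \<bullet> t)" and ?X = "levi (s *\<^sub>R \<nu>)"
  let ?B = "\<lambda>s. \<Sum>L\<in>tuples (card K). form_weight K J L \<nu> * of_real (B_fun P (\<mu> \<nu>) L (exp (- s)))"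
  have s2: "0 < 2 * s" using s by simp
  have gz: "gap * (norm z)\<^sup>2 > 0" using gap(1) z by simp
  have n: "den \<nu> (exp (- s)) z t \<noteq> 0" "den \<nu> (exp (- (2 * s))) z t \<noteq> 0"
    using den_lower[OF A_fun_lower[OF \<nu> s], of z t] den_lower[OF A_fun_lower[OF \<nu> s2], of z t] gz by auto
  note ph = phase_levi[OF \<nu> s, of t z]
  have "phase1 ?X ?w z \<noteq> 0" "phase2 ?X ?w z \<noteq> 0" unfolding ph using n s by auto
  note kq = kern_eq[OF this]
  have k: "kern ?k K J ?X ?w z = of_real (s ^ CARD('d)) * ?B s * inverse (of_real s * den \<nu> (exp (- s)) z t) ^ ?k
     - of_real (s ^ CARD('d)) * ?B (2 * s) * inverse (of_real s * den \<nu> (exp (- (2 * s))) z t) ^ ?k"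
    unfolding kq symbol_dbl_levi[OF \<nu> s] symbol_levi[OF \<nu> s] ph ..
  have p: "complex_of_real (s ^ (CARD('m) - 1)) * (of_real (s ^ CARD('d)) * b * inverse (of_real s * c) ^ ?k) = b * (1 / c ^ ?k)" for b c
  proof -
    have "s ^ (CARD('m) - 1) * s ^ CARD('d) = s ^ ?k"
      by (subst power_add[symmetric]) (simp add: Suc_leI add.commute)
    then have "complex_of_real (s ^ (CARD('m) - 1)) * of_real (s ^ CARD('d)) = of_real s ^ ?k"
      by (metis of_real_mult of_real_power)
    moreover have "inverse (of_real s * c) ^ ?k = inverse (of_real s ^ ?k) * (1 / c ^ ?k)"
      by (simp add: power_mult_distrib power_inverse divide_inverse)
    moreover have "complex_of_real s ^ ?k \<noteq> 0" using s by simp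
    ultimately show ?thesis by (simp add: field_simps)
  qed
  have "of_real (s ^ (CARD('m) - 1)) * kern ?k K J ?X ?w z =
    ?B s * (1 / den \<nu> (exp (- s)) z t ^ ?k) - ?B (2 * s) * (1 / den \<nu> (exp (- (2 * s))) z t ^ ?k)"
    unfolding k right_diff_distrib p ..
  also have "\<dots> = (\<Sum>L\<in>tuples (card K). form_weight K J L \<nu> * (F L \<nu> z t s - F L \<nu> z t (2 * s)))"
  proof -
    have "?B s * (1 / den \<nu> (exp (- s)) z t ^ ?k) = (\<Sum>L\<in>tuples (card K). form_weight K J L \<nu> * F L \<nu> z t s)" for s
      unfolding F_def sum_distrib_right by (intro sum.cong refl) simp
    then show ?thesis by (simp only: right_diff_distrib sum_subtractf)
  qed
  finally show ?thesis .
qed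

lemma measurable_F_section: "\<nu> \<in> sphere 0 1 \<Longrightarrow> (\<lambda>s. F L \<nu> z t s) \<in> borel_measurable borel"
  unfolding F_def den_def A_fun_def B_fun_eq bfac_def by measurable

lemma set_integrable_exp_bound:
  fixes G :: "real \<Rightarrow> complex"
  assumes "G \<in> borel_measurable borel" "0 < c" "\<And>s. 0 < s \<Longrightarrow> cmod (G s) \<le> C * exp (- c * s)"
  shows "set_integrable lborel {0<..} G"
  unfolding set_integrable_def
proof (rule Bochner_Integration.integrable_bound)
  show "integrable lborel (\<lambda>s::real. C * exp (- c * norm s))"
    using integrable_exp_norm[OF assms(2)] by (rule integrable_mult_right)
  have "C \<ge> 0"
  proof -
    have "0 \<le> C * exp (- c * 1)" by (rule order.trans[OF norm_ge_zero assms(3)]) simp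
    then show ?thesis by (simp add: zero_le_mult_iff)
  qed
  then show "AE s in lborel. norm (indicator {0<..} s *\<^sub>R G s) \<le> norm (C * exp (- c * norm s))"
    using assms(3) by (intro AE_I2) (auto simp: indicator_def)
qed (use assms(1) in measurable)

lemma integral_exp_bound:
  fixes G :: "real \<Rightarrow> complex"
  assumes "G \<in> borel_measurable borel" "0 < c" "\<And>s. 0 < s \<Longrightarrow> cmod (G s) \<le> C * exp (- c * s)"
  shows "cmod (LINT s:{0<..}|lborel. G s) \<le> C * (LINT s|lborel. exp (- c * norm (s::real)))"
proof -
  have C: "C \<ge> 0"
  proof -
    have "0 \<le> C * exp (- c * 1)" by (rule order.trans[OF norm_ge_zero assms(3)]) simp
    then show ?thesis by (simp add: zero_le_mult_iff)
  qed
  have "cmod (LINT s:{0<..}|lborel. G s) \<le> (LINT s|lborel. norm (indicator {0<..} s *\<^sub>R G s))"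
    unfolding set_lebesgue_integral_def by (rule integral_norm_bound)
  also have "\<dots> \<le> (LINT s|lborel. C * exp (- c * norm (s::real)))"
  proof (rule Bochner_Integration.integral_mono)
    show "integrable lborel (\<lambda>s. norm (indicator {0<..} s *\<^sub>R G s))"
      using set_integrable_exp_bound[OF assms] unfolding set_integrable_def by (rule integrable_norm)
    show "integrable lborel (\<lambda>s::real. C * exp (- c * norm s))"
      using integrable_exp_norm[OF assms(2)] by (rule integrable_mult_right)
    show "norm (indicator {0<..} s *\<^sub>R G s) \<le> C * exp (- c * norm s)" for s
      using assms(3)[of s] C by (auto simp: indicator_def)
  qed
  finally show ?thesis by simp
qed

definition radial :: "'d set \<Rightarrow> 'm rvec \<Rightarrow> 'd cvec \<Rightarrow> 'm rvec \<Rightarrow> complex" where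
  "radial L \<nu> z t = (LINT s:{0<..}|lborel. F L \<nu> z t s - F L \<nu> z t (2 * s))"

lemma F_dilation_bound:
  assumes "z \<noteq> 0"
  obtains C where "C > 0" "\<And>L \<nu> t s. \<nu> \<in> sphere 0 1 \<Longrightarrow> 0 < s \<Longrightarrow> cmod (F L \<nu> z t s - F L \<nu> z t (2 * s)) \<le> C * exp (- gap * s)"
proof -
  obtain C where C: "C > 0" "\<And>L \<nu> t s. \<nu> \<in> sphere 0 1 \<Longrightarrow> 0 < s \<Longrightarrow> cmod (F L \<nu> z t s - F_lim L \<nu> z t) \<le> C * exp (- gap * s)"
    using F_diff_bound[OF assms] by metis
  show ?thesis
  proof (rule that[of "2 * C"])
    fix L and \<nu> t :: "'m rvec" and s :: real assume \<nu>: "\<nu> \<in> sphere 0 1" and s: "0 < s"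
    have "exp (- gap * (2 * s)) \<le> exp (- gap * s)" using s gap(1) by simp
    then have "C * exp (- gap * (2 * s)) \<le> C * exp (- gap * s)" using C(1) by (intro mult_left_mono) auto
    then show "cmod (F L \<nu> z t s - F L \<nu> z t (2 * s)) \<le> 2 * C * exp (- gap * s)"
      using C(2)[OF \<nu> s, of L t] C(2)[OF \<nu>, of "2 * s" L t] s
        norm_triangle_ineq4[of "F L \<nu> z t s - F_lim L \<nu> z t" "F L \<nu> z t (2 * s) - F_lim L \<nu> z t"] by simp
  qed (use C in auto)
qed

text \<open>Let G be the deviation of F from its limit. The integral of s \<mapsto> G(2 s) is half
  that of G, so the integral of G is twice that of G(s) - G(2 s), where the limit no longer
  appears.\<close>

lemma integral_F_diff:
  assumes \<nu>: "\<nu> \<in> sphere 0 1" and z: "z \<noteq> 0"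
  shows "(LINT r:{0<..<1}|lborel. (of_real (B_fun P (\<mu> \<nu>) L r) / green_denom \<mu> U r \<nu> z t - of_real (B_lim L \<nu>) / green_denom \<mu> U 0 \<nu> z t) / of_real r) =
    2 * radial L \<nu> z t"
proof -
  define G where "G s = F L \<nu> z t s - F_lim L \<nu> z t" for s
  have Gm: "G \<in> borel_measurable borel" unfolding G_def using measurable_F_section[OF \<nu>] by measurable
  obtain C where "C > 0" "\<And>L \<nu> t s. \<nu> \<in> sphere 0 1 \<Longrightarrow> 0 < s \<Longrightarrow> cmod (F L \<nu> z t s - F_lim L \<nu> z t) \<le> C * exp (- gap * s)"
    using F_diff_bound[OF z] by metis
  then have int: "set_integrable lborel {0<..} G"
    using \<nu> gap(1) by (intro set_integrable_exp_bound[OF Gm, of gap C]) (auto simp: G_def)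
  have "(LINT r:{0<..<1}|lborel. (of_real (B_fun P (\<mu> \<nu>) L r) / green_denom \<mu> U r \<nu> z t - of_real (B_lim L \<nu>) / green_denom \<mu> U 0 \<nu> z t) / of_real r) =
    (LINT r:{0<..<1}|lborel. G (- ln r) / of_real r)"
    by (rule set_lebesgue_integral_cong) (auto simp: G_def F_def F_lim_def green_denom_def den_def)
  also have "\<dots> = (LINT s:{0<..}|lborel. G s)" by (rule exp_substitution[OF Gm int])
  also have "\<dots> = 2 * ((LINT s:{0<..}|lborel. G s) - (LINT s:{0<..}|lborel. G (2 * s)))"
    using set_integral_scale[of G] by simp
  also have "(LINT s:{0<..}|lborel. G s) - (LINT s:{0<..}|lborel. G (2 * s)) = (LINT s:{0<..}|lborel. G s - G (2 * s))"
    by (rule set_integral_diff(2)[OF int set_integrable_scale[OF int], symmetric])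
  also have "(LINT s:{0<..}|lborel. G s - G (2 * s)) = radial L \<nu> z t"
    unfolding radial_def G_def by simp
  finally show ?thesis .
qed

text \<open>\<open>B_lim\<close> is 0 for L \<noteq> P and the modulus of the determinant for L = P,
  so \<open>integral_F_diff\<close> covers the plain and the corrected integral alike.\<close>

lemma radial_integral_eq:
  assumes "\<nu> \<in> sphere 0 1" "z \<noteq> 0"
  shows "L \<noteq> P \<Longrightarrow> radial_integral P \<mu> U L \<nu> z t = 2 * radial L \<nu> z t"
    "radial_integral_rel \<phi> P \<mu> U \<nu> z t = 2 * radial P \<nu> z t"
  using integral_F_diff[OF assms, of L t] integral_F_diff[OF assms, of P t]
  by (simp_all add: radial_integral_def radial_integral_rel_def B_lim_eq_0 det_levi[OF assms(1)])

lemma measurable_form_weight: "form_weight K J L \<in> borel_measurable sphere_measure"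
proof -
  have "mmeas sphere_measure (\<lambda>\<nu>. conj_matrix (U \<nu>))"
    using mmeas_U unfolding mmeas_def conj_matrix_def by (auto intro: measurable_compose[OF _ measurable_cnj])
  then show ?thesis unfolding form_weight_def
    by (intro borel_measurable_times measurable_minor_det measurable_dZbar_wedge mmeas_U)
qed

lemma measurable_radial_fn: "(\<lambda>\<nu>. radial L \<nu> z t) \<in> borel_measurable sphere_measure"
proof -
  have "(\<lambda>p. indicator {0<..} (snd p) *\<^sub>R (F L (fst p) z t (1 * snd p) - F L (fst p) z t (2 * snd p))) \<in> borel_measurable (sphere_measure \<Otimes>\<^sub>M lborel)"
    using measurable_F[of L z t 1] measurable_F[of L z t 2] by measurable
  then show ?thesis
    unfolding radial_def set_lebesgue_integral_def
    by (intro lborel.borel_measurable_lebesgue_integral) (simp add: case_prod_beta)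
qed

lemma integrable_form_weight_radial:
  assumes "z \<noteq> 0" "L \<in> tuples (card K)"
  shows "integrable sphere_measure (\<lambda>\<nu>. form_weight K J L \<nu> * radial L \<nu> z t)"
proof -
  interpret S: finite_measure "sphere_measure :: 'm rvec measure" by (rule finite_sphere_measure)
  obtain C where C: "C > 0" "\<And>L \<nu> t s. \<nu> \<in> sphere 0 1 \<Longrightarrow> 0 < s \<Longrightarrow> cmod (F L \<nu> z t s - F L \<nu> z t (2 * s)) \<le> C * exp (- gap * s)"
    using F_dilation_bound[OF assms(1)] by metis
  show ?thesis
  proof (rule S.integrable_const_bound)
    show "AE \<nu> in sphere_measure. norm (form_weight K J L \<nu> * radial L \<nu> z t) \<le> weight_bound K * (C * (LINT s|lborel. exp (- gap * norm (s::real))))"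
    proof (rule AE_I2)
      fix \<nu> :: "'m rvec" assume "\<nu> \<in> space sphere_measure"
      then have \<nu>: "\<nu> \<in> sphere 0 1" by (simp add: space_sphere_measure)
      have m: "(\<lambda>s. F L \<nu> z t s - F L \<nu> z t (2 * s)) \<in> borel_measurable borel"
        using measurable_F_section[OF \<nu>, of L z t] measurable_compose[OF _ measurable_F_section[OF \<nu>, of L z t], of "\<lambda>s. 2 * s" borel]
        by (intro borel_measurable_diff) auto
      have "cmod (radial L \<nu> z t) \<le> C * (LINT s|lborel. exp (- gap * norm (s::real)))"
        unfolding radial_def by (rule integral_exp_bound[OF m gap(1) C(2)[OF \<nu>]])
      then show "norm (form_weight K J L \<nu> * radial L \<nu> z t) \<le> weight_bound K * (C * (LINT s|lborel. exp (- gap * norm (s::real))))"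
        unfolding norm_mult by (intro mult_mono form_weight_le[OF \<nu> assms(2)] weight_bound_nonneg) auto
    qed
    show "(\<lambda>\<nu>. form_weight K J L \<nu> * radial L \<nu> z t) \<in> borel_measurable sphere_measure"
      by (intro borel_measurable_times measurable_form_weight measurable_radial_fn)
  qed
qed

definition kern_integral :: "'d set \<Rightarrow> 'd set \<Rightarrow> 'd cvec \<Rightarrow> 'm rvec \<Rightarrow> complex" where
  "kern_integral K J z t = (\<integral>x. kern (CARD('d) + CARD('m) - 1) K J (levi x) (of_real (x \<bullet> t)) z \<partial>lborel)"

text \<open>Only the sum over L depends on \<nu> and s through x = s \<nu> alone, so the sum is
  taken under both integrals before polar coordinates are undone. The two cases for q merge because
  all radial integrals have the same form.\<close>

lemma green_kernel_eq:
  assumes z: "z \<noteq> 0" and K: "card K = q"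
    and int: "integrable lborel (\<lambda>x. kern (CARD('d) + CARD('m) - 1) K J (levi x) (of_real (x \<bullet> t)) z)"
  shows "green_kernel \<phi> P \<mu> U q K J (z, t) = of_real (green_const (CARD('d) div 2) CARD('m)) * (2 * kern_integral K J z t)"
proof -
  let ?N = "\<Sum>L\<in>tuples q. LINT \<nu>|sphere_measure. form_weight K J L \<nu> * (2 * radial L \<nu> z t)"
  have c1: "(LINT \<nu>|sphere_measure. minor_det (conj_matrix (U \<nu>)) K L * dZbar_wedge (U \<nu>) L J * radial_integral P \<mu> U L \<nu> z t) =
    (LINT \<nu>|sphere_measure. form_weight K J L \<nu> * (2 * radial L \<nu> z t))" if "L \<noteq> P" for L
    using that z by (intro Bochner_Integration.integral_cong) (auto simp: space_sphere_measure form_weight_def radial_integral_eq)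
  have c2: "(LINT \<nu>|sphere_measure. minor_det (conj_matrix (U \<nu>)) K P * dZbar_wedge (U \<nu>) P J * radial_integral_rel \<phi> P \<mu> U \<nu> z t) =
    (LINT \<nu>|sphere_measure. form_weight K J P \<nu> * (2 * radial P \<nu> z t))"
    using z by (intro Bochner_Integration.integral_cong) (auto simp: space_sphere_measure form_weight_def radial_integral_eq)
  have "green_kernel \<phi> P \<mu> U q K J (z, t) = of_real (green_const (CARD('d) div 2) CARD('m)) * ?N"
  proof (cases "q = card P")
    case True
    then have "P \<in> tuples q" by (simp add: tuples_def)
    then have "?N = (\<Sum>L\<in>tuples q - {P}. LINT \<nu>|sphere_measure. form_weight K J L \<nu> * (2 * radial L \<nu> z t)) + (LINT \<nu>|sphere_measure. form_weight K J P \<nu> * (2 * radial P \<nu> z t))"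
      by (subst sum.remove[of _ P]) (auto simp: add.commute)
    then show ?thesis using True by (simp add: green_kernel_def c1 c2)
  next
    case False
    then have "L \<noteq> P" if "L \<in> tuples q" for L using that by (auto simp: tuples_def)
    then show ?thesis using False by (simp add: green_kernel_def c1)
  qed
  also have "?N = (LINT \<nu>|sphere_measure. (\<Sum>L\<in>tuples q. form_weight K J L \<nu> * (2 * radial L \<nu> z t)))"
    using integrable_form_weight_radial[OF z, of _ K J t] K
    by (intro Bochner_Integration.integral_sum[symmetric]) (simp add: mult.left_commute[of _ 2])
  also have "\<dots> = (LINT \<nu>|sphere_measure. 2 * (LINT s:{0<..}|lborel. of_real (s ^ (DIM('m rvec) - 1)) * kern (CARD('d) + CARD('m) - 1) K J (levi (s *\<^sub>R \<nu>)) (of_real ((s *\<^sub>R \<nu>) \<bullet> t)) z))"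
  proof (rule Bochner_Integration.integral_cong[OF refl])
    fix \<nu> :: "'m rvec" assume "\<nu> \<in> space sphere_measure"
    then have \<nu>: "\<nu> \<in> sphere 0 1" by (simp add: space_sphere_measure)
    obtain C where C: "C > 0" "\<And>L \<nu> t s. \<nu> \<in> sphere 0 1 \<Longrightarrow> 0 < s \<Longrightarrow> cmod (F L \<nu> z t s - F L \<nu> z t (2 * s)) \<le> C * exp (- gap * s)"
      using F_dilation_bound[OF z] by metis
    have m: "(\<lambda>s. F L \<nu> z t s - F L \<nu> z t (2 * s)) \<in> borel_measurable borel" for L
      using measurable_F_section[OF \<nu>, of L z t] measurable_compose[OF _ measurable_F_section[OF \<nu>, of L z t], of "\<lambda>s. 2 * s" borel]
      by (intro borel_measurable_diff) auto
    have si: "set_integrable lborel {0<..} (\<lambda>s. F L \<nu> z t s - F L \<nu> z t (2 * s))" for L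
      by (rule set_integrable_exp_bound[OF m gap(1) C(2)[OF \<nu>]])
    have "(LINT s:{0<..}|lborel. of_real (s ^ (DIM('m rvec) - 1)) * kern (CARD('d) + CARD('m) - 1) K J (levi (s *\<^sub>R \<nu>)) (of_real ((s *\<^sub>R \<nu>) \<bullet> t)) z) =
      (LINT s:{0<..}|lborel. (\<Sum>L\<in>tuples q. form_weight K J L \<nu> * (F L \<nu> z t s - F L \<nu> z t (2 * s))))"
      using kern_levi[OF \<nu> _ z, of _ K J t] K by (intro set_lebesgue_integral_cong) (auto simp del: inner_scaleR_left)
    also have "\<dots> = (\<Sum>L\<in>tuples q. form_weight K J L \<nu> * radial L \<nu> z t)"
    proof -
      have "(LINT s:{0<..}|lborel. (\<Sum>L\<in>tuples q. form_weight K J L \<nu> * (F L \<nu> z t s - F L \<nu> z t (2 * s)))) =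
        (LINT s|lborel. (\<Sum>L\<in>tuples q. form_weight K J L \<nu> * (indicator {0<..} s *\<^sub>R (F L \<nu> z t s - F L \<nu> z t (2 * s)))))"
        unfolding set_lebesgue_integral_def by (simp add: scaleR_right.sum)
      also have "\<dots> = (\<Sum>L\<in>tuples q. LINT s|lborel. form_weight K J L \<nu> * (indicator {0<..} s *\<^sub>R (F L \<nu> z t s - F L \<nu> z t (2 * s))))"
        using si unfolding set_integrable_def by (intro Bochner_Integration.integral_sum integrable_mult_right) auto
      also have "\<dots> = (\<Sum>L\<in>tuples q. form_weight K J L \<nu> * radial L \<nu> z t)"
        unfolding radial_def set_lebesgue_integral_def by (simp only: integral_mult_right_zero)
      finally show ?thesis .
    qed
    finally show "(\<Sum>L\<in>tuples q. form_weight K J L \<nu> * (2 * radial L \<nu> z t)) =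
      2 * (LINT s:{0<..}|lborel. of_real (s ^ (DIM('m rvec) - 1)) * kern (CARD('d) + CARD('m) - 1) K J (levi (s *\<^sub>R \<nu>)) (of_real ((s *\<^sub>R \<nu>) \<bullet> t)) z)"
      by (simp add: sum_distrib_left mult.left_commute)
  qed
  also have "\<dots> = 2 * kern_integral K J z t"
    unfolding kern_integral_def integral_polar[OF int] by simp
  finally show ?thesis .
qed

end

subsection \<open>Shift of the contour\<close>

lemma tame_integrable:
  fixes f :: "'x::euclidean_space \<Rightarrow> 'a::euclidean_space \<Rightarrow> complex"
  assumes "\<psi> \<in> borel_measurable borel" "0 < c" "\<And>x. cmod (\<psi> x) \<le> C * exp (- c * norm x)"
    and "tame0 B f" "p \<in> B"
  shows "integrable lborel (\<lambda>x. \<psi> x * f x p)"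
proof -
  obtain D N where D: "D \<ge> 0" "\<And>x p. p \<in> B \<Longrightarrow> cmod (f x p) \<le> D * (1 + norm x) ^ N"
    "\<And>p. p \<in> B \<Longrightarrow> (\<lambda>x. f x p) \<in> borel_measurable borel" using tame0E[OF assms(4)] by blast
  obtain M where M: "M > 0" "\<And>y. y \<ge> 0 \<Longrightarrow> (1 + y) ^ N \<le> M * exp (c / 2 * y)"
    using power_exp_bound[of "c / 2" N] assms(2) by auto
  have "0 \<le> C * exp (- c * norm (0::'x))" by (rule order.trans[OF norm_ge_zero assms(3)])
  then have C0: "C \<ge> 0" by simp
  have "integrable lborel (\<lambda>x::'x. C * D * M * exp (- (c / 2) * norm x))"
    using integrable_exp_norm[of "c / 2", where 'a = 'x] assms(2) by (intro integrable_mult_right) auto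
  then show ?thesis
  proof (rule Bochner_Integration.integrable_bound)
    show "AE x in lborel. norm (\<psi> x * f x p) \<le> norm (C * D * M * exp (- (c / 2) * norm x))"
    proof (rule AE_I2)
      fix x :: 'x
      have "cmod (f x p) \<le> D * (M * exp (c / 2 * norm x))"
        using D(2)[OF assms(5), of x] mult_left_mono[OF M(2)[OF norm_ge_zero, of x] D(1)] by linarith
      then have "norm (\<psi> x * f x p) \<le> (C * exp (- c * norm x)) * (D * (M * exp (c / 2 * norm x)))"
        unfolding norm_mult using assms(3) C0 by (intro mult_mono) auto
      also have "\<dots> = C * D * M * (exp (- c * norm x) * exp (c / 2 * norm x))" by simp
      also have "exp (- c * norm x) * exp (c / 2 * norm x) = exp (- (c / 2) * norm x)"
        by (simp add: exp_add[symmetric] algebra_simps)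
      finally show "norm (\<psi> x * f x p) \<le> norm (C * D * M * exp (- (c / 2) * norm x))"
        using C0 D(1) M(1) by (simp add: abs_mult)
    qed
  qed (use assms(1) D(3)[OF assms(5)] in auto)
qed

text \<open>In every term of the geometric sum the exponents of the two inverse phases add up to k +
  1.\<close>

lemma norm_kern_le:
  fixes X :: "'d::{finite,linorder} cmat"
  assumes c: "0 < c" "c \<le> cmod (phase1 X w z)" "c \<le> cmod (phase2 X w z)"
  shows "cmod (kern k K J X w z) \<le> cmod (symbol_diff K J X) * (1 / c) ^ k +
    (\<Sum>a\<in>UNIV. \<Sum>b\<in>UNIV. cmod (symbol_cross K J a b X)) * ((norm z)\<^sup>2 * (real k * (1 / c) ^ (k + 1)))"
proof -
  have i1: "cmod (inverse (phase1 X w z)) \<le> 1 / c" "cmod (inverse (phase2 X w z)) \<le> 1 / c"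
    using c by (simp_all add: norm_inverse divide_inverse le_imp_inverse_le)
  have a1: "cmod (symbol_diff K J X * inverse (phase1 X w z) ^ k) \<le> cmod (symbol_diff K J X) * (1 / c) ^ k"
    unfolding norm_mult norm_power using i1 by (intro mult_left_mono power_mono) auto
  have a2: "cmod (cross_form K J X z) \<le> (\<Sum>a\<in>UNIV. \<Sum>b\<in>UNIV. cmod (symbol_cross K J a b X)) * (norm z)\<^sup>2"
    unfolding cross_form_def sum_distrib_right
  proof (intro sum_norm_le)
    fix a b
    have "cmod (cnj (z $ a) * z $ b) \<le> (norm z)\<^sup>2"
      unfolding norm_mult power2_eq_square complex_mod_cnj
      by (intro mult_mono Finite_Cartesian_Product.norm_nth_le) auto
    then show "cmod (symbol_cross K J a b X * (cnj (z $ a) * z $ b)) \<le> cmod (symbol_cross K J a b X) * (norm z)\<^sup>2"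
      unfolding norm_mult[of "symbol_cross K J a b X"] by (intro mult_left_mono) auto
  qed
  have a3: "cmod (\<Sum>i<k. inverse (phase1 X w z) ^ Suc i * inverse (phase2 X w z) ^ (k - i)) \<le> real k * (1 / c) ^ (k + 1)"
  proof -
    have "cmod (inverse (phase1 X w z) ^ Suc i * inverse (phase2 X w z) ^ (k - i)) \<le> (1 / c) ^ (k + 1)" if "i < k" for i
    proof -
      have "cmod (inverse (phase1 X w z) ^ Suc i * inverse (phase2 X w z) ^ (k - i)) \<le> (1 / c) ^ Suc i * (1 / c) ^ (k - i)"
        unfolding norm_mult norm_power using i1 c(1) by (intro mult_mono power_mono) auto
      also have "\<dots> = (1 / c) ^ (k + 1)" using that by (simp only: power_add[symmetric]) simp
      finally show ?thesis .
    qed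
    then have "cmod (\<Sum>i<k. inverse (phase1 X w z) ^ Suc i * inverse (phase2 X w z) ^ (k - i)) \<le> (\<Sum>i<k. (1 / c) ^ (k + 1))"
      by (intro sum_norm_le) auto
    then show ?thesis by simp
  qed
  have "cmod (cross_form K J X z * (\<Sum>i<k. inverse (phase1 X w z) ^ Suc i * inverse (phase2 X w z) ^ (k - i))) \<le>
    ((\<Sum>a\<in>UNIV. \<Sum>b\<in>UNIV. cmod (symbol_cross K J a b X)) * (norm z)\<^sup>2) * (real k * (1 / c) ^ (k + 1))"
    unfolding norm_mult[of "cross_form K J X z"]
    by (rule mult_mono[OF a2 a3]) (auto intro!: mult_nonneg_nonneg sum_nonneg)
  then show ?thesis
    unfolding kern_def mult.assoc[of _ "(norm z)\<^sup>2"] by (rule order.trans[OF norm_triangle_ineq add_mono[OF a1]])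
qed

text \<open>The factor 1/2 comes from the halved form in \<open>phase2\<close>. The imaginary part
  of w enters with a plus sign, which is what the shift of the contour exploits.\<close>

lemma Re_phase:
  assumes "near_hermitian (1 / 4) X"
  shows "(norm z)\<^sup>2 / 2 + Im w \<le> Re (phase1 X w z)" "(norm z)\<^sup>2 / 2 + Im w \<le> Re (phase2 X w z)"
proof -
  have 0: "0 \<le> (norm z)\<^sup>2" by simp
  have 1: "(norm z)\<^sup>2 \<le> Re (cip z (xcoth X *v z))" by (rule Re_cip_xcoth[OF assms]) auto
  have 2: "(norm z)\<^sup>2 \<le> Re (cip z (xcoth (dbl X) *v z))" by (rule Re_cip_xcoth[OF near_hermitian_dbl[OF assms]]) auto
  have "Re (phase1 X w z) = Re (cip z (xcoth X *v z)) + Im w" by (simp add: phase1_def)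
  then show "(norm z)\<^sup>2 / 2 + Im w \<le> Re (phase1 X w z)" using 0 1 by linarith
  have "Re (phase2 X w z) = Re (cip z (xcoth (dbl X) *v z)) / 2 + Im w" by (simp add: phase2_def)
  then show "(norm z)\<^sup>2 / 2 + Im w \<le> Re (phase2 X w z)" using 2 by linarith
qed

context quadric begin

text \<open>The complex-linear extension of x \<bullet> t, evaluated at x + \<sigma> \<eta>.\<close>

definition shift_phase :: "'m rvec \<Rightarrow> complex \<Rightarrow> 'm rvec \<Rightarrow> 'm rvec \<Rightarrow> complex" where
  "shift_phase \<eta> \<sigma> x t = of_real (x \<bullet> t) + \<sigma> * of_real (\<eta> \<bullet> t)"

definition shifted_integral :: "'d set \<Rightarrow> 'd set \<Rightarrow> 'm rvec \<Rightarrow> complex \<Rightarrow> 'd cvec \<Rightarrow> 'm rvec \<Rightarrow> complex" where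
  "shifted_integral K J \<eta> \<sigma> z t = (\<integral>x. kern (CARD('d) + CARD('m) - 1) K J (line x \<eta> \<sigma>) (shift_phase \<eta> \<sigma> x t) z \<partial>lborel)"

text \<open>Finitely many decaying functions share their constants: add the bounds, take the
  smallest rate and the smallest width. The width is also capped so that the tube keeps the
  tolerance 1/4.\<close>

lemma tube_width:
  obtains C c \<epsilon> where "C > 0" "c > 0" "\<epsilon> > 0" "levi_bound * \<epsilon> \<le> 1 / 4"
    "\<And>x \<eta> w. norm \<eta> = 1 \<Longrightarrow> \<bar>Im w\<bar> \<le> \<epsilon> \<Longrightarrow> cmod (symbol_diff K J (line x \<eta> w)) \<le> C * exp (- c * norm (x + Re w *\<^sub>R \<eta>))"
    "\<And>x \<eta> w a b. norm \<eta> = 1 \<Longrightarrow> \<bar>Im w\<bar> \<le> \<epsilon> \<Longrightarrow> cmod (symbol_cross K J a b (line x \<eta> w)) \<le> C * exp (- c * norm (x + Re w *\<^sub>R \<eta>))"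
proof -
  have dd: "decaying (symbol_diff K J)" and dc: "\<And>a b. decaying (symbol_cross K J a b)"
    using decay_levi[of K J] by blast+
  have ex: "\<exists>C c \<epsilon>. C > 0 \<and> c > 0 \<and> \<epsilon> > 0 \<and> (\<forall>f\<in>A. \<forall>x \<eta> w. norm \<eta> = 1 \<longrightarrow> \<bar>Im w\<bar> \<le> \<epsilon> \<longrightarrow>
     cmod (f (line x \<eta> w)) \<le> C * exp (- c * norm (x + Re w *\<^sub>R \<eta>)))" if "finite A" "\<forall>f\<in>A. decaying f" for A
    using that
  proof (induction A rule: finite_induct)
    case empty
    then show ?case by (intro exI[of _ 1]) auto
  next
    case (insert f A)
    then obtain C c \<epsilon> where 1: "C > 0" "c > 0" "\<epsilon> > 0" "\<And>g x \<eta> w. g \<in> A \<Longrightarrow> norm \<eta> = 1 \<Longrightarrow> \<bar>Im w\<bar> \<le> \<epsilon> \<Longrightarrow>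
     cmod (g (line x \<eta> w)) \<le> C * exp (- c * norm (x + Re w *\<^sub>R \<eta>))" by auto
    obtain C' c' \<epsilon>' where 2: "C' > 0" "c' > 0" "\<epsilon>' > 0" "\<And>x \<eta> w. norm \<eta> = 1 \<Longrightarrow> \<bar>Im w\<bar> \<le> \<epsilon>' \<Longrightarrow>
     cmod (f (line x \<eta> w)) \<le> C' * exp (- c' * norm (x + Re w *\<^sub>R \<eta>))"
      using insert.prems unfolding decaying_def by auto
    have e: "C * exp (- c * y) \<le> (C + C') * exp (- min c c' * y)" "C' * exp (- c' * y) \<le> (C + C') * exp (- min c c' * y)" if "y \<ge> 0" for y
      using 1(1) 2(1) that by (auto intro!: mult_mono mult_right_mono)
    show ?case
    proof (intro exI conjI ballI allI impI)
      show "C + C' > 0" "min c c' > 0" "min \<epsilon> \<epsilon>' > 0" using 1 2 by auto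
      fix g and x \<eta> :: "'m rvec" and w assume g: "g \<in> insert f A" and \<eta>: "norm \<eta> = 1" and w: "\<bar>Im w\<bar> \<le> min \<epsilon> \<epsilon>'"
      show "cmod (g (line x \<eta> w)) \<le> (C + C') * exp (- min c c' * norm (x + Re w *\<^sub>R \<eta>))"
      proof (cases "g = f")
        case True
        then show ?thesis using order.trans[OF 2(4)[OF \<eta>, of w x] e(2)[OF norm_ge_zero]] w by simp
      next
        case False
        then show ?thesis using order.trans[OF 1(4)[OF _ \<eta>, of g w x] e(1)[OF norm_ge_zero]] w g by simp
      qed
    qed
  qed
  define A where "A = insert (symbol_diff K J) (range (\<lambda>(a, b). symbol_cross K J a b))"
  have "finite A" "\<forall>f\<in>A. decaying f" using dd dc by (auto simp: A_def)
  from ex[OF this] obtain C c \<epsilon> where all: "C > 0 \<and> c > 0 \<and> \<epsilon> > 0 \<and> (\<forall>f\<in>A. \<forall>x \<eta> w. norm \<eta> = 1 \<longrightarrow> \<bar>Im w\<bar> \<le> \<epsilon> \<longrightarrow>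
     cmod (f (line x \<eta> w)) \<le> C * exp (- c * norm (x + Re w *\<^sub>R \<eta>)))"
    by (elim exE) (rule that)
  have *: "C > 0" "c > 0" "\<epsilon> > 0" "\<And>f x \<eta> w. f \<in> A \<Longrightarrow>
     norm \<eta> = 1 \<Longrightarrow> \<bar>Im w\<bar> \<le> \<epsilon> \<Longrightarrow> cmod (f (line x \<eta> w)) \<le> C * exp (- c * norm (x + Re w *\<^sub>R \<eta>))"
    using all by auto
  have lb: "levi_bound > 0" using levi_bound_ge_1 by simp
  show ?thesis
  proof (rule that[of C c "min \<epsilon> (1 / (4 * levi_bound))"])
    have "levi_bound * min \<epsilon> (1 / (4 * levi_bound)) \<le> levi_bound * (1 / (4 * levi_bound))"
      using lb by (intro mult_left_mono) auto
    then show "levi_bound * min \<epsilon> (1 / (4 * levi_bound)) \<le> 1 / 4" using lb by simp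
    fix x \<eta> :: "'m rvec" and w assume \<eta>: "norm \<eta> = 1" "\<bar>Im w\<bar> \<le> min \<epsilon> (1 / (4 * levi_bound))"
    show "cmod (symbol_diff K J (line x \<eta> w)) \<le> C * exp (- c * norm (x + Re w *\<^sub>R \<eta>))"
      using \<eta> by (intro *(4)) (auto simp: A_def)
    show "cmod (symbol_cross K J a b (line x \<eta> w)) \<le> C * exp (- c * norm (x + Re w *\<^sub>R \<eta>))" for a b
      using \<eta> by (intro *(4)) (auto simp: A_def image_def)
  qed (use * lb in auto)
qed

lemma near_hermitian_tube:
  assumes "norm \<eta> = 1" "\<bar>Im w\<bar> \<le> \<epsilon>" "levi_bound * \<epsilon> \<le> 1 / 4"
  shows "near_hermitian (1 / 4) (line x \<eta> w)"
proof (rule near_hermitian_mono[OF near_hermitian_line[OF assms(1)]])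
  have "levi_bound * \<bar>Im w\<bar> \<le> levi_bound * \<epsilon>"
    using assms(2) levi_bound_ge_1 by (intro mult_left_mono) auto
  then show "levi_bound * \<bar>Im w\<bar> \<le> 1 / 4" using assms(3) by linarith
qed

lemma measurable_kern:
  "(\<lambda>x. kern k K J (line x \<eta> \<sigma>) (shift_phase \<eta> \<sigma> x t) z) \<in> borel_measurable borel"
proof -
  note [measurable] = measurable_symbols[OF mmeas_line[of \<eta> \<sigma>]]
  show ?thesis
    unfolding kern_def cross_form_def phase1_def phase2_def cip_def matrix_vector_mult_def shift_phase_def
    by (simp, measurable)
qed

text \<open>The phases are quadratic in z and affine in t, with coefficients of at most quadratic
  growth in x. The lower bound c on their real parts makes the reciprocals tame.\<close>

lemma tame_kern_parts:
  assumes \<eta>: "norm \<eta> = 1" and y: "\<bar>y\<bar> \<le> \<epsilon>" "levi_bound * \<epsilon> \<le> 1 / 4"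
    and B: "bounded B" and c: "0 < c" "\<And>z t. (z, t) \<in> B \<Longrightarrow> c \<le> (norm z)\<^sup>2 / 2 + y * (\<eta> \<bullet> t)"
  shows "tame n B (\<lambda>x (p :: 'd cvec \<times> 'm rvec). inverse (phase1 (line x \<eta> (\<i> * of_real y)) (shift_phase \<eta> (\<i> * of_real y) x (snd p)) (fst p)))"
    "tame n B (\<lambda>x (p :: 'd cvec \<times> 'm rvec). inverse (phase2 (line x \<eta> (\<i> * of_real y)) (shift_phase \<eta> (\<i> * of_real y) x (snd p)) (fst p)))"
    "tame n B (\<lambda>(x :: 'm rvec) (p :: 'd cvec \<times> 'm rvec). cnj (fst p $ a) * fst p $ b)"
proof -
  let ?\<sigma> = "\<i> * complex_of_real y"
  have nh: "near_hermitian (1 / 4) (line x \<eta> ?\<sigma>)" for x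
    by (rule near_hermitian_tube[OF \<eta> _ y(2)]) (use y in simp)
  have bl1: "bounded_linear (\<lambda>p :: 'd cvec \<times> 'm rvec. fst p $ b)" for b
    by (rule bounded_linear_compose[OF bounded_linear_vec_nth bounded_linear_fst])
  have bl2: "bounded_linear (\<lambda>p :: 'd cvec \<times> 'm rvec. cnj (fst p $ b))" for b
    by (rule bounded_linear_compose[OF bounded_linear_cnj bl1])
  have bl3: "bounded_linear (\<lambda>p :: 'd cvec \<times> 'm rvec. complex_of_real (snd p $ i))" for i
    by (rule bounded_linear_compose[OF bounded_linear_of_real bounded_linear_compose[OF bounded_linear_vec_nth bounded_linear_snd]])
  show zz: "tame n B (\<lambda>(x :: 'm rvec) (p :: 'd cvec \<times> 'm rvec). cnj (fst p $ a) * fst p $ b)" for a b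
    by (intro tame_mult tame_linear bl1 bl2 B)
  have "entry_norm (line x \<eta> ?\<sigma>) \<le> (levi_bound * (1 + \<bar>y\<bar>)) * (1 + norm x)" for x
  proof -
    have "norm x + \<bar>y\<bar> \<le> (1 + \<bar>y\<bar>) * (1 + norm x)" by (simp add: algebra_simps)
    then have "levi_bound * (norm x + \<bar>y\<bar>) \<le> levi_bound * ((1 + \<bar>y\<bar>) * (1 + norm x))"
      using levi_bound_ge_1 by (intro mult_left_mono) auto
    then show ?thesis using entry_norm_line[OF \<eta>, of x ?\<sigma>] by (simp add: norm_mult mult.assoc)
  qed
  from power_mono[OF this entry_norm_nonneg, of _ 2]
  have en: "(entry_norm (line x \<eta> ?\<sigma>))\<^sup>2 \<le> (levi_bound * (1 + \<bar>y\<bar>))\<^sup>2 * (1 + norm x)\<^sup>2" for x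
    by (simp add: power_mult_distrib)
  \<comment> \<open>The factor 4 covers the doubled matrix as well, whose entry norm is twice as
    large.\<close>
  define M where "M = 2 + 4 * (levi_bound * (1 + \<bar>y\<bar>))\<^sup>2"
  have one: "1 \<le> (1 + norm x)\<^sup>2" for x :: "'m rvec" by (rule one_le_power) simp
  have g1: "cmod (xcoth (line x \<eta> ?\<sigma>) $ a $ b) \<le> M * (1 + norm x) ^ 2" for x a b
  proof -
    have "cmod (xcoth (line x \<eta> ?\<sigma>) $ a $ b) \<le> 2 * 1 + (entry_norm (line x \<eta> ?\<sigma>))\<^sup>2"
      using norm_xcoth[OF nh[of x], of a b] by simp
    also have "\<dots> \<le> 2 * (1 + norm x)\<^sup>2 + 4 * ((levi_bound * (1 + \<bar>y\<bar>))\<^sup>2 * (1 + norm x)\<^sup>2)"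
      using en[of x] zero_le_power2[of "entry_norm (line x \<eta> ?\<sigma>)"] one[of x] by (intro add_mono mult_left_mono) linarith+
    finally show ?thesis by (simp add: M_def distrib_right)
  qed
  have g2: "cmod (xcoth (dbl (line x \<eta> ?\<sigma>)) $ a $ b) \<le> M * (1 + norm x) ^ 2" for x a b
  proof -
    have "cmod (xcoth (dbl (line x \<eta> ?\<sigma>)) $ a $ b) \<le> 2 * 1 + 4 * (entry_norm (line x \<eta> ?\<sigma>))\<^sup>2"
      using norm_xcoth[OF near_hermitian_dbl[OF nh[of x]], of a b] by (simp add: entry_norm_dbl power_mult_distrib)
    also have "\<dots> \<le> 2 * (1 + norm x)\<^sup>2 + 4 * ((levi_bound * (1 + \<bar>y\<bar>))\<^sup>2 * (1 + norm x)\<^sup>2)"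
      using en[of x] one[of x] by (intro add_mono mult_left_mono) auto
    finally show ?thesis by (simp add: M_def distrib_right)
  qed
  note meas = measurable_symbols[OF mmeas_line[of \<eta> ?\<sigma>]]
  have quad: "tame n B (\<lambda>x p. cip (fst p) (G x *v fst p))"
    if "\<And>a b. (\<lambda>x. G x $ a $ b) \<in> borel_measurable borel" "\<And>x a b. cmod (G x $ a $ b) \<le> M * (1 + norm x) ^ 2" for G :: "'m rvec \<Rightarrow> 'd cmat"
  proof -
    have "tame n B (\<lambda>x p. \<Sum>a\<in>UNIV. \<Sum>b\<in>UNIV. G x $ a $ b * (cnj (fst p $ a) * fst p $ b))"
      by (intro tame_sum tame_mult[OF _ zz] tame_coeff[OF that(1) that(2)])
    moreover have "(\<lambda>x p. \<Sum>a\<in>UNIV. \<Sum>b\<in>UNIV. G x $ a $ b * (cnj (fst p $ a) * fst p $ b)) = (\<lambda>x p :: 'd cvec \<times> 'm rvec. cip (fst p) (G x *v fst p))"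
      by (simp add: cip_def matrix_vector_mult_def sum_distrib_left mult_ac fun_eq_iff)
    ultimately show ?thesis by simp
  qed
  have cx: "(\<lambda>x :: 'm rvec. complex_of_real (x $ i)) \<in> borel_measurable borel" for i
    by (intro borel_measurable_continuous_onI continuous_intros)
  have "tame n B (\<lambda>x (p :: 'd cvec \<times> 'm rvec). (\<Sum>i\<in>UNIV. of_real (x $ i) * of_real (snd p $ i)) + (\<Sum>i\<in>UNIV. (?\<sigma> * of_real (\<eta> $ i)) * of_real (snd p $ i)))"
  proof (intro tame_add tame_sum tame_const tame_mult tame_linear[OF bl3 B])
    show "tame n B (\<lambda>(x :: 'm rvec) (p :: 'd cvec \<times> 'm rvec). complex_of_real (x $ i))" for i
    proof (rule tame_coeff[OF cx, of _ 1 1])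
      show "cmod (complex_of_real (x $ i)) \<le> 1 * (1 + norm x) ^ 1" for x :: "'m rvec"
        using component_le_norm_cart[of x i] by simp
    qed
  qed
  moreover have "(\<lambda>x (p :: 'd cvec \<times> 'm rvec). (\<Sum>i\<in>UNIV. of_real (x $ i) * of_real (snd p $ i)) + (\<Sum>i\<in>UNIV. (?\<sigma> * of_real (\<eta> $ i)) * of_real (snd p $ i))) =
    (\<lambda>x p. shift_phase \<eta> ?\<sigma> x (snd p))"
    by (simp add: shift_phase_def inner_vec_def sum_distrib_left mult.assoc fun_eq_iff)
  ultimately have sh: "tame n B (\<lambda>x (p :: 'd cvec \<times> 'm rvec). shift_phase \<eta> ?\<sigma> x (snd p))" by simp
  have im: "Im (shift_phase \<eta> ?\<sigma> x t) = y * (\<eta> \<bullet> t)" for x t by (simp add: shift_phase_def)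
  have p1: "tame n B (\<lambda>x (p :: 'd cvec \<times> 'm rvec). phase1 (line x \<eta> ?\<sigma>) (shift_phase \<eta> ?\<sigma> x (snd p)) (fst p))"
  proof -
    have "tame n B (\<lambda>x (p :: 'd cvec \<times> 'm rvec). cip (fst p) (xcoth (line x \<eta> ?\<sigma>) *v fst p) + (- \<i>) * shift_phase \<eta> ?\<sigma> x (snd p))"
      by (intro tame_add tame_mult tame_const sh quad meas(3) g1)
    then show ?thesis by (simp add: phase1_def)
  qed
  have p2: "tame n B (\<lambda>x (p :: 'd cvec \<times> 'm rvec). phase2 (line x \<eta> ?\<sigma>) (shift_phase \<eta> ?\<sigma> x (snd p)) (fst p))"
  proof -
    have "tame n B (\<lambda>x (p :: 'd cvec \<times> 'm rvec). (1 / 2) * cip (fst p) (xcoth (dbl (line x \<eta> ?\<sigma>)) *v fst p) + (- \<i>) * shift_phase \<eta> ?\<sigma> x (snd p))"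
      by (intro tame_add tame_mult tame_const sh quad meas(4) g2)
    then show ?thesis by (simp add: phase2_def)
  qed
  have lo: "c \<le> cmod (phase1 (line x \<eta> ?\<sigma>) (shift_phase \<eta> ?\<sigma> x (snd p)) (fst p))"
    "c \<le> cmod (phase2 (line x \<eta> ?\<sigma>) (shift_phase \<eta> ?\<sigma> x (snd p)) (fst p))" if "p \<in> B" for x p
    using c(2)[of "fst p" "snd p"] that Re_phase[OF nh[of x], of "fst p" "shift_phase \<eta> ?\<sigma> x (snd p)"]
      complex_Re_le_cmod[of "phase1 (line x \<eta> ?\<sigma>) (shift_phase \<eta> ?\<sigma> x (snd p)) (fst p)"]
      complex_Re_le_cmod[of "phase2 (line x \<eta> ?\<sigma>) (shift_phase \<eta> ?\<sigma> x (snd p)) (fst p)"]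
    unfolding im by auto
  show "tame n B (\<lambda>x (p :: 'd cvec \<times> 'm rvec). inverse (phase1 (line x \<eta> ?\<sigma>) (shift_phase \<eta> ?\<sigma> x (snd p)) (fst p)))"
    by (rule tame_inverse[OF p1 c(1) lo(1)])
  show "tame n B (\<lambda>x (p :: 'd cvec \<times> 'm rvec). inverse (phase2 (line x \<eta> ?\<sigma>) (shift_phase \<eta> ?\<sigma> x (snd p)) (fst p)))"
    by (rule tame_inverse[OF p2 c(1) lo(2)])
qed

text \<open>\<open>kern\<close> is a finite sum of products of an exponentially small coefficient in
  x alone with a tame factor in x and (z, t), so \<open>Ck_integral\<close> applies term by
  term.\<close>

lemma Ck_shifted_integral:
  assumes \<eta>: "norm \<eta> = 1" and y: "\<bar>y\<bar> \<le> \<epsilon>" "levi_bound * \<epsilon> \<le> 1 / 4"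
    and C: "0 < c'" "\<And>x. cmod (symbol_diff K J (line x \<eta> (\<i> * of_real y))) \<le> C * exp (- c' * norm x)"
    "\<And>x a b. cmod (symbol_cross K J a b (line x \<eta> (\<i> * of_real y))) \<le> C * exp (- c' * norm x)"
    and B: "open B" "bounded B" and c: "0 < c" "\<And>z t. (z, t) \<in> B \<Longrightarrow> c \<le> (norm z)\<^sup>2 / 2 + y * (\<eta> \<bullet> t)"
  shows "Ck n B (\<lambda>(z, t). shifted_integral K J \<eta> (\<i> * of_real y) z t)"
    "(z, t) \<in> B \<Longrightarrow> integrable lborel (\<lambda>x. kern (CARD('d) + CARD('m) - 1) K J (line x \<eta> (\<i> * of_real y)) (shift_phase \<eta> (\<i> * of_real y) x t) z)"
proof -
  let ?\<sigma> = "\<i> * complex_of_real y" and ?k = "CARD('d) + CARD('m) - 1"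
  let ?p1 = "\<lambda>x (p :: 'd cvec \<times> 'm rvec). inverse (phase1 (line x \<eta> ?\<sigma>) (shift_phase \<eta> ?\<sigma> x (snd p)) (fst p))"
  let ?p2 = "\<lambda>x (p :: 'd cvec \<times> 'm rvec). inverse (phase2 (line x \<eta> ?\<sigma>) (shift_phase \<eta> ?\<sigma> x (snd p)) (fst p))"
  let ?g = "\<lambda>a b x (p :: 'd cvec \<times> 'm rvec). (cnj (fst p $ a) * fst p $ b) * (\<Sum>i<?k. ?p1 x p ^ Suc i * ?p2 x p ^ (?k - i))"
  note t = tame_kern_parts[OF \<eta> y B(2) c]
  have t1: "tame n B (\<lambda>x p. ?p1 x p ^ ?k)" for n by (intro tame_power t)
  have t2: "tame n B (?g a b)" for n a b by (intro tame_power t tame_mult tame_sum)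
  note meas = measurable_symbols[OF mmeas_line[of \<eta> ?\<sigma>]]
  have i1: "integrable lborel (\<lambda>x. symbol_diff K J (line x \<eta> ?\<sigma>) * ?p1 x p ^ ?k)" if "p \<in> B" for p
    using that by (intro tame_integrable[OF meas(1) C(1,2), where B = B] tame_imp_tame0[OF t1[of 0]]) auto
  have i2: "integrable lborel (\<lambda>x. symbol_cross K J a b (line x \<eta> ?\<sigma>) * ?g a b x p)" if "p \<in> B" for a b p
    using that by (intro tame_integrable[OF meas(2) C(1,3), where B = B] tame_imp_tame0[OF t2[of 0]]) auto
  have kern: "kern ?k K J (line x \<eta> ?\<sigma>) (shift_phase \<eta> ?\<sigma> x (snd p)) (fst p) = symbol_diff K J (line x \<eta> ?\<sigma>) * ?p1 x p ^ ?k +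
    (\<Sum>a\<in>UNIV. \<Sum>b\<in>UNIV. symbol_cross K J a b (line x \<eta> ?\<sigma>) * ?g a b x p)" for x p
    unfolding kern_def cross_form_def by (simp only: sum_distrib_right mult.assoc)
  show "integrable lborel (\<lambda>x. kern ?k K J (line x \<eta> ?\<sigma>) (shift_phase \<eta> ?\<sigma> x t) z)" if "(z, t) \<in> B"
    using kern[of _ "(z, t)"] i1[OF that] i2[OF that]
    by (simp only: fst_conv snd_conv) (intro Bochner_Integration.integrable_add Bochner_Integration.integrable_sum, auto)
  have "Ck n B (\<lambda>p. (\<integral>x. symbol_diff K J (line x \<eta> ?\<sigma>) * ?p1 x p ^ ?k \<partial>lborel) +
    (\<Sum>a\<in>UNIV. \<Sum>b\<in>UNIV. \<integral>x. symbol_cross K J a b (line x \<eta> ?\<sigma>) * ?g a b x p \<partial>lborel))"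
    by (intro Ck_add Ck_sum B(1) Ck_integral[OF B(1) meas(1) C(1,2) integrable_exp_norm t1]
        Ck_integral[OF B(1) meas(2) C(1,3) integrable_exp_norm t2])
  moreover have "(\<integral>x. symbol_diff K J (line x \<eta> ?\<sigma>) * ?p1 x p ^ ?k \<partial>lborel) +
    (\<Sum>a\<in>UNIV. \<Sum>b\<in>UNIV. \<integral>x. symbol_cross K J a b (line x \<eta> ?\<sigma>) * ?g a b x p \<partial>lborel) = (case p of (z, t) \<Rightarrow> shifted_integral K J \<eta> ?\<sigma> z t)"
    if "p \<in> B" for p
  proof -
    have "(case p of (z, t) \<Rightarrow> shifted_integral K J \<eta> ?\<sigma> z t) = (\<integral>x. symbol_diff K J (line x \<eta> ?\<sigma>) * ?p1 x p ^ ?k +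
      (\<Sum>a\<in>UNIV. \<Sum>b\<in>UNIV. symbol_cross K J a b (line x \<eta> ?\<sigma>) * ?g a b x p) \<partial>lborel)"
      unfolding shifted_integral_def case_prod_beta kern ..
    also have "\<dots> = (\<integral>x. symbol_diff K J (line x \<eta> ?\<sigma>) * ?p1 x p ^ ?k \<partial>lborel) +
      (\<integral>x. (\<Sum>a\<in>UNIV. \<Sum>b\<in>UNIV. symbol_cross K J a b (line x \<eta> ?\<sigma>) * ?g a b x p) \<partial>lborel)"
      by (intro Bochner_Integration.integral_add i1 that Bochner_Integration.integrable_sum i2)
    also have "(\<integral>x. (\<Sum>a\<in>UNIV. \<Sum>b\<in>UNIV. symbol_cross K J a b (line x \<eta> ?\<sigma>) * ?g a b x p) \<partial>lborel) =
      (\<Sum>a\<in>UNIV. \<Sum>b\<in>UNIV. \<integral>x. symbol_cross K J a b (line x \<eta> ?\<sigma>) * ?g a b x p \<partial>lborel)"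
      by (subst Bochner_Integration.integral_sum, (intro Bochner_Integration.integrable_sum i2 that),
          intro sum.cong refl Bochner_Integration.integral_sum i2 that)
    finally show ?thesis ..
  qed
  ultimately show "Ck n B (\<lambda>(z, t). shifted_integral K J \<eta> ?\<sigma> z t)"
    by (subst (asm) Ck_cong[OF B(1)]) auto
qed

end

lemma integral_translation:
  fixes f :: "'a::euclidean_space \<Rightarrow> complex"
  assumes [measurable]: "f \<in> borel_measurable borel"
  shows "(\<integral>x. f (c + x) \<partial>lborel) = (\<integral>x. f x \<partial>lborel)"
proof -
  have "(\<integral>x. f x \<partial>lborel) = (\<integral>x. f x \<partial>(distr lborel borel ((+) c)))"
    by (simp add: lborel_distr_plus)
  also have "\<dots> = (\<integral>x. f (c + x) \<partial>lborel)" by (rule integral_distr) measurable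
  finally show ?thesis ..
qed

context quadric begin

text \<open>A real shift is a translation of the integration variable.\<close>

lemma shifted_integral_real: "shifted_integral K J \<eta> (of_real r) z t = kern_integral K J z t"
proof -
  let ?f = "\<lambda>x. kern (CARD('d) + CARD('m) - 1) K J (levi x) (of_real (x \<bullet> t)) z"
  have m: "?f \<in> borel_measurable borel"
    using measurable_kern[of "CARD('d) + CARD('m) - 1" K J 0 0 t z] by (simp add: line_def shift_phase_def)
  have "shifted_integral K J \<eta> (of_real r) z t = (\<integral>x. ?f (r *\<^sub>R \<eta> + x) \<partial>lborel)"
    unfolding shifted_integral_def line_real by (simp add: shift_phase_def inner_add_left add.commute)
  also have "\<dots> = kern_integral K J z t" unfolding kern_integral_def by (rule integral_translation[OF m])
  finally show ?thesis .
qed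

text \<open>The integral is holomorphic in the shift \<sigma> and constant for real \<sigma>, hence
  constant on the strip by the identity theorem. Since z \<noteq> 0, the phases stay away from zero
  even slightly below the real axis.\<close>

lemma shifted_integral_shift:
  assumes \<eta>: "norm \<eta> = 1" and \<epsilon>: "0 < \<epsilon>" "levi_bound * \<epsilon> \<le> 1 / 4" and C: "0 < C" "0 < c"
    and dec: "\<And>x w. \<bar>Im w\<bar> \<le> \<epsilon> \<Longrightarrow> cmod (symbol_diff K J (line x \<eta> w)) \<le> C * exp (- c * norm (x + Re w *\<^sub>R \<eta>))"
    "\<And>x w a b. \<bar>Im w\<bar> \<le> \<epsilon> \<Longrightarrow> cmod (symbol_cross K J a b (line x \<eta> w)) \<le> C * exp (- c * norm (x + Re w *\<^sub>R \<eta>))"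
    and z: "z \<noteq> 0" and t: "0 \<le> \<eta> \<bullet> t" and y: "0 \<le> y" "y < \<epsilon>"
  shows "shifted_integral K J \<eta> (\<i> * of_real y) z t = kern_integral K J z t"
proof -
  let ?k = "CARD('d) + CARD('m) - 1"
  have z2: "(norm z)\<^sup>2 > 0" using z by simp
  \<comment> \<open>The real axis must lie in the interior of the strip, and below it Im w (\<eta>
    \<bullet> t) may be negative. At depth \<delta> the loss is at most |z|^2/4, half of the
    coercive term; the summand 1 keeps the quotient defined when \<eta> \<bullet> t = 0.\<close>
  define \<delta> where "\<delta> = min \<epsilon> ((norm z)\<^sup>2 / (4 * (1 + \<eta> \<bullet> t)))"
  have \<delta>: "0 < \<delta>" "\<delta> \<le> \<epsilon>" using \<epsilon> z2 t by (auto simp: \<delta>_def)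
  define S where "S = {w :: complex. - \<delta> < Im w \<and> Im w < \<epsilon>}"
  define c0 where "c0 = (norm z)\<^sup>2 / 4"
  have c0: "c0 > 0" using z2 by (simp add: c0_def)
  have oS: "open S" unfolding S_def by (intro open_Collect_conj open_Collect_less continuous_intros)
  have imS: "\<bar>Im w\<bar> \<le> \<epsilon>" if "w \<in> S" for w using that \<delta> by (auto simp: S_def)
  have nh: "near_hermitian (1 / 4) (line x \<eta> w)" if "w \<in> S" for x w
    by (rule near_hermitian_tube[OF \<eta> imS[OF that] \<epsilon>(2)])
  have lowIm: "- c0 \<le> Im w * (\<eta> \<bullet> t)" if "w \<in> S" for w
  proof (cases "Im w \<ge> 0")
    case True
    then have "0 \<le> Im w * (\<eta> \<bullet> t)" using t by simp
    then show ?thesis using c0 by linarith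
  next
    case False
    have "- Im w \<le> (norm z)\<^sup>2 / (4 * (1 + \<eta> \<bullet> t))" proof -
      have "\<delta> \<le> (norm z)\<^sup>2 / (4 * (1 + \<eta> \<bullet> t))" unfolding \<delta>_def by (rule min.cobounded2)
      moreover have "- \<delta> < Im w" using that by (simp add: S_def)
      ultimately show ?thesis by linarith
    qed
    then have "- Im w * (\<eta> \<bullet> t) \<le> (norm z)\<^sup>2 / (4 * (1 + \<eta> \<bullet> t)) * (1 + \<eta> \<bullet> t)"
      using t False z2 by (intro mult_mono) auto
    also have "\<dots> = c0" proof -
      have cancel: "a / (4 * u) * u = a / 4" if "u \<noteq> 0" for a u :: real using that by simp
      show ?thesis unfolding c0_def by (rule cancel) (use t in linarith)
    qed
    finally show ?thesis by simp
  qed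
  have ph: "c0 \<le> cmod (phase1 (line x \<eta> w) (shift_phase \<eta> w x t) z)" "c0 \<le> cmod (phase2 (line x \<eta> w) (shift_phase \<eta> w x t) z)"
    if w: "w \<in> S" for x w
  proof -
    have "Im (shift_phase \<eta> w x t) = Im w * (\<eta> \<bullet> t)" by (simp add: shift_phase_def)
    then have "c0 \<le> (norm z)\<^sup>2 / 2 + Im (shift_phase \<eta> w x t)" using lowIm[OF w] by (simp add: c0_def)
    then show "c0 \<le> cmod (phase1 (line x \<eta> w) (shift_phase \<eta> w x t) z)" "c0 \<le> cmod (phase2 (line x \<eta> w) (shift_phase \<eta> w x t) z)"
      using Re_phase[OF nh[OF w], of z "shift_phase \<eta> w x t" x] complex_Re_le_cmod order.trans by meson+
  qed
  define M where "M = C * (1 / c0) ^ ?k + (real (CARD('d) * CARD('d)) * C) * ((norm z)\<^sup>2 * (real ?k * (1 / c0) ^ (?k + 1)))"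
  have M0: "M \<ge> 0" using C c0 by (simp add: M_def)
  have kb: "cmod (kern ?k K J (line x \<eta> w) (shift_phase \<eta> w x t) z) \<le> M * exp (- c * norm (x + Re w *\<^sub>R \<eta>))" if w: "w \<in> S" for x w
  proof -
    let ?e = "exp (- c * norm (x + Re w *\<^sub>R \<eta>))"
    have "cmod (symbol_diff K J (line x \<eta> w)) * (1 / c0) ^ ?k \<le> (C * ?e) * (1 / c0) ^ ?k"
      using c0 by (intro mult_right_mono dec imS w) auto
    moreover have "(\<Sum>a\<in>UNIV. \<Sum>b\<in>UNIV. cmod (symbol_cross K J a b (line x \<eta> w))) \<le> (\<Sum>a\<in>(UNIV::'d set). \<Sum>b\<in>(UNIV::'d set). C * ?e)"
      by (intro sum_mono dec imS w)
    then have "(\<Sum>a\<in>UNIV. \<Sum>b\<in>UNIV. cmod (symbol_cross K J a b (line x \<eta> w))) * ((norm z)\<^sup>2 * (real ?k * (1 / c0) ^ (?k + 1))) \<le>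
      (real (CARD('d) * CARD('d)) * C * ?e) * ((norm z)\<^sup>2 * (real ?k * (1 / c0) ^ (?k + 1)))"
      using c0 by (intro mult_right_mono) (auto simp: mult.assoc)
    moreover have distr: "(C * A + R * B) * e = C * e * A + R * e * B" for A B R e by (simp add: algebra_simps)
    ultimately show ?thesis
      unfolding M_def distr by (intro order.trans[OF norm_kern_le[OF c0 ph[OF w]]] add_mono)
  qed
  have "(\<lambda>w. shifted_integral K J \<eta> w z t) holomorphic_on S"
    unfolding shifted_integral_def
  proof (rule holomorphic_on_integral)
    show "(\<lambda>x. kern ?k K J (line x \<eta> w) (shift_phase \<eta> w x t) z) \<in> borel_measurable lborel" for w
      using measurable_kern by simp
    show "(\<lambda>w. kern ?k K J (line x \<eta> w) (shift_phase \<eta> w x t) z) holomorphic_on S" for x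
    proof -
      note h = holomorphic_symbols[OF mhol_line oS nh]
      have nz: "phase1 (line x \<eta> w) (shift_phase \<eta> w x t) z \<noteq> 0" "phase2 (line x \<eta> w) (shift_phase \<eta> w x t) z \<noteq> 0" if "w \<in> S" for w
        using ph[OF that, of x] c0 by auto
      have "(\<lambda>w. phase1 (line x \<eta> w) (shift_phase \<eta> w x t) z) holomorphic_on S"
        unfolding phase1_def cip_def matrix_vector_mult_def shift_phase_def
        by (simp, intro holomorphic_intros h(3))
      moreover have "(\<lambda>w. phase2 (line x \<eta> w) (shift_phase \<eta> w x t) z) holomorphic_on S"
        unfolding phase2_def cip_def matrix_vector_mult_def shift_phase_def
        by (simp, intro holomorphic_intros h(4)) simp_all
      ultimately show ?thesis
        unfolding kern_def cross_form_def using nz by (intro holomorphic_intros h(1,2)) auto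
    qed
    fix w assume w: "w \<in> S"
    obtain e where e: "e > 0" "cball w e \<subseteq> S" using oS w open_contains_cball by blast
    \<comment> \<open>On the disc |Re w'| \<le> R, so decay in x + Re w' \<eta> is decay in x up to
      the factor exp (c R).\<close>
    define R where "R = cmod w + e"
    show "\<exists>e>0. \<exists>g. cball w e \<subseteq> S \<and> integrable lborel g \<and>
      (\<forall>x\<in>space lborel. \<forall>w'\<in>cball w e. cmod (kern ?k K J (line x \<eta> w') (shift_phase \<eta> w' x t) z) \<le> g x)"
    proof (intro exI conjI ballI)
      show "integrable lborel (\<lambda>x::'m rvec. (M * exp (c * R)) * exp (- c * norm x))"
        using integrable_exp_norm[OF C(2)] by (rule integrable_mult_right)
      fix x :: "'m rvec" and w' assume w': "w' \<in> cball w e"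
      have "cmod w' \<le> R" using w' norm_triangle_ineq2[of w' w] unfolding R_def by (simp add: dist_norm norm_minus_commute)
      then have "\<bar>Re w'\<bar> \<le> R" using abs_Re_le_cmod[of w'] by linarith
      then have "norm x - R \<le> norm (x + Re w' *\<^sub>R \<eta>)"
        using norm_triangle_ineq4[of "x + Re w' *\<^sub>R \<eta>" "Re w' *\<^sub>R \<eta>"] \<eta> by simp
      then have "c * (norm x - R) \<le> c * norm (x + Re w' *\<^sub>R \<eta>)" using C(2) by (intro mult_left_mono) auto
      then have "exp (- c * norm (x + Re w' *\<^sub>R \<eta>)) \<le> exp (c * R) * exp (- c * norm x)"
        unfolding exp_add[symmetric] by (simp add: algebra_simps)
      then have "M * exp (- c * norm (x + Re w' *\<^sub>R \<eta>)) \<le> (M * exp (c * R)) * exp (- c * norm x)"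
        using M0 unfolding mult.assoc by (rule mult_left_mono)
      then show "cmod (kern ?k K J (line x \<eta> w') (shift_phase \<eta> w' x t) z) \<le> (M * exp (c * R)) * exp (- c * norm x)"
        using kb[of w' x] w' e by (meson order.trans subsetD)
    qed (use e in auto)
  qed
  then have hol: "(\<lambda>w. shifted_integral K J \<eta> w z t - kern_integral K J z t) holomorphic_on S"
    by (intro holomorphic_intros)
  have "shifted_integral K J \<eta> (\<i> * of_real y) z t - kern_integral K J z t = 0"
  proof (rule analytic_continuation[OF hol oS, of "range of_real" 0])
    have "convex S"
    proof -
      have "S = {w. Im w > - \<delta>} \<inter> {w. Im w < \<epsilon>}" by (auto simp: S_def)
      then show ?thesis by (simp only:) (intro convex_Int convex_halfspace_Im_gt convex_halfspace_Im_lt)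
    qed
    then show "connected S" by (rule convex_connected)
    show "range of_real \<subseteq> S" using \<delta> \<epsilon> by (auto simp: S_def)
    show "0 \<in> S" using \<delta> \<epsilon> by (auto simp: S_def)
    show "0 islimpt range complex_of_real"
      unfolding islimpt_approachable
    proof (intro allI impI)
      fix e :: real assume "e > 0"
      then show "\<exists>x'\<in>range complex_of_real. x' \<noteq> 0 \<and> dist x' 0 < e"
        by (intro bexI[OF _ rangeI[of complex_of_real "e / 2"]]) auto
    qed
    show "\<And>w. w \<in> range complex_of_real \<Longrightarrow> shifted_integral K J \<eta> w z t - kern_integral K J z t = 0"
      by (auto simp: shifted_integral_real)
    show "\<i> * of_real y \<in> S" using y \<delta> by (simp add: S_def)
  qed
  then show ?thesis by simp
qed

definition kernel_ext :: "nat \<Rightarrow> 'd set \<Rightarrow> 'd set \<Rightarrow> 'd cvec \<times> 'm rvec \<Rightarrow> complex" where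
  "kernel_ext q K J = cont_extension (green_kernel \<phi> P \<mu> U q K J)"

end

section \<open>Smooth extension across z = 0\<close>

lemma off_axis_iff: "p \<in> off_axis \<longleftrightarrow> fst p \<noteq> 0"
  by (auto simp: off_axis_def)

lemma open_off_axis: "open (off_axis :: ('d::finite cvec \<times> 'm::finite rvec) set)"
proof -
  have e: "(off_axis :: ('d cvec \<times> 'm rvec) set) = fst -` (- {0})" by (auto simp: off_axis_iff)
  show ?thesis unfolding e by (intro open_vimage_fst open_Compl closed_singleton)
qed

text \<open>Limits from z \<noteq> 0 are therefore unique at every point. Of two displacements of
  different length at most one can cancel the z-component, so the other one leads off the
  axis.\<close>

lemma at_off_axis_nontrivial: "at p within (off_axis :: ('d::finite cvec \<times> 'm::finite rvec) set) \<noteq> bot"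
proof -
  have "p islimpt (off_axis :: ('d cvec \<times> 'm rvec) set)"
    unfolding islimpt_approachable
  proof (intro allI impI)
    fix e :: real assume e: "e > 0"
    obtain u :: "'d cvec" where u: "norm u = e / 2" using vector_choose_size[of "e / 2"] e by auto
    obtain v :: "'d cvec" where v: "norm v = e / 4" using vector_choose_size[of "e / 4"] e by auto
    define h where "h = (if fst p + u = 0 then v else u)"
    have h: "h \<noteq> 0" "norm h < e" using u v e by (auto simp: h_def)
    have "fst p + h \<noteq> 0"
    proof
      assume a: "fst p + h = 0"
      then have "fst p + u = 0" by (auto simp: h_def split: if_splits)
      with a have "u = v" by (simp add: h_def add_eq_0_iff split: if_splits) 
      then show False using u v e by simp
    qed
    then show "\<exists>x'\<in>off_axis. x' \<noteq> p \<and> dist x' p < e"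
      using h by (intro bexI[of _ "p + (h, 0)"]) (auto simp: off_axis_iff dist_norm norm_Pair prod_eq_iff)
  qed
  then show ?thesis by (simp add: trivial_limit_within)
qed

lemma cont_extension_eq:
  assumes "open B" "continuous_on B g" "\<And>q. q \<in> B \<Longrightarrow> q \<in> off_axis \<Longrightarrow> f q = g q" "p \<in> B"
  shows "cont_extension f p = g p" "(f \<longlongrightarrow> g p) (at p within off_axis)"
proof -
  have "(g \<longlongrightarrow> g p) (at p within off_axis)"
    using assms(1,2,4) continuous_on_eq_continuous_at[OF assms(1)] by (meson continuous_at_imp_continuous_at_within continuous_within)
  moreover have "\<forall>\<^sub>F q in at p within off_axis. g q = f q"
    using assms by (auto simp: eventually_at_topological intro!: exI[of _ B])
  ultimately show lim: "(f \<longlongrightarrow> g p) (at p within off_axis)"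
    using Lim_transform_eventually by fast
  show "cont_extension f p = g p"
    using assms(3)[OF assms(4)] tendsto_Lim[OF at_off_axis_nontrivial lim] by (simp add: cont_extension_def)
qed

lemma Ck_subset: "Ck n B f \<Longrightarrow> A \<subseteq> B \<Longrightarrow> Ck n A f"
  by (subst Ck_pointwise, subst (asm) Ck_pointwise) auto

lemma Ck_continuous_on: "Ck 1 B f \<Longrightarrow> continuous_on B f"
  by (simp add: continuous_at_imp_continuous_on differentiable_imp_continuous_within)

context quadric begin

text \<open>Off the axis the unshifted integral is locally smooth because |z| is bounded below; near
  (0, t0) the shifted one is. Both represent the kernel wherever they apply and z \<noteq> 0, so the
  local formulas fit together.\<close>

lemma Ck_kernel_ext:
  assumes K: "card K = q"
  shows "Ck n (- {0}) (kernel_ext q K J)"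
    "p \<in> off_axis \<Longrightarrow> kernel_ext q K J p = green_kernel \<phi> P \<mu> U q K J p"
proof -
  let ?c = "of_real (green_const (CARD('d) div 2) CARD('m)) * 2 :: complex"
  obtain C c \<epsilon> where tw: "C > 0" "c > 0" "\<epsilon> > 0" "levi_bound * \<epsilon> \<le> 1 / 4"
    "\<And>x \<eta> w. norm \<eta> = 1 \<Longrightarrow> \<bar>Im w\<bar> \<le> \<epsilon> \<Longrightarrow> cmod (symbol_diff K J (line x \<eta> w)) \<le> C * exp (- c * norm (x + Re w *\<^sub>R \<eta>))"
    "\<And>x \<eta> w a b. norm \<eta> = 1 \<Longrightarrow> \<bar>Im w\<bar> \<le> \<epsilon> \<Longrightarrow> cmod (symbol_cross K J a b (line x \<eta> w)) \<le> C * exp (- c * norm (x + Re w *\<^sub>R \<eta>))"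
    using tube_width[of K J] by metis
  obtain \<eta>0 :: "'m rvec" where \<eta>0: "norm \<eta>0 = 1" using vector_choose_size[of 1] by auto
  have rep: "green_kernel \<phi> P \<mu> U q K J (z, t) = ?c * kern_integral K J z t" if z: "z \<noteq> 0" for z t
  proof -
    \<comment> \<open>On this ball the norm of the z-component stays above |z|/2, so the phases are
      bounded below already at y = 0.\<close>
    define B where "B = ball (z, t) (norm z / 2)"
    have far: "norm z / 2 \<le> norm z'" if "(z', t') \<in> B" for z' t'
    proof -
      have "norm (z - z') < norm z / 2"
        using that norm_fst_le[of "z - z'" "t - t'"] by (simp add: B_def dist_norm)
      then show ?thesis using norm_triangle_ineq2[of z z'] by simp
    qed
    have b: "(norm z / 2)\<^sup>2 / 2 \<le> (norm z')\<^sup>2 / 2 + 0 * (\<eta>0 \<bullet> t')" if "(z', t') \<in> B" for z' t'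
      using power_mono[OF far[OF that], of 2] by simp
    have "integrable lborel (\<lambda>x. kern (CARD('d) + CARD('m) - 1) K J (line x \<eta>0 (\<i> * of_real 0)) (shift_phase \<eta>0 (\<i> * of_real 0) x t) z)"
      by (rule Ck_shifted_integral(2)[of \<eta>0 0 \<epsilon> c K J C B "(norm z / 2)\<^sup>2 / 2"])
         (use \<eta>0 tw(1-4) tw(5,6)[OF \<eta>0, of 0] b z in \<open>auto simp: B_def\<close>)
    then have "integrable lborel (\<lambda>x. kern (CARD('d) + CARD('m) - 1) K J (levi x) (of_real (x \<bullet> t)) z)"
      by (simp add: line_def shift_phase_def)
    from green_kernel_eq[OF z K this] show ?thesis by simp
  qed
  have local: "\<exists>B g. open B \<and> p \<in> B \<and> (\<forall>n. Ck n B g) \<and> (\<forall>q'\<in>B. q' \<in> off_axis \<longrightarrow> green_kernel \<phi> P \<mu> U q K J q' = g q')"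
    if p: "p \<noteq> 0" for p
  proof (cases "fst p = 0")
    case False
    obtain z t where p: "p = (z, t)" by (cases p)
    have z: "z \<noteq> 0" using False p by simp
    define B where "B = ball (z, t) (norm z / 2)"
    have far: "norm z / 2 \<le> norm z'" if "(z', t') \<in> B" for z' t'
    proof -
      have "norm (z - z') < norm z / 2"
        using that norm_fst_le[of "z - z'" "t - t'"] by (simp add: B_def dist_norm)
      then show ?thesis using norm_triangle_ineq2[of z z'] by simp
    qed
    have b: "(norm z / 2)\<^sup>2 / 2 \<le> (norm z')\<^sup>2 / 2 + 0 * (\<eta>0 \<bullet> t')" if "(z', t') \<in> B" for z' t'
      using power_mono[OF far[OF that], of 2] by simp
    have ck: "Ck n B (\<lambda>(z, t). shifted_integral K J \<eta>0 (\<i> * of_real 0) z t)" for n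
      by (rule Ck_shifted_integral(1)[of \<eta>0 0 \<epsilon> c K J C B "(norm z / 2)\<^sup>2 / 2"])
         (use \<eta>0 tw(1-4) tw(5,6)[OF \<eta>0, of 0] b z in \<open>auto simp: B_def\<close>)
    have "Ck n B (\<lambda>p. ?c * (case p of (z, t) \<Rightarrow> shifted_integral K J \<eta>0 (\<i> * of_real 0) z t))" for n
      by (rule Ck_cmult[OF _ ck]) (simp add: B_def)
    moreover have "green_kernel \<phi> P \<mu> U q K J q' = ?c * (case q' of (z, t) \<Rightarrow> shifted_integral K J \<eta>0 (\<i> * of_real 0) z t)" if "q' \<in> off_axis" for q'
      using that rep[of "fst q'" "snd q'"] shifted_integral_real[of K J \<eta>0 0] by (cases q') (simp add: off_axis_iff)
    ultimately show ?thesis using z unfolding p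
      by (intro exI[of _ B] exI[of _ "\<lambda>p. ?c * (case p of (z, t) \<Rightarrow> shifted_integral K J \<eta>0 (\<i> * of_real 0) z t)"]) (auto simp: B_def)
  next
    case True
    obtain t0 where p0: "p = (0, t0)" "t0 \<noteq> 0" using True p by (cases p) (auto simp: zero_prod_def)
    \<comment> \<open>On the ball of radius |t0|/2 one has \<eta> \<bullet> t \<ge> |t0|/2, so the
      shift by i y \<eta> keeps the real parts of the phases above y |t0|/2, at z = 0 as
      well.\<close>
    define \<eta> where "\<eta> = t0 /\<^sub>R norm t0"
    have \<eta>: "norm \<eta> = 1" using p0 by (simp add: \<eta>_def)
    have \<eta>t0: "\<eta> \<bullet> t0 = norm t0" using p0 by (simp add: \<eta>_def dot_square_norm power2_eq_square)
    define y where "y = \<epsilon> / 2"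
    have y: "0 < y" "y < \<epsilon>" using tw(3) by (auto simp: y_def)
    define B :: "('d cvec \<times> 'm rvec) set" where "B = ball (0, t0) (norm t0 / 2)"
    have tt: "norm t0 / 2 \<le> \<eta> \<bullet> t'" if "(z', t') \<in> B" for z' t'
    proof -
      have "norm (t0 - t') < norm t0 / 2"
        using that norm_snd_le[of "t0 - t'" "0 - z'"] by (simp add: B_def dist_norm)
      moreover have "\<eta> \<bullet> (t0 - t') \<le> norm (t0 - t')" using norm_cauchy_schwarz[of \<eta> "t0 - t'"] \<eta> by simp
      ultimately show ?thesis unfolding inner_diff_right \<eta>t0 by linarith
    qed
    have b: "y * (norm t0 / 2) \<le> (norm z')\<^sup>2 / 2 + y * (\<eta> \<bullet> t')" if "(z', t') \<in> B" for z' t'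
      using mult_left_mono[OF tt[OF that], of y] y zero_le_power2[of "norm z'"] by linarith
    have ck: "Ck n B (\<lambda>(z, t). shifted_integral K J \<eta> (\<i> * of_real y) z t)" for n
      by (rule Ck_shifted_integral(1)[of \<eta> y \<epsilon> c K J C B "y * (norm t0 / 2)"])
         (use \<eta> y p0 tw(1-4) tw(5,6)[OF \<eta>, of "\<i> * of_real y"] b in \<open>auto simp: B_def\<close>)
    have "Ck n B (\<lambda>p. ?c * (case p of (z, t) \<Rightarrow> shifted_integral K J \<eta> (\<i> * of_real y) z t))" for n
      by (rule Ck_cmult[OF _ ck]) (simp add: B_def)
    moreover have "green_kernel \<phi> P \<mu> U q K J q' = ?c * (case q' of (z, t) \<Rightarrow> shifted_integral K J \<eta> (\<i> * of_real y) z t)" if q': "q' \<in> off_axis" "q' \<in> B" for q'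
    proof -
      obtain z' t' where zt: "q' = (z', t')" by (cases q')
      have z': "z' \<noteq> 0" using q' zt by (simp add: off_axis_iff)
      have "0 \<le> \<eta> \<bullet> t'" using tt[of z' t'] q' zt order.trans[of 0 "norm t0 / 2"] by simp
      from shifted_integral_shift[OF \<eta> tw(3,4,1,2) tw(5)[OF \<eta>] tw(6)[OF \<eta>] z' this] y
      have "shifted_integral K J \<eta> (\<i> * of_real y) z' t' = kern_integral K J z' t'" by simp
      then show ?thesis using rep[OF z'] zt by simp
    qed
    ultimately show ?thesis using p0
      by (intro exI[of _ B] exI[of _ "\<lambda>p. ?c * (case p of (z, t) \<Rightarrow> shifted_integral K J \<eta> (\<i> * of_real y) z t)"]) (auto simp: B_def)
  qed
  show "Ck n (- {0}) (kernel_ext q K J)"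
  proof (subst Ck_pointwise, rule ballI)
    fix p :: "'d cvec \<times> 'm rvec" assume "p \<in> - {0}"
    then obtain B g where B: "open B" "p \<in> B" "\<And>n. Ck n B g" "\<And>q'. q' \<in> B \<Longrightarrow> q' \<in> off_axis \<Longrightarrow> green_kernel \<phi> P \<mu> U q K J q' = g q'"
      using local[of p] by blast
    have "kernel_ext q K J q' = g q'" if "q' \<in> B" for q'
      unfolding kernel_ext_def by (rule cont_extension_eq(1)[OF B(1) Ck_continuous_on[OF B(3)] B(4) that])
    then have "Ck n B (kernel_ext q K J)" using B(1,3) Ck_cong by blast
    then show "Ck n {p} (kernel_ext q K J)" by (rule Ck_subset) (use B(2) in simp)
  qed
  show "p \<in> off_axis \<Longrightarrow> kernel_ext q K J p = green_kernel \<phi> P \<mu> U q K J p"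
    by (simp add: kernel_ext_def cont_extension_def)
qed

end

subsection \<open>Homogeneity\<close>

definition smooth_off_0 :: "('d::finite cvec \<times> 'm::finite rvec \<Rightarrow> complex) \<Rightarrow> bool" where
  "smooth_off_0 f \<longleftrightarrow> (\<forall>n. Ck n (- {0}) f)"

lemma open_off_0: "open (- {0} :: ('d::finite cvec \<times> 'm::finite rvec) set)"
  by (rule open_Compl[OF closed_singleton])

lemma smooth_dir_deriv: "smooth_off_0 f \<Longrightarrow> smooth_off_0 (dir_deriv v f)"
  unfolding smooth_off_0_def by (metis Ck.simps(2))

lemma smooth_differentiable: "smooth_off_0 f \<Longrightarrow> p \<noteq> 0 \<Longrightarrow> f differentiable (at p)"
  unfolding smooth_off_0_def by (metis Ck.simps(2) ComplI singletonD)

lemma smooth_add: "smooth_off_0 f \<Longrightarrow> smooth_off_0 g \<Longrightarrow> smooth_off_0 (\<lambda>p. f p + g p)"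
  unfolding smooth_off_0_def using Ck_add[OF open_off_0] by blast

lemma smooth_cmult: "smooth_off_0 f \<Longrightarrow> smooth_off_0 (\<lambda>p. c * f p)"
  unfolding smooth_off_0_def using Ck_cmult[OF open_off_0] by blast

lemma d_z_eq: "d_z j f = (\<lambda>p. (1 / 2) * dir_deriv (axis j 1, 0) f p + (- \<i> / 2) * dir_deriv (axis j \<i>, 0) f p)"
  by (simp add: d_z_def fun_eq_iff diff_divide_distrib)

lemma d_zbar_eq: "d_zbar j f = (\<lambda>p. (1 / 2) * dir_deriv (axis j 1, 0) f p + (\<i> / 2) * dir_deriv (axis j \<i>, 0) f p)"
  by (simp add: d_zbar_def fun_eq_iff add_divide_distrib)

lemma d_t_eq: "d_t k f = dir_deriv (0, axis k 1) f"
  by (simp add: d_t_def fun_eq_iff)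

definition dilate :: "real \<Rightarrow> 'd::finite cvec \<times> 'm::finite rvec \<Rightarrow> 'd cvec \<times> 'm rvec" where
  "dilate r p = (r *\<^sub>R fst p, r\<^sup>2 *\<^sub>R snd p)"

lemma dilate_eq_0: "r \<noteq> 0 \<Longrightarrow> dilate r p = 0 \<longleftrightarrow> p = 0"
  by (auto simp: dilate_def prod_eq_iff)

lemma dilate_inverse: "r \<noteq> 0 \<Longrightarrow> dilate r (dilate (inverse r) p) = p"
  by (simp add: dilate_def power_inverse)

lemma bounded_linear_dilate: "bounded_linear (dilate r)"
  unfolding dilate_def[abs_def]
  by (intro bounded_linear_Pair bounded_linear_scaleR_right[THEN bounded_linear_compose] bounded_linear_fst bounded_linear_snd)

text \<open>The degree is -e; counting it as a natural number lets every derivative simply add its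
  weight to e.\<close>

definition homogeneous :: "nat \<Rightarrow> ('d::finite cvec \<times> 'm::finite rvec \<Rightarrow> complex) \<Rightarrow> bool" where
  "homogeneous e f \<longleftrightarrow> (\<forall>r>0. \<forall>p. p \<noteq> 0 \<longrightarrow> f (dilate r p) = f p / of_real (r ^ e))"

lemma homogeneous_add: "homogeneous e f \<Longrightarrow> homogeneous e g \<Longrightarrow> homogeneous e (\<lambda>p. f p + g p)"
  by (simp add: homogeneous_def add_divide_distrib)

lemma homogeneous_cmult: "homogeneous e f \<Longrightarrow> homogeneous e (\<lambda>p. c * f p)"
  by (simp add: homogeneous_def)

text \<open>Off the origin f equals r^(-e) times its composition with
  \<open>dilate (inverse r)\<close>. The chain rule in direction v then yields the additional factor
  r^(-k) by which the inverse dilation scales v.\<close>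

lemma dir_deriv_homogeneous:
  assumes f: "smooth_off_0 f" "homogeneous e f" and v: "\<And>r. r > 0 \<Longrightarrow> dilate (inverse r) v = inverse (r ^ k) *\<^sub>R v"
  shows "homogeneous (e + k) (dir_deriv v f)"
  unfolding homogeneous_def
proof (intro allI impI)
  fix r :: real and p :: "'a cvec \<times> 'b rvec" assume r: "r > 0" and p: "p \<noteq> 0"
  obtain f' where f': "(f has_derivative f') (at p)"
    using smooth_differentiable[OF f(1) p] by (auto simp: differentiable_def)
  have lin: "linear f'" using f' has_derivative_linear by blast
  have undo: "dilate (inverse r) (dilate r p) = p" using dilate_inverse[of "inverse r" p] r by simp
  have "((\<lambda>q. f (dilate (inverse r) q)) has_derivative (\<lambda>h. f' (dilate (inverse r) h))) (at (dilate r p))"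
    by (rule has_derivative_compose[of "dilate (inverse r)" "dilate (inverse r)"])
       (use f' undo bounded_linear_imp_has_derivative[OF bounded_linear_dilate] in auto)
  then have deriv: "((\<lambda>q. inverse (of_real (r ^ e)) * f (dilate (inverse r) q)) has_derivative (\<lambda>h. inverse (of_real (r ^ e)) * f' (dilate (inverse r) h))) (at (dilate r p))"
    by (rule has_derivative_mult_right)
  have same: "inverse (of_real (r ^ e)) * f (dilate (inverse r) q) = f q" if "q \<in> - {0}" for q
  proof -
    have "dilate (inverse r) q \<noteq> 0" using that r by (simp add: dilate_eq_0)
    then show ?thesis
      using f(2) r dilate_inverse[of r q] unfolding homogeneous_def by (metis divide_inverse less_irrefl mult.commute)
  qed
  have "(f has_derivative (\<lambda>h. inverse (of_real (r ^ e)) * f' (dilate (inverse r) h))) (at (dilate r p))"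
    by (rule has_derivative_transform_within_open[OF deriv open_off_0 _ same]) (use p r in \<open>auto simp: dilate_eq_0\<close>)
  from dir_deriv_eq[OF this, of v] have "dir_deriv v f (dilate r p) = inverse (of_real (r ^ e)) * (inverse (of_real (r ^ k)) * f' v)"
    by (simp add: v[OF r] linear_cmul[OF lin] scaleR_conv_of_real)
  then show "dir_deriv v f (dilate r p) = dir_deriv v f p / of_real (r ^ (e + k))"
    by (simp add: dir_deriv_eq[OF f'] power_add divide_inverse)
qed

definition smooth_homogeneous :: "nat \<Rightarrow> ('d::finite cvec \<times> 'm::finite rvec \<Rightarrow> complex) \<Rightarrow> bool" where
  "smooth_homogeneous e f \<longleftrightarrow> smooth_off_0 f \<and> homogeneous e f"

lemma smooth_homogeneous_dir_z: "smooth_homogeneous e f \<Longrightarrow> smooth_homogeneous (e + 1) (dir_deriv (u, 0) f)"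
  unfolding smooth_homogeneous_def by (auto intro: smooth_dir_deriv intro!: dir_deriv_homogeneous[where k = 1, simplified] simp: dilate_def)

lemma smooth_homogeneous_d_t: "smooth_homogeneous e f \<Longrightarrow> smooth_homogeneous (e + 2) (d_t k f)"
  unfolding smooth_homogeneous_def d_t_eq by (auto intro: smooth_dir_deriv intro!: dir_deriv_homogeneous[where k = 2, simplified] simp: dilate_def power_inverse)

lemma smooth_homogeneous_comb: "smooth_homogeneous e f \<Longrightarrow> smooth_homogeneous e g \<Longrightarrow> smooth_homogeneous e (\<lambda>p. c * f p + d * g p)"
  unfolding smooth_homogeneous_def by (auto intro: smooth_add smooth_cmult homogeneous_add homogeneous_cmult)

lemma smooth_homogeneous_d_z: "smooth_homogeneous e f \<Longrightarrow> smooth_homogeneous (e + 1) (d_z j f)"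
  unfolding d_z_eq by (intro smooth_homogeneous_comb smooth_homogeneous_dir_z)

lemma smooth_homogeneous_d_zbar: "smooth_homogeneous e f \<Longrightarrow> smooth_homogeneous (e + 1) (d_zbar j f)"
  unfolding d_zbar_eq by (intro smooth_homogeneous_comb smooth_homogeneous_dir_z)

lemma smooth_homogeneous_funpow:
  fixes D :: "('d::finite cvec \<times> 'm::finite rvec \<Rightarrow> complex) \<Rightarrow> 'd cvec \<times> 'm rvec \<Rightarrow> complex"
  assumes "\<And>e f. smooth_homogeneous e f \<Longrightarrow> smooth_homogeneous (e + w) (D f)" "smooth_homogeneous e f"
  shows "smooth_homogeneous (e + w * n) ((D ^^ n) f)"
proof (induction n)
  case (Suc n)
  have "e + w * Suc n = (e + w * n) + w" by simp
  with assms(1)[OF Suc.IH] show ?case by (simp only: funpow.simps o_apply)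
qed (use assms in simp)

lemma smooth_homogeneous_foldr:
  assumes "\<And>j e f. smooth_homogeneous e f \<Longrightarrow> smooth_homogeneous (e + w) (D j f)" "smooth_homogeneous e f"
  shows "smooth_homogeneous (e + w * (\<Sum>j\<leftarrow>js. n j)) (foldr (\<lambda>j. D j ^^ n j) js f)"
proof (induction js)
  case (Cons j js)
  have "smooth_homogeneous ((e + w * (\<Sum>j\<leftarrow>js. n j)) + w * n j) ((D j ^^ n j) (foldr (\<lambda>j. D j ^^ n j) js f))"
    by (rule smooth_homogeneous_funpow[OF assms(1) Cons])
  then show ?case by (simp add: algebra_simps)
qed (use assms in simp)

lemma sum_list_sorted_UNIV: "(\<Sum>j\<leftarrow>sorted_list_of_set UNIV. n j) = (\<Sum>j\<in>(UNIV :: 'a::{finite,linorder} set). n j :: nat)"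
  using sum_list_distinct_conv_sum_set[of "sorted_list_of_set (UNIV :: 'a set)" n] by simp

lemma smooth_homogeneous_D_multi:
  assumes "smooth_homogeneous e f"
  shows "smooth_homogeneous (e + weight I1 I2) (D_multi I1 I2 f)"
proof -
  have w: "weight I1 I2 = 2 * (\<Sum>k\<in>UNIV. I2 $ k) + 1 * (\<Sum>j\<in>UNIV. I1 $ Inr j) + 1 * (\<Sum>j\<in>UNIV. I1 $ Inl j)"
  proof -
    have "(\<Sum>j\<in>UNIV. I1 $ j) = (\<Sum>j\<in>UNIV. I1 $ Inl j) + (\<Sum>j\<in>UNIV. I1 $ Inr j)"
      unfolding UNIV_Plus_UNIV[symmetric] by (subst sum.Plus) auto
    then show ?thesis by (simp add: weight_def)
  qed
  have "smooth_homogeneous (((e + 2 * (\<Sum>k\<leftarrow>sorted_list_of_set UNIV. I2 $ k)) + 1 * (\<Sum>j\<leftarrow>sorted_list_of_set UNIV. I1 $ Inr j)) + 1 * (\<Sum>j\<leftarrow>sorted_list_of_set UNIV. I1 $ Inl j))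
    (D_multi I1 I2 f)"
    unfolding D_multi_def
    by (intro smooth_homogeneous_foldr[OF smooth_homogeneous_d_z] smooth_homogeneous_foldr[OF smooth_homogeneous_d_zbar] smooth_homogeneous_foldr[OF smooth_homogeneous_d_t] assms)
  then show ?thesis unfolding sum_list_sorted_UNIV w by (simp add: add.assoc)
qed

lemma foldr_funpow_cong:
  assumes "\<And>j f g. (\<forall>p\<in>B. f p = g p) \<Longrightarrow> (\<forall>p\<in>B. D j f p = D j g p)" "\<forall>p\<in>B. f p = g p"
  shows "\<forall>p\<in>B. foldr (\<lambda>j. D j ^^ n j) js f p = foldr (\<lambda>j. D j ^^ n j) js g p"
proof (induction js)
  case (Cons j js)
  have "\<forall>p\<in>B. (D j ^^ k) (foldr (\<lambda>j. D j ^^ n j) js f) p = (D j ^^ k) (foldr (\<lambda>j. D j ^^ n j) js g) p" for k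
    by (induction k) (use Cons assms(1) in auto)
  then show ?case by simp
qed (use assms in simp)

text \<open>Derivatives are local: as the kernel and its extension agree on the open set z \<noteq>
  0, so do all their derivatives there.\<close>

lemma D_multi_cong:
  assumes "open B" "\<And>p. p \<in> B \<Longrightarrow> f p = g p" "p \<in> B"
  shows "D_multi I1 I2 f p = D_multi I1 I2 g p"
proof -
  have c: "\<forall>p\<in>B. dir_deriv v f p = dir_deriv v g p" if "\<forall>p\<in>B. f p = g p" for f g v
    using dir_deriv_cong[OF assms(1)] that by blast
  have "\<forall>p\<in>B. D_multi I1 I2 f p = D_multi I1 I2 g p"
    unfolding D_multi_def
  proof (intro foldr_funpow_cong)
    show "\<forall>p\<in>B. d_z j f p = d_z j g p" if "\<forall>p\<in>B. f p = g p" for j f g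
      using c[OF that] by (simp add: d_z_def)
    show "\<forall>p\<in>B. d_zbar j f p = d_zbar j g p" if "\<forall>p\<in>B. f p = g p" for j f g
      using c[OF that] by (simp add: d_zbar_def)
    show "\<forall>p\<in>B. d_t j f p = d_t j g p" if "\<forall>p\<in>B. f p = g p" for j f g
      using c[OF that] by (simp add: d_t_def)
  qed (use assms(2) in auto)
  then show ?thesis using assms(3) by blast
qed

lemma hom_norm_dilate: "r > 0 \<Longrightarrow> hom_norm (dilate r p) = r * hom_norm p"
  by (cases p) (simp add: dilate_def hom_norm_def real_sqrt_mult max_mult_distrib_left)

lemma hom_norm_pos: "p \<noteq> 0 \<Longrightarrow> hom_norm p > 0"
  by (cases p) (auto simp: hom_norm_def zero_prod_def less_max_iff_disj)

text \<open>Every p \<noteq> 0 is a dilate of a point of homogeneous norm 1, and these points form a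
  compact set that avoids the origin.\<close>

lemma smooth_homogeneous_bound:
  assumes "smooth_homogeneous e (f :: 'd::finite cvec \<times> 'm::finite rvec \<Rightarrow> complex)"
  obtains C where "C > 0" "\<And>p. p \<noteq> 0 \<Longrightarrow> cmod (f p) \<le> C / hom_norm p ^ e"
proof -
  let ?K = "{p :: 'd cvec \<times> 'm rvec. hom_norm p = 1}"
  have ch: "continuous_on UNIV (hom_norm :: 'd cvec \<times> 'm rvec \<Rightarrow> real)"
    unfolding hom_norm_def case_prod_beta by (intro continuous_intros)
  have "closed ?K" by (intro closed_Collect_eq ch continuous_intros)
  moreover have "bounded ?K"
    unfolding bounded_iff
  proof (intro exI ballI)
    fix p :: "'d cvec \<times> 'm rvec" assume "p \<in> ?K"
    then have "norm (fst p) \<le> 1" "sqrt (norm (snd p)) \<le> 1" by (cases p; simp add: hom_norm_def max_def split: if_splits)+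
    then show "norm p \<le> 2" using norm_Pair_le[of "fst p" "snd p"] by simp
  qed
  ultimately have "compact ?K" by (simp add: compact_eq_bounded_closed)
  moreover have K0: "0 \<notin> ?K" by (simp add: hom_norm_def zero_prod_def)
  have "continuous_on (- {0}) f"
    using assms Ck_continuous_on[of "- {0}" f] by (simp add: smooth_homogeneous_def smooth_off_0_def del: Ck.simps)
  then have "continuous_on ?K f" by (rule continuous_on_subset) (use K0 in auto)
  ultimately have "bounded (f ` ?K)" using compact_continuous_image compact_imp_bounded by blast
  then obtain C where C: "C > 0" "\<And>p. hom_norm p = 1 \<Longrightarrow> cmod (f p) \<le> C"
    unfolding bounded_pos by auto
  show ?thesis
  proof (rule that[OF C(1)])
    fix p :: "'d cvec \<times> 'm rvec" assume p: "p \<noteq> 0"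
    let ?r = "hom_norm p"
    have r: "?r > 0" by (rule hom_norm_pos[OF p])
    let ?q = "dilate (inverse ?r) p"
    have "hom_norm ?q = 1" using hom_norm_dilate[of "inverse ?r" p] r by simp
    then have "cmod (f ?q) \<le> C" by (rule C(2))
    moreover have "f (dilate ?r ?q) = f ?q / of_real (?r ^ e)"
    proof -
      have "?q \<noteq> 0" using r p by (simp add: dilate_eq_0)
      then show ?thesis using assms r unfolding smooth_homogeneous_def homogeneous_def by blast
    qed
    then have "cmod (f p) = cmod (f ?q) / ?r ^ e"
      using r dilate_inverse[of ?r p] by (simp add: norm_divide norm_power)
    ultimately show "cmod (f p) \<le> C / ?r ^ e" using r by (simp add: divide_right_mono)
  qed
qed

section \<open>Homogeneity of the kernel\<close>

context quadric begin

text \<open>z and t enter only through A and \<nu> \<bullet> t, which both scale by r^2. A constant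
  divisor leaves the integrals without any question of convergence, so the identity holds for the
  defining expression as it stands.\<close>

lemma green_kernel_dilate:
  assumes "r > 0" "card K = q"
  shows "green_kernel \<phi> P \<mu> U q K J (dilate r p) = green_kernel \<phi> P \<mu> U q K J p / of_real (r ^ (2 * (CARD('d) + CARD('m) - 1)))"
proof -
  obtain z t where p: "p = (z, t)" by (cases p)
  let ?k = "CARD('d) + CARD('m) - 1" and ?c = "complex_of_real (r ^ (2 * (CARD('d) + CARD('m) - 1)))"
  have A: "A_fun m V s (r *\<^sub>R z) = r\<^sup>2 * A_fun m V s z" for m V s
  proof -
    have "(ctranspose V *v (r *\<^sub>R z)) $ j = of_real r * (ctranspose V *v z) $ j" for j
      by (simp add: matrix_vector_mult_def sum_distrib_left scaleR_conv_of_real[where 'a = complex] mult_ac)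
    then show ?thesis
      by (simp add: A_fun_def norm_mult power_mult_distrib sum_distrib_left mult_ac)
  qed
  have D: "green_denom \<mu> U s \<nu> (r *\<^sub>R z) (r\<^sup>2 *\<^sub>R t) = ?c * green_denom \<mu> U s \<nu> z t" for s \<nu>
  proof -
    have "of_real (A_fun (\<mu> \<nu>) (U \<nu>) s (r *\<^sub>R z)) - \<i> * of_real (\<nu> \<bullet> (r\<^sup>2 *\<^sub>R t)) =
      of_real (r\<^sup>2) * (of_real (A_fun (\<mu> \<nu>) (U \<nu>) s z) - \<i> * of_real (\<nu> \<bullet> t))"
      unfolding A by (simp add: algebra_simps)
    then show ?thesis unfolding green_denom_def
      by (simp only: power_mult_distrib of_real_power power_mult)
  qed
  have i1: "radial_integral P \<mu> U L \<nu> (r *\<^sub>R z) (r\<^sup>2 *\<^sub>R t) = radial_integral P \<mu> U L \<nu> z t / ?c" for L \<nu>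
  proof -
    have "radial_integral P \<mu> U L \<nu> (r *\<^sub>R z) (r\<^sup>2 *\<^sub>R t) = (LINT s:{0<..<1}|lborel. ((of_real (B_fun P (\<mu> \<nu>) L s) / green_denom \<mu> U s \<nu> z t) / of_real s) / ?c)"
      unfolding radial_integral_def D by (intro arg_cong[where f = "set_lebesgue_integral lborel {0<..<1}"] ext) (simp add: mult_ac)
    then show ?thesis unfolding radial_integral_def by (simp only: set_integral_divide_zero)
  qed
  have i2: "radial_integral_rel \<phi> P \<mu> U \<nu> (r *\<^sub>R z) (r\<^sup>2 *\<^sub>R t) = radial_integral_rel \<phi> P \<mu> U \<nu> z t / ?c" for \<nu>
  proof -
    have "radial_integral_rel \<phi> P \<mu> U \<nu> (r *\<^sub>R z) (r\<^sup>2 *\<^sub>R t) = (LINT s:{0<..<1}|lborel. ((of_real (B_fun P (\<mu> \<nu>) P s) / green_denom \<mu> U s \<nu> z t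
         - of_real (cmod (det (levi_matrix \<phi> \<nu>))) / green_denom \<mu> U 0 \<nu> z t) / of_real s) / ?c)"
      unfolding radial_integral_rel_def D by (intro arg_cong[where f = "set_lebesgue_integral lborel {0<..<1}"] ext) (simp add: diff_divide_distrib mult_ac)
    then show ?thesis unfolding radial_integral_rel_def by (simp only: set_integral_divide_zero)
  qed
  have "green_kernel \<phi> P \<mu> U q K J (r *\<^sub>R z, r\<^sup>2 *\<^sub>R t) = green_kernel \<phi> P \<mu> U q K J (z, t) / ?c"
    unfolding green_kernel_def prod.case i1 i2 times_divide_eq_right integral_divide_zero sum_divide_distrib[symmetric] add_divide_distrib[symmetric]
    by simp
  then show ?thesis by (simp add: p dilate_def)
qed

text \<open>Off the axis the scaling is that of the defining integrals. Both sides are continuous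
  away from the origin, so it passes to the points (0, t) by uniqueness of limits.\<close>

lemma smooth_homogeneous_kernel_ext:
  assumes K: "card K = q"
  shows "smooth_homogeneous (2 * (CARD('d) + CARD('m) - 1)) (kernel_ext q K J)"
proof -
  let ?f = "kernel_ext q K J" and ?e = "2 * (CARD('d) + CARD('m) - 1)"
  have sm: "smooth_off_0 ?f" unfolding smooth_off_0_def using Ck_kernel_ext(1)[OF K] by blast
  have co: "continuous_on (- {0}) ?f" by (rule Ck_continuous_on[OF Ck_kernel_ext(1)[OF K]])
  have "homogeneous ?e ?f"
    unfolding homogeneous_def
  proof (intro allI impI)
    fix r :: real and p :: "'d cvec \<times> 'm rvec" assume r: "r > 0" and p: "p \<noteq> 0"
    have d: "continuous_on (- {0}) (dilate r :: 'd cvec \<times> 'm rvec \<Rightarrow> _)"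
      by (rule linear_continuous_on[OF bounded_linear_dilate])
    have c1: "continuous_on (- {0}) (\<lambda>p. ?f (dilate r p))"
      by (rule continuous_on_compose2[OF co d]) (use r in \<open>auto simp: dilate_eq_0\<close>)
    have c2: "continuous_on (- {0}) (\<lambda>p. ?f p / of_real (r ^ ?e))"
      using r by (intro continuous_intros co) auto
    have eq: "?f (dilate r q') = ?f q' / of_real (r ^ ?e)" if "q' \<in> off_axis" for q'
    proof -
      have "dilate r q' \<in> off_axis" using that r by (simp add: off_axis_iff dilate_def)
      then show ?thesis using Ck_kernel_ext(2)[OF K] that green_kernel_dilate[OF r K] by simp
    qed
    have "((\<lambda>p. ?f (dilate r p)) \<longlongrightarrow> ?f p / of_real (r ^ ?e)) (at p within off_axis)"
      by (rule cont_extension_eq(2)[OF open_off_0 c2]) (use eq p in auto)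
    moreover have "((\<lambda>p. ?f (dilate r p)) \<longlongrightarrow> ?f (dilate r p)) (at p within off_axis)"
      by (rule cont_extension_eq(2)[OF open_off_0 c1]) (use p in auto)
    ultimately show "?f (dilate r p) = ?f p / of_real (r ^ ?e)"
      using tendsto_unique[OF at_off_axis_nontrivial] by blast
  qed
  with sm show ?thesis by (simp add: smooth_homogeneous_def)
qed

end

section \<open>The bounds on all derivatives of the kernel\<close>

theorem theorem2p1:
  fixes \<phi> :: "'d::{finite,linorder} cvec \<Rightarrow> 'd cvec \<Rightarrow> 'm::{finite,linorder} cvec"
    and n m q :: nat
    and P :: "'d set"
    and \<mu> :: "'m rvec \<Rightarrow> 'd \<Rightarrow> real"
    and U :: "'m rvec \<Rightarrow> 'd cmat"
    and I1 :: "('d + 'd) nvec"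
    and I2 :: "'m nvec"
  assumes dims: "CARD('d) = 2 * n" "CARD('m) = m" "1 \<le> n" "2 \<le> m"
    and \<phi>: "sesquilinear \<phi>" "real_on_diagonal \<phi>"
    and nondegenerate: "\<forall>\<nu>\<in>sphere 0 1. \<forall>c. is_eigenvalue (levi_matrix \<phi> \<nu>) c \<longrightarrow> c \<noteq> 0"
    and diag: "card P = n" "levi_diagonalization \<phi> P \<mu> U"
    and q: "0 \<le> q" "q \<le> 2 * n"
  shows "(\<forall>K\<in>tuples q. \<forall>J\<in>tuples q.
            green_deriv \<phi> P \<mu> U q I1 I2 K J differentiable_on off_axis \<and>
            (\<forall>t. t \<noteq> 0 \<longrightarrow>
               (\<exists>l. (green_deriv \<phi> P \<mu> U q I1 I2 K J \<longlongrightarrow> l) (at (0, t) within off_axis)))) \<and>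
         (\<exists>C>0. \<forall>z t. (z, t) \<noteq> (0, 0) \<longrightarrow>
            green_deriv_norm \<phi> P \<mu> U q I1 I2 (z, t)
              \<le> C / hom_norm (z, t) ^ (2 * (2 * n + m - 1) + weight I1 I2))"
proof -
  interpret quadric \<phi> P \<mu> U
    by unfold_locales (use \<phi> nondegenerate diag in auto)
  let ?e = "2 * (2 * n + m - 1) + weight I1 I2"
  \<comment> \<open>Derivatives of the smooth extension. Off the axis they are the derivatives of
    the kernel, and at (0, t) continuity identifies them with the extensions of those.\<close>
  define G where "G K J = D_multi I1 I2 (kernel_ext q K J)" for K J
  have smooth_homogeneous: "smooth_homogeneous ?e (G K J)" if "K \<in> tuples q" for K J
    using smooth_homogeneous_D_multi[OF smooth_homogeneous_kernel_ext[of K q J], of I1 I2] that dims by (simp add: tuples_def G_def)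
  have cont: "continuous_on (- {0}) (G K J)" if "K \<in> tuples q" for K J
    using smooth_homogeneous[OF that] Ck_continuous_on[of "- {0}" "G K J"] by (simp add: smooth_homogeneous_def smooth_off_0_def del: Ck.simps)
  have eq: "green_deriv \<phi> P \<mu> U q I1 I2 K J p = G K J p" if "K \<in> tuples q" "p \<in> off_axis" for K J p
    unfolding green_deriv_def G_def
    by (rule D_multi_cong[OF open_off_axis _ that(2)]) (use that(1) Ck_kernel_ext(2)[of K q] in \<open>auto simp: tuples_def\<close>)
  have ext: "cont_extension (green_deriv \<phi> P \<mu> U q I1 I2 K J) p = G K J p"
    "(green_deriv \<phi> P \<mu> U q I1 I2 K J \<longlongrightarrow> G K J p) (at p within off_axis)" if "K \<in> tuples q" "p \<noteq> 0" for K J p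
    using cont_extension_eq[OF open_off_0 cont[OF that(1)] eq[OF that(1)], of p] that(2) by simp_all
  have diff: "green_deriv \<phi> P \<mu> U q I1 I2 K J differentiable_on off_axis" if K: "K \<in> tuples q" for K J
    unfolding differentiable_on_def
  proof
    fix p :: "'d cvec \<times> 'm rvec" assume p: "p \<in> off_axis"
    then have "p \<noteq> 0" by (auto simp: off_axis_iff)
    then obtain D where "(G K J has_derivative D) (at p)"
      using smooth_homogeneous[OF K] smooth_differentiable unfolding smooth_homogeneous_def differentiable_def by blast
    then have "(green_deriv \<phi> P \<mu> U q I1 I2 K J has_derivative D) (at p)"
      by (rule has_derivative_transform_within_open[OF _ open_off_axis p]) (simp add: eq[OF K])
    then show "green_deriv \<phi> P \<mu> U q I1 I2 K J differentiable at p within off_axis"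
      using has_derivative_at_withinI differentiable_def by blast
  qed
  have "\<exists>C>0. \<forall>p. p \<noteq> 0 \<longrightarrow> cmod (G K J p) \<le> C / hom_norm p ^ ?e" if "K \<in> tuples q" for K J
    using smooth_homogeneous_bound[OF smooth_homogeneous[OF that]] by metis
  then obtain C where C: "\<And>K J. K \<in> tuples q \<Longrightarrow> C K J > 0"
    "\<And>K J p. K \<in> tuples q \<Longrightarrow> p \<noteq> 0 \<Longrightarrow> cmod (G K J p) \<le> C K J / hom_norm p ^ ?e"
    by metis
  let ?T = "tuples q :: 'd set set"
  \<comment> \<open>The sum over all pairs dominates each single constant, and hence the maximum in
    \<open>green_deriv_norm\<close>.\<close>
  define M where "M = (\<Sum>K\<in>?T. \<Sum>J\<in>?T. C K J)"
  have CM: "C K J \<le> M" if "K \<in> ?T" "J \<in> ?T" for K J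
    unfolding M_def using C(1) that
    by (intro order.trans[OF member_le_sum[of J ?T "C K"] member_le_sum[of K ?T "\<lambda>K. \<Sum>J\<in>?T. C K J"]])
       (auto intro!: sum_nonneg intro: less_imp_le)
  \<comment> \<open>The bound on q provides an index set, so that the maximum runs over a nonempty
    set and M is positive.\<close>
  obtain K0 :: "'d set" where "card K0 = q"
    using obtain_subset_with_card_n[of q "UNIV :: 'd set"] q dims by metis
  then have K0: "K0 \<in> ?T" by (simp add: tuples_def)
  have M0: "M > 0" using CM[OF K0 K0] C(1)[OF K0, of K0] by linarith
  have "green_deriv_norm \<phi> P \<mu> U q I1 I2 (z, t) \<le> M / hom_norm (z, t) ^ ?e" if zt: "(z, t) \<noteq> (0, 0)" for z t
  proof -
    let ?p = "(z, t)"
    have p: "?p \<noteq> 0" using zt by (simp add: zero_prod_def)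
    let ?A = "{cmod (cont_extension (green_deriv \<phi> P \<mu> U q I1 I2 K J) ?p) | K J. K \<in> ?T \<and> J \<in> ?T}"
    have A: "?A = (\<lambda>(K, J). cmod (cont_extension (green_deriv \<phi> P \<mu> U q I1 I2 K J) ?p)) ` (?T \<times> ?T)"
      by auto
    have "a \<le> M / hom_norm ?p ^ ?e" if "a \<in> ?A" for a
    proof -
      from that obtain K J where KJ: "K \<in> ?T" "J \<in> ?T" "a = cmod (G K J ?p)"
        using ext(1)[OF _ p] by auto
      have "a \<le> C K J / hom_norm ?p ^ ?e" unfolding KJ(3) by (rule C(2)[OF KJ(1) p])
      also have "\<dots> \<le> M / hom_norm ?p ^ ?e"
        using CM[OF KJ(1,2)] hom_norm_pos[OF p] by (intro divide_right_mono) auto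
      finally show ?thesis .
    qed
    moreover have "finite ?A" "?A \<noteq> {}" unfolding A using K0 by auto
    ultimately show ?thesis unfolding green_deriv_norm_def by (subst Max_le_iff) auto
  qed
  moreover have "(green_deriv \<phi> P \<mu> U q I1 I2 K J \<longlongrightarrow> G K J (0, t)) (at (0, t) within off_axis)"
    if "K \<in> tuples q" "t \<noteq> 0" for K J t
    using ext(2)[OF that(1), of "(0, t)" J] that(2) by (simp add: zero_prod_def)
  ultimately show ?thesis using M0 diff by blast
qed

end
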